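(* Let $\mathbf{Skula}_{\mathcal I}$ and $\mathbf{Skula}_{\mathcal T}$ be the full subcategories of $\mathbf{Skula}$ of fiber-initial, respectively fiber-terminal, objects, and let $I_{\mathcal T}:\mathbf{Skula}_{\mathcal T}\hookrightarrow\mathbf{Skula}$ be the inclusion. (a) $I_{\mathcal T}:\mathbf{Skula}_{\mathcal T}\to\mathbf{Skula}$ and $\mathcal S\mathcal O_{\mathcal S}:\mathbf{Skula}\to\mathbf{Skula}_{\mathcal I}$ are morphisms of SFC-categories (all three categories with distinguished object $\mathbf 2_{\mathcal S}$ and the restrictions of $\mathcal O_{\mathcal S}$). (b) There are adjunctions (left adjoint first): (A1) $\mathsf{pt}_{\mathcal S}\dashv\mathcal S\mathcal O_{\mathcal S}\mathcal{SK}$ between $\mathbf{Skula}_{\mathcal I}$ and $\mathbf{Top}^{\mathrm{op}}$; (A2) $\mathsf{pt}_{\mathcal S}\dashv\mathcal{SK}$ between $\mathbf{Skula}$ and $\mathbf{Top}^{\mathrm{op}}$; (A3) $\mathsf{pt}_{\mathcal S}\dashv\mathcal{SK}$ between $\mathbf{Skula}_{\mathcal T}$ and $\mathbf{Top}_D^{\mathrm{op}}$; (A4) $\mathsf{pt}_{\mathcal{LE}}\dashv\Omega$ between $\mathbf{Frm}_{\mathcal{LE}}$ and $\mathbf{Top}_D^{\mathrm{op}}$; (A5) $\mathsf{pt}\dashv\Omega$ between $\mathbf{Frm}$ and $\mathbf{Top}^{\mathrm{op}}$. (c) The following pairs of functors, with the canonical natural transformations, are right adjunction morphisms: $(\mathcal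 S\mathcal O_{\mathcal S},\mathrm{id})$ from (A2) to (A1); $(I_{\mathcal T},\text{inclusion})$ from (A3) to (A2); $(\mathcal O_{\mathcal S}I_{\mathcal T},\mathrm{id})$ from (A3) to (A4), where $\mathcal O_{\mathcal S}I_{\mathcal T}:\mathbf{Skula}_{\mathcal T}\to\mathbf{Frm}_{\mathcal{LE}}$ is an equivalence; and (inclusion, inclusion) from (A4) to (A5). Moreover those given by $I_{\mathcal T}$ and by $\mathcal O_{\mathcal S}I_{\mathcal T}$ are strong adjunction morphisms.
   Context: $\mathbf{Frm}$: frames and frame homomorphisms; $\mathbf 2=\{0<1\}$; $\mathbf{Top}$: topological spaces; $\mathbf{Top}_D$: the full subcategory of $T_D$-spaces (every point is the intersection of an open and a closed set); $\mathbb S$: the Sierpinski space; $|\cdot|$: underlying sets/functions. $\Omega(X)$ is the frame of opens; $\mathsf{pt}(L)=\mathbf{Frm}(L,\mathbf 2)$ with opens $\{f\mid f(a)=1\}$, $a\in L$. SFC-categories. For a faithful $U:\mathcal A\to\mathcal B$, a morphism $U(A)\to U(A')$ lifts if it is $U(p)$ for some $p:A\to A'$; a cartesian lift of a family $\{f_i:X\to U(C)\}$ is $(\overline X,\theta:U(\overline X)\cong X)$ such that $h:U(D)\to U(\overline X)$ lifts iff all $f_i\theta h$ lift. A PFC-category is $(\mathcal O_{\mathcal C},\mathcal C,\mathbf 2_{\mathcal C},\iota_{\mathcal C})$ with $\mathcal O_{\mathcal C}:\mathcal C\to\mathbf{Frm}$ faithful, $\mathbf 2_{\mathcal C}\in\mathcal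 C$, $\iota_{\mathcal C}:\mathcal O_{\mathcal C}\mathbf 2_{\mathcal C}\cong\mathbf 2$. $\mathbf{Top}_{\mathcal C}\subseteq\mathbf{Top}$ consists of the $X$ such that $\{|\iota_{\mathcal C}^{-1}|\circ\chi_x:\mathbf{Top}(X,\mathbb S)\to|\mathcal O_{\mathcal C}\mathbf 2_{\mathcal C}|\mid x\in X\}$, $\chi_x(g)=g(x)$, has a cartesian lift $(\Omega_{\mathcal C}X,\theta_{\mathcal C,X})$ w.r.t. $|\mathcal O_{\mathcal C}(-)|$; $\mathsf{pt}_{\mathcal C}(C)=\mathcal C(C,\mathbf 2_{\mathcal C})$ with opens $\{f\mid\iota_{\mathcal C}(\mathcal O_{\mathcal C}f(a))=1\}$. It is an SFC-category if $\mathbb S$ and all $\mathsf{pt}_{\mathcal C}(C)$ lie in $\mathbf{Top}_{\mathcal C}$. A morphism of SFC-categories $(H,\alpha,i):\mathcal C\to\mathcal D$ is a functor $H$ with a natural isomorphism $\alpha:\mathcal O_{\mathcal D}H\to\mathcal O_{\mathcal C}$ and an isomorphism $i:H\mathbf 2_{\mathcal C}\to\mathbf 2_{\mathcal D}$ with $\iota_{\mathcal D}\mathcal O_{\mathcal D}(i)=\iota_{\mathcal C}\alpha_{\mathbf 2_{\mathcal C}}$, such that for $X\in\mathbf{Top}_{\mathcal C}$, $(H\Omega_{\mathcal C}X,\theta_{\mathcal C,X}|\alpha_{\Omega_{\mathcal C}X}|)$ is a cartesian lift w.r.t. $|\mathcal O_{\mathcal D}(-)|$ of $\{|\alpha_{\mathbf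 2_{\mathcal C}}^{-1}||\iota_{\mathcal C}^{-1}|\chi_x\}$. In (a), $\alpha$ and $i$ are identities. Right adjunction morphisms. For adjunctions $F\dashv G$ (unit $\eta$) and $P\dashv Q$ (counit $\delta$), a right adjunction morphism consists of functors $U,V$ and a mate-pair $\zeta:UG\to QV$, $\xi:PU\to VF$ (i.e. $\xi=\delta_{VF}\circ P\zeta_F\circ PU\eta$) with $\zeta$ invertible; it is strong if $\xi$ is also invertible. In (c) the canonical $\zeta$ is the identity (on underlying frames), and the canonical $\xi$ has as components the continuous maps $f\mapsto H(f)$ between spectra, $H$ being the first functor of the pair. Skula extensions. $\mathcal SL$ is the coframe of sublocales of $L$ under inclusion (subsets closed under all meets and under $a\to-$ for $a\in L$); $\mathfrak o(a)=\{a\to x\mid x\in L\}$ is the open sublocale of $a$, the complement of ${\uparrow}a$. $\mathcal FL$ is the set of all joins in $\mathcal SL$ of sublocales ${\uparrow}a\cap\mathfrak o(b)$; ordered by inclusion it is a complete Boolean algebra, and $a\mapsto\mathfrak o(a)$ embeds $L$ in it (the Funayama embedding). In a coframe $K$, $x\setminus k$ is the least $c$ with $x\le k\vee c$; a subcolocale is a subset $A$ closed under all joins with $x\setminus k\in A$ for $x\in A,k\in K$. For a frame map $f:L\to M$, $\mathcal Sf:\mathcal SL\to\mathcal SM$ is the coframe map with ${\uparrow}a\mapsto{\uparrow}f(a)$, $\mathfrak o(a)\mapsto\mathfrak o(f(a))$, and $\mathcal Sf^*$ its left adjoint. A Skula extension is $(L,\mathcal D)$ with $\mathcal D$ a subcolocale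 of $\mathcal SL$ containing $\mathcal FL$; a morphism $(L,\mathcal D)\to(M,\mathcal E)$ is a frame map $f$ with $\mathcal Sf^*(E)\in\mathcal D$ for all $E\in\mathcal E$. $\mathcal O_{\mathcal S}(L,\mathcal D)=L$; $\mathbf 2_{\mathcal S}=(\mathbf 2,\mathcal S\mathbf 2)$. $\mathsf{pt}_{\mathcal S}(L,\mathcal D)=\mathbf{Skula}((L,\mathcal D),\mathbf 2_{\mathcal S})$ with opens $\{f\mid f(a)=1\}$, $a\in L$. The functor $\mathcal S:\mathbf{Frm}\to\mathbf{Skula}$ sends $L$ to $(L,\mathcal SL)$. $\mathcal{SK}:\mathbf{Top}^{\mathrm{op}}\to\mathbf{Skula}$ sends $X$ to $(\Omega X,\mathcal{SKC}^*X)$, where $\mathcal{SKC}^*X=\{\bigvee\{b(x)\mid x\in Y\}\mid Y\subseteq X\text{ Skula-closed}\}$, $b(x)=\{X\setminus\overline{\{x\}},X\}\in\mathcal S\Omega X$, and Skula-closed means closed in the topology generated by the opens of $X$ and their complements. An object $C$ of a category with faithful $\mathcal O:\mathcal C\to\mathbf{Frm}$ is fiber-initial (fiber-terminal) if for every $D$ and isomorphism $\theta:\mathcal O(D)\cong\mathcal O(C)$ there is $p:C\to D$ with $\theta\circ\mathcal O(p)=\mathrm{id}$ (resp. $p:D\to C$ with $\mathcal O(p)=\theta$). $\mathbf{Frm}_{\mathcal{LE}}$: frames with locally exact maps, i.e. frame maps $f:L\to M$ that extend along the Funayama embeddings to a homomorphism of complete Boolean algebras $\mathcal FL\to\mathcal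 FM$. $\mathsf{pt}_{\mathcal{LE}}(L)=\mathbf{Frm}_{\mathcal{LE}}(L,\mathbf 2)$ with opens $\{f\mid f(a)=1\}$. *)

theory Defs
  imports
    "HOL-Algebra.Complete_Lattice"
    "HOL-Analysis.Abstract_Topology"
    "HOL-Library.Equipollence"
begin

section \<open>The universe of small sets\<close>

text \<open>Sets, spaces and frames in the sense of the categories below are those whose points lie in a
  fixed type \<open>'u\<close> and form a \<^emph>\<open>small\<close> set. The type plays the role of a Grothendieck universe: its
  cardinality is a regular strong limit, which forces it to be infinite.\<close>

definition small :: "'u set \<Rightarrow> bool"
  where "small A \<longleftrightarrow> A \<prec> (UNIV :: 'u set)"

definition universe :: "'u itself \<Rightarrow> bool"
  where "universe _ \<longleftrightarrow>
    (\<forall>A :: 'u set. small A \<longrightarrow> Pow A \<prec> (UNIV :: 'u set)) \<and>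
    (\<forall>\<A> :: 'u set set. \<A> \<prec> (UNIV :: 'u set) \<and> (\<forall>A\<in>\<A>. small A) \<longrightarrow> small (\<Union>\<A>))"

text \<open>Small sets are themselves elements of the universe, by means of an injection \<open>enc\<close> of the
  small sets into \<open>'u\<close>; it exists by \<open>inj_on_enc\<close> below.\<close>

definition enc :: "'u set \<Rightarrow> 'u"
  where "enc = (SOME c. inj_on c {A. small A})"

definition dec :: "'u \<Rightarrow> 'u set"
  where "dec = inv_into {A. small A} enc"

definition zero_u :: 'u where "zero_u = enc {}"
definition one_u :: 'u where "one_u = enc {enc {}}"

text \<open>The element of the universe that represents a function from \<open>A\<close> to \<open>{zero_u, one_u}\<close>. It is
  used to regard the hom-sets \<open>C \<rightarrow> 2\<close> and \<open>X \<rightarrow> \<S>\<close> as small sets.\<close>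

definition name2 :: "'u set \<Rightarrow> ('u \<Rightarrow> 'u) \<Rightarrow> 'u"
  where "name2 A f = enc {a \<in> A. f a = one_u}"

lemma inj_on_enc:
  assumes U: "universe TYPE('u)"
  shows "inj_on (enc :: 'u set \<Rightarrow> 'u) {A. small A}"
proof -
  have lt: "X \<prec> Y \<longleftrightarrow> (card_of X, card_of Y) \<in> ordLess" for X :: "'c set" and Y :: "'d set"
  proof -
    have "X \<prec> Y \<longleftrightarrow> \<not> Y \<lesssim> X"
      by (metis card_of_ordLeq card_of_ordLess eqpoll_imp_lepoll eqpoll_sym lepoll_antisym lepoll_def
          lesspoll_def ordLess_imp_ordLeq)
    then show ?thesis
      using card_of_ordLess[of Y X] by (simp add: lepoll_def)
  qed
  let ?r = "card_of (UNIV :: 'u set)"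
  have r: "Card_order ?r" "Field ?r = UNIV" "Well_order ?r"
    using card_of_Card_order[of "UNIV :: 'u set"] card_of_Well_order[of "UNIV :: 'u set"] Field_card_of[of "UNIV :: 'u set"]
    by simp_all
  have Pow: "Pow A \<prec> (UNIV :: 'u set)" if "small A" for A :: "'u set"
    using U that by (auto simp: universe_def)
  have inf: "infinite (UNIV :: 'u set)"
  proof
    assume fin: "finite (UNIV :: 'u set)"
    obtain x :: 'u where True by blast
    let ?A = "UNIV - {x}"
    have c: "card (UNIV :: 'u set) = Suc (card ?A)"
      using fin card.remove[of UNIV x] by simp
    have "\<not> (UNIV :: 'u set) \<lesssim> ?A"
      using lepoll_iff_card_le[OF fin finite_Diff[OF fin]] c by (metis Suc_n_not_le_n)
    then have "small ?A"
      unfolding small_def lesspoll_def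
      using eqpoll_imp_lepoll[OF eqpoll_sym] subset_imp_lepoll[OF subset_UNIV] by blast
    then have "Pow ?A \<lesssim> (UNIV :: 'u set)" "\<not> Pow ?A \<approx> (UNIV :: 'u set)"
      using Pow by (auto simp: lesspoll_def)
    moreover have "finite (Pow ?A)" using finite_subset[OF subset_UNIV fin] by simp
    moreover have "card (UNIV :: 'u set) \<le> card (Pow ?A)"
      using c less_exp[of "card ?A"] finite_subset[OF subset_UNIV fin, of ?A] by (metis Suc_leI card_Pow)
    ultimately show False
      using fin lepoll_iff_card_le[of "UNIV :: 'u set" "Pow ?A"] lepoll_antisym by blast
  qed
  have small_underS: "small (underS ?r x)" for x
    unfolding small_def lt using card_of_underS[OF r(1), of x] r by simp
  have small_under: "small (under ?r x)" for x
  proof -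
    have "under ?r x \<subseteq> insert x (underS ?r x)" by (auto simp: under_def underS_def)
    moreover have "small (insert x (underS ?r x))"
    proof -
      have fin: "F \<prec> (UNIV :: 'u set)" if "finite F" for F :: "'c set"
        using inf that by (rule finite_lesspoll_infinite)
      have "{underS ?r x, {x}} \<prec> (UNIV :: 'u set)" "small {x}"
        unfolding small_def by (intro fin; simp)+
      then have "small (\<Union>{underS ?r x, {x}})"
        using U small_underS unfolding universe_def by blast
      then show ?thesis by simp
    qed
    ultimately show ?thesis
      unfolding small_def by (meson lesspoll_trans1 subset_imp_lepoll)
  qed
  have bounded: "\<exists>x. A \<subseteq> under ?r x" if A: "small A" for A
  proof (rule ccontr)
    assume n: "\<nexists>x. A \<subseteq> under ?r x"
    have "\<exists>a\<in>A. x \<in> under ?r a" for x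
    proof -
      obtain a where "a \<in> A" "a \<notin> under ?r x" using n by blast
      then show ?thesis
        using r(2,3) unfolding under_def well_order_on_def linear_order_on_def total_on_def
          partial_order_on_def preorder_on_def refl_on_def
        by (metis (no_types, lifting) UNIV_I mem_Collect_eq)
    qed
    then have "UNIV = \<Union>(under ?r ` A)" by blast
    moreover have "small (\<Union>(under ?r ` A))"
    proof -
      have "under ?r ` A \<prec> (UNIV :: 'u set)"
        using A unfolding small_def by (meson image_lepoll lesspoll_trans1)
      then show ?thesis using U small_under unfolding universe_def by blast
    qed
    ultimately show False by (simp add: small_def)
  qed
  have "{A :: 'u set. small A} \<subseteq> (\<Union>x. Pow (under ?r x))" using bounded by blast
  moreover have "(card_of (\<Union>x. Pow (under ?r x)), ?r) \<in> ordLeq"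
    by (rule card_of_UNION_ordLeq_infinite[OF inf])
       (use Pow[OF small_under] in \<open>auto simp: lt intro: ordLess_imp_ordLeq card_of_mono1\<close>)
  ultimately have "\<exists>c :: 'u set \<Rightarrow> 'u. inj_on c {A. small A}"
    by (metis card_of_ordLeq inj_on_subset)
  then show ?thesis unfolding enc_def by (rule someI_ex)
qed

lemma universe_nat: "universe TYPE(nat)"
proof -
  have *: "X \<prec> (UNIV :: nat set) \<longleftrightarrow> finite X" for X :: "'b set"
    using finite_lesspoll_infinite infinite_le_lepoll lepoll_antisym lesspoll_def infinite_UNIV_nat
    by metis
  show ?thesis unfolding universe_def small_def * by auto
qed

section \<open>Categories\<close>

record ('o, 'm) cat =
  Obj :: "'o set"
  Arr :: "'m set"
  Dom :: "'m \<Rightarrow> 'o"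
  Cod :: "'m \<Rightarrow> 'o"
  Id :: "'o \<Rightarrow> 'm"
  Comp :: "'m \<Rightarrow> 'm \<Rightarrow> 'm"  (infixr \<open>\<cdot>\<index>\<close> 75)

definition Hom :: "('o, 'm) cat \<Rightarrow> 'o \<Rightarrow> 'o \<Rightarrow> 'm set"
  where "Hom C A B = {f \<in> Arr C. Dom C f = A \<and> Cod C f = B}"

definition category :: "('o, 'm) cat \<Rightarrow> bool"
  where "category C \<longleftrightarrow>
    (\<forall>f \<in> Arr C. Dom C f \<in> Obj C \<and> Cod C f \<in> Obj C) \<and>
    (\<forall>A \<in> Obj C. Id C A \<in> Hom C A A) \<and>
    (\<forall>f \<in> Arr C. \<forall>g \<in> Arr C. Cod C f = Dom C g \<longrightarrow> g \<cdot>\<^bsub>C\<^esub> f \<in> Hom C (Dom C f) (Cod C g)) \<and>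
    (\<forall>f \<in> Arr C. f \<cdot>\<^bsub>C\<^esub> Id C (Dom C f) = f \<and> Id C (Cod C f) \<cdot>\<^bsub>C\<^esub> f = f) \<and>
    (\<forall>f \<in> Arr C. \<forall>g \<in> Arr C. \<forall>h \<in> Arr C. Cod C f = Dom C g \<and> Cod C g = Dom C h \<longrightarrow>
       (h \<cdot>\<^bsub>C\<^esub> g) \<cdot>\<^bsub>C\<^esub> f = h \<cdot>\<^bsub>C\<^esub> (g \<cdot>\<^bsub>C\<^esub> f))"

definition op_cat :: "('o, 'm) cat \<Rightarrow> ('o, 'm) cat"
  where "op_cat C = \<lparr> Obj = Obj C, Arr = Arr C, Dom = Cod C, Cod = Dom C, Id = Id C,
    Comp = (\<lambda>g f. f \<cdot>\<^bsub>C\<^esub> g) \<rparr>"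

definition full_sub :: "('o, 'm) cat \<Rightarrow> ('o \<Rightarrow> bool) \<Rightarrow> ('o, 'm) cat"
  where "full_sub C P = C\<lparr> Obj := {A \<in> Obj C. P A}, Arr := {f \<in> Arr C. P (Dom C f) \<and> P (Cod C f)} \<rparr>"

definition is_inverse :: "('o, 'm) cat \<Rightarrow> 'm \<Rightarrow> 'm \<Rightarrow> bool"
  where "is_inverse C f g \<longleftrightarrow> f \<in> Arr C \<and> g \<in> Hom C (Cod C f) (Dom C f) \<and>
    g \<cdot>\<^bsub>C\<^esub> f = Id C (Dom C f) \<and> f \<cdot>\<^bsub>C\<^esub> g = Id C (Cod C f)"

definition isos :: "('o, 'm) cat \<Rightarrow> 'o \<Rightarrow> 'o \<Rightarrow> 'm set"
  where "isos C A B = {f \<in> Hom C A B. \<exists>g. is_inverse C f g}"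

definition inverse_arr :: "('o, 'm) cat \<Rightarrow> 'm \<Rightarrow> 'm"
  where "inverse_arr C f = (THE g. is_inverse C f g)"

record ('o, 'm, 'p, 'n) ftor =
  fobj :: "'o \<Rightarrow> 'p"
  fmap :: "'m \<Rightarrow> 'n"

definition is_functor :: "('o, 'm) cat \<Rightarrow> ('p, 'n) cat \<Rightarrow> ('o, 'm, 'p, 'n) ftor \<Rightarrow> bool"
  where "is_functor C D F \<longleftrightarrow> category C \<and> category D \<and>
    (\<forall>A \<in> Obj C. fobj F A \<in> Obj D) \<and>
    (\<forall>f \<in> Arr C. fmap F f \<in> Hom D (fobj F (Dom C f)) (fobj F (Cod C f))) \<and>
    (\<forall>A \<in> Obj C. fmap F (Id C A) = Id D (fobj F A)) \<and>
    (\<forall>f \<in> Arr C. \<forall>g \<in> Arr C. Cod C f = Dom C g \<longrightarrow> fmap F (g \<cdot>\<^bsub>C\<^esub> f) = fmap F g \<cdot>\<^bsub>D\<^esub> fmap F f)"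

definition faithful :: "('o, 'm) cat \<Rightarrow> ('p, 'n) cat \<Rightarrow> ('o, 'm, 'p, 'n) ftor \<Rightarrow> bool"
  where "faithful C D F \<longleftrightarrow> is_functor C D F \<and>
    (\<forall>A \<in> Obj C. \<forall>B \<in> Obj C. inj_on (fmap F) (Hom C A B))"

text \<open>The identity functor, and also the inclusion functor of any subcategory.\<close>

definition idF :: "('o, 'm, 'o, 'm) ftor"
  where "idF = \<lparr> fobj = (\<lambda>A. A), fmap = (\<lambda>f. f) \<rparr>"

definition compF :: "('p, 'n, 'q, 'k) ftor \<Rightarrow> ('o, 'm, 'p, 'n) ftor \<Rightarrow> ('o, 'm, 'q, 'k) ftor"
    (infixr \<open>\<odot>\<close> 70)
  where "G \<odot> F = \<lparr> fobj = (\<lambda>A. fobj G (fobj F A)), fmap = (\<lambda>f. fmap G (fmap F f)) \<rparr>"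

definition natural :: "('o, 'm) cat \<Rightarrow> ('p, 'n) cat \<Rightarrow>
    ('o, 'm, 'p, 'n) ftor \<Rightarrow> ('o, 'm, 'p, 'n) ftor \<Rightarrow> ('o \<Rightarrow> 'n) \<Rightarrow> bool"
  where "natural C D F G \<tau> \<longleftrightarrow> is_functor C D F \<and> is_functor C D G \<and>
    (\<forall>A \<in> Obj C. \<tau> A \<in> Hom D (fobj F A) (fobj G A)) \<and>
    (\<forall>f \<in> Arr C. \<tau> (Cod C f) \<cdot>\<^bsub>D\<^esub> fmap F f = fmap G f \<cdot>\<^bsub>D\<^esub> \<tau> (Dom C f))"

definition natural_iso :: "('o, 'm) cat \<Rightarrow> ('p, 'n) cat \<Rightarrow>
    ('o, 'm, 'p, 'n) ftor \<Rightarrow> ('o, 'm, 'p, 'n) ftor \<Rightarrow> ('o \<Rightarrow> 'n) \<Rightarrow> bool"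
  where "natural_iso C D F G \<tau> \<longleftrightarrow> natural C D F G \<tau> \<and>
    (\<forall>A \<in> Obj C. \<tau> A \<in> isos D (fobj F A) (fobj G A))"

text \<open>The family of identities at the values of \<open>F\<close>.\<close>

definition id_trans :: "('p, 'n) cat \<Rightarrow> ('o, 'm, 'p, 'n) ftor \<Rightarrow> 'o \<Rightarrow> 'n"
  where "id_trans D F = (\<lambda>A. Id D (fobj F A))"

definition equivalence :: "('o, 'm) cat \<Rightarrow> ('p, 'n) cat \<Rightarrow> ('o, 'm, 'p, 'n) ftor \<Rightarrow> bool"
  where "equivalence C D F \<longleftrightarrow>
    (\<exists>G \<eta> \<epsilon>. natural_iso C C idF (G \<odot> F) \<eta> \<and> natural_iso D D (F \<odot> G) idF \<epsilon> \<and>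
      is_functor C D F \<and> is_functor D C G)"

section \<open>Adjunctions and right adjunction morphisms\<close>

record ('o, 'm, 'p, 'n) adj =
  lcat :: "('o, 'm) cat"
  rcat :: "('p, 'n) cat"
  ladj :: "('o, 'm, 'p, 'n) ftor"
  radj :: "('p, 'n, 'o, 'm) ftor"
  unit :: "'o \<Rightarrow> 'm"
  counit :: "'p \<Rightarrow> 'n"

text \<open>\<open>ladj : lcat \<rightarrow> rcat\<close> is left adjoint to \<open>radj : rcat \<rightarrow> lcat\<close>.\<close>

definition adjunction :: "('o, 'm, 'p, 'n) adj \<Rightarrow> bool"
  where "adjunction T \<longleftrightarrow>
    natural (lcat T) (lcat T) idF (radj T \<odot> ladj T) (unit T) \<and>
    natural (rcat T) (rcat T) (ladj T \<odot> radj T) idF (counit T) \<and>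
    is_functor (lcat T) (rcat T) (ladj T) \<and> is_functor (rcat T) (lcat T) (radj T) \<and>
    (\<forall>A \<in> Obj (lcat T). counit T (fobj (ladj T) A) \<cdot>\<^bsub>rcat T\<^esub> fmap (ladj T) (unit T A)
       = Id (rcat T) (fobj (ladj T) A)) \<and>
    (\<forall>B \<in> Obj (rcat T). fmap (radj T) (counit T B) \<cdot>\<^bsub>lcat T\<^esub> unit T (fobj (radj T) B)
       = Id (lcat T) (fobj (radj T) B))"

definition right_adjunction_morphism ::
  "('o, 'm, 'p, 'n) adj \<Rightarrow> ('a, 'b, 'c, 'd) adj \<Rightarrow> ('o, 'm, 'a, 'b) ftor \<Rightarrow> ('p, 'n, 'c, 'd) ftor
    \<Rightarrow> ('p \<Rightarrow> 'b) \<Rightarrow> ('o \<Rightarrow> 'd) \<Rightarrow> bool"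
  where "right_adjunction_morphism S T U V \<zeta> \<xi> \<longleftrightarrow>
    adjunction S \<and> adjunction T \<and>
    is_functor (lcat S) (lcat T) U \<and> is_functor (rcat S) (rcat T) V \<and>
    natural_iso (rcat S) (lcat T) (U \<odot> radj S) (radj T \<odot> V) \<zeta> \<and>
    natural (lcat S) (rcat T) (ladj T \<odot> U) (V \<odot> ladj S) \<xi> \<and>
    (\<forall>A \<in> Obj (lcat S). \<xi> A =
       counit T (fobj V (fobj (ladj S) A)) \<cdot>\<^bsub>rcat T\<^esub>
       fmap (ladj T) (\<zeta> (fobj (ladj S) A)) \<cdot>\<^bsub>rcat T\<^esub>
       fmap (ladj T) (fmap U (unit S A)))"

definition strong_adjunction_morphism ::
  "('o, 'm, 'p, 'n) adj \<Rightarrow> ('a, 'b, 'c, 'd) adj \<Rightarrow> ('o, 'm, 'a, 'b) ftor \<Rightarrow> ('p, 'n, 'c, 'd) ftor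
    \<Rightarrow> ('p \<Rightarrow> 'b) \<Rightarrow> ('o \<Rightarrow> 'd) \<Rightarrow> bool"
  where "strong_adjunction_morphism S T U V \<zeta> \<xi> \<longleftrightarrow> right_adjunction_morphism S T U V \<zeta> \<xi> \<and>
    natural_iso (lcat S) (rcat T) (ladj T \<odot> U) (V \<odot> ladj S) \<xi>"

section \<open>Concrete categories of sets, spaces and frames\<close>

datatype ('o, 'u) arrow = Arrow (src: 'o) (fn: "'u \<Rightarrow> 'u") (tgt: 'o)

text \<open>The category with objects \<open>\<O>\<close>, underlying sets given by \<open>car\<close>, and as arrows \<open>A \<rightarrow> B\<close> the
  functions on \<open>car A\<close> (normalised to be \<^const>\<open>undefined\<close> elsewhere) that satisfy \<open>hom A B\<close>.\<close>

definition concrete :: "'o set \<Rightarrow> ('o \<Rightarrow> 'u set) \<Rightarrow> ('o \<Rightarrow> 'o \<Rightarrow> ('u \<Rightarrow> 'u) \<Rightarrow> bool)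
    \<Rightarrow> ('o, ('o, 'u) arrow) cat"
  where "concrete \<O> car hom = \<lparr> Obj = \<O>,
    Arr = {f. src f \<in> \<O> \<and> tgt f \<in> \<O> \<and> fn f \<in> extensional (car (src f)) \<and> hom (src f) (tgt f) (fn f)},
    Dom = src, Cod = tgt,
    Id = (\<lambda>A. Arrow A (\<lambda>x\<in>car A. x) A),
    Comp = (\<lambda>g f. Arrow (src f) (compose (car (src f)) (fn g) (fn f)) (tgt g)) \<rparr>"

definition SET :: "('u set, ('u set, 'u) arrow) cat"
  where "SET = concrete {A. small A} (\<lambda>A. A) (\<lambda>A B f. f \<in> A \<rightarrow> B)"

definition TOP :: "('u topology, ('u topology, 'u) arrow) cat"
  where "TOP = concrete {X. small (topspace X)} topspace continuous_map"

definition T_D :: "'u topology \<Rightarrow> bool"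
  where "T_D X \<longleftrightarrow> (\<forall>x \<in> topspace X. \<exists>U C. openin X U \<and> closedin X C \<and> {x} = U \<inter> C)"

definition TOP_D :: "('u topology, ('u topology, 'u) arrow) cat"
  where "TOP_D = full_sub TOP T_D"

definition sierpinski :: "'u topology"
  where "sierpinski = topology (\<lambda>U. U \<in> {{}, {one_u}, {zero_u, one_u}})"

definition frame :: "'a gorder \<Rightarrow> bool"
  where "frame L \<longleftrightarrow> complete_lattice L \<and>
    (\<forall>a \<in> carrier L. \<forall>B \<subseteq> carrier L. a \<sqinter>\<^bsub>L\<^esub> (\<Squnion>\<^bsub>L\<^esub> B) = \<Squnion>\<^bsub>L\<^esub> ((\<lambda>b. a \<sqinter>\<^bsub>L\<^esub> b) ` B))"

definition frame_hom :: "'a gorder \<Rightarrow> 'b gorder \<Rightarrow> ('a \<Rightarrow> 'b) \<Rightarrow> bool"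
  where "frame_hom L M f \<longleftrightarrow> f \<in> carrier L \<rightarrow> carrier M \<and>
    sup_pres L M f \<and> meet_pres L M f \<and> f \<top>\<^bsub>L\<^esub> = \<top>\<^bsub>M\<^esub>"

definition coframe_hom :: "'a gorder \<Rightarrow> 'b gorder \<Rightarrow> ('a \<Rightarrow> 'b) \<Rightarrow> bool"
  where "coframe_hom K M f \<longleftrightarrow> f \<in> carrier K \<rightarrow> carrier M \<and>
    inf_pres K M f \<and> join_pres K M f \<and> f \<bottom>\<^bsub>K\<^esub> = \<bottom>\<^bsub>M\<^esub>"

text \<open>Homomorphisms of complete Boolean algebras; complements are then preserved automatically.\<close>

definition complete_hom :: "'a gorder \<Rightarrow> 'b gorder \<Rightarrow> ('a \<Rightarrow> 'b) \<Rightarrow> bool"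
  where "complete_hom K M f \<longleftrightarrow> f \<in> carrier K \<rightarrow> carrier M \<and> sup_pres K M f \<and> inf_pres K M f"

definition FRM :: "('u gorder, ('u gorder, 'u) arrow) cat"
  where "FRM = concrete {L. frame L \<and> small (carrier L)} carrier frame_hom"

definition two_frm :: "'u gorder"
  where "two_frm = \<lparr> carrier = {zero_u, one_u}, eq = (=), le = (\<lambda>x y. x = zero_u \<or> y = one_u) \<rparr>"

definition underlying :: "('u gorder, ('u gorder, 'u) arrow, 'u set, ('u set, 'u) arrow) ftor"
  where "underlying = \<lparr> fobj = carrier, fmap = (\<lambda>f. Arrow (carrier (src f)) (fn f) (carrier (tgt f))) \<rparr>"

text \<open>The frame of opens, as a functor on the opposite of \<open>TOP\<close>.\<close>

definition Omega :: "('u topology, ('u topology, 'u) arrow, 'u gorder, ('u gorder, 'u) arrow) ftor"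
  where "Omega = (let \<Omega> = (\<lambda>X. \<lparr> carrier = enc ` {U. openin X U}, eq = (=), le = (\<lambda>u v. dec u \<subseteq> dec v) \<rparr>)
    in \<lparr> fobj = \<Omega>,
         fmap = (\<lambda>g. Arrow (\<Omega> (tgt g))
           (\<lambda>u \<in> carrier (\<Omega> (tgt g)). enc {x \<in> topspace (src g). fn g x \<in> dec u})
           (\<Omega> (src g))) \<rparr>)"

section \<open>Cartesian lifts, PFC- and SFC-categories\<close>

definition lifts :: "('o, 'm) cat \<Rightarrow> ('o, 'm, 'p, 'n) ftor \<Rightarrow> 'o \<Rightarrow> 'o \<Rightarrow> 'n \<Rightarrow> bool"
  where "lifts A U D D' h \<longleftrightarrow> (\<exists>p \<in> Hom A D D'. fmap U p = h)"

definition cartesian_lift :: "('o, 'm) cat \<Rightarrow> ('p, 'n) cat \<Rightarrow> ('o, 'm, 'p, 'n) ftor \<Rightarrow>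
    'p \<Rightarrow> 'o \<Rightarrow> 'n set \<Rightarrow> 'o \<Rightarrow> 'n \<Rightarrow> bool"
  where "cartesian_lift A B U X C F Y \<theta> \<longleftrightarrow>
    Y \<in> Obj A \<and> \<theta> \<in> isos B (fobj U Y) X \<and>
    (\<forall>D \<in> Obj A. \<forall>h \<in> Hom B (fobj U D) (fobj U Y).
       lifts A U D Y h \<longleftrightarrow> (\<forall>f \<in> F. lifts A U D C (f \<cdot>\<^bsub>B\<^esub> \<theta> \<cdot>\<^bsub>B\<^esub> h)))"

record ('o, 'm, 'u) pfc =
  pcat :: "('o, 'm) cat"
  pO :: "('o, 'm, 'u gorder, ('u gorder, 'u) arrow) ftor"
  ptwo :: 'o
  piota :: "('u gorder, 'u) arrow"

definition pfc_category :: "('o, 'm, 'u) pfc \<Rightarrow> bool"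
  where "pfc_category P \<longleftrightarrow> faithful (pcat P) FRM (pO P) \<and> ptwo P \<in> Obj (pcat P) \<and>
    piota P \<in> isos FRM (fobj (pO P) (ptwo P)) two_frm"

text \<open>The frame map \<open>\<O> C \<rightarrow> 2\<close> that underlies a point \<open>f : C \<rightarrow> 2\<^sub>C\<close>.\<close>

definition pt_map :: "('o, 'm, 'u) pfc \<Rightarrow> 'm \<Rightarrow> 'u \<Rightarrow> 'u"
  where "pt_map P f = fn (piota P \<cdot>\<^bsub>FRM\<^esub> fmap (pO P) f)"

text \<open>The points of the space \<open>pt\<^sub>C(C)\<close> are the arrows \<open>C \<rightarrow> 2\<^sub>C\<close>, represented in the universe by
  their names; since \<open>\<O>\<close> is faithful this loses nothing.\<close>

definition pt_name :: "('o, 'm, 'u) pfc \<Rightarrow> 'o \<Rightarrow> 'm \<Rightarrow> 'u"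
  where "pt_name P C f = name2 (carrier (fobj (pO P) C)) (pt_map P f)"

definition pt_of_name :: "('o, 'm, 'u) pfc \<Rightarrow> 'o \<Rightarrow> 'u \<Rightarrow> 'm"
  where "pt_of_name P C = inv_into (Hom (pcat P) C (ptwo P)) (pt_name P C)"

definition pt_open :: "('o, 'm, 'u) pfc \<Rightarrow> 'o \<Rightarrow> 'u \<Rightarrow> 'u set"
  where "pt_open P C a = pt_name P C ` {f \<in> Hom (pcat P) C (ptwo P). pt_map P f a = one_u}"

definition pt_space :: "('o, 'm, 'u) pfc \<Rightarrow> 'o \<Rightarrow> 'u topology"
  where "pt_space P C = topology (\<lambda>U. \<exists>a \<in> carrier (fobj (pO P) C). U = pt_open P C a)"

text \<open>\<open>pt\<^sub>C\<close> as a functor to the opposite of \<open>TOP\<close>, acting on arrows by precomposition.\<close>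

definition pt :: "('o, 'm, 'u) pfc \<Rightarrow> ('o, 'm, 'u topology, ('u topology, 'u) arrow) ftor"
  where "pt P = \<lparr> fobj = pt_space P,
    fmap = (\<lambda>p. Arrow (pt_space P (Cod (pcat P) p))
      (\<lambda>n \<in> topspace (pt_space P (Cod (pcat P) p)).
         pt_name P (Dom (pcat P) p) (pt_of_name P (Cod (pcat P) p) n \<cdot>\<^bsub>pcat P\<^esub> p))
      (pt_space P (Dom (pcat P) p))) \<rparr>"

text \<open>The set \<open>Top(X, \<S>)\<close>, again by names, and the evaluations \<open>\<chi>\<^sub>x : Top(X, \<S>) \<rightarrow> |2|\<close>.\<close>

definition sierp_name :: "'u topology \<Rightarrow> ('u topology, 'u) arrow \<Rightarrow> 'u"
  where "sierp_name X g = name2 (topspace X) (fn g)"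

definition sierp_maps :: "'u topology \<Rightarrow> 'u set"
  where "sierp_maps X = sierp_name X ` Hom TOP X sierpinski"

definition chi :: "'u topology \<Rightarrow> 'u \<Rightarrow> ('u set, 'u) arrow"
  where "chi X x = Arrow (sierp_maps X)
    (\<lambda>n \<in> sierp_maps X. fn (inv_into (Hom TOP X sierpinski) (sierp_name X) n) x)
    (carrier two_frm)"

definition pfc_lift :: "('o, 'm, 'u) pfc \<Rightarrow> 'u topology \<Rightarrow> 'o \<Rightarrow> ('u set, 'u) arrow \<Rightarrow> bool"
  where "pfc_lift P X Y \<theta> \<longleftrightarrow>
    cartesian_lift (pcat P) SET (underlying \<odot> pO P) (sierp_maps X) (ptwo P)
      {fmap underlying (inverse_arr FRM (piota P)) \<cdot>\<^bsub>SET\<^esub> chi X x | x. x \<in> topspace X} Y \<theta>"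

definition Top_of :: "('o, 'm, 'u) pfc \<Rightarrow> ('u topology, ('u topology, 'u) arrow) cat"
  where "Top_of P = full_sub TOP (\<lambda>X. \<exists>Y \<theta>. pfc_lift P X Y \<theta>)"

definition sfc_category :: "('o, 'm, 'u) pfc \<Rightarrow> bool"
  where "sfc_category P \<longleftrightarrow> pfc_category P \<and> sierpinski \<in> Obj (Top_of P) \<and>
    (\<forall>C \<in> Obj (pcat P). pt_space P C \<in> Obj (Top_of P))"

text \<open>Cartesian lifts are unique up to isomorphism, so it is immaterial which of them is chosen as
  \<open>(\<Omega>\<^sub>C X, \<theta>\<^sub>C\<^sub>,\<^sub>X)\<close>; the last condition is imposed on all of them.\<close>

definition sfc_morphism :: "('o, 'm, 'u) pfc \<Rightarrow> ('p, 'n, 'u) pfc \<Rightarrow> ('o, 'm, 'p, 'n) ftor \<Rightarrow>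
    ('o \<Rightarrow> ('u gorder, 'u) arrow) \<Rightarrow> 'n \<Rightarrow> bool"
  where "sfc_morphism P Q H \<alpha> i \<longleftrightarrow> sfc_category P \<and> sfc_category Q \<and>
    is_functor (pcat P) (pcat Q) H \<and>
    natural_iso (pcat P) FRM (pO Q \<odot> H) (pO P) \<alpha> \<and>
    i \<in> isos (pcat Q) (fobj H (ptwo P)) (ptwo Q) \<and>
    piota Q \<cdot>\<^bsub>FRM\<^esub> fmap (pO Q) i = piota P \<cdot>\<^bsub>FRM\<^esub> \<alpha> (ptwo P) \<and>
    (\<forall>X \<in> Obj (Top_of P). \<forall>Y \<theta>. pfc_lift P X Y \<theta> \<longrightarrow>
       cartesian_lift (pcat Q) SET (underlying \<odot> pO Q) (sierp_maps X) (fobj H (ptwo P))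
         {fmap underlying (inverse_arr FRM (\<alpha> (ptwo P))) \<cdot>\<^bsub>SET\<^esub>
          fmap underlying (inverse_arr FRM (piota P)) \<cdot>\<^bsub>SET\<^esub> chi X x | x. x \<in> topspace X}
         (fobj H Y) (\<theta> \<cdot>\<^bsub>SET\<^esub> fmap underlying (\<alpha> Y)))"

definition fiber_initial :: "('o, 'm) cat \<Rightarrow> ('o, 'm, 'u gorder, ('u gorder, 'u) arrow) ftor \<Rightarrow> 'o \<Rightarrow> bool"
  where "fiber_initial C \<O> A \<longleftrightarrow> (\<forall>D \<in> Obj C. \<forall>\<theta> \<in> isos FRM (fobj \<O> D) (fobj \<O> A).
    \<exists>p \<in> Hom C A D. \<theta> \<cdot>\<^bsub>FRM\<^esub> fmap \<O> p = Id FRM (fobj \<O> A))"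

definition fiber_terminal :: "('o, 'm) cat \<Rightarrow> ('o, 'm, 'u gorder, ('u gorder, 'u) arrow) ftor \<Rightarrow> 'o \<Rightarrow> bool"
  where "fiber_terminal C \<O> A \<longleftrightarrow> (\<forall>D \<in> Obj C. \<forall>\<theta> \<in> isos FRM (fobj \<O> D) (fobj \<O> A).
    \<exists>p \<in> Hom C D A. fmap \<O> p = \<theta>)"

section \<open>Sublocales and the Funayama envelope\<close>

definition heyting :: "'a gorder \<Rightarrow> 'a \<Rightarrow> 'a \<Rightarrow> 'a"
  where "heyting L a b = \<Squnion>\<^bsub>L\<^esub> {c \<in> carrier L. c \<sqinter>\<^bsub>L\<^esub> a \<sqsubseteq>\<^bsub>L\<^esub> b}"

definition sublocale_of :: "'a gorder \<Rightarrow> 'a set \<Rightarrow> bool"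
  where "sublocale_of L S \<longleftrightarrow> S \<subseteq> carrier L \<and> (\<forall>B \<subseteq> S. \<Sqinter>\<^bsub>L\<^esub> B \<in> S) \<and>
    (\<forall>a \<in> carrier L. \<forall>s \<in> S. heyting L a s \<in> S)"

definition by_inclusion :: "'a set set \<Rightarrow> 'a set gorder"
  where "by_inclusion \<D> = \<lparr> carrier = \<D>, eq = (=), le = (\<subseteq>) \<rparr>"

definition Sl :: "'a gorder \<Rightarrow> 'a set gorder"
  where "Sl L = by_inclusion {S. sublocale_of L S}"

definition closed_sl :: "'a gorder \<Rightarrow> 'a \<Rightarrow> 'a set"
  where "closed_sl L a = {x \<in> carrier L. a \<sqsubseteq>\<^bsub>L\<^esub> x}"

definition open_sl :: "'a gorder \<Rightarrow> 'a \<Rightarrow> 'a set"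
  where "open_sl L a = heyting L a ` carrier L"

definition Fl :: "'a gorder \<Rightarrow> 'a set gorder"
  where "Fl L = by_inclusion {\<Squnion>\<^bsub>Sl L\<^esub> \<B> | \<B>.
    \<B> \<subseteq> {closed_sl L a \<inter> open_sl L b | a b. a \<in> carrier L \<and> b \<in> carrier L}}"

definition codiff :: "'a gorder \<Rightarrow> 'a \<Rightarrow> 'a \<Rightarrow> 'a"
  where "codiff K x k = (THE c. least K c {c \<in> carrier K. x \<sqsubseteq>\<^bsub>K\<^esub> k \<squnion>\<^bsub>K\<^esub> c})"

definition subcolocale :: "'a gorder \<Rightarrow> 'a set \<Rightarrow> bool"
  where "subcolocale K A \<longleftrightarrow> A \<subseteq> carrier K \<and> (\<forall>B \<subseteq> A. \<Squnion>\<^bsub>K\<^esub> B \<in> A) \<and>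
    (\<forall>x \<in> A. \<forall>k \<in> carrier K. codiff K x k \<in> A)"

text \<open>\<open>\<S>f\<close>. Every sublocale is a meet of sublocales \<open>\<up>a \<or> \<o>(b)\<close>, so the two equations determine it.\<close>

definition Sl_map :: "'a gorder \<Rightarrow> 'b gorder \<Rightarrow> ('a \<Rightarrow> 'b) \<Rightarrow> 'a set \<Rightarrow> 'b set"
  where "Sl_map L M f = (THE \<phi>. \<phi> \<in> extensional (carrier (Sl L)) \<and> coframe_hom (Sl L) (Sl M) \<phi> \<and>
    (\<forall>a \<in> carrier L. \<phi> (closed_sl L a) = closed_sl M (f a) \<and> \<phi> (open_sl L a) = open_sl M (f a)))"

definition left_adjoint :: "'a gorder \<Rightarrow> 'b gorder \<Rightarrow> ('a \<Rightarrow> 'b) \<Rightarrow> 'b \<Rightarrow> 'a"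
  where "left_adjoint K M \<phi> = (THE \<psi>. \<psi> \<in> carrier M \<rightarrow>\<^sub>E carrier K \<and>
    (\<forall>y \<in> carrier M. \<forall>x \<in> carrier K. \<psi> y \<sqsubseteq>\<^bsub>K\<^esub> x \<longleftrightarrow> y \<sqsubseteq>\<^bsub>M\<^esub> \<phi> x))"

definition Sl_adj :: "'a gorder \<Rightarrow> 'b gorder \<Rightarrow> ('a \<Rightarrow> 'b) \<Rightarrow> 'b set \<Rightarrow> 'a set"
  where "Sl_adj L M f = left_adjoint (Sl L) (Sl M) (Sl_map L M f)"

definition locally_exact :: "'a gorder \<Rightarrow> 'b gorder \<Rightarrow> ('a \<Rightarrow> 'b) \<Rightarrow> bool"
  where "locally_exact L M f \<longleftrightarrow> frame_hom L M f \<and>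
    (\<exists>\<phi>. complete_hom (Fl L) (Fl M) \<phi> \<and> (\<forall>a \<in> carrier L. \<phi> (open_sl L a) = open_sl M (f a)))"

definition FRM_LE :: "('u gorder, ('u gorder, 'u) arrow) cat"
  where "FRM_LE = concrete (Obj FRM) carrier locally_exact"

section \<open>Skula extensions\<close>

type_synonym 'u skula = "'u gorder \<times> 'u set set"

definition skula_ext :: "'u skula \<Rightarrow> bool"
  where "skula_ext A \<longleftrightarrow> (case A of (L, \<D>) \<Rightarrow>
    L \<in> Obj FRM \<and> subcolocale (Sl L) \<D> \<and> carrier (Fl L) \<subseteq> \<D>)"

definition skula_hom :: "'u skula \<Rightarrow> 'u skula \<Rightarrow> ('u \<Rightarrow> 'u) \<Rightarrow> bool"
  where "skula_hom A B f \<longleftrightarrow> (case (A, B) of ((L, \<D>), (M, \<E>)) \<Rightarrow>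
    frame_hom L M f \<and> (\<forall>E \<in> \<E>. Sl_adj L M f E \<in> \<D>))"

definition SKULA :: "('u skula, ('u skula, 'u) arrow) cat"
  where "SKULA = concrete {A. skula_ext A} (\<lambda>A. carrier (fst A)) skula_hom"

definition O_S :: "('u skula, ('u skula, 'u) arrow, 'u gorder, ('u gorder, 'u) arrow) ftor"
  where "O_S = \<lparr> fobj = fst, fmap = (\<lambda>f. Arrow (fst (src f)) (fn f) (fst (tgt f))) \<rparr>"

definition S_F :: "('u gorder, ('u gorder, 'u) arrow, 'u skula, ('u skula, 'u) arrow) ftor"
  where "S_F = \<lparr> fobj = (\<lambda>L. (L, carrier (Sl L))),
    fmap = (\<lambda>f. Arrow (src f, carrier (Sl (src f))) (fn f) (tgt f, carrier (Sl (tgt f)))) \<rparr>"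

definition two_S :: "'u skula"
  where "two_S = fobj S_F two_frm"

definition skula_top :: "'u topology \<Rightarrow> 'u topology"
  where "skula_top X = topology_generated_by
    ({U. openin X U} \<union> {topspace X - U | U. openin X U})"

definition point_sl :: "'u topology \<Rightarrow> 'u \<Rightarrow> 'u set"
  where "point_sl X x = {enc (topspace X - X closure_of {x}), enc (topspace X)}"

definition SKC :: "'u topology \<Rightarrow> 'u set set"
  where "SKC X = {\<Squnion>\<^bsub>Sl (fobj Omega X)\<^esub> (point_sl X ` Y) | Y. closedin (skula_top X) Y}"

text \<open>\<open>\<S>\<K>\<close>, as a functor on the opposite of \<open>TOP\<close>.\<close>

definition SK :: "('u topology, ('u topology, 'u) arrow, 'u skula, ('u skula, 'u) arrow) ftor"
  where "SK = \<lparr> fobj = (\<lambda>X. (fobj Omega X, SKC X)),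
    fmap = (\<lambda>g. Arrow (fobj Omega (tgt g), SKC (tgt g)) (fn (fmap Omega g)) (fobj Omega (src g), SKC (src g))) \<rparr>"

definition SKULA_I :: "('u skula, ('u skula, 'u) arrow) cat"
  where "SKULA_I = full_sub SKULA (fiber_initial SKULA O_S)"

definition SKULA_T :: "('u skula, ('u skula, 'u) arrow) cat"
  where "SKULA_T = full_sub SKULA (fiber_terminal SKULA O_S)"

section \<open>The categories as PFC-categories, and the spectral adjunctions\<close>

type_synonym 'u skula_pfc = "('u skula, ('u skula, 'u) arrow, 'u) pfc"
type_synonym 'u frame_pfc = "('u gorder, ('u gorder, 'u) arrow, 'u) pfc"

definition Skula :: "'u skula_pfc"
  where "Skula = \<lparr> pcat = SKULA, pO = O_S, ptwo = two_S, piota = Id FRM two_frm \<rparr>"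

definition Skula_I :: "'u skula_pfc"
  where "Skula_I = \<lparr> pcat = SKULA_I, pO = O_S, ptwo = two_S, piota = Id FRM two_frm \<rparr>"

definition Skula_T :: "'u skula_pfc"
  where "Skula_T = \<lparr> pcat = SKULA_T, pO = O_S, ptwo = two_S, piota = Id FRM two_frm \<rparr>"

definition Frm :: "'u frame_pfc"
  where "Frm = \<lparr> pcat = FRM, pO = idF, ptwo = two_frm, piota = Id FRM two_frm \<rparr>"

definition Frm_LE :: "'u frame_pfc"
  where "Frm_LE = \<lparr> pcat = FRM_LE, pO = idF, ptwo = two_frm, piota = Id FRM two_frm \<rparr>"

text \<open>In the following, \<open>G\<close> is a functor on a category of spaces such that the frame underlying \<open>G X\<close>
  is \<open>\<Omega> X\<close>. The unit sends \<open>a\<close> to the open set \<open>{f | f(a) = 1}\<close>, and the counit is, as a continuous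
  map \<open>X \<rightarrow> pt(G X)\<close>, the map that sends \<open>x\<close> to the point \<open>U \<mapsto> (x \<in> U)\<close>.\<close>

definition spec_unit :: "('o, ('o, 'u) arrow, 'u) pfc \<Rightarrow>
    ('u topology, ('u topology, 'u) arrow, 'o, ('o, 'u) arrow) ftor \<Rightarrow> 'o \<Rightarrow> ('o, 'u) arrow"
  where "spec_unit P G C = Arrow C (\<lambda>a \<in> carrier (fobj (pO P) C). enc (pt_open P C a))
    (fobj G (pt_space P C))"

definition spec_counit :: "('o, ('o, 'u) arrow, 'u) pfc \<Rightarrow>
    ('u topology, ('u topology, 'u) arrow, 'o, ('o, 'u) arrow) ftor \<Rightarrow> 'u topology
      \<Rightarrow> ('u topology, 'u) arrow"
  where "spec_counit P G X = Arrow X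
    (\<lambda>x \<in> topspace X. pt_name P (fobj G X)
       (Arrow (fobj G X)
          (\<lambda>u \<in> carrier (fobj Omega X). if x \<in> dec u then one_u else zero_u) (ptwo P)))
    (pt_space P (fobj G X))"

definition spec_adj :: "('o, ('o, 'u) arrow, 'u) pfc \<Rightarrow> ('u topology, ('u topology, 'u) arrow) cat
    \<Rightarrow> ('u topology, ('u topology, 'u) arrow, 'o, ('o, 'u) arrow) ftor
    \<Rightarrow> ('o, ('o, 'u) arrow, 'u topology, ('u topology, 'u) arrow) adj"
  where "spec_adj P \<T> G = \<lparr> lcat = pcat P, rcat = op_cat \<T>, ladj = pt P, radj = G,
    unit = spec_unit P G, counit = spec_counit P G \<rparr>"

text \<open>The continuous map \<open>pt\<^sub>P(C) \<rightarrow> pt\<^sub>Q(H C)\<close>, \<open>f \<mapsto> H f\<close>, where \<open>H\<close> preserves the distinguished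
  object strictly.\<close>

definition spec_comparison :: "('o, 'm, 'u) pfc \<Rightarrow> ('p, 'n, 'u) pfc \<Rightarrow> ('o, 'm, 'p, 'n) ftor
    \<Rightarrow> 'o \<Rightarrow> ('u topology, 'u) arrow"
  where "spec_comparison P Q H C = Arrow (pt_space P C)
    (\<lambda>n \<in> topspace (pt_space P C). pt_name Q (fobj H C) (fmap H (pt_of_name P C n)))
    (pt_space Q (fobj H C))"

end

theory Submission
  imports Defs
begin

text \<open>All five adjunctions are instances of one construction. A point of an object \<open>A\<close> is an arrow
  \<open>A \<rightarrow> 2\<close>, and is determined by the completely prime filter of the \<open>a\<close> that it sends to \<open>1\<close>. Let
  \<open>G X\<close> be a structure on \<open>\<Omega>X\<close>, for \<open>X\<close> in a class of spaces that contains all spectra, and suppose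
  that a function \<open>k : A \<rightarrow> \<Omega>X\<close> is an arrow \<open>A \<rightarrow> G X\<close> if and only if its composites with all
  evaluations \<open>ev\<^sub>x : \<Omega>X \<rightarrow> 2\<close>, \<open>x \<in> X\<close>, are points of \<open>A\<close>. Then \<open>pt\<close> is left adjoint to \<open>G\<close>
  (\<open>spec_adjunction\<close>): the composites of the unit with evaluations are points by construction, and the
  composites of a preimage map with evaluations are evaluations. A functor that changes neither
  frames nor functions, preserves \<open>2\<close> and takes \<open>G\<close> to \<open>G'\<close> induces a right adjunction morphism, in
  which the comparison of spectra is the inclusion of one set of filters in another; it is strong as
  soon as both objects have the same points. For such a functor to be a morphism of SFC-categories,
  it suffices that it preserves the lift given by \<open>G\<close> of every space in question, since all
  cartesian lifts of a space are isomorphic (\<open>lift_preserved\<close>). It remains to verify the universal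
  property of \<open>G X\<close> in the five categories.

  A sublocale \<open>S\<close> forces \<open>a \<le> b\<close> if the quotient map onto \<open>S\<close> sends \<open>a\<close> below the image of \<open>b\<close>, that is,
  if \<open>S\<close> is contained in \<open>\<up>a \<or> \<o>(b)\<close> (\<open>subset_ineq_sl_iff\<close>). Sublocales are determined by the
  inequalities that they force (\<open>mem_sublocale_if\<close>), and \<open>\<up>a \<or> \<o>(b)\<close> has the complement
  \<open>\<up>b \<inter> \<o>(a)\<close> (\<open>subset_ineq_join_iff\<close>). For a frame map \<open>f\<close> with right adjoint \<open>f\<^sub>*\<close>, the image \<open>f\<^sub>*[T]\<close>
  forces \<open>a \<le> b\<close> precisely if \<open>T\<close> forces \<open>f a \<le> f b\<close> (\<open>image_subset_ineq_iff\<close>). Therefore the left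
  adjoint of \<open>\<S>f\<close> is \<open>T \<mapsto> f\<^sub>*[T]\<close> (\<open>Sl_adj_eq\<close>), and arrows of Skula extensions are the frame maps
  for which \<open>f\<^sub>*[-]\<close> respects the chosen subcolocales. In particular, a point \<open>p\<close> of the frame \<open>L\<close> is a point
  of \<open>(L, \<D>)\<close> if and only if \<open>p\<^sub>*[2] \<in> \<D>\<close>.

  For the evaluation \<open>ev\<^sub>x\<close> this image is \<open>b(x)\<close> (\<open>point_sl_eq\<close>). As \<open>\<S>\<K>\<C>\<^sup>*X\<close> consists of all joins of
  sublocales \<open>b(x)\<close> (\<open>SKC_eq\<close>) and images under \<open>f\<^sub>*\<close> preserve joins (\<open>image_Sup\<close>), the universal
  property holds for \<open>\<S>\<K>\<close> (\<open>skula_hom_SK_iff\<close>). The fiber-initial objects are the \<open>(L, \<S>L)\<close>, from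
  which all frame maps are arrows, and the fiber-terminal ones are the \<open>(L, \<F>L)\<close>
  (\<open>fiber_initial_iff\<close>, \<open>fiber_terminal_iff\<close>); hence the universal property for \<open>\<S>\<O>\<S>\<K>\<close> and for the
  functor \<open>\<Omega>\<close> into all frames is that of the frame of opens (\<open>frame_hom_Omega_iff\<close>). A frame map \<open>f\<close> is an arrow
  \<open>(L, \<F>L) \<rightarrow> (M, \<F>M)\<close> if and only if it is locally exact, because an extension of \<open>f\<close> to the
  Funayama envelopes is a right adjoint of \<open>f\<^sub>*[-]\<close> (\<open>locally_exact_iff\<close>). Finally, if \<open>p\<close> is a point of
  \<open>(L, \<F>L)\<close>, then \<open>p\<^sub>*[2]\<close> is of the form \<open>\<up>a \<inter> \<o>(b)\<close>, which isolates \<open>p\<close> among all points in the way that the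
  \<open>T\<^sub>D\<close>-axiom demands (\<open>T_D_pt_space\<close>); conversely \<open>\<S>\<K>\<C>\<^sup>*X = \<F>(\<Omega>X)\<close> for every \<open>T\<^sub>D\<close>-space \<open>X\<close>.\<close>


section \<open>Frames and their sublocales\<close>

lemma complete_lattice_if_sups:
  assumes "partial_order K" and sups: "\<And>A. A \<subseteq> carrier K \<Longrightarrow> \<exists>s. least K s (Upper K A)"
  shows "complete_lattice K"
proof -
  interpret partial_order K by fact
  show ?thesis
  proof (rule complete_latticeI[OF sups])
    fix A assume A: "A \<subseteq> carrier K"
    obtain s where "least K s (Upper K (Lower K A))"
      using sups[of "Lower K A"] by (auto simp: Lower_def)
    then have "greatest K s (Lower K A)"
      using A unfolding greatest_def least_def Lower_def Upper_def by blast
    then show "\<exists>i. greatest K i (Lower K A)" ..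
  qed
qed

lemma by_inclusion_simps [simp]:
  "carrier (by_inclusion \<D>) = \<D>" "S \<sqsubseteq>\<^bsub>by_inclusion \<D>\<^esub> T \<longleftrightarrow> S \<subseteq> T"
  by (simp_all add: by_inclusion_def)

lemma partial_order_by_inclusion: "partial_order (by_inclusion \<D>)"
  by unfold_locales (auto simp: by_inclusion_def)

lemma Sup_by_inclusion:
  assumes "S \<in> \<D>" "\<B> \<subseteq> \<D>" "\<And>A. A \<in> \<B> \<Longrightarrow> A \<subseteq> S"
    and "\<And>T. T \<in> \<D> \<Longrightarrow> (\<And>A. A \<in> \<B> \<Longrightarrow> A \<subseteq> T) \<Longrightarrow> S \<subseteq> T"
  shows "least (by_inclusion \<D>) S (Upper (by_inclusion \<D>) \<B>)" "\<Squnion>\<^bsub>by_inclusion \<D>\<^esub> \<B> = S"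
proof -
  show l: "least (by_inclusion \<D>) S (Upper (by_inclusion \<D>) \<B>)"
    unfolding least_def Upper_def
  proof (intro conjI ballI)
    fix T assume "T \<in> {u. \<forall>x. x \<in> \<B> \<inter> carrier (by_inclusion \<D>) \<longrightarrow> x \<sqsubseteq>\<^bsub>by_inclusion \<D>\<^esub> u}
      \<inter> carrier (by_inclusion \<D>)"
    then have "T \<in> \<D>" "\<And>A. A \<in> \<B> \<Longrightarrow> A \<subseteq> T" using assms(2) by auto
    then show "S \<sqsubseteq>\<^bsub>by_inclusion \<D>\<^esub> T" using assms(4) by simp
  qed (use assms(1,3) in auto)
  show "\<Squnion>\<^bsub>by_inclusion \<D>\<^esub> \<B> = S"
    unfolding sup_def
    by (rule some_equality) (metis l partial_order.least_unique partial_order_by_inclusion)+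
qed

lemma Inf_by_inclusion:
  assumes "S \<in> \<D>" "\<B> \<subseteq> \<D>" "\<And>A. A \<in> \<B> \<Longrightarrow> S \<subseteq> A"
    and "\<And>T. T \<in> \<D> \<Longrightarrow> (\<And>A. A \<in> \<B> \<Longrightarrow> T \<subseteq> A) \<Longrightarrow> T \<subseteq> S"
  shows "\<Sqinter>\<^bsub>by_inclusion \<D>\<^esub> \<B> = S"
proof -
  have l: "greatest (by_inclusion \<D>) S (Lower (by_inclusion \<D>) \<B>)"
    unfolding greatest_def Lower_def
  proof (intro conjI ballI)
    fix T assume "T \<in> {l. \<forall>x. x \<in> \<B> \<inter> carrier (by_inclusion \<D>) \<longrightarrow> l \<sqsubseteq>\<^bsub>by_inclusion \<D>\<^esub> x}
      \<inter> carrier (by_inclusion \<D>)"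
    then have "T \<in> \<D>" "\<And>A. A \<in> \<B> \<Longrightarrow> T \<subseteq> A" using assms(2) by auto
    then show "T \<sqsubseteq>\<^bsub>by_inclusion \<D>\<^esub> S" using assms(4) by simp
  qed (use assms(1,3) in auto)
  show ?thesis
    unfolding inf_def
    by (rule some_equality) (metis l partial_order.greatest_unique partial_order_by_inclusion)+
qed

context complete_lattice
begin

lemma Sup_le_iff: "A \<subseteq> carrier L \<Longrightarrow> z \<in> carrier L \<Longrightarrow> \<Squnion>A \<sqsubseteq> z \<longleftrightarrow> (\<forall>x\<in>A. x \<sqsubseteq> z)"
  by (meson in_mono le_trans sup_closed sup_least sup_upper)

lemma le_Inf_iff: "A \<subseteq> carrier L \<Longrightarrow> z \<in> carrier L \<Longrightarrow> z \<sqsubseteq> \<Sqinter>A \<longleftrightarrow> (\<forall>x\<in>A. z \<sqsubseteq> x)"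
  by (meson in_mono le_trans inf_closed inf_greatest inf_lower)

lemma join_le_iff:
  "x \<in> carrier L \<Longrightarrow> y \<in> carrier L \<Longrightarrow> z \<in> carrier L \<Longrightarrow> x \<squnion> y \<sqsubseteq> z \<longleftrightarrow> x \<sqsubseteq> z \<and> y \<sqsubseteq> z"
  by (meson join_closed join_le join_left join_right le_trans)

lemma le_meet_iff:
  "x \<in> carrier L \<Longrightarrow> y \<in> carrier L \<Longrightarrow> z \<in> carrier L \<Longrightarrow> z \<sqsubseteq> x \<sqinter> y \<longleftrightarrow> z \<sqsubseteq> x \<and> z \<sqsubseteq> y"
  by (meson meet_closed meet_le meet_left meet_right le_trans)

lemma meet_le_left: "x \<sqsubseteq> z \<Longrightarrow> x \<in> carrier L \<Longrightarrow> y \<in> carrier L \<Longrightarrow> z \<in> carrier L \<Longrightarrow> x \<sqinter> y \<sqsubseteq> z"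
  by (rule le_trans[OF meet_left]) simp_all

lemma meet_le_right: "y \<sqsubseteq> z \<Longrightarrow> x \<in> carrier L \<Longrightarrow> y \<in> carrier L \<Longrightarrow> z \<in> carrier L \<Longrightarrow> x \<sqinter> y \<sqsubseteq> z"
  by (rule le_trans[OF meet_right]) simp_all

lemma meet_mono:
  "a \<sqsubseteq> a' \<Longrightarrow> b \<sqsubseteq> b' \<Longrightarrow> a \<in> carrier L \<Longrightarrow> a' \<in> carrier L \<Longrightarrow> b \<in> carrier L \<Longrightarrow> b' \<in> carrier L
    \<Longrightarrow> a \<sqinter> b \<sqsubseteq> a' \<sqinter> b'"
  by (simp add: le_meet_iff meet_le_left meet_le_right)

lemma meet_absorb: "x \<sqsubseteq> y \<Longrightarrow> x \<in> carrier L \<Longrightarrow> y \<in> carrier L \<Longrightarrow> x \<sqinter> y = x"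
  by (metis le_iff_join)

lemma Inf_empty: "\<Sqinter>{} = \<top>" and Sup_empty: "\<Squnion>{} = \<bottom>"
  using weak_inf_empty weak_sup_empty by (simp_all add: eq_is_equal)

lemma eq_if_same_below:
  assumes "x \<in> carrier L" "y \<in> carrier L" "\<And>c. c \<in> carrier L \<Longrightarrow> c \<sqsubseteq> x \<longleftrightarrow> c \<sqsubseteq> y"
  shows "x = y"
  using assms by (meson le_antisym le_refl)

end

text \<open>Frames, as a locale.\<close>

locale frm =
  fixes L :: "'a gorder" (structure)
  assumes frame: "frame L"

sublocale frm \<subseteq> complete_lattice L
  using frame by (simp add: frame_def)

context frm
begin

abbreviation imp (infixr \<open>\<rightharpoonup>\<close> 60) where "a \<rightharpoonup> b \<equiv> heyting L a b"

lemma meet_Sup: "a \<in> carrier L \<Longrightarrow> B \<subseteq> carrier L \<Longrightarrow> a \<sqinter> \<Squnion>B = \<Squnion>((\<lambda>b. a \<sqinter> b) ` B)"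
  using frame by (simp add: frame_def)

lemma meet_Sup_le_iff:
  assumes "a \<in> carrier L" "B \<subseteq> carrier L" "z \<in> carrier L"
  shows "a \<sqinter> \<Squnion>B \<sqsubseteq> z \<longleftrightarrow> (\<forall>b\<in>B. a \<sqinter> b \<sqsubseteq> z)"
proof -
  have "(\<lambda>b. a \<sqinter> b) ` B \<subseteq> carrier L" using assms by auto
  then show ?thesis using assms by (simp add: meet_Sup Sup_le_iff)
qed

lemma imp_closed [simp]: "a \<rightharpoonup> b \<in> carrier L"
  by (simp add: heyting_def)

lemma le_imp_iff:
  assumes "a \<in> carrier L" "b \<in> carrier L" "c \<in> carrier L"
  shows "c \<sqsubseteq> (a \<rightharpoonup> b) \<longleftrightarrow> c \<sqinter> a \<sqsubseteq> b"
proof -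
  let ?A = "{c \<in> carrier L. c \<sqinter> a \<sqsubseteq> b}"
  have "a \<sqinter> \<Squnion>?A \<sqsubseteq> b"
    using assms by (subst meet_Sup_le_iff) (auto simp: meet_comm)
  moreover have "c \<sqinter> a \<sqsubseteq> b" if "c \<sqsubseteq> d" "a \<sqinter> d \<sqsubseteq> b" "d \<in> carrier L" for d
  proof -
    have "c \<sqinter> a \<sqsubseteq> a \<sqinter> d"
      using that assms by (simp add: le_meet_iff meet_le_left meet_right)
    then show ?thesis by (rule le_trans) (use that assms in simp_all)
  qed
  ultimately show ?thesis
    using assms sup_upper[of ?A c] sup_closed[of ?A] unfolding heyting_def by blast
qed

lemma meet_join_le_iff:
  assumes "a \<in> carrier L" "b \<in> carrier L" "c \<in> carrier L" "z \<in> carrier L"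
  shows "a \<sqinter> (b \<squnion> c) \<sqsubseteq> z \<longleftrightarrow> a \<sqinter> b \<sqsubseteq> z \<and> a \<sqinter> c \<sqsubseteq> z"
  using meet_Sup_le_iff[of a "{b, c}" z] assms by (auto simp: join_def)

lemma le_imp_self: "a \<in> carrier L \<Longrightarrow> x \<in> carrier L \<Longrightarrow> x \<sqsubseteq> (a \<rightharpoonup> x)"
  by (simp add: le_imp_iff meet_left)

lemma imp_eq_self_iff:
  assumes "a \<in> carrier L" "x \<in> carrier L"
  shows "a \<rightharpoonup> x = x \<longleftrightarrow> (\<forall>c\<in>carrier L. c \<sqinter> a \<sqsubseteq> x \<longrightarrow> c \<sqsubseteq> x)"
proof
  assume "a \<rightharpoonup> x = x"
  then show "\<forall>c\<in>carrier L. c \<sqinter> a \<sqsubseteq> x \<longrightarrow> c \<sqsubseteq> x" using assms by (metis le_imp_iff)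
next
  assume r: "\<forall>c\<in>carrier L. c \<sqinter> a \<sqsubseteq> x \<longrightarrow> c \<sqsubseteq> x"
  have "(a \<rightharpoonup> x) \<sqinter> a \<sqsubseteq> x" using assms by (metis imp_closed le_imp_iff le_refl)
  then show "a \<rightharpoonup> x = x" using r assms by (simp add: le_antisym le_imp_self)
qed

lemma meet_imp: "a \<in> carrier L \<Longrightarrow> x \<in> carrier L \<Longrightarrow> x \<sqsubseteq> a \<Longrightarrow> a \<sqinter> (a \<rightharpoonup> x) = x"
  by (rule eq_if_same_below)
    (auto simp: le_meet_iff le_imp_iff meet_le_left meet_absorb intro: le_trans)

text \<open>Every \<open>x\<close> is the meet of \<open>a \<rightarrow> x\<close>, which belongs to \<open>\<o>(a)\<close>, and of \<open>(a \<rightarrow> x) \<rightarrow> x\<close>, which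
  belongs to \<open>\<up>a\<close>.\<close>

lemma imp_split:
  assumes "a \<in> carrier L" "x \<in> carrier L"
  shows "(a \<rightharpoonup> x) \<sqinter> ((a \<rightharpoonup> x) \<rightharpoonup> x) = x" "a \<rightharpoonup> (a \<rightharpoonup> x) = a \<rightharpoonup> x" "a \<sqsubseteq> ((a \<rightharpoonup> x) \<rightharpoonup> x)"
proof -
  show "(a \<rightharpoonup> x) \<sqinter> ((a \<rightharpoonup> x) \<rightharpoonup> x) = x" using assms by (simp add: meet_imp le_imp_self)
  have "c \<sqinter> a \<sqinter> a = c \<sqinter> a" if "c \<in> carrier L" for c
    using that assms by (metis le_iff_join meet_closed meet_right)
  then show "a \<rightharpoonup> (a \<rightharpoonup> x) = a \<rightharpoonup> x"
    using assms by (subst imp_eq_self_iff) (auto simp: le_imp_iff)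
  have "(a \<rightharpoonup> x) \<sqinter> a \<sqsubseteq> x" using assms by (metis imp_closed le_imp_iff le_refl)
  then show "a \<sqsubseteq> ((a \<rightharpoonup> x) \<rightharpoonup> x)" using assms by (simp add: le_imp_iff meet_comm)
qed

lemma open_sl_iff: "a \<in> carrier L \<Longrightarrow> x \<in> open_sl L a \<longleftrightarrow> x \<in> carrier L \<and> a \<rightharpoonup> x = x"
  unfolding open_sl_def using imp_split(2)[of a] by (auto simp: image_iff) (metis)

lemma mem_open_sl_iff:
  "a \<in> carrier L \<Longrightarrow> x \<in> open_sl L a \<longleftrightarrow> x \<in> carrier L \<and> (\<forall>c\<in>carrier L. c \<sqinter> a \<sqsubseteq> x \<longrightarrow> c \<sqsubseteq> x)"
  using imp_eq_self_iff by (auto simp: open_sl_iff)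

lemma sublocaleD:
  assumes "sublocale_of L S"
  shows "S \<subseteq> carrier L" "B \<subseteq> S \<Longrightarrow> \<Sqinter>B \<in> S" "a \<in> carrier L \<Longrightarrow> s \<in> S \<Longrightarrow> a \<rightharpoonup> s \<in> S"
    "\<top> \<in> S" "s \<in> S \<Longrightarrow> t \<in> S \<Longrightarrow> s \<sqinter> t \<in> S"
proof -
  show *: "B \<subseteq> S \<Longrightarrow> \<Sqinter>B \<in> S" for B using assms by (simp add: sublocale_of_def)
  show "S \<subseteq> carrier L" "a \<in> carrier L \<Longrightarrow> s \<in> S \<Longrightarrow> a \<rightharpoonup> s \<in> S"
    using assms by (auto simp: sublocale_of_def)
  show "\<top> \<in> S" using *[of "{}"] by (simp add: Inf_empty)
  show "s \<in> S \<Longrightarrow> t \<in> S \<Longrightarrow> s \<sqinter> t \<in> S" using *[of "{s, t}"] by (simp add: meet_def)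
qed

lemma sublocale_top: "sublocale_of L {\<top>}"
proof -
  have "\<Sqinter>B = \<top>" if "B \<subseteq> {\<top>}" for B
    using that by (metis Inf_empty inf_of_singleton subset_singletonD top_closed)
  moreover have "a \<rightharpoonup> \<top> = \<top>" if "a \<in> carrier L" for a
    using that by (simp add: le_antisym le_imp_self)
  ultimately show ?thesis by (simp add: sublocale_of_def)
qed

lemma sublocale_carrier: "sublocale_of L (carrier L)"
  by (simp add: sublocale_of_def)

lemma sublocale_Inter:
  assumes "\<And>S. S \<in> \<B> \<Longrightarrow> sublocale_of L S"
  shows "sublocale_of L (carrier L \<inter> \<Inter>\<B>)"
  using assms unfolding sublocale_of_def
  by (auto intro!: inf_closed) (metis le_inf_iff subset_iff Inter_lower)

lemma sublocale_Int: "sublocale_of L S \<Longrightarrow> sublocale_of L T \<Longrightarrow> sublocale_of L (S \<inter> T)"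
  unfolding sublocale_of_def by auto

end

subsection \<open>The sublocales \<open>\<up>a \<or> \<o>(b)\<close>\<close>

text \<open>\<open>ineq_sl L a b\<close> is the largest sublocale of \<open>L\<close> that forces \<open>a \<le> b\<close>, that is, whose nucleus
  sends \<open>a\<close> below the image of \<open>b\<close>. Its elements are the \<open>x\<close> with \<open>a \<and> (b \<rightarrow> x) \<le> x\<close>; the definition
  spells this out without Heyting implication. It is the join of \<open>\<up>a\<close> and \<open>\<o>(b)\<close>
  (\<open>ineq_sl_eq_join\<close> below).\<close>

definition ineq_sl :: "'a gorder \<Rightarrow> 'a \<Rightarrow> 'a \<Rightarrow> 'a set"
  where "ineq_sl L a b =
    {x \<in> carrier L. \<forall>c\<in>carrier L. c \<sqsubseteq>\<^bsub>L\<^esub> a \<longrightarrow> c \<sqinter>\<^bsub>L\<^esub> b \<sqsubseteq>\<^bsub>L\<^esub> x \<longrightarrow> c \<sqsubseteq>\<^bsub>L\<^esub> x}"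

context frm
begin

lemma ineq_sl_bot: "a \<in> carrier L \<Longrightarrow> ineq_sl L a \<bottom> = closed_sl L a"
  unfolding ineq_sl_def closed_sl_def
  by auto (metis bottom_closed bottom_lower le_refl le_trans meet_closed meet_right, metis le_trans)

lemma ineq_sl_top: "b \<in> carrier L \<Longrightarrow> ineq_sl L \<top> b = open_sl L b"
  by (auto simp: ineq_sl_def open_sl_iff imp_eq_self_iff)

lemma ineq_sl_top_bot: "ineq_sl L \<top> \<bottom> = {\<top>}"
  by (auto simp: ineq_sl_bot closed_sl_def intro: le_antisym)

lemma ineq_sl_mono:
  assumes "a' \<sqsubseteq> a" "b \<sqsubseteq> b'" "a \<in> carrier L" "a' \<in> carrier L" "b \<in> carrier L" "b' \<in> carrier L"
  shows "ineq_sl L a b \<subseteq> ineq_sl L a' b'"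
proof
  fix x assume x: "x \<in> ineq_sl L a b"
  have "c \<sqsubseteq> x" if c: "c \<in> carrier L" "c \<sqsubseteq> a'" "c \<sqinter> b' \<sqsubseteq> x" for c
  proof -
    have "c \<sqinter> b \<sqsubseteq> c \<sqinter> b'" using assms c by (simp add: meet_mono)
    then have "c \<sqsubseteq> a" "c \<sqinter> b \<sqsubseteq> x" using x assms c by (auto simp: ineq_sl_def intro: le_trans)
    then show ?thesis using x c by (simp add: ineq_sl_def)
  qed
  then show "x \<in> ineq_sl L a' b'" using x by (simp add: ineq_sl_def)
qed

lemma sublocale_ineq_sl:
  assumes a: "a \<in> carrier L" and b: "b \<in> carrier L"
  shows "sublocale_of L (ineq_sl L a b)"
  unfolding sublocale_of_def
proof (intro conjI allI impI ballI)
  show "ineq_sl L a b \<subseteq> carrier L" by (auto simp: ineq_sl_def)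
  fix B assume B: "B \<subseteq> ineq_sl L a b"
  then have Bc: "B \<subseteq> carrier L" by (auto simp: ineq_sl_def)
  show "\<Sqinter>B \<in> ineq_sl L a b"
    using B Bc b by (auto simp: ineq_sl_def le_Inf_iff subset_iff)
next
  fix d x assume d: "d \<in> carrier L" and x: "x \<in> ineq_sl L a b"
  then have xc: "x \<in> carrier L" by (auto simp: ineq_sl_def)
  have "c \<sqinter> d \<sqsubseteq> x" if c: "c \<in> carrier L" "c \<sqsubseteq> a" "c \<sqinter> b \<sqinter> d \<sqsubseteq> x" for c
  proof -
    have "c \<sqinter> d \<sqinter> b = c \<sqinter> b \<sqinter> d" using c b d by (metis meet_assoc meet_comm)
    moreover have "c \<sqinter> d \<sqsubseteq> a" using c d a by (meson le_trans meet_closed meet_left)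
    ultimately show ?thesis using c d x by (simp add: ineq_sl_def)
  qed
  then show "d \<rightharpoonup> x \<in> ineq_sl L a b"
    using xc b d by (auto simp: ineq_sl_def le_imp_iff)
qed

lemma sublocale_closed: "a \<in> carrier L \<Longrightarrow> sublocale_of L (closed_sl L a)"
  using sublocale_ineq_sl[of a \<bottom>] by (simp add: ineq_sl_bot)

lemma sublocale_open: "a \<in> carrier L \<Longrightarrow> sublocale_of L (open_sl L a)"
  using sublocale_ineq_sl[of \<top> a] by (simp add: ineq_sl_top)

lemma subset_ineq_sl_iff:
  assumes S: "sublocale_of L S" and a: "a \<in> carrier L" and b: "b \<in> carrier L"
  shows "S \<subseteq> ineq_sl L a b \<longleftrightarrow> (\<forall>s\<in>S. b \<sqsubseteq> s \<longrightarrow> a \<sqsubseteq> s)"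
proof (intro iffI ballI impI subsetI)
  fix s assume "S \<subseteq> ineq_sl L a b" "s \<in> S" "b \<sqsubseteq> s"
  then have "s \<in> ineq_sl L a b" "a \<sqinter> b \<sqsubseteq> s"
    using a b sublocaleD(1)[OF S] by (auto intro!: meet_le_right)
  then show "a \<sqsubseteq> s" using a by (simp add: ineq_sl_def)
next
  fix s assume *: "\<forall>s\<in>S. b \<sqsubseteq> s \<longrightarrow> a \<sqsubseteq> s" and s: "s \<in> S"
  have sc: "s \<in> carrier L" using s sublocaleD(1)[OF S] by auto
  have "c \<sqsubseteq> s" if c: "c \<in> carrier L" "c \<sqsubseteq> a" "c \<sqinter> b \<sqsubseteq> s" for c
  proof -
    have "b \<sqsubseteq> (c \<rightharpoonup> s)" using c b sc by (simp add: le_imp_iff meet_comm)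
    then have "a \<sqsubseteq> (c \<rightharpoonup> s)" using * s c sublocaleD(3)[OF S] by simp
    then have "c \<sqsubseteq> (c \<rightharpoonup> s)" using c a by (meson imp_closed le_trans)
    then show ?thesis using c sc by (simp add: le_imp_iff) (metis le_iff_join le_refl)
  qed
  then show "s \<in> ineq_sl L a b" using sc by (simp add: ineq_sl_def)
qed

text \<open>Sublocales are determined by the inequalities that they force. The proof applies the assumption
  to \<open>b = x\<close> and to the least element \<open>a\<close> of \<open>S\<close> above \<open>x\<close>.\<close>

lemma mem_sublocale_if:
  assumes S: "sublocale_of L S" and x: "x \<in> carrier L"
    and ineq: "\<And>a b. a \<in> carrier L \<Longrightarrow> b \<in> carrier L \<Longrightarrow> S \<subseteq> ineq_sl L a b \<Longrightarrow> x \<in> ineq_sl L a b"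
  shows "x \<in> S"
proof -
  let ?A = "{s \<in> S. x \<sqsubseteq> s}"
  have A: "?A \<subseteq> carrier L" using sublocaleD(1)[OF S] by auto
  have "S \<subseteq> ineq_sl L (\<Sqinter>?A) x"
    using S x A by (subst subset_ineq_sl_iff) (auto intro: inf_lower)
  then have "x \<in> ineq_sl L (\<Sqinter>?A) x" using ineq x A by simp
  then have "\<Sqinter>?A \<sqsubseteq> x" using x A unfolding ineq_sl_def by (auto simp: meet_right)
  moreover have "x \<sqsubseteq> \<Sqinter>?A" using x A by (simp add: le_Inf_iff)
  ultimately have "x = \<Sqinter>?A" using x A by (simp add: le_antisym)
  then show ?thesis using sublocaleD(2)[OF S, of ?A] by auto
qed

lemma sublocale_eq_Inter:
  assumes S: "sublocale_of L S"
  shows "S = carrier L \<inter> \<Inter>{ineq_sl L a b | a b. a \<in> carrier L \<and> b \<in> carrier L \<and> S \<subseteq> ineq_sl L a b}"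
    (is "_ = carrier L \<inter> \<Inter>?I")
proof
  show "S \<subseteq> carrier L \<inter> \<Inter>?I" using sublocaleD(1)[OF S] by auto
  show "carrier L \<inter> \<Inter>?I \<subseteq> S"
  proof
    fix x assume x: "x \<in> carrier L \<inter> \<Inter>?I"
    show "x \<in> S" by (rule mem_sublocale_if[OF S]) (use x in auto)
  qed
qed

lemma sublocale_subset_if:
  assumes "sublocale_of L S" "sublocale_of L T"
    and "\<And>a b. a \<in> carrier L \<Longrightarrow> b \<in> carrier L \<Longrightarrow> S \<subseteq> ineq_sl L a b \<Longrightarrow> T \<subseteq> ineq_sl L a b"
  shows "T \<subseteq> S"
  using assms mem_sublocale_if[of S] sublocaleD(1)[of T] by blast

subsection \<open>The coframe of sublocales\<close>

lemma carrier_Sl [simp]: "carrier (Sl L) = {S. sublocale_of L S}"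
  and le_Sl [simp]: "S \<sqsubseteq>\<^bsub>Sl L\<^esub> T \<longleftrightarrow> S \<subseteq> T"
  by (simp_all add: Sl_def)

lemma Sup_Sl:
  assumes "\<And>S. S \<in> \<B> \<Longrightarrow> sublocale_of L S"
  shows "least (Sl L) (carrier L \<inter> \<Inter>{T. sublocale_of L T \<and> (\<forall>S\<in>\<B>. S \<subseteq> T)}) (Upper (Sl L) \<B>)"
    and "\<Squnion>\<^bsub>Sl L\<^esub> \<B> = carrier L \<inter> \<Inter>{T. sublocale_of L T \<and> (\<forall>S\<in>\<B>. S \<subseteq> T)}"
proof -
  let ?S = "carrier L \<inter> \<Inter>{T. sublocale_of L T \<and> (\<forall>S\<in>\<B>. S \<subseteq> T)}"
  have *: "?S \<in> {S. sublocale_of L S}" "\<B> \<subseteq> {S. sublocale_of L S}"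
    "S \<in> \<B> \<Longrightarrow> S \<subseteq> ?S" for S
    using assms sublocaleD(1) by (auto intro!: sublocale_Inter)
  show "least (Sl L) ?S (Upper (Sl L) \<B>)" "\<Squnion>\<^bsub>Sl L\<^esub> \<B> = ?S"
    unfolding Sl_def by (rule Sup_by_inclusion[OF *]; auto)+
qed

lemma complete_lattice_Sl: "complete_lattice (Sl L)"
  by (rule complete_lattice_if_sups) (auto simp: Sl_def[symmetric] intro: Sup_Sl
      partial_order_by_inclusion[of "{S. sublocale_of L S}", folded Sl_def])

lemma sublocale_Sup: "(\<And>S. S \<in> \<B> \<Longrightarrow> sublocale_of L S) \<Longrightarrow> sublocale_of L (\<Squnion>\<^bsub>Sl L\<^esub> \<B>)"
  using complete_lattice.Sup_le_iff[OF complete_lattice_Sl] by (auto simp: Sup_Sl intro!: sublocale_Inter)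

lemma Sup_Sl_subset_iff:
  "(\<And>S. S \<in> \<B> \<Longrightarrow> sublocale_of L S) \<Longrightarrow> sublocale_of L T \<Longrightarrow> \<Squnion>\<^bsub>Sl L\<^esub> \<B> \<subseteq> T \<longleftrightarrow> (\<forall>S\<in>\<B>. S \<subseteq> T)"
  using complete_lattice.Sup_le_iff[OF complete_lattice_Sl, of \<B> T] by auto

lemma subset_Sup_Sl: "(\<And>S. S \<in> \<B> \<Longrightarrow> sublocale_of L S) \<Longrightarrow> S \<in> \<B> \<Longrightarrow> S \<subseteq> \<Squnion>\<^bsub>Sl L\<^esub> \<B>"
  using Sup_Sl_subset_iff[of \<B> "\<Squnion>\<^bsub>Sl L\<^esub> \<B>"] sublocale_Sup[of \<B>] by blast

lemma Inf_Sl: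
  assumes "\<And>S. S \<in> \<B> \<Longrightarrow> sublocale_of L S"
  shows "\<Sqinter>\<^bsub>Sl L\<^esub> \<B> = carrier L \<inter> \<Inter>\<B>"
  unfolding Sl_def
proof (rule Inf_by_inclusion)
  fix T assume "T \<in> {S. sublocale_of L S}" "\<And>A. A \<in> \<B> \<Longrightarrow> T \<subseteq> A"
  then show "T \<subseteq> carrier L \<inter> \<Inter>\<B>" using sublocaleD(1)[of T] by blast
qed (use assms sublocale_Inter[of \<B>] in auto)

lemma bottom_Sl: "\<bottom>\<^bsub>Sl L\<^esub> = {\<top>}"
proof -
  interpret S: complete_lattice "Sl L" by (rule complete_lattice_Sl)
  have "\<bottom>\<^bsub>Sl L\<^esub> \<subseteq> {\<top>}" "sublocale_of L \<bottom>\<^bsub>Sl L\<^esub>"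
    using S.bottom_lower[of "{\<top>}"] S.bottom_closed sublocale_top by auto
  then show ?thesis using sublocaleD(4) by blast
qed

lemma join_Sl:
  assumes S: "sublocale_of L S" and T: "sublocale_of L T"
  shows "S \<squnion>\<^bsub>Sl L\<^esub> T = {s \<sqinter> t | s t. s \<in> S \<and> t \<in> T}" (is "_ = ?J")
proof -
  have ST: "S \<subseteq> carrier L" "T \<subseteq> carrier L" using S T sublocaleD by auto
  have "?J \<subseteq> carrier L" using ST by (auto simp: subset_iff)
  have J: "sublocale_of L ?J"
    unfolding sublocale_of_def
  proof (intro conjI allI impI ballI)
    show "?J \<subseteq> carrier L" by fact
  next
    fix B assume B: "B \<subseteq> ?J"
    then have "\<forall>x\<in>B. \<exists>s t. x = s \<sqinter> t \<and> s \<in> S \<and> t \<in> T" by blast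
    then obtain f g where fg: "\<And>x. x \<in> B \<Longrightarrow> x = f x \<sqinter> g x \<and> f x \<in> S \<and> g x \<in> T" by metis
    have c: "f ` B \<subseteq> carrier L" "g ` B \<subseteq> carrier L" "B \<subseteq> carrier L"
      using fg ST B \<open>?J \<subseteq> carrier L\<close> by auto
    have "\<Sqinter>B = \<Sqinter>(f ` B) \<sqinter> \<Sqinter>(g ` B)"
    proof (rule eq_if_same_below)
      fix d assume d: "d \<in> carrier L"
      have "d \<sqsubseteq> x \<longleftrightarrow> d \<sqsubseteq> f x \<and> d \<sqsubseteq> g x" if "x \<in> B" for x
        using fg[OF that] ST d le_meet_iff[of "f x" "g x" d] by (metis subsetD)
      then show "d \<sqsubseteq> \<Sqinter>B \<longleftrightarrow> d \<sqsubseteq> \<Sqinter>(f ` B) \<sqinter> \<Sqinter>(g ` B)"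
        using c d by (auto simp: le_Inf_iff le_meet_iff)
    qed (use c in auto)
    moreover have "\<Sqinter>(f ` B) \<in> S" "\<Sqinter>(g ` B) \<in> T"
      using fg sublocaleD(2)[OF S, of "f ` B"] sublocaleD(2)[OF T, of "g ` B"] by auto
    ultimately show "\<Sqinter>B \<in> ?J" by blast
  next
    fix a x assume a: "a \<in> carrier L" and "x \<in> ?J"
    then obtain s t where x: "x = s \<sqinter> t" "s \<in> S" "t \<in> T" by blast
    have "a \<rightharpoonup> x = (a \<rightharpoonup> s) \<sqinter> (a \<rightharpoonup> t)"
      using x ST a by (intro eq_if_same_below) (auto simp: le_imp_iff le_meet_iff subset_iff)
    then show "a \<rightharpoonup> x \<in> ?J" using a x sublocaleD(3)[OF S] sublocaleD(3)[OF T] by blast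
  qed
  have "S \<subseteq> ?J"
  proof
    fix s assume "s \<in> S"
    moreover have "s = s \<sqinter> \<top>" using \<open>s \<in> S\<close> ST by (simp add: meet_absorb subset_iff)
    ultimately show "s \<in> ?J" using sublocaleD(4)[OF T] by blast
  qed
  moreover have "T \<subseteq> ?J"
  proof
    fix t assume "t \<in> T"
    moreover have "t = \<top> \<sqinter> t"
      using \<open>t \<in> T\<close> ST by (simp add: meet_comm[of L \<top>] meet_absorb subset_iff)
    ultimately show "t \<in> ?J" using sublocaleD(4)[OF S] by blast
  qed
  ultimately show ?thesis
    unfolding join_def Sl_def using S T J sublocaleD(5)
    by (intro Sup_by_inclusion) (auto, blast)
qed

lemma sublocale_join: "sublocale_of L S \<Longrightarrow> sublocale_of L T \<Longrightarrow> sublocale_of L (S \<squnion>\<^bsub>Sl L\<^esub> T)"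
  unfolding join_def by (rule sublocale_Sup) auto

lemma join_Sl_subset_iff:
  "sublocale_of L S \<Longrightarrow> sublocale_of L T \<Longrightarrow> sublocale_of L R \<Longrightarrow> S \<squnion>\<^bsub>Sl L\<^esub> T \<subseteq> R \<longleftrightarrow> S \<subseteq> R \<and> T \<subseteq> R"
  unfolding join_def by (subst Sup_Sl_subset_iff) auto

lemma join_Sl_upper:
  assumes "sublocale_of L S" "sublocale_of L T"
  shows "S \<subseteq> S \<squnion>\<^bsub>Sl L\<^esub> T" "T \<subseteq> S \<squnion>\<^bsub>Sl L\<^esub> T"
  using join_Sl_subset_iff[OF assms sublocale_join[OF assms]] by auto

lemma join_Sl_mono:
  assumes "sublocale_of L S" "sublocale_of L S'" "sublocale_of L T" "sublocale_of L T'" "S \<subseteq> S'" "T \<subseteq> T'"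
  shows "S \<squnion>\<^bsub>Sl L\<^esub> T \<subseteq> S' \<squnion>\<^bsub>Sl L\<^esub> T'"
  using assms by (auto simp: join_Sl)

text \<open>The coframe law. An element \<open>x\<close> of every \<open>S \<or> T\<close> has a factorisation \<open>x = s \<and> (s \<rightarrow> x)\<close> that works
  for all \<open>T\<close> simultaneously: \<open>s\<close> is the meet of the \<open>S\<close>-factors of \<open>x\<close>.\<close>

lemma join_Sl_Inter:
  assumes S: "sublocale_of L S" and \<T>: "\<And>T. T \<in> \<T> \<Longrightarrow> sublocale_of L T"
    and x: "x \<in> carrier L" "\<And>T. T \<in> \<T> \<Longrightarrow> x \<in> S \<squnion>\<^bsub>Sl L\<^esub> T"
  shows "x \<in> S \<squnion>\<^bsub>Sl L\<^esub> (carrier L \<inter> \<Inter>\<T>)"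
proof -
  have "\<forall>T\<in>\<T>. \<exists>s t. x = s \<sqinter> t \<and> s \<in> S \<and> t \<in> T" using x \<T> S by (auto simp: join_Sl)
  then obtain f g where fg: "\<And>T. T \<in> \<T> \<Longrightarrow> x = f T \<sqinter> g T \<and> f T \<in> S \<and> g T \<in> T" by metis
  have Sc: "S \<subseteq> carrier L" using S sublocaleD by auto
  have fc: "f ` \<T> \<subseteq> carrier L" using fg Sc by auto
  have gc: "g T \<in> carrier L" if "T \<in> \<T>" for T using fg that \<T> sublocaleD(1) by blast
  let ?s = "\<Sqinter>(f ` \<T>)"
  have s: "?s \<in> S" "?s \<in> carrier L" using fg fc sublocaleD(2)[OF S, of "f ` \<T>"] by auto
  have "x \<sqsubseteq> f T" if "T \<in> \<T>" for T
    using fg[OF that] fc gc[OF that] that by (metis image_subset_iff meet_left)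
  then have xs: "x \<sqsubseteq> ?s" using fc x by (simp add: le_Inf_iff)
  have "?s \<rightharpoonup> x \<in> T" if T: "T \<in> \<T>" for T
  proof -
    have fT: "f T \<in> carrier L" using fc T by auto
    have sf: "?s \<sqsubseteq> f T" using fc T by (auto intro: inf_lower)
    have "?s \<rightharpoonup> x = ?s \<rightharpoonup> g T"
    proof (rule eq_if_same_below)
      fix c assume c: "c \<in> carrier L"
      have "c \<sqinter> ?s \<sqsubseteq> f T" using c s fT sf by (meson le_trans meet_closed meet_right)
      then have "c \<sqinter> ?s \<sqsubseteq> x \<longleftrightarrow> c \<sqinter> ?s \<sqsubseteq> g T"
        using fg[OF T] le_meet_iff[of "f T" "g T" "c \<sqinter> ?s"] c s fT gc[OF T] by auto
      then show "c \<sqsubseteq> (?s \<rightharpoonup> x) \<longleftrightarrow> c \<sqsubseteq> (?s \<rightharpoonup> g T)"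
        using c s x gc[OF T] by (simp add: le_imp_iff)
    qed auto
    then show ?thesis using fg[OF T] sublocaleD(3)[OF \<T>[OF T]] s by simp
  qed
  then have "?s \<rightharpoonup> x \<in> carrier L \<inter> \<Inter>\<T>" by auto
  moreover have "x = ?s \<sqinter> (?s \<rightharpoonup> x)" using s x xs by (simp add: meet_imp)
  ultimately have "\<exists>t \<in> carrier L \<inter> \<Inter>\<T>. x = ?s \<sqinter> t" by (rule bexI[rotated])
  then show ?thesis
    using s by (subst join_Sl[OF S sublocale_Inter[OF \<T>]]) blast+
qed

text \<open>\<open>\<up>b \<inter> \<o>(a)\<close> is the complement of \<open>\<up>a \<or> \<o>(b)\<close>.\<close>

lemma subset_ineq_join_iff:
  assumes S: "sublocale_of L S" and T: "sublocale_of L T" and a: "a \<in> carrier L" and b: "b \<in> carrier L"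
  shows "S \<subseteq> ineq_sl L a b \<squnion>\<^bsub>Sl L\<^esub> T \<longleftrightarrow> S \<inter> (closed_sl L b \<inter> open_sl L a) \<subseteq> T"
proof
  note E = sublocale_ineq_sl[OF a b]
  assume *: "S \<subseteq> ineq_sl L a b \<squnion>\<^bsub>Sl L\<^esub> T"
  show "S \<inter> (closed_sl L b \<inter> open_sl L a) \<subseteq> T"
  proof
    fix x assume x: "x \<in> S \<inter> (closed_sl L b \<inter> open_sl L a)"
    then obtain e t where et: "x = e \<sqinter> t" "e \<in> ineq_sl L a b" "t \<in> T"
      using * E T by (auto simp: join_Sl)
    have c: "e \<in> carrier L" "t \<in> carrier L" "x \<in> carrier L"
      using et x sublocaleD(1)[OF E] sublocaleD(1)[OF T] sublocaleD(1)[OF S] by auto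
    have "b \<sqsubseteq> e" using x et c b by (auto simp: closed_sl_def intro: le_trans meet_left)
    then have "a \<sqsubseteq> e" using et E a b subset_ineq_sl_iff[OF E a b] by auto
    have "a \<rightharpoonup> x = a \<rightharpoonup> t"
    proof (rule eq_if_same_below)
      fix d assume d: "d \<in> carrier L"
      have "d \<sqinter> a \<sqsubseteq> e" using \<open>a \<sqsubseteq> e\<close> a c d by (meson le_trans meet_closed meet_right)
      then show "d \<sqsubseteq> (a \<rightharpoonup> x) \<longleftrightarrow> d \<sqsubseteq> (a \<rightharpoonup> t)"
        using a c d et by (simp add: le_imp_iff le_meet_iff)
    qed auto
    moreover have "a \<rightharpoonup> x = x" using x a by (simp add: open_sl_iff)
    ultimately show "x \<in> T" using sublocaleD(3)[OF T a \<open>t \<in> T\<close>] by simp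
  qed
next
  note E = sublocale_ineq_sl[OF a b]
  assume *: "S \<inter> (closed_sl L b \<inter> open_sl L a) \<subseteq> T"
  show "S \<subseteq> ineq_sl L a b \<squnion>\<^bsub>Sl L\<^esub> T"
  proof
    fix x assume x: "x \<in> S"
    then have xc: "x \<in> carrier L" using sublocaleD(1)[OF S] by auto
    \<comment> \<open>Split \<open>x\<close> along \<open>b\<close>, and then its part in \<open>\<up>b\<close> along \<open>a\<close>.\<close>
    define u v where "u = b \<rightharpoonup> x" and "v = u \<rightharpoonup> x"
    define t w where "t = a \<rightharpoonup> v" and "w = t \<rightharpoonup> v"
    have c: "u \<in> carrier L" "v \<in> carrier L" "t \<in> carrier L" "w \<in> carrier L"
      by (simp_all add: u_def v_def t_def w_def)
    have x_eq: "x = u \<sqinter> v" and v_eq: "v = t \<sqinter> w" and vb: "b \<sqsubseteq> v" and wa: "a \<sqsubseteq> w"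
      using imp_split[OF b xc] imp_split[OF a c(2)] by (simp_all add: u_def v_def t_def w_def)
    have "v \<in> S" "t \<in> S" using x a b c sublocaleD(3)[OF S] by (simp_all add: u_def v_def t_def)
    moreover have "t \<in> open_sl L a" using imp_split(2)[OF a c(2)] a by (simp add: open_sl_iff t_def)
    moreover have "b \<sqsubseteq> t" using vb le_imp_self[OF a c(2)] b c unfolding t_def by (meson imp_closed le_trans)
    ultimately have tT: "t \<in> T" using * c by (auto simp: closed_sl_def)
    have "u \<in> open_sl L b" "w \<in> closed_sl L a"
      using imp_split(2)[OF b xc] b wa c by (simp_all add: open_sl_iff u_def closed_sl_def)
    then have "u \<in> ineq_sl L a b" "w \<in> ineq_sl L a b"
      using ineq_sl_mono[of a \<top> b b] ineq_sl_mono[of a a \<bottom> b] a b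
      by (auto simp: ineq_sl_top ineq_sl_bot subset_iff)
    then have "u \<sqinter> w \<in> ineq_sl L a b" by (rule sublocaleD(5)[OF E])
    moreover have "x = (u \<sqinter> w) \<sqinter> t" using x_eq v_eq c by (metis meet_assoc meet_comm)
    ultimately show "x \<in> ineq_sl L a b \<squnion>\<^bsub>Sl L\<^esub> T" using tT E T by (auto simp: join_Sl)
  qed
qed

lemma ineq_sl_eq_join:
  assumes a: "a \<in> carrier L" and b: "b \<in> carrier L"
  shows "ineq_sl L a b = closed_sl L a \<squnion>\<^bsub>Sl L\<^esub> open_sl L b"
proof
  have "ineq_sl L a b \<inter> (closed_sl L \<bottom> \<inter> open_sl L a) \<subseteq> ineq_sl L \<top> b"
  proof
    fix x assume x: "x \<in> ineq_sl L a b \<inter> (closed_sl L \<bottom> \<inter> open_sl L a)"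
    then have xc: "x \<in> carrier L" and ax: "a \<rightharpoonup> x = x" using a by (auto simp: open_sl_iff)
    have "c \<sqsubseteq> x" if c: "c \<in> carrier L" "c \<sqinter> b \<sqsubseteq> x" for c
    proof -
      have "c \<sqinter> a \<sqinter> b \<sqsubseteq> c \<sqinter> b" using a b c by (intro meet_mono) (auto intro: meet_left)
      then have "c \<sqinter> a \<sqinter> b \<sqsubseteq> x" using a b c xc by (meson le_trans meet_closed)
      then have "c \<sqinter> a \<sqsubseteq> x" using x a c by (auto simp: ineq_sl_def meet_right)
      then show ?thesis using ax a c xc by (metis le_imp_iff)
    qed
    then show "x \<in> ineq_sl L \<top> b" using xc by (simp add: ineq_sl_def)
  qed
  then show "ineq_sl L a b \<subseteq> closed_sl L a \<squnion>\<^bsub>Sl L\<^esub> open_sl L b"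
    using subset_ineq_join_iff[of "ineq_sl L a b" "open_sl L b" a \<bottom>] a b
    by (simp add: ineq_sl_bot ineq_sl_top sublocale_ineq_sl sublocale_open)
  show "closed_sl L a \<squnion>\<^bsub>Sl L\<^esub> open_sl L b \<subseteq> ineq_sl L a b"
    using a b ineq_sl_mono[of a \<top> b b] ineq_sl_mono[of a a \<bottom> b]
    by (simp add: join_Sl_subset_iff sublocale_closed sublocale_open sublocale_ineq_sl
        ineq_sl_top ineq_sl_bot)
qed

lemma ineq_sl_meet_join:
  assumes "a \<in> carrier L" "b \<in> carrier L" "a' \<in> carrier L" "b' \<in> carrier L"
  shows "ineq_sl L (a \<sqinter> a') (b \<squnion> b') = ineq_sl L a b \<squnion>\<^bsub>Sl L\<^esub> ineq_sl L a' b'"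
proof
  show "ineq_sl L a b \<squnion>\<^bsub>Sl L\<^esub> ineq_sl L a' b' \<subseteq> ineq_sl L (a \<sqinter> a') (b \<squnion> b')"
    using assms ineq_sl_mono[of "a \<sqinter> a'" a b "b \<squnion> b'"] ineq_sl_mono[of "a \<sqinter> a'" a' b' "b \<squnion> b'"]
    by (simp add: join_Sl_subset_iff sublocale_ineq_sl meet_left meet_right join_left join_right)
  have "x \<in> ineq_sl L a' b'"
    if x: "x \<in> ineq_sl L (a \<sqinter> a') (b \<squnion> b')" "x \<in> closed_sl L b" "x \<in> open_sl L a" for x
  proof -
    have xc: "x \<in> carrier L" and ax: "a \<rightharpoonup> x = x" and bx: "b \<sqsubseteq> x"
      using x assms by (auto simp: open_sl_iff closed_sl_def)
    have "c \<sqsubseteq> x" if c: "c \<in> carrier L" "c \<sqsubseteq> a'" "c \<sqinter> b' \<sqsubseteq> x" for c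
    proof -
      have "c \<sqinter> a \<sqsubseteq> a \<sqinter> a'" using c assms meet_mono[of c a' a a] by (simp add: meet_comm)
      moreover have "c \<sqinter> a \<sqinter> b \<sqsubseteq> x" using c assms bx xc by (meson le_trans meet_closed meet_right)
      moreover have "c \<sqinter> a \<sqinter> b' \<sqsubseteq> x"
      proof -
        have "c \<sqinter> a \<sqinter> b' \<sqsubseteq> c \<sqinter> b'" using assms c by (intro meet_mono) (auto intro: meet_left)
        then show ?thesis using c assms xc by (meson le_trans meet_closed)
      qed
      ultimately have "c \<sqinter> a \<sqsubseteq> x" using x c assms xc by (simp add: ineq_sl_def meet_join_le_iff)
      then show ?thesis using ax assms c xc by (metis le_imp_iff)
    qed
    then show ?thesis using xc by (simp add: ineq_sl_def)
  qed
  then show "ineq_sl L (a \<sqinter> a') (b \<squnion> b') \<subseteq> ineq_sl L a b \<squnion>\<^bsub>Sl L\<^esub> ineq_sl L a' b'"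
    using assms by (subst subset_ineq_join_iff) (auto simp: sublocale_ineq_sl)
qed

end


section \<open>Frame maps and their action on sublocales\<close>

text \<open>The right adjoint \<open>f\<^sub>* : M \<rightarrow> L\<close> of a frame map \<open>f : L \<rightarrow> M\<close>.\<close>

definition right_adj :: "'a gorder \<Rightarrow> 'b gorder \<Rightarrow> ('a \<Rightarrow> 'b) \<Rightarrow> 'b \<Rightarrow> 'a"
  where "right_adj L M f m = \<Squnion>\<^bsub>L\<^esub> {a \<in> carrier L. f a \<sqsubseteq>\<^bsub>M\<^esub> m}"

lemma frame_hom_funcset: "frame_hom L M f \<Longrightarrow> f \<in> carrier L \<rightarrow> carrier M"
  by (simp add: frame_hom_def)

text \<open>A frame map between two frames; in this locale \<open>fr\<close> denotes its right adjoint.\<close>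

locale frm_hom = L: frm L + M: frm M for L :: "'a gorder" and M :: "'b gorder" +
  fixes f :: "'a \<Rightarrow> 'b"
  assumes frame_hom: "frame_hom L M f"
begin

lemma f_closed [simp]: "a \<in> carrier L \<Longrightarrow> f a \<in> carrier M"
  using frame_hom by (auto simp: frame_hom_def)

lemma f_Sup: "A \<subseteq> carrier L \<Longrightarrow> f (\<Squnion>\<^bsub>L\<^esub> A) = \<Squnion>\<^bsub>M\<^esub> (f ` A)"
  using frame_hom by (simp add: frame_hom_def sup_pres_def)

lemma f_meet: "a \<in> carrier L \<Longrightarrow> b \<in> carrier L \<Longrightarrow> f (a \<sqinter>\<^bsub>L\<^esub> b) = f a \<sqinter>\<^bsub>M\<^esub> f b"
  using frame_hom by (simp add: frame_hom_def meet_pres_def)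

lemma f_top: "f \<top>\<^bsub>L\<^esub> = \<top>\<^bsub>M\<^esub>"
  using frame_hom by (simp add: frame_hom_def)

lemma f_bot: "f \<bottom>\<^bsub>L\<^esub> = \<bottom>\<^bsub>M\<^esub>"
  using f_Sup[of "{}"] by (simp add: L.Sup_empty M.Sup_empty)

lemma f_join: "a \<in> carrier L \<Longrightarrow> b \<in> carrier L \<Longrightarrow> f (a \<squnion>\<^bsub>L\<^esub> b) = f a \<squnion>\<^bsub>M\<^esub> f b"
  using f_Sup[of "{a, b}"] by (simp add: join_def)

lemma f_mono: "a \<sqsubseteq>\<^bsub>L\<^esub> b \<Longrightarrow> a \<in> carrier L \<Longrightarrow> b \<in> carrier L \<Longrightarrow> f a \<sqsubseteq>\<^bsub>M\<^esub> f b"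
  by (metis L.meet_absorb M.meet_right f_closed f_meet)

abbreviation fr where "fr \<equiv> right_adj L M f"

lemma fr_closed [simp]: "fr m \<in> carrier L"
  unfolding right_adj_def by (rule L.sup_closed) auto

lemma le_fr_iff:
  assumes "a \<in> carrier L" "m \<in> carrier M"
  shows "a \<sqsubseteq>\<^bsub>L\<^esub> fr m \<longleftrightarrow> f a \<sqsubseteq>\<^bsub>M\<^esub> m"
proof
  let ?A = "{a \<in> carrier L. f a \<sqsubseteq>\<^bsub>M\<^esub> m}"
  have A: "?A \<subseteq> carrier L" by auto
  show "f a \<sqsubseteq>\<^bsub>M\<^esub> m \<Longrightarrow> a \<sqsubseteq>\<^bsub>L\<^esub> fr m"
    unfolding right_adj_def using assms by (auto intro!: L.sup_upper)
  have "f (fr m) \<sqsubseteq>\<^bsub>M\<^esub> m"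
    unfolding right_adj_def f_Sup[OF A] using assms(2) by (subst M.Sup_le_iff) auto
  then show "a \<sqsubseteq>\<^bsub>L\<^esub> fr m \<Longrightarrow> f a \<sqsubseteq>\<^bsub>M\<^esub> m"
    using assms f_mono[of a "fr m"] by (meson M.le_trans f_closed fr_closed)
qed

lemma fr_top: "fr \<top>\<^bsub>M\<^esub> = \<top>\<^bsub>L\<^esub>"
  by (rule L.eq_if_same_below) (simp_all add: le_fr_iff)

lemma sublocale_image:
  assumes T: "sublocale_of M T"
  shows "sublocale_of L (fr ` T)"
  unfolding sublocale_of_def
proof (intro conjI allI impI ballI)
  have Tc: "T \<subseteq> carrier M" using T M.sublocaleD(1) by blast
  show "fr ` T \<subseteq> carrier L" by auto
  show "\<Sqinter>\<^bsub>L\<^esub> B \<in> fr ` T" if "B \<subseteq> fr ` T" for B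
  proof -
    from that obtain C where C: "C \<subseteq> T" "B = fr ` C" by (rule subset_imageE)
    have c: "C \<subseteq> carrier M" "fr ` C \<subseteq> carrier L" using C Tc by auto
    have "\<Sqinter>\<^bsub>L\<^esub> (fr ` C) = fr (\<Sqinter>\<^bsub>M\<^esub> C)"
      using c by (intro L.eq_if_same_below) (auto simp: L.le_Inf_iff M.le_Inf_iff le_fr_iff subset_iff)
    moreover have "\<Sqinter>\<^bsub>M\<^esub> C \<in> T" using T C M.sublocaleD(2) by blast
    ultimately show ?thesis using C by simp
  qed
  show "heyting L a s \<in> fr ` T" if "a \<in> carrier L" "s \<in> fr ` T" for a s
  proof -
    from that obtain t where t: "s = fr t" "t \<in> T" by blast
    have tc: "t \<in> carrier M" using t Tc by auto
    have "heyting L a (fr t) = fr (heyting M (f a) t)"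
    proof (rule L.eq_if_same_below)
      fix c assume c: "c \<in> carrier L"
      have "c \<sqsubseteq>\<^bsub>L\<^esub> heyting L a (fr t) \<longleftrightarrow> f (c \<sqinter>\<^bsub>L\<^esub> a) \<sqsubseteq>\<^bsub>M\<^esub> t"
        using c tc that(1) by (simp add: L.le_imp_iff le_fr_iff)
      also have "\<dots> \<longleftrightarrow> f c \<sqsubseteq>\<^bsub>M\<^esub> heyting M (f a) t"
        using c tc that(1) by (simp add: M.le_imp_iff f_meet)
      finally show "c \<sqsubseteq>\<^bsub>L\<^esub> heyting L a (fr t) \<longleftrightarrow> c \<sqsubseteq>\<^bsub>L\<^esub> fr (heyting M (f a) t)"
        using c by (simp add: le_fr_iff)
    qed simp_all
    moreover have "heyting M (f a) t \<in> T" using M.sublocaleD(3)[OF T] t that(1) by simp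
    ultimately show ?thesis unfolding t(1) by simp
  qed
qed

text \<open>The image of a sublocale under the right adjoint forces the inequality \<open>a \<le> b\<close> just in case the
  sublocale forces \<open>f a \<le> f b\<close>. Hence \<open>T \<mapsto> f\<^sub>*[T]\<close> is left adjoint to \<^term>\<open>Sl_map L M f\<close>.\<close>

lemma image_subset_ineq_iff:
  assumes T: "sublocale_of M T" and a: "a \<in> carrier L" and b: "b \<in> carrier L"
  shows "fr ` T \<subseteq> ineq_sl L a b \<longleftrightarrow> T \<subseteq> ineq_sl M (f a) (f b)"
proof -
  have "(\<forall>s\<in>fr ` T. b \<sqsubseteq>\<^bsub>L\<^esub> s \<longrightarrow> a \<sqsubseteq>\<^bsub>L\<^esub> s) \<longleftrightarrow> (\<forall>t\<in>T. f b \<sqsubseteq>\<^bsub>M\<^esub> t \<longrightarrow> f a \<sqsubseteq>\<^bsub>M\<^esub> t)"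
    using a b M.sublocaleD(1)[OF T] by (auto simp: le_fr_iff subset_iff)
  then show ?thesis
    using L.subset_ineq_sl_iff[OF sublocale_image[OF T] a b] M.subset_ineq_sl_iff[OF T] a b by simp
qed

text \<open>The preimage of a sublocale, defined by the inequalities that it has to force. It is the value
  of \<^const>\<open>Sl_map\<close> (\<open>Sl_map_eq\<close> below).\<close>

definition preimage_sl :: "'a set \<Rightarrow> 'b set"
  where "preimage_sl S = carrier M \<inter> \<Inter>{ineq_sl M (f a) (f b) | a b.
    a \<in> carrier L \<and> b \<in> carrier L \<and> S \<subseteq> ineq_sl L a b}"

lemma sublocale_preimage: "sublocale_of M (preimage_sl S)"
  unfolding preimage_sl_def by (rule M.sublocale_Inter) (auto intro: M.sublocale_ineq_sl)

lemma subset_preimage_iff: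
  assumes T: "sublocale_of M T" and S: "sublocale_of L S"
  shows "T \<subseteq> preimage_sl S \<longleftrightarrow> fr ` T \<subseteq> S"
proof
  assume "fr ` T \<subseteq> S"
  then have "T \<subseteq> ineq_sl M (f a) (f b)" if "a \<in> carrier L" "b \<in> carrier L" "S \<subseteq> ineq_sl L a b" for a b
    using image_subset_ineq_iff[OF T that(1,2)] that(3) by auto
  then show "T \<subseteq> preimage_sl S" using M.sublocaleD(1)[OF T] by (auto simp: preimage_sl_def)
next
  assume *: "T \<subseteq> preimage_sl S"
  show "fr ` T \<subseteq> S"
  proof (rule L.sublocale_subset_if[OF S sublocale_image[OF T]])
    fix a b assume "a \<in> carrier L" "b \<in> carrier L" "S \<subseteq> ineq_sl L a b"
    moreover from this have "T \<subseteq> ineq_sl M (f a) (f b)" using * unfolding preimage_sl_def by blast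
    ultimately show "fr ` T \<subseteq> ineq_sl L a b" using image_subset_ineq_iff[OF T] by simp
  qed
qed

lemma preimage_eqI:
  assumes "sublocale_of L S" "sublocale_of M R"
    and "\<And>T. sublocale_of M T \<Longrightarrow> fr ` T \<subseteq> S \<longleftrightarrow> T \<subseteq> R"
  shows "preimage_sl S = R"
  using assms subset_preimage_iff sublocale_preimage by (meson subset_antisym subset_refl)

lemma preimage_ineq:
  "a \<in> carrier L \<Longrightarrow> b \<in> carrier L \<Longrightarrow> preimage_sl (ineq_sl L a b) = ineq_sl M (f a) (f b)"
  by (rule preimage_eqI) (simp_all add: L.sublocale_ineq_sl M.sublocale_ineq_sl image_subset_ineq_iff)

lemma preimage_closed: "a \<in> carrier L \<Longrightarrow> preimage_sl (closed_sl L a) = closed_sl M (f a)"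
  using preimage_ineq[of a "\<bottom>\<^bsub>L\<^esub>"] by (simp add: L.ineq_sl_bot M.ineq_sl_bot f_bot)

lemma preimage_open: "a \<in> carrier L \<Longrightarrow> preimage_sl (open_sl L a) = open_sl M (f a)"
  using preimage_ineq[of "\<top>\<^bsub>L\<^esub>" a] by (simp add: L.ineq_sl_top M.ineq_sl_top f_top)

lemma preimage_Inter:
  assumes "\<And>S. S \<in> \<B> \<Longrightarrow> sublocale_of L S"
  shows "preimage_sl (carrier L \<inter> \<Inter>\<B>) = carrier M \<inter> \<Inter>(preimage_sl ` \<B>)"
proof (rule preimage_eqI)
  show "sublocale_of L (carrier L \<inter> \<Inter>\<B>)" using assms by (rule L.sublocale_Inter)
  show "sublocale_of M (carrier M \<inter> \<Inter>(preimage_sl ` \<B>))"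
    by (rule M.sublocale_Inter) (auto intro: sublocale_preimage)
  fix T assume T: "sublocale_of M T"
  have "fr ` T \<subseteq> carrier L" "T \<subseteq> carrier M" using M.sublocaleD(1)[OF T] by auto
  moreover have "fr ` T \<subseteq> S \<longleftrightarrow> T \<subseteq> preimage_sl S" if "S \<in> \<B>" for S
    using subset_preimage_iff[OF T assms[OF that]] by simp
  ultimately show "fr ` T \<subseteq> carrier L \<inter> \<Inter>\<B> \<longleftrightarrow> T \<subseteq> carrier M \<inter> \<Inter>(preimage_sl ` \<B>)"
    by (simp add: le_Inf_iff)
qed

lemma preimage_mono: "S \<subseteq> S' \<Longrightarrow> preimage_sl S \<subseteq> preimage_sl S'"
  unfolding preimage_sl_def by blast

text \<open>By the coframe law, the join of the preimages of \<open>S\<close> and \<open>S'\<close> is the meet of all joins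
  \<open>E \<or> E'\<close> of inequalities defining them, and each \<open>E \<or> E'\<close> is an inequality again.\<close>

lemma preimage_join:
  assumes S: "sublocale_of L S" and S': "sublocale_of L S'"
  shows "preimage_sl (S \<squnion>\<^bsub>Sl L\<^esub> S') = preimage_sl S \<squnion>\<^bsub>Sl M\<^esub> preimage_sl S'"
proof
  show "preimage_sl S \<squnion>\<^bsub>Sl M\<^esub> preimage_sl S' \<subseteq> preimage_sl (S \<squnion>\<^bsub>Sl L\<^esub> S')"
    using assms by (simp add: M.join_Sl_subset_iff sublocale_preimage preimage_mono L.join_Sl_upper)
  define \<E> where "\<E> R = {ineq_sl M (f a) (f b) | a b. a \<in> carrier L \<and> b \<in> carrier L \<and> R \<subseteq> ineq_sl L a b}" for R
  have \<E>: "E \<in> \<E> R \<Longrightarrow> sublocale_of M E" for E R by (auto simp: \<E>_def M.sublocale_ineq_sl)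
  have pre: "preimage_sl R = carrier M \<inter> \<Inter>(\<E> R)" for R by (simp add: preimage_sl_def \<E>_def)
  show "preimage_sl (S \<squnion>\<^bsub>Sl L\<^esub> S') \<subseteq> preimage_sl S \<squnion>\<^bsub>Sl M\<^esub> preimage_sl S'"
  proof
    fix y assume y: "y \<in> preimage_sl (S \<squnion>\<^bsub>Sl L\<^esub> S')"
    then have yc: "y \<in> carrier M" by (simp add: preimage_sl_def)
    have "y \<in> E \<squnion>\<^bsub>Sl M\<^esub> E'" if E: "E \<in> \<E> S" "E' \<in> \<E> S'" for E E'
    proof -
      obtain a b where ab: "a \<in> carrier L" "b \<in> carrier L" "S \<subseteq> ineq_sl L a b" "E = ineq_sl M (f a) (f b)"
        using E(1) by (auto simp: \<E>_def)
      obtain a' b' where ab': "a' \<in> carrier L" "b' \<in> carrier L" "S' \<subseteq> ineq_sl L a' b'"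
        "E' = ineq_sl M (f a') (f b')"
        using E(2) by (auto simp: \<E>_def)
      have "S \<squnion>\<^bsub>Sl L\<^esub> S' \<subseteq> ineq_sl L (a \<sqinter>\<^bsub>L\<^esub> a') (b \<squnion>\<^bsub>L\<^esub> b')"
        using ab ab' by (simp add: L.ineq_sl_meet_join L.join_Sl_mono S S' L.sublocale_ineq_sl)
      then have "y \<in> preimage_sl (ineq_sl L (a \<sqinter>\<^bsub>L\<^esub> a') (b \<squnion>\<^bsub>L\<^esub> b'))"
        using y preimage_mono by blast
      then show ?thesis
        using ab ab' by (simp add: preimage_ineq f_meet f_join M.ineq_sl_meet_join)
    qed
    note y_mem = this
    have "y \<in> preimage_sl S' \<squnion>\<^bsub>Sl M\<^esub> E" if E: "E \<in> \<E> S" for E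
      unfolding pre[of S'] join_comm[of _ _ E]
      by (rule M.join_Sl_Inter) (use E \<E> yc y_mem in auto)
    note y_mem = this
    show "y \<in> preimage_sl S \<squnion>\<^bsub>Sl M\<^esub> preimage_sl S'"
      unfolding pre[of S] join_comm[of _ _ "preimage_sl S'"]
      by (intro M.join_Sl_Inter) (use \<E> yc y_mem sublocale_preimage in auto)
  qed
qed

lemma Sl_map_eq: "Sl_map L M f = restrict preimage_sl (carrier (Sl L))"
  unfolding Sl_map_def
proof (rule the_equality)
  interpret SL: complete_lattice "Sl L" by (rule L.complete_lattice_Sl)
  interpret SM: complete_lattice "Sl M" by (rule M.complete_lattice_Sl)
  let ?p = "restrict preimage_sl (carrier (Sl L))"
  have inf: "inf_pres (Sl L) (Sl M) ?p"
    unfolding inf_pres_def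
  proof (intro conjI allI impI)
    fix \<B> assume \<B>: "\<B> \<subseteq> carrier (Sl L)"
    then have sl: "S \<in> \<B> \<Longrightarrow> sublocale_of L S" for S by auto
    have "?p ` \<B> = preimage_sl ` \<B>" using \<B> by auto
    moreover have "\<Sqinter>\<^bsub>Sl M\<^esub> (preimage_sl ` \<B>) = carrier M \<inter> \<Inter>(preimage_sl ` \<B>)"
      by (rule M.Inf_Sl) (auto simp: sublocale_preimage)
    moreover have "?p (\<Sqinter>\<^bsub>Sl L\<^esub> \<B>) = preimage_sl (carrier L \<inter> \<Inter>\<B>)"
      using L.sublocale_Inter[OF sl] by (simp add: L.Inf_Sl[OF sl])
    ultimately show "?p (\<Sqinter>\<^bsub>Sl L\<^esub> \<B>) = \<Sqinter>\<^bsub>Sl M\<^esub> (?p ` \<B>)"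
      by (simp add: preimage_Inter[OF sl])
  qed unfold_locales
  have join: "join_pres (Sl L) (Sl M) ?p"
    unfolding join_pres_def
    by (auto simp: preimage_join L.sublocale_join intro!: complete_lattice_lattice) unfold_locales
  have "?p \<bottom>\<^bsub>Sl L\<^esub> = \<bottom>\<^bsub>Sl M\<^esub>"
    using preimage_ineq[of "\<top>\<^bsub>L\<^esub>" "\<bottom>\<^bsub>L\<^esub>"]
    by (simp add: L.bottom_Sl M.bottom_Sl L.sublocale_top f_top f_bot L.ineq_sl_top_bot M.ineq_sl_top_bot)
  then show "?p \<in> extensional (carrier (Sl L)) \<and> coframe_hom (Sl L) (Sl M) ?p \<and>
    (\<forall>a \<in> carrier L. ?p (closed_sl L a) = closed_sl M (f a) \<and> ?p (open_sl L a) = open_sl M (f a))"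
    using inf join by (auto simp: coframe_hom_def sublocale_preimage L.sublocale_closed L.sublocale_open
        preimage_closed preimage_open)
  fix \<phi> assume \<phi>: "\<phi> \<in> extensional (carrier (Sl L)) \<and> coframe_hom (Sl L) (Sl M) \<phi> \<and>
    (\<forall>a \<in> carrier L. \<phi> (closed_sl L a) = closed_sl M (f a) \<and> \<phi> (open_sl L a) = open_sl M (f a))"
  have \<phi>_ineq: "\<phi> (ineq_sl L a b) = ineq_sl M (f a) (f b)" if "a \<in> carrier L" "b \<in> carrier L" for a b
    using \<phi> that
    by (simp add: L.ineq_sl_eq_join M.ineq_sl_eq_join coframe_hom_def join_pres_def
        L.sublocale_closed L.sublocale_open)
  show "\<phi> = ?p"
  proof (rule extensionalityI[of _ "carrier (Sl L)"])
    fix S assume "S \<in> carrier (Sl L)"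
    then have S: "sublocale_of L S" by simp
    let ?I = "{ineq_sl L a b | a b. a \<in> carrier L \<and> b \<in> carrier L \<and> S \<subseteq> ineq_sl L a b}"
    have I: "?I \<subseteq> carrier (Sl L)" by (auto simp: L.sublocale_ineq_sl)
    have "S = \<Sqinter>\<^bsub>Sl L\<^esub> ?I" using I L.sublocale_eq_Inter[OF S] by (subst L.Inf_Sl) auto
    then have "\<phi> S = \<Sqinter>\<^bsub>Sl M\<^esub> (\<phi> ` ?I)" using \<phi> I by (metis (no_types, lifting) coframe_hom_def inf_pres_def)
    also have "\<phi> ` ?I = {ineq_sl M (f a) (f b) | a b. a \<in> carrier L \<and> b \<in> carrier L \<and> S \<subseteq> ineq_sl L a b}"
      (is "_ = ?J")
    proof (intro subset_antisym subsetI)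
      fix R assume "R \<in> ?J"
      then obtain a b where ab: "a \<in> carrier L" "b \<in> carrier L" "S \<subseteq> ineq_sl L a b"
        "R = ineq_sl M (f a) (f b)" by blast
      then have "R = \<phi> (ineq_sl L a b)" by (simp add: \<phi>_ineq)
      then show "R \<in> \<phi> ` ?I" using ab by blast
    next
      fix R assume "R \<in> \<phi> ` ?I"
      then obtain a b where "a \<in> carrier L" "b \<in> carrier L" "S \<subseteq> ineq_sl L a b"
        "R = \<phi> (ineq_sl L a b)" by blast
      then show "R \<in> ?J" using \<phi>_ineq by blast
    qed
    also have "\<Sqinter>\<^bsub>Sl M\<^esub> ?J = preimage_sl S"
      unfolding preimage_sl_def by (rule M.Inf_Sl) (auto simp: M.sublocale_ineq_sl)
    finally show "\<phi> S = ?p S" using S by simp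
  qed (use \<phi> in auto)
qed

lemma Sl_adj_eq:
  assumes "sublocale_of M T"
  shows "Sl_adj L M f T = fr ` T"
proof -
  let ?\<psi> = "\<lambda>T \<in> carrier (Sl M). fr ` T"
  have "Sl_adj L M f = ?\<psi>"
    unfolding Sl_adj_def left_adjoint_def
  proof (rule the_equality)
    show "?\<psi> \<in> carrier (Sl M) \<rightarrow>\<^sub>E carrier (Sl L) \<and>
      (\<forall>y\<in>carrier (Sl M). \<forall>x\<in>carrier (Sl L). ?\<psi> y \<sqsubseteq>\<^bsub>Sl L\<^esub> x \<longleftrightarrow> y \<sqsubseteq>\<^bsub>Sl M\<^esub> Sl_map L M f x)"
      by (auto simp: sublocale_image Sl_map_eq subset_preimage_iff)
    fix \<psi> assume \<psi>: "\<psi> \<in> carrier (Sl M) \<rightarrow>\<^sub>E carrier (Sl L) \<and>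
      (\<forall>y\<in>carrier (Sl M). \<forall>x\<in>carrier (Sl L). \<psi> y \<sqsubseteq>\<^bsub>Sl L\<^esub> x \<longleftrightarrow> y \<sqsubseteq>\<^bsub>Sl M\<^esub> Sl_map L M f x)"
    show "\<psi> = ?\<psi>"
    proof (rule extensionalityI[of _ "carrier (Sl M)"])
      fix T assume T: "T \<in> carrier (Sl M)"
      then have "sublocale_of L (\<psi> T)" using \<psi> by auto
      moreover have "\<psi> T \<subseteq> S \<longleftrightarrow> fr ` T \<subseteq> S" if "sublocale_of L S" for S
        using \<psi> T that by (simp add: Sl_map_eq subset_preimage_iff)
      ultimately show "\<psi> T = ?\<psi> T"
        using T sublocale_image by auto
    qed (use \<psi> in \<open>auto simp: PiE_def\<close>)
  qed
  then show ?thesis using assms by simp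
qed

lemma image_Sup:
  assumes "\<And>T. T \<in> \<B> \<Longrightarrow> sublocale_of M T"
  shows "fr ` (\<Squnion>\<^bsub>Sl M\<^esub> \<B>) = \<Squnion>\<^bsub>Sl L\<^esub> ((`) fr ` \<B>)"
proof -
  have B: "R \<in> (`) fr ` \<B> \<Longrightarrow> sublocale_of L R" for R using assms sublocale_image by auto
  have "fr ` (\<Squnion>\<^bsub>Sl M\<^esub> \<B>) \<subseteq> S \<longleftrightarrow> \<Squnion>\<^bsub>Sl L\<^esub> ((`) fr ` \<B>) \<subseteq> S" if S: "sublocale_of L S" for S
  proof -
    have "fr ` (\<Squnion>\<^bsub>Sl M\<^esub> \<B>) \<subseteq> S \<longleftrightarrow> \<Squnion>\<^bsub>Sl M\<^esub> \<B> \<subseteq> preimage_sl S"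
      using subset_preimage_iff[OF M.sublocale_Sup[OF assms] S] by blast
    also have "\<dots> \<longleftrightarrow> (\<forall>T\<in>\<B>. T \<subseteq> preimage_sl S)"
      using assms by (simp add: M.Sup_Sl_subset_iff sublocale_preimage)
    also have "\<dots> \<longleftrightarrow> (\<forall>T\<in>\<B>. fr ` T \<subseteq> S)" using assms S by (simp add: subset_preimage_iff)
    also have "\<dots> \<longleftrightarrow> \<Squnion>\<^bsub>Sl L\<^esub> ((`) fr ` \<B>) \<subseteq> S"
      using L.Sup_Sl_subset_iff[OF B S] by auto
    finally show ?thesis .
  qed
  then show ?thesis
    using L.sublocale_Sup[OF B] sublocale_image[OF M.sublocale_Sup[OF assms]] by (metis subset_antisym subset_refl)
qed

lemma fr_bot_image: "fr ` {\<top>\<^bsub>M\<^esub>} = {\<top>\<^bsub>L\<^esub>}"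
  by (simp add: fr_top)

end

lemma frame_hom_id:
  assumes "frame L"
  shows "frame_hom L L (\<lambda>x\<in>carrier L. x)"
proof -
  interpret frm L by unfold_locales fact
  have "restrict (\<lambda>x. x) (carrier L) ` A = A" if "A \<subseteq> carrier L" for A using that by auto
  then show ?thesis
    by (auto simp: frame_hom_def sup_pres_def meet_pres_def intro: complete_lattice_lattice) unfold_locales
qed

lemma frame_hom_compose:
  assumes "frame_hom L M f" "frame_hom M N g"
  shows "frame_hom L N (compose (carrier L) g f)"
proof -
  have *: "f \<in> carrier L \<rightarrow> carrier M" "g \<in> carrier M \<rightarrow> carrier N"
    "complete_lattice L" "complete_lattice M" "complete_lattice N"
    using assms by (auto simp: frame_hom_def sup_pres_def)
  interpret L: complete_lattice L by fact
  interpret M: complete_lattice M by fact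
  have "compose (carrier L) g f (\<Squnion>\<^bsub>L\<^esub> A) = \<Squnion>\<^bsub>N\<^esub> (compose (carrier L) g f ` A)" if A: "A \<subseteq> carrier L" for A
  proof -
    have "f ` A \<subseteq> carrier M" using A * by auto
    moreover have "compose (carrier L) g f ` A = g ` f ` A" using A by (auto simp: compose_def)
    ultimately show ?thesis
      using A assms by (simp add: compose_eq frame_hom_def sup_pres_def)
  qed
  moreover have "compose (carrier L) g f (x \<sqinter>\<^bsub>L\<^esub> y) = compose (carrier L) g f x \<sqinter>\<^bsub>N\<^esub> compose (carrier L) g f y"
    if "x \<in> carrier L" "y \<in> carrier L" for x y
  proof -
    have "f x \<in> carrier M" "f y \<in> carrier M" using that * by auto
    then show ?thesis using that assms by (simp add: compose_eq frame_hom_def meet_pres_def)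
  qed
  moreover have "compose (carrier L) g f \<in> carrier L \<rightarrow> carrier N"
    using * by (auto simp: compose_eq)
  moreover have "compose (carrier L) g f \<top>\<^bsub>L\<^esub> = \<top>\<^bsub>N\<^esub>"
    using assms by (simp add: compose_eq frame_hom_def)
  ultimately show ?thesis
    using * by (simp add: frame_hom_def sup_pres_def meet_pres_def)
qed

lemma right_adj_id:
  assumes "frame L" "m \<in> carrier L"
  shows "right_adj L L (\<lambda>x\<in>carrier L. x) m = m"
proof -
  interpret frm_hom L L "\<lambda>x\<in>carrier L. x" using assms by unfold_locales (auto intro: frame_hom_id)
  show ?thesis using assms(2) by (intro L.eq_if_same_below) (simp_all add: le_fr_iff)
qed

lemma right_adj_id_image:
  assumes "frame L" "S \<subseteq> carrier L"
  shows "right_adj L L (\<lambda>x\<in>carrier L. x) ` S = S"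
  using assms(2) right_adj_id[OF assms(1)] by (force simp: image_iff subset_iff)

lemma right_adj_compose:
  assumes "frame L" "frame M" "frame N" "frame_hom L M f" "frame_hom M N g" "n \<in> carrier N"
  shows "right_adj L N (compose (carrier L) g f) n = right_adj L M f (right_adj M N g n)"
proof -
  interpret F: frm_hom L M f using assms by unfold_locales
  interpret G: frm_hom M N g using assms by unfold_locales
  interpret GF: frm_hom L N "compose (carrier L) g f"
    using assms by unfold_locales (auto intro: frame_hom_compose)
  show ?thesis
    using assms(6) by (intro F.L.eq_if_same_below) (simp_all add: F.le_fr_iff G.le_fr_iff GF.le_fr_iff compose_eq)
qed


section \<open>The Funayama envelope and locally exact maps\<close>

text \<open>The sublocales \<open>\<up>a \<inter> \<o>(b)\<close>, the complements of the sublocales \<^const>\<open>ineq_sl\<close>.\<close>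

definition basic_sl :: "'a gorder \<Rightarrow> 'a set set"
  where "basic_sl L = {closed_sl L a \<inter> open_sl L b | a b. a \<in> carrier L \<and> b \<in> carrier L}"

context frm
begin

lemma codiff_Sl:
  assumes S: "sublocale_of L S" and K: "sublocale_of L K"
  shows sublocale_codiff: "sublocale_of L (codiff (Sl L) S K)"
    and codiff_subset_iff: "sublocale_of L C \<Longrightarrow> codiff (Sl L) S K \<subseteq> C \<longleftrightarrow> S \<subseteq> K \<squnion>\<^bsub>Sl L\<^esub> C"
proof -
  let ?C = "{C \<in> carrier (Sl L). S \<sqsubseteq>\<^bsub>Sl L\<^esub> K \<squnion>\<^bsub>Sl L\<^esub> C}"
  let ?D = "carrier L \<inter> \<Inter>?C"
  have D: "sublocale_of L ?D" by (rule sublocale_Inter) auto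
  have SD: "S \<subseteq> K \<squnion>\<^bsub>Sl L\<^esub> ?D"
  proof
    fix x assume "x \<in> S"
    then show "x \<in> K \<squnion>\<^bsub>Sl L\<^esub> ?D"
      using sublocaleD(1)[OF S] by (intro join_Sl_Inter K) auto
  qed
  have l: "least (Sl L) ?D ?C" using D SD by (auto simp: least_def)
  have eq: "codiff (Sl L) S K = ?D"
    unfolding codiff_def
  proof (rule the_equality)
    show "least (Sl L) ?D ?C" by (rule l)
    fix c assume "least (Sl L) c ?C"
    then show "c = ?D"
      by (rule partial_order.least_unique[OF complete_lattice.axioms(1)[OF complete_lattice_Sl] _ l])
  qed
  show "sublocale_of L (codiff (Sl L) S K)" using D eq by simp
  show "codiff (Sl L) S K \<subseteq> C \<longleftrightarrow> S \<subseteq> K \<squnion>\<^bsub>Sl L\<^esub> C" if C: "sublocale_of L C"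
  proof
    assume "codiff (Sl L) S K \<subseteq> C"
    then show "S \<subseteq> K \<squnion>\<^bsub>Sl L\<^esub> C"
      using SD eq join_Sl_mono[OF K K D C] by auto
  next
    assume "S \<subseteq> K \<squnion>\<^bsub>Sl L\<^esub> C"
    then show "codiff (Sl L) S K \<subseteq> C" using C eq by auto
  qed
qed

lemma subset_ineq_iff_disjoint:
  assumes "sublocale_of L S" "a \<in> carrier L" "b \<in> carrier L"
  shows "S \<subseteq> ineq_sl L a b \<longleftrightarrow> S \<inter> (closed_sl L b \<inter> open_sl L a) \<subseteq> {\<top>}"
proof -
  have "ineq_sl L a b \<squnion>\<^bsub>Sl L\<^esub> {\<top>} = ineq_sl L a b"
  proof (rule subset_antisym)
    show "ineq_sl L a b \<squnion>\<^bsub>Sl L\<^esub> {\<top>} \<subseteq> ineq_sl L a b"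
      using sublocaleD(4)[OF sublocale_ineq_sl] assms
      by (simp add: join_Sl_subset_iff sublocale_ineq_sl sublocale_top)
  qed (simp add: assms join_Sl_upper sublocale_ineq_sl sublocale_top)
  then show ?thesis using subset_ineq_join_iff[OF assms(1) sublocale_top assms(2,3)] by simp
qed

lemma sublocale_basic: "c \<in> basic_sl L \<Longrightarrow> sublocale_of L c"
  by (auto simp: basic_sl_def intro: sublocale_Int sublocale_closed sublocale_open)

lemma basicI: "a \<in> carrier L \<Longrightarrow> b \<in> carrier L \<Longrightarrow> closed_sl L a \<inter> open_sl L b \<in> basic_sl L"
  by (auto simp: basic_sl_def)

lemma closed_bot: "closed_sl L \<bottom> = carrier L" and open_top: "open_sl L \<top> = carrier L"
proof -
  show "closed_sl L \<bottom> = carrier L" by (auto simp: closed_sl_def)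
  have "\<top> \<rightharpoonup> x = x" if "x \<in> carrier L" for x
    using that by (subst imp_eq_self_iff) (auto simp: meet_absorb)
  then show "open_sl L \<top> = carrier L" by (auto simp: open_sl_iff)
qed

lemma closed_basic: "a \<in> carrier L \<Longrightarrow> closed_sl L a \<in> basic_sl L"
  using basicI[of a \<top>] sublocaleD(1)[OF sublocale_closed] by (simp add: open_top Int_absorb2)

lemma open_basic: "a \<in> carrier L \<Longrightarrow> open_sl L a \<in> basic_sl L"
  using basicI[of \<bottom> a] sublocaleD(1)[OF sublocale_open] by (simp add: closed_bot Int_absorb1)

lemma basic_Int: "c \<in> basic_sl L \<Longrightarrow> d \<in> basic_sl L \<Longrightarrow> c \<inter> d \<in> basic_sl L"
proof -
  have closed_Int: "closed_sl L a \<inter> closed_sl L a' = closed_sl L (a \<squnion> a')"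
    if "a \<in> carrier L" "a' \<in> carrier L" for a a'
    using that by (auto simp: closed_sl_def join_le_iff)
  have open_Int: "open_sl L b \<inter> open_sl L b' = open_sl L (b \<sqinter> b')"
    if b: "b \<in> carrier L" "b' \<in> carrier L" for b b'
  proof -
    have "x \<in> open_sl L b \<inter> open_sl L b' \<longleftrightarrow> x \<in> open_sl L (b \<sqinter> b')" if x: "x \<in> carrier L" for x
    proof -
      have "x \<in> open_sl L b \<and> x \<in> open_sl L b'" if *: "x \<in> open_sl L (b \<sqinter> b')"
      proof -
        have "c \<sqsubseteq> x" if c: "c \<in> carrier L" "c \<sqinter> b \<sqsubseteq> x \<or> c \<sqinter> b' \<sqsubseteq> x" for c
        proof -
          have "c \<sqinter> (b \<sqinter> b') \<sqsubseteq> c \<sqinter> b" "c \<sqinter> (b \<sqinter> b') \<sqsubseteq> c \<sqinter> b'"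
            using b c by (auto intro!: meet_mono simp: meet_left meet_right)
          then have "c \<sqinter> (b \<sqinter> b') \<sqsubseteq> x"
            using b c(1) x c(2) le_trans[of "c \<sqinter> (b \<sqinter> b')" "c \<sqinter> b" x]
              le_trans[of "c \<sqinter> (b \<sqinter> b')" "c \<sqinter> b'" x] by fastforce
          moreover have "\<forall>c\<in>carrier L. c \<sqinter> (b \<sqinter> b') \<sqsubseteq> x \<longrightarrow> c \<sqsubseteq> x"
            using * unfolding mem_open_sl_iff[OF meet_closed[OF b]] by blast
          ultimately show ?thesis using c(1) by blast
        qed
        then show ?thesis using x unfolding mem_open_sl_iff[OF b(1)] mem_open_sl_iff[OF b(2)] by blast
      qed
      moreover have "x \<in> open_sl L (b \<sqinter> b')" if *: "x \<in> open_sl L b" "x \<in> open_sl L b'"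
      proof -
        have "c \<sqsubseteq> x" if c: "c \<in> carrier L" "c \<sqinter> (b \<sqinter> b') \<sqsubseteq> x" for c
        proof -
          have "c \<sqinter> b \<sqinter> b' \<sqsubseteq> x" using b c by (simp add: meet_assoc)
          then have "c \<sqinter> b \<sqsubseteq> x" using *(2) mem_open_sl_iff[of b' x] b c(1) by (meson meet_closed)
          then show ?thesis using *(1) mem_open_sl_iff[of b x] b c(1) by meson
        qed
        then show ?thesis using x unfolding mem_open_sl_iff[OF meet_closed[OF b]] by blast
      qed
      ultimately show ?thesis by blast
    qed
    then show ?thesis
      using b sublocaleD(1)[OF sublocale_open[of b]] sublocaleD(1)[OF sublocale_open[of "b \<sqinter> b'"]]
      by (intro subset_antisym subsetI) auto
  qed
  assume "c \<in> basic_sl L" "d \<in> basic_sl L"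
  then obtain a b a' b' where ab: "a \<in> carrier L" "b \<in> carrier L" "a' \<in> carrier L" "b' \<in> carrier L"
    and c: "c = closed_sl L a \<inter> open_sl L b" and d: "d = closed_sl L a' \<inter> open_sl L b'"
    unfolding basic_sl_def by blast
  have "c \<inter> d = (closed_sl L a \<inter> closed_sl L a') \<inter> (open_sl L b \<inter> open_sl L b')"
    unfolding c d by blast
  also have "\<dots> = closed_sl L (a \<squnion> a') \<inter> open_sl L (b \<sqinter> b')" using ab by (simp add: closed_Int open_Int)
  finally show "c \<inter> d \<in> basic_sl L" using ab by (simp add: basicI)
qed

subsection \<open>Joins of sublocales from a given family\<close>

end

text \<open>The sublocales that are joins of members of \<open>\<G>\<close>. Both \<open>\<F>L\<close> and \<open>\<S>\<K>\<C>\<^sup>*X\<close> are of this form, for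
  the sublocales \<open>\<up>a \<inter> \<o>(b)\<close> and for the two-element sublocales \<open>b(x)\<close>, respectively.\<close>

definition joins_of :: "'a gorder \<Rightarrow> 'a set set \<Rightarrow> 'a set set"
  where "joins_of L \<G> = {\<Squnion>\<^bsub>Sl L\<^esub> \<B> | \<B>. \<B> \<subseteq> \<G>}"

context frm
begin

lemma mem_joins_of_iff:
  assumes G: "\<And>c. c \<in> \<G> \<Longrightarrow> sublocale_of L c"
  shows "S \<in> joins_of L \<G> \<longleftrightarrow> sublocale_of L S \<and>
    (\<forall>T. sublocale_of L T \<longrightarrow> (\<forall>c\<in>\<G>. c \<subseteq> S \<longrightarrow> c \<subseteq> T) \<longrightarrow> S \<subseteq> T)"
proof
  assume "S \<in> joins_of L \<G>"
  then obtain \<B> where \<B>: "S = \<Squnion>\<^bsub>Sl L\<^esub> \<B>" "\<B> \<subseteq> \<G>" by (auto simp: joins_of_def)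
  then have B: "\<And>S. S \<in> \<B> \<Longrightarrow> sublocale_of L S" using G by auto
  have sub: "c \<subseteq> S" if "c \<in> \<B>" for c unfolding \<B>(1) by (rule subset_Sup_Sl[OF B that])
  have "S \<subseteq> T" if T: "sublocale_of L T" "\<forall>c\<in>\<G>. c \<subseteq> S \<longrightarrow> c \<subseteq> T" for T
  proof -
    have "\<forall>c\<in>\<B>. c \<subseteq> T" using T(2) \<B>(2) sub by (meson subsetD)
    then show ?thesis using Sup_Sl_subset_iff[OF B T(1)] \<B>(1) by blast
  qed
  then show "sublocale_of L S \<and>
    (\<forall>T. sublocale_of L T \<longrightarrow> (\<forall>c\<in>\<G>. c \<subseteq> S \<longrightarrow> c \<subseteq> T) \<longrightarrow> S \<subseteq> T)"
    using sublocale_Sup[OF B] \<B>(1) by simp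
next
  assume *: "sublocale_of L S \<and>
    (\<forall>T. sublocale_of L T \<longrightarrow> (\<forall>c\<in>\<G>. c \<subseteq> S \<longrightarrow> c \<subseteq> T) \<longrightarrow> S \<subseteq> T)"
  let ?B = "{c \<in> \<G>. c \<subseteq> S}"
  have B: "\<And>S. S \<in> ?B \<Longrightarrow> sublocale_of L S" using G by auto
  have "c \<subseteq> \<Squnion>\<^bsub>Sl L\<^esub> ?B" if "c \<in> \<G>" "c \<subseteq> S" for c
    by (rule subset_Sup_Sl[OF B]) (use that in auto)
  then have "S \<subseteq> \<Squnion>\<^bsub>Sl L\<^esub> ?B" using * sublocale_Sup[of ?B, OF B] by blast
  moreover have "\<Squnion>\<^bsub>Sl L\<^esub> ?B \<subseteq> S" using * by (subst Sup_Sl_subset_iff[OF B]) auto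
  ultimately have "S = \<Squnion>\<^bsub>Sl L\<^esub> ?B" by (rule subset_antisym)
  then show "S \<in> joins_of L \<G>" unfolding joins_of_def by blast
qed

lemma joins_of_subsetI:
  assumes "\<And>c. c \<in> \<G> \<Longrightarrow> sublocale_of L c" "S \<in> joins_of L \<G>" "sublocale_of L T"
    "\<And>c. c \<in> \<G> \<Longrightarrow> c \<subseteq> S \<Longrightarrow> c \<subseteq> T"
  shows "S \<subseteq> T"
  using assms(2-4) by (simp add: mem_joins_of_iff[OF assms(1)])

lemma Sup_joins_of_closed:
  assumes G: "\<And>c. c \<in> \<G> \<Longrightarrow> sublocale_of L c" and \<B>: "\<B> \<subseteq> joins_of L \<G>"
  shows "\<Squnion>\<^bsub>Sl L\<^esub> \<B> \<in> joins_of L \<G>"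
proof -
  have B: "\<And>S. S \<in> \<B> \<Longrightarrow> sublocale_of L S" using \<B> mem_joins_of_iff[OF G] by auto
  have "sublocale_of L (\<Squnion>\<^bsub>Sl L\<^esub> \<B>) \<and> (\<forall>T. sublocale_of L T \<longrightarrow>
    (\<forall>c\<in>\<G>. c \<subseteq> \<Squnion>\<^bsub>Sl L\<^esub> \<B> \<longrightarrow> c \<subseteq> T) \<longrightarrow> \<Squnion>\<^bsub>Sl L\<^esub> \<B> \<subseteq> T)"
  proof (intro conjI allI impI)
    show "sublocale_of L (\<Squnion>\<^bsub>Sl L\<^esub> \<B>)" by (rule sublocale_Sup[OF B])
    fix T assume T: "sublocale_of L T" "\<forall>c\<in>\<G>. c \<subseteq> \<Squnion>\<^bsub>Sl L\<^esub> \<B> \<longrightarrow> c \<subseteq> T"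
    have "S \<subseteq> T" if "S \<in> \<B>" for S
    proof (rule joins_of_subsetI[OF G])
      show "S \<in> joins_of L \<G>" using that \<B> by auto
      show "c \<subseteq> T" if "c \<in> \<G>" "c \<subseteq> S" for c
        using T that subset_Sup_Sl[OF B \<open>S \<in> \<B>\<close>] by blast
    qed (auto intro: T(1))
    then show "\<Squnion>\<^bsub>Sl L\<^esub> \<B> \<subseteq> T" using Sup_Sl_subset_iff[OF B T(1)] by blast
  qed
  then show ?thesis using mem_joins_of_iff[of \<G>] G by simp
qed

lemma gen_in_joins_of: "c \<in> \<G> \<Longrightarrow> sublocale_of L c \<Longrightarrow> c \<in> joins_of L \<G>"
proof -
  assume "c \<in> \<G>" "sublocale_of L c"
  moreover from this have "\<Squnion>\<^bsub>Sl L\<^esub> {c} = c"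
    using subset_Sup_Sl[of "{c}" c] Sup_Sl_subset_iff[of "{c}" c] by blast
  ultimately show ?thesis unfolding joins_of_def by (metis (mono_tags, lifting) CollectI empty_subsetI insert_subset)
qed

lemma joins_of_mono:
  assumes "\<And>c. c \<in> \<G> \<Longrightarrow> c \<in> joins_of L \<H>" "\<And>c. c \<in> \<H> \<Longrightarrow> sublocale_of L c"
  shows "joins_of L \<G> \<subseteq> joins_of L \<H>"
proof
  fix S assume "S \<in> joins_of L \<G>"
  then obtain \<B> where "S = \<Squnion>\<^bsub>Sl L\<^esub> \<B>" "\<B> \<subseteq> joins_of L \<H>" using assms(1) unfolding joins_of_def[of L \<G>] by blast
  then show "S \<in> joins_of L \<H>" using Sup_joins_of_closed[OF assms(2)] by simp
qed

subsection \<open>The complete Boolean algebra \<open>\<F>L\<close>\<close>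

lemma carrier_Fl: "carrier (Fl L) = joins_of L (basic_sl L)"
  by (simp add: Fl_def basic_sl_def joins_of_def)

lemma mem_Fl_iff:
  "S \<in> carrier (Fl L) \<longleftrightarrow> sublocale_of L S \<and>
    (\<forall>T. sublocale_of L T \<longrightarrow> (\<forall>c\<in>basic_sl L. c \<subseteq> S \<longrightarrow> c \<subseteq> T) \<longrightarrow> S \<subseteq> T)"
  unfolding carrier_Fl by (rule mem_joins_of_iff[OF sublocale_basic])

lemma sublocale_Fl: "S \<in> carrier (Fl L) \<Longrightarrow> sublocale_of L S"
  by (simp add: mem_Fl_iff)

lemma Fl_subsetI:
  "S \<in> carrier (Fl L) \<Longrightarrow> sublocale_of L T \<Longrightarrow> (\<And>c. c \<in> basic_sl L \<Longrightarrow> c \<subseteq> S \<Longrightarrow> c \<subseteq> T) \<Longrightarrow> S \<subseteq> T"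
  by (simp add: mem_Fl_iff)

lemma basic_Fl: "c \<in> basic_sl L \<Longrightarrow> c \<in> carrier (Fl L)"
  by (auto simp: mem_Fl_iff sublocale_basic)

lemma Sup_Fl_closed: "\<B> \<subseteq> carrier (Fl L) \<Longrightarrow> \<Squnion>\<^bsub>Sl L\<^esub> \<B> \<in> carrier (Fl L)"
  unfolding carrier_Fl by (rule Sup_joins_of_closed[OF sublocale_basic])

lemma le_Fl [simp]: "S \<sqsubseteq>\<^bsub>Fl L\<^esub> T \<longleftrightarrow> S \<subseteq> T"
  by (simp add: Fl_def)

lemma Sup_Fl:
  assumes "\<B> \<subseteq> carrier (Fl L)"
  shows "least (Fl L) (\<Squnion>\<^bsub>Sl L\<^esub> \<B>) (Upper (Fl L) \<B>)" "\<Squnion>\<^bsub>Fl L\<^esub> \<B> = \<Squnion>\<^bsub>Sl L\<^esub> \<B>"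
proof -
  have B: "\<And>S. S \<in> \<B> \<Longrightarrow> sublocale_of L S" using assms sublocale_Fl by auto
  obtain \<D> where \<D>: "Fl L = by_inclusion \<D>" by (simp add: Fl_def)
  have *: "\<Squnion>\<^bsub>Sl L\<^esub> \<B> \<in> \<D>" "\<B> \<subseteq> \<D>" "\<And>A. A \<in> \<B> \<Longrightarrow> A \<subseteq> \<Squnion>\<^bsub>Sl L\<^esub> \<B>"
    "\<And>T. T \<in> \<D> \<Longrightarrow> (\<And>A. A \<in> \<B> \<Longrightarrow> A \<subseteq> T) \<Longrightarrow> \<Squnion>\<^bsub>Sl L\<^esub> \<B> \<subseteq> T"
    using assms Sup_Fl_closed[OF assms] subset_Sup_Sl[OF B] Sup_Sl_subset_iff[OF B] sublocale_Fl
    unfolding \<D> by auto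
  show "least (Fl L) (\<Squnion>\<^bsub>Sl L\<^esub> \<B>) (Upper (Fl L) \<B>)" "\<Squnion>\<^bsub>Fl L\<^esub> \<B> = \<Squnion>\<^bsub>Sl L\<^esub> \<B>"
    unfolding \<D> by (rule Sup_by_inclusion[OF *]; assumption)+
qed

lemma complete_lattice_Fl: "complete_lattice (Fl L)"
proof (rule complete_lattice_if_sups)
  show "partial_order (Fl L)" unfolding Fl_def by (rule partial_order_by_inclusion)
qed (use Sup_Fl(1) in blast)

text \<open>If \<open>S\<close> is a join of basic sublocales \<open>c\<^sub>i\<close> and \<open>K\<close> is the meet of inequalities \<open>\<up>a\<^sub>j \<or> \<o>(b\<^sub>j)\<close>,
  then \<open>S \<setminus> K\<close> is the join of the basic sublocales \<open>c\<^sub>i \<inter> \<up>b\<^sub>j \<inter> \<o>(a\<^sub>j)\<close>.\<close>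

lemma codiff_Fl_closed:
  assumes S: "S \<in> carrier (Fl L)" and K: "sublocale_of L K"
  shows "codiff (Sl L) S K \<in> carrier (Fl L)"
  unfolding mem_Fl_iff
proof (intro conjI allI impI)
  let ?D = "codiff (Sl L) S K"
  note S' = sublocale_Fl[OF S]
  show D: "sublocale_of L ?D" using S' K by (rule sublocale_codiff)
  have SD: "S \<subseteq> K \<squnion>\<^bsub>Sl L\<^esub> ?D" using codiff_subset_iff[OF S' K D] by simp
  fix T assume T: "sublocale_of L T" "\<forall>c\<in>basic_sl L. c \<subseteq> ?D \<longrightarrow> c \<subseteq> T"
  have "S \<subseteq> K \<squnion>\<^bsub>Sl L\<^esub> T"
  proof (rule Fl_subsetI[OF S sublocale_join[OF K T(1)]])
    fix c assume c: "c \<in> basic_sl L" "c \<subseteq> S"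
    let ?I = "{ineq_sl L a b | a b. a \<in> carrier L \<and> b \<in> carrier L \<and> K \<subseteq> ineq_sl L a b}"
    have "c \<subseteq> ineq_sl L a b \<squnion>\<^bsub>Sl L\<^esub> T"
      if ab: "a \<in> carrier L" "b \<in> carrier L" "K \<subseteq> ineq_sl L a b" for a b
    proof -
      let ?d = "c \<inter> (closed_sl L b \<inter> open_sl L a)"
      have "c \<subseteq> ineq_sl L a b \<squnion>\<^bsub>Sl L\<^esub> ?D"
        using c SD join_Sl_mono[OF K sublocale_ineq_sl D D] ab by blast
      then have "?d \<subseteq> ?D" using subset_ineq_join_iff[OF sublocale_basic[OF c(1)] D ab(1,2)] by simp
      moreover have "?d \<in> basic_sl L" using c ab basic_Int basicI by simp
      ultimately have "?d \<subseteq> T" using T by blast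
      then show ?thesis using subset_ineq_join_iff[OF sublocale_basic[OF c(1)] T(1) ab(1,2)] by simp
    qed
    note c_sub = this
    have "x \<in> T \<squnion>\<^bsub>Sl L\<^esub> (carrier L \<inter> \<Inter>?I)" if x: "x \<in> c" for x
    proof (rule join_Sl_Inter[OF T(1)])
      show "x \<in> carrier L" using x sublocaleD(1)[OF sublocale_basic[OF c(1)]] by blast
      fix E assume "E \<in> ?I"
      then obtain a b where ab: "a \<in> carrier L" "b \<in> carrier L" "K \<subseteq> ineq_sl L a b" "E = ineq_sl L a b"
        by blast
      show "sublocale_of L E" "x \<in> T \<squnion>\<^bsub>Sl L\<^esub> E"
        using ab c_sub[OF ab(1-3)] x by (auto simp: sublocale_ineq_sl join_comm[of _ T])
    qed
    then have "c \<subseteq> T \<squnion>\<^bsub>Sl L\<^esub> K" by (subst sublocale_eq_Inter[OF K]) blast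
    then show "c \<subseteq> K \<squnion>\<^bsub>Sl L\<^esub> T" by (simp add: join_comm[of _ K])
  qed
  then show "?D \<subseteq> T" using codiff_subset_iff[OF S' K T(1)] by simp
qed

lemma subcolocale_Fl: "subcolocale (Sl L) (carrier (Fl L))"
  unfolding subcolocale_def by (auto simp: sublocale_Fl Sup_Fl_closed codiff_Fl_closed)

lemma subcolocale_Sl: "subcolocale (Sl L) (carrier (Sl L))"
  unfolding subcolocale_def by (auto intro: sublocale_Sup simp: sublocale_codiff)

end

subsection \<open>Local exactness in terms of sublocales\<close>

context frm_hom
begin

text \<open>If \<open>f\<^sub>*[-]\<close> maps \<open>\<F>M\<close> into \<open>\<F>L\<close>, the extension \<open>\<phi>\<close> of \<open>f\<close> to \<open>\<F>L \<rightarrow> \<F>M\<close> is the right adjoint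
  of the map so obtained. As such it preserves meets. For joins, the difference \<open>w\<close> of the element
  \<open>\<phi>(\<Or>\<A>)\<close> and the join of the \<open>\<phi>(A)\<close>, \<open>A \<in> \<A>\<close>, has to be trivial: its image \<open>f\<^sub>*[w]\<close> lies below
  \<open>\<Or>\<A>\<close> but is disjoint from every basic sublocale below a member of \<open>\<A>\<close>.\<close>

lemma locally_exact_if_image_Fl:
  assumes fl: "\<And>E. E \<in> carrier (Fl M) \<Longrightarrow> fr ` E \<in> carrier (Fl L)"
  shows "locally_exact L M f"
proof -
  interpret FL: complete_lattice "Fl L" by (rule L.complete_lattice_Fl)
  interpret FM: complete_lattice "Fl M" by (rule M.complete_lattice_Fl)
  \<comment> \<open>\<open>\<phi>\<close> is the right adjoint of \<open>f\<^sub>*[-]\<close>, restricted to the Funayama envelopes.\<close>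
  define \<phi> where "\<phi> S = \<Squnion>\<^bsub>Sl M\<^esub> {E \<in> carrier (Fl M). fr ` E \<subseteq> S}" for S
  have \<phi>_Fl: "\<phi> S \<in> carrier (Fl M)" for S unfolding \<phi>_def by (rule M.Sup_Fl_closed) auto
  have \<phi>_iff: "E \<subseteq> \<phi> S \<longleftrightarrow> fr ` E \<subseteq> S" if E: "E \<in> carrier (Fl M)" and S: "sublocale_of L S" for E S
  proof
    let ?B = "{E \<in> carrier (Fl M). fr ` E \<subseteq> S}"
    have B: "\<And>T. T \<in> ?B \<Longrightarrow> sublocale_of M T" using M.sublocale_Fl by auto
    have "\<phi> S \<subseteq> preimage_sl S"
      unfolding \<phi>_def using subset_preimage_iff[OF M.sublocale_Fl S]
      by (subst M.Sup_Sl_subset_iff[OF B sublocale_preimage]) auto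
    then show "E \<subseteq> \<phi> S \<Longrightarrow> fr ` E \<subseteq> S" using subset_preimage_iff[OF M.sublocale_Fl[OF E] S] by blast
    show "fr ` E \<subseteq> S \<Longrightarrow> E \<subseteq> \<phi> S"
      unfolding \<phi>_def using E by (intro M.subset_Sup_Sl) (auto simp: M.sublocale_Fl)
  qed
  have inf: "\<phi> (\<Sqinter>\<^bsub>Fl L\<^esub> \<A>) = \<Sqinter>\<^bsub>Fl M\<^esub> (\<phi> ` \<A>)" if \<A>: "\<A> \<subseteq> carrier (Fl L)" for \<A>
  proof (rule FM.eq_if_same_below)
    show "\<phi> (\<Sqinter>\<^bsub>Fl L\<^esub> \<A>) \<in> carrier (Fl M)" "\<Sqinter>\<^bsub>Fl M\<^esub> (\<phi> ` \<A>) \<in> carrier (Fl M)"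
      using \<phi>_Fl by (auto intro!: FM.inf_closed)
    fix E assume E: "E \<in> carrier (Fl M)"
    have "E \<subseteq> \<phi> (\<Sqinter>\<^bsub>Fl L\<^esub> \<A>) \<longleftrightarrow> fr ` E \<sqsubseteq>\<^bsub>Fl L\<^esub> \<Sqinter>\<^bsub>Fl L\<^esub> \<A>"
      using \<phi>_iff[OF E L.sublocale_Fl[OF FL.inf_closed[OF \<A>]]] by simp
    also have "\<dots> \<longleftrightarrow> (\<forall>A\<in>\<A>. fr ` E \<subseteq> A)" using FL.le_Inf_iff[OF \<A> fl[OF E]] by simp
    also have "\<dots> \<longleftrightarrow> (\<forall>A\<in>\<A>. E \<subseteq> \<phi> A)"
      using \<A> by (intro ball_cong refl \<phi>_iff[OF E, symmetric] L.sublocale_Fl) auto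
    also have "\<dots> \<longleftrightarrow> E \<sqsubseteq>\<^bsub>Fl M\<^esub> \<Sqinter>\<^bsub>Fl M\<^esub> (\<phi> ` \<A>)"
      using FM.le_Inf_iff[of "\<phi> ` \<A>" E] E \<phi>_Fl by auto
    finally show "E \<sqsubseteq>\<^bsub>Fl M\<^esub> \<phi> (\<Sqinter>\<^bsub>Fl L\<^esub> \<A>) \<longleftrightarrow> E \<sqsubseteq>\<^bsub>Fl M\<^esub> \<Sqinter>\<^bsub>Fl M\<^esub> (\<phi> ` \<A>)" by simp
  qed
  have basic: "closed_sl M (f a) \<inter> open_sl M (f b) \<subseteq> \<phi> S"
    if "a \<in> carrier L" "b \<in> carrier L" "closed_sl L a \<inter> open_sl L b \<subseteq> S" "sublocale_of L S" for a b S
  proof -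
    have "preimage_sl (closed_sl L a) \<inter> preimage_sl (open_sl L b) \<in> basic_sl M" (is "?c \<in> _")
      using that by (simp add: preimage_closed preimage_open M.basicI)
    moreover from this have "fr ` ?c \<subseteq> closed_sl L a" "fr ` ?c \<subseteq> open_sl L b"
      using that subset_preimage_iff[OF M.sublocale_basic L.sublocale_closed]
        subset_preimage_iff[OF M.sublocale_basic L.sublocale_open] by (metis inf_le1, metis inf_le2)
    ultimately have "fr ` ?c \<subseteq> S" "?c \<in> basic_sl M" using that(3) by auto
    then show ?thesis
      using that \<phi>_iff[OF M.basic_Fl] by (simp add: preimage_closed preimage_open)
  qed
  have sup: "\<phi> (\<Squnion>\<^bsub>Fl L\<^esub> \<A>) = \<Squnion>\<^bsub>Fl M\<^esub> (\<phi> ` \<A>)" if \<A>: "\<A> \<subseteq> carrier (Fl L)" for \<A>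
  proof (rule subset_antisym)
    let ?y = "\<phi> (\<Squnion>\<^bsub>Fl L\<^esub> \<A>)" and ?z = "\<Squnion>\<^bsub>Fl M\<^esub> (\<phi> ` \<A>)"
    have AFl: "\<And>A. A \<in> \<A> \<Longrightarrow> sublocale_of L A" using \<A> L.sublocale_Fl by auto
    have sub: "A \<subseteq> \<Squnion>\<^bsub>Fl L\<^esub> \<A>" if "A \<in> \<A>" for A using FL.sup_upper[OF \<A> that] by simp
    have y: "?y \<in> carrier (Fl M)" and z: "?z \<in> carrier (Fl M)"
      using \<phi>_Fl by (auto intro!: FM.sup_closed)
    have SA: "sublocale_of L (\<Squnion>\<^bsub>Fl L\<^esub> \<A>)" using L.sublocale_Fl FL.sup_closed[OF \<A>] by blast
    have "\<phi> A \<subseteq> ?y" if "A \<in> \<A>" for A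
      using \<phi>_iff[OF \<phi>_Fl SA] \<phi>_iff[OF \<phi>_Fl AFl[OF that]] sub[OF that] by blast
    then show "?z \<subseteq> ?y" using FM.Sup_le_iff[of "\<phi> ` \<A>" ?y] y \<phi>_Fl by auto
    let ?w = "codiff (Sl M) ?y ?z"
    note [simp] = M.sublocale_Fl[OF y] M.sublocale_Fl[OF z] and w = M.codiff_Fl_closed[OF y M.sublocale_Fl[OF z]]
    note w' = M.sublocale_Fl[OF w]
    have wy: "?w \<subseteq> ?y" by (simp add: M.codiff_subset_iff M.join_Sl_upper)
    have fw: "fr ` ?w \<in> carrier (Fl L)" by (rule fl[OF w])
    have fw_disjoint: "fr ` ?w \<subseteq> ineq_sl L b a"
      if ab: "a \<in> carrier L" "b \<in> carrier L" and A: "closed_sl L a \<inter> open_sl L b \<subseteq> A" "A \<in> \<A>" for a b A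
    proof -
      have "closed_sl M (f a) \<inter> open_sl M (f b) \<subseteq> \<phi> A" using basic ab A AFl by simp
      also have "\<dots> \<subseteq> ?z" using FM.sup_upper[of "\<phi> ` \<A>" "\<phi> A"] A \<phi>_Fl by auto
      finally have "?y \<subseteq> ineq_sl M (f b) (f a) \<squnion>\<^bsub>Sl M\<^esub> ?z"
        using ab by (subst M.subset_ineq_join_iff) auto
      then have "?w \<subseteq> ineq_sl M (f b) (f a)"
        using ab by (simp add: M.codiff_subset_iff M.sublocale_ineq_sl join_comm[of _ ?z])
      then show ?thesis using image_subset_ineq_iff[OF w'] ab by simp
    qed
    have "fr ` ?w \<subseteq> {\<top>\<^bsub>L\<^esub>}"
    proof (rule L.Fl_subsetI[OF fw L.sublocale_top])
      fix e assume e: "e \<in> basic_sl L" "e \<subseteq> fr ` ?w"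
      then obtain p q where pq: "p \<in> carrier L" "q \<in> carrier L" "e = closed_sl L p \<inter> open_sl L q"
        by (auto simp: basic_sl_def)
      have "A \<subseteq> ineq_sl L q p" if A: "A \<in> \<A>" for A
      proof (rule L.Fl_subsetI)
        show "A \<in> carrier (Fl L)" "sublocale_of L (ineq_sl L q p)"
          using A \<A> pq L.sublocale_ineq_sl by auto
        fix c assume c: "c \<in> basic_sl L" "c \<subseteq> A"
        then obtain a b where ab: "a \<in> carrier L" "b \<in> carrier L" "c = closed_sl L a \<inter> open_sl L b"
          by (auto simp: basic_sl_def)
        have "e \<subseteq> ineq_sl L b a" using fw_disjoint[of a b A] ab c A e by blast
        then have "e \<inter> c \<subseteq> {\<top>\<^bsub>L\<^esub>}"
          using L.subset_ineq_iff_disjoint[OF L.sublocale_basic[OF e(1)] ab(2,1)] ab by simp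
        then show "c \<subseteq> ineq_sl L q p"
          using L.subset_ineq_iff_disjoint[OF L.sublocale_basic[OF c(1)] pq(2,1)] pq by blast
      qed
      then have "\<Squnion>\<^bsub>Sl L\<^esub> \<A> \<subseteq> ineq_sl L q p"
        using L.Sup_Sl_subset_iff[OF AFl] pq L.sublocale_ineq_sl by auto
      moreover have "e \<subseteq> \<Squnion>\<^bsub>Sl L\<^esub> \<A>"
        using e wy \<phi>_iff[OF w SA] L.Sup_Fl(2)[OF \<A>] by auto
      ultimately show "e \<subseteq> {\<top>\<^bsub>L\<^esub>}"
        using L.subset_ineq_iff_disjoint[OF L.sublocale_basic[OF e(1)] pq(2,1)] pq by blast
    qed
    then have "?w \<subseteq> {\<top>\<^bsub>M\<^esub>}"
      using image_subset_ineq_iff[OF w', of "\<top>\<^bsub>L\<^esub>" "\<bottom>\<^bsub>L\<^esub>"]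
      by (simp add: L.ineq_sl_top_bot M.ineq_sl_top_bot f_top f_bot)
    then have "?w \<subseteq> ?z" using M.sublocaleD(4)[OF M.sublocale_Fl[OF z]] by auto
    then have "?y \<subseteq> ?z \<squnion>\<^bsub>Sl M\<^esub> ?z" by (simp add: M.codiff_subset_iff)
    then show "?y \<subseteq> ?z" using M.join_Sl_subset_iff[of ?z ?z ?z] by auto
  qed
  have "complete_hom (Fl L) (Fl M) \<phi>"
    using inf sup \<phi>_Fl unfolding complete_hom_def sup_pres_def inf_pres_def
    by (auto intro: L.complete_lattice_Fl M.complete_lattice_Fl)
  moreover have "\<phi> (open_sl L a) = open_sl M (f a)" if a: "a \<in> carrier L" for a
  proof (rule FM.eq_if_same_below)
    show "open_sl M (f a) \<in> carrier (Fl M)" using a by (simp add: M.basic_Fl M.open_basic)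
    fix E assume E: "E \<in> carrier (Fl M)"
    show "E \<sqsubseteq>\<^bsub>Fl M\<^esub> \<phi> (open_sl L a) \<longleftrightarrow> E \<sqsubseteq>\<^bsub>Fl M\<^esub> open_sl M (f a)"
      using \<phi>_iff[OF E L.sublocale_open[OF a]] subset_preimage_iff[OF M.sublocale_Fl[OF E] L.sublocale_open[OF a]]
      by (simp add: preimage_open a)
  qed (rule \<phi>_Fl)
  ultimately show ?thesis using frame_hom unfolding locally_exact_def by blast
qed

text \<open>Conversely, an extension \<open>\<phi>\<close> of \<open>f\<close> sends \<open>\<up>a\<close> to \<open>\<up>(f a)\<close> and inequalities to inequalities. Hence
  its left adjoint sends \<open>E\<close> to a sublocale that forces the same inequalities as \<open>f\<^sub>*[E]\<close>.\<close>

lemma image_Fl_if_locally_exact: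
  assumes "locally_exact L M f" and E: "E \<in> carrier (Fl M)"
  shows "fr ` E \<in> carrier (Fl L)"
proof -
  interpret FL: complete_lattice "Fl L" by (rule L.complete_lattice_Fl)
  interpret FM: complete_lattice "Fl M" by (rule M.complete_lattice_Fl)
  obtain \<phi> where "complete_hom (Fl L) (Fl M) \<phi>" and \<phi>_open: "\<And>a. a \<in> carrier L \<Longrightarrow> \<phi> (open_sl L a) = open_sl M (f a)"
    using assms by (auto simp: locally_exact_def)
  then have \<phi>_closed: "\<And>S. S \<in> carrier (Fl L) \<Longrightarrow> \<phi> S \<in> carrier (Fl M)"
    and sup: "\<And>\<A>. \<A> \<subseteq> carrier (Fl L) \<Longrightarrow> \<phi> (\<Squnion>\<^bsub>Fl L\<^esub> \<A>) = \<Squnion>\<^bsub>Fl M\<^esub> (\<phi> ` \<A>)"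
    and inf: "\<And>\<A>. \<A> \<subseteq> carrier (Fl L) \<Longrightarrow> \<phi> (\<Sqinter>\<^bsub>Fl L\<^esub> \<A>) = \<Sqinter>\<^bsub>Fl M\<^esub> (\<phi> ` \<A>)"
    by (auto simp: complete_hom_def sup_pres_def inf_pres_def)
  have Fl: "closed_sl L a \<in> carrier (Fl L)" "open_sl L a \<in> carrier (Fl L)" if "a \<in> carrier L" for a
    using that by (simp_all add: L.basic_Fl L.closed_basic L.open_basic)
  have FlM: "closed_sl M a \<in> carrier (Fl M)" "open_sl M a \<in> carrier (Fl M)" if "a \<in> carrier M" for a
    using that by (simp_all add: M.basic_Fl M.closed_basic M.open_basic)
  have join: "\<phi> (S \<squnion>\<^bsub>Sl L\<^esub> T) = \<phi> S \<squnion>\<^bsub>Sl M\<^esub> \<phi> T" if "S \<in> carrier (Fl L)" "T \<in> carrier (Fl L)" for S T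
    using sup[of "{S, T}"] L.Sup_Fl(2)[of "{S, T}"] M.Sup_Fl(2)[of "{\<phi> S, \<phi> T}"] that \<phi>_closed
    by (simp add: join_def)
  \<comment> \<open>The value of \<open>\<phi>\<close> at \<open>\<up>a\<close> is determined because \<open>\<up>a\<close> is the complement of \<open>\<o>(a)\<close>.\<close>
  have \<phi>_cl: "\<phi> (closed_sl L a) = closed_sl M (f a)" if a: "a \<in> carrier L" for a
  proof (rule subset_antisym)
    have "closed_sl L a \<squnion>\<^bsub>Sl L\<^esub> open_sl L a = carrier L"
      using a L.sublocaleD(1)[OF L.sublocale_ineq_sl, of a a]
      by (auto simp: L.ineq_sl_eq_join[symmetric]) (auto simp: ineq_sl_def L.meet_absorb)
    then have "\<phi> (closed_sl L a) \<squnion>\<^bsub>Sl M\<^esub> open_sl M (f a) = \<phi> (open_sl L \<top>\<^bsub>L\<^esub>)"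
      using join[of "closed_sl L a" "open_sl L a"] Fl a \<phi>_open by (simp add: L.open_top)
    then have "ineq_sl M \<top>\<^bsub>M\<^esub> (f a) \<squnion>\<^bsub>Sl M\<^esub> \<phi> (closed_sl L a) = carrier M"
      using \<phi>_open[of "\<top>\<^bsub>L\<^esub>"] a by (simp add: f_top M.open_top M.ineq_sl_top join_comm)
    then have "carrier M \<inter> (closed_sl M (f a) \<inter> open_sl M \<top>\<^bsub>M\<^esub>) \<subseteq> \<phi> (closed_sl L a)"
      using M.subset_ineq_join_iff[of "carrier M" "\<phi> (closed_sl L a)" "\<top>\<^bsub>M\<^esub>" "f a"] a
        M.sublocale_Fl[OF \<phi>_closed[OF Fl(1)[OF a]]] M.sublocale_carrier by simp
    then show "closed_sl M (f a) \<subseteq> \<phi> (closed_sl L a)"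
      using a by (auto simp: M.open_top closed_sl_def)
    have "\<Sqinter>\<^bsub>Fl L\<^esub> {closed_sl L a, open_sl L a} \<subseteq> closed_sl L a \<inter> open_sl L a"
      using FL.inf_lower[of "{closed_sl L a, open_sl L a}"] Fl a by auto
    also have "\<dots> \<subseteq> {\<top>\<^bsub>L\<^esub>}"
      using L.subset_ineq_iff_disjoint[of "carrier L" a a] a L.sublocale_carrier L.sublocaleD(1)[OF L.sublocale_closed]
      by (auto simp: ineq_sl_def L.meet_absorb)
    finally have "\<Sqinter>\<^bsub>Fl L\<^esub> {closed_sl L a, open_sl L a} = \<Squnion>\<^bsub>Fl L\<^esub> {}"
      using FL.inf_closed[of "{closed_sl L a, open_sl L a}"] Fl a L.sublocaleD(4)[OF L.sublocale_Fl]
        L.Sup_Fl(2)[of "{}"] L.sublocale_Sup[of "{}"] L.Sup_Sl_subset_iff[of "{}", OF _ L.sublocale_top] by auto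
    then have "\<Sqinter>\<^bsub>Fl M\<^esub> {\<phi> (closed_sl L a), open_sl M (f a)} = \<Squnion>\<^bsub>Fl M\<^esub> {}"
      using inf[of "{closed_sl L a, open_sl L a}"] sup[of "{}"] Fl a \<phi>_open by simp
    also have "\<dots> \<subseteq> {\<top>\<^bsub>M\<^esub>}"
      using M.Sup_Fl(2)[of "{}"] M.Sup_Sl_subset_iff[of "{}", OF _ M.sublocale_top] by auto
    finally have bot: "\<Sqinter>\<^bsub>Fl M\<^esub> {\<phi> (closed_sl L a), open_sl M (f a)} \<subseteq> {\<top>\<^bsub>M\<^esub>}" .
    show "\<phi> (closed_sl L a) \<subseteq> closed_sl M (f a)"
    proof (rule M.Fl_subsetI)
      show "\<phi> (closed_sl L a) \<in> carrier (Fl M)" "sublocale_of M (closed_sl M (f a))"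
        using a Fl \<phi>_closed M.sublocale_closed by auto
      fix c assume c: "c \<in> basic_sl M" "c \<subseteq> \<phi> (closed_sl L a)"
      have co: "c \<inter> open_sl M (f a) \<in> carrier (Fl M)"
        using c a by (simp add: M.basic_Fl M.basic_Int M.open_basic)
      have "c \<inter> open_sl M (f a) \<sqsubseteq>\<^bsub>Fl M\<^esub> \<Sqinter>\<^bsub>Fl M\<^esub> {\<phi> (closed_sl L a), open_sl M (f a)}"
        using c co a Fl FlM \<phi>_closed by (intro FM.inf_greatest) auto
      then have "c \<inter> (closed_sl M \<bottom>\<^bsub>M\<^esub> \<inter> open_sl M (f a)) \<subseteq> {\<top>\<^bsub>M\<^esub>}" using bot by auto
      then show "c \<subseteq> closed_sl M (f a)"
        using M.subset_ineq_iff_disjoint[OF M.sublocale_basic[OF c(1)], of "f a" "\<bottom>\<^bsub>M\<^esub>"] a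
        by (simp add: M.ineq_sl_bot)
    qed
  qed
  have ineq: "ineq_sl L a b \<in> carrier (Fl L)" "\<phi> (ineq_sl L a b) = ineq_sl M (f a) (f b)"
    if "a \<in> carrier L" "b \<in> carrier L" for a b
    using that Fl join[of "closed_sl L a" "open_sl L b"] L.Sup_Fl_closed[of "{closed_sl L a, open_sl L b}"]
    by (simp_all add: L.ineq_sl_eq_join M.ineq_sl_eq_join \<phi>_cl \<phi>_open join_def)
  \<comment> \<open>\<open>?S\<close> is the value at \<open>E\<close> of the left adjoint of \<open>\<phi>\<close>.\<close>
  let ?A = "{S \<in> carrier (Fl L). E \<subseteq> \<phi> S}"
  let ?S = "\<Sqinter>\<^bsub>Fl L\<^esub> ?A"
  have A: "?A \<subseteq> carrier (Fl L)" by auto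
  have S: "?S \<in> carrier (Fl L)" by (rule FL.inf_closed[OF A])
  note E' = M.sublocale_Fl[OF E] and S' = L.sublocale_Fl[OF S]
  have "E \<sqsubseteq>\<^bsub>Fl M\<^esub> \<phi> ?S"
    using E \<phi>_closed by (subst inf[OF A], intro FM.inf_greatest) auto
  have *: "?S \<subseteq> ineq_sl L a b \<longleftrightarrow> fr ` E \<subseteq> ineq_sl L a b" if ab: "a \<in> carrier L" "b \<in> carrier L" for a b
  proof
    assume "?S \<subseteq> ineq_sl L a b"
    then have "\<Squnion>\<^bsub>Fl L\<^esub> {?S, ineq_sl L a b} = ineq_sl L a b"
      using FL.le_iff_meet[OF S ineq(1)[OF ab]] by (simp add: join_def)
    then have "\<phi> ?S \<subseteq> ineq_sl M (f a) (f b)"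
      using sup[of "{?S, ineq_sl L a b}"] FM.sup_upper[of "{\<phi> ?S, \<phi> (ineq_sl L a b)}" "\<phi> ?S"]
        S ineq[OF ab] \<phi>_closed[OF S] \<phi>_closed[OF ineq(1)[OF ab]] by auto
    then show "fr ` E \<subseteq> ineq_sl L a b"
      using \<open>E \<sqsubseteq>\<^bsub>Fl M\<^esub> \<phi> ?S\<close> image_subset_ineq_iff[OF E' ab] by auto
  next
    assume "fr ` E \<subseteq> ineq_sl L a b"
    then have "ineq_sl L a b \<in> ?A" using image_subset_ineq_iff[OF E' ab] ineq[OF ab] by auto
    then show "?S \<subseteq> ineq_sl L a b" using FL.inf_lower[OF A] by auto
  qed
  have "fr ` E = ?S"
    by (intro subset_antisym L.sublocale_subset_if[OF S' sublocale_image[OF E']]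
        L.sublocale_subset_if[OF sublocale_image[OF E'] S']) (use * in auto)
  then show ?thesis using S by simp
qed

lemma locally_exact_iff:
  "locally_exact L M f \<longleftrightarrow> (\<forall>E\<in>carrier (Fl M). fr ` E \<in> carrier (Fl L))"
  using locally_exact_if_image_Fl image_Fl_if_locally_exact by blast

end


section \<open>Small sets\<close>

lemma small_subset: "small B \<Longrightarrow> A \<subseteq> B \<Longrightarrow> small A"
  unfolding small_def by (meson lesspoll_trans1 subset_imp_lepoll)

text \<open>The type \<open>'u\<close> as a universe of small sets.\<close>

locale univ =
  fixes u :: "'u itself"
  assumes universe: "universe u"
begin

lemma small_image_Pow: "small (A :: 'u set) \<Longrightarrow> small (h ` Pow A :: 'u set)"
  using universe unfolding universe_def small_def by (meson image_lepoll lesspoll_trans1)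

text \<open>Starting from the empty set, taking power sets yields small sets with one and with two elements.\<close>

lemma small_pair: "small {x, y :: 'u}"
proof -
  have "small ({} :: 'u set)"
    unfolding small_def lesspoll_def by (auto simp: eqpoll_iff_bijections lepoll_def)
  then have "small ((\<lambda>_. x) ` Pow ({} :: 'u set))" by (rule small_image_Pow)
  then have "small {x}" by simp
  then have "small ((\<lambda>A. if A = {} then x else y) ` Pow {x})" by (rule small_image_Pow)
  moreover have "(\<lambda>A. if A = {} then x else y) ` Pow {x} = {x, y}" by (auto simp: Pow_insert)
  ultimately show ?thesis by simp
qed

lemma dec_enc [simp]: "small A \<Longrightarrow> dec (enc A :: 'u) = A"
  unfolding dec_def using inj_on_enc universe by (metis inv_into_f_f mem_Collect_eq universe_def)

lemma enc_eq_iff: "small A \<Longrightarrow> small B \<Longrightarrow> (enc A :: 'u) = enc B \<longleftrightarrow> A = B"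
  by (metis dec_enc)

lemma zero_one [simp]: "(zero_u :: 'u) \<noteq> one_u" "(one_u :: 'u) \<noteq> zero_u"
proof -
  have "small ({} :: 'u set)" "small {enc {} :: 'u}"
    by (rule small_subset[OF small_pair]; blast)+
  then show "(zero_u :: 'u) \<noteq> one_u" unfolding zero_u_def one_u_def by (simp add: enc_eq_iff)
  then show "(one_u :: 'u) \<noteq> zero_u" by simp
qed

end

section \<open>Concrete categories\<close>

lemma concrete_simps [simp]:
  "Obj (concrete \<O> c h) = \<O>" "Dom (concrete \<O> c h) = src" "Cod (concrete \<O> c h) = tgt"
  "Id (concrete \<O> c h) A = Arrow A (\<lambda>x\<in>c A. x) A"
  "g \<cdot>\<^bsub>concrete \<O> c h\<^esub> f = Arrow (src f) (compose (c (src f)) (fn g) (fn f)) (tgt g)"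
  "f \<in> Arr (concrete \<O> c h) \<longleftrightarrow>
    src f \<in> \<O> \<and> tgt f \<in> \<O> \<and> fn f \<in> extensional (c (src f)) \<and> h (src f) (tgt f) (fn f)"
  by (simp_all add: concrete_def)

lemma Hom_concrete:
  "p \<in> Hom (concrete \<O> c h) A B \<longleftrightarrow>
    A \<in> \<O> \<and> B \<in> \<O> \<and> (\<exists>f. p = Arrow A f B \<and> f \<in> extensional (c A) \<and> h A B f)"
  by (cases p) (auto simp: Hom_def)

lemma Hom_concreteD:
  assumes "p \<in> Hom (concrete \<O> c h) A B"
  shows "A \<in> \<O>" "B \<in> \<O>" "src p = A" "tgt p = B" "fn p \<in> extensional (c A)" "h A B (fn p)"
  using assms by (auto simp: Hom_concrete)

lemma Arrow_Hom_concrete: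
  "Arrow A f B \<in> Hom (concrete \<O> c h) A B \<longleftrightarrow> A \<in> \<O> \<and> B \<in> \<O> \<and> f \<in> extensional (c A) \<and> h A B f"
  by (auto simp: Hom_def)

lemma full_sub_concrete: "full_sub (concrete \<O> c h) P = concrete {A \<in> \<O>. P A} c h"
  by (auto simp: full_sub_def concrete_def)

text \<open>The closure properties of the maps that make \<^term>\<open>concrete \<O> c h\<close> a category.\<close>

definition concrete_data :: "'o set \<Rightarrow> ('o \<Rightarrow> 'u set) \<Rightarrow> ('o \<Rightarrow> 'o \<Rightarrow> ('u \<Rightarrow> 'u) \<Rightarrow> bool) \<Rightarrow> bool"
  where "concrete_data \<O> c h \<longleftrightarrow>
    (\<forall>A\<in>\<O>. h A A (\<lambda>x\<in>c A. x)) \<and>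
    (\<forall>A\<in>\<O>. \<forall>B\<in>\<O>. \<forall>f. h A B f \<longrightarrow> f \<in> c A \<rightarrow> c B) \<and>
    (\<forall>A\<in>\<O>. \<forall>B\<in>\<O>. \<forall>C\<in>\<O>. \<forall>f g. h A B f \<longrightarrow> h B C g \<longrightarrow> h A C (compose (c A) g f))"

lemma concrete_data_subset: "concrete_data \<O> c h \<Longrightarrow> \<O>' \<subseteq> \<O> \<Longrightarrow> concrete_data \<O>' c h"
  unfolding concrete_data_def by (meson subsetD)

lemma category_concrete:
  assumes "concrete_data \<O> c h"
  shows "category (concrete \<O> c h)"
  unfolding category_def
proof (intro conjI ballI impI)
  note d = assms[unfolded concrete_data_def]
  let ?C = "concrete \<O> c h"
  show "Id ?C A \<in> Hom ?C A A" if "A \<in> Obj ?C" for A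
    using that d by (simp add: Arrow_Hom_concrete)
  show "g \<cdot>\<^bsub>?C\<^esub> f \<in> Hom ?C (Dom ?C f) (Cod ?C g)"
    if "f \<in> Arr ?C" "g \<in> Arr ?C" "Cod ?C f = Dom ?C g" for f g
    using that d by (auto simp: Arrow_Hom_concrete)
  fix f assume f: "f \<in> Arr ?C"
  then have fc: "fn f \<in> c (src f) \<rightarrow> c (tgt f)" using d by auto
  show "Dom ?C f \<in> Obj ?C" "Cod ?C f \<in> Obj ?C" using f by auto
  have "compose (c (src f)) (fn f) (\<lambda>x\<in>c (src f). x) = fn f"
    using f by (auto simp: compose_def extensional_def)
  then show "f \<cdot>\<^bsub>?C\<^esub> Id ?C (Dom ?C f) = f" by (simp add: arrow.expand)
  have "compose (c (src f)) (\<lambda>x\<in>c (tgt f). x) (fn f) = fn f"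
    by (rule ext) (use f fc in \<open>auto simp: compose_def extensional_def\<close>)
  then show "Id ?C (Cod ?C f) \<cdot>\<^bsub>?C\<^esub> f = f" by (simp add: arrow.expand)
  fix g k assume "g \<in> Arr ?C" "k \<in> Arr ?C" "Cod ?C f = Dom ?C g \<and> Cod ?C g = Dom ?C k"
  then show "(k \<cdot>\<^bsub>?C\<^esub> g) \<cdot>\<^bsub>?C\<^esub> f = k \<cdot>\<^bsub>?C\<^esub> (g \<cdot>\<^bsub>?C\<^esub> f)"
    using fc by (simp add: compose_assoc)
qed

lemma op_simps [simp]:
  "Obj (op_cat C) = Obj C" "Arr (op_cat C) = Arr C" "Dom (op_cat C) = Cod C" "Cod (op_cat C) = Dom C"
  "Id (op_cat C) = Id C" "f \<cdot>\<^bsub>op_cat C\<^esub> g = g \<cdot>\<^bsub>C\<^esub> f" "Hom (op_cat C) A B = Hom C B A"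
  by (auto simp: op_cat_def Hom_def)

lemma category_op: "category C \<Longrightarrow> category (op_cat C)"
  unfolding category_def op_cat_def Hom_def by auto

lemma is_functor_comp: "is_functor C D F \<Longrightarrow> is_functor D E K \<Longrightarrow> is_functor C E (K \<odot> F)"
  unfolding is_functor_def Hom_def compF_def by auto

lemma is_functor_id: "category C \<Longrightarrow> is_functor C C idF"
  unfolding is_functor_def category_def Hom_def idF_def by auto

lemma isos_concrete:
  "p \<in> isos (concrete \<O> c h) A B \<longleftrightarrow> p \<in> Hom (concrete \<O> c h) A B \<and>
    (\<exists>q \<in> Hom (concrete \<O> c h) B A.
      compose (c A) (fn q) (fn p) = (\<lambda>x\<in>c A. x) \<and> compose (c B) (fn p) (fn q) = (\<lambda>x\<in>c B. x))"
  by (auto simp: isos_def is_inverse_def Hom_def)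

lemma Id_iso: "category C \<Longrightarrow> A \<in> Obj C \<Longrightarrow> Id C A \<in> isos C A A"
  unfolding category_def isos_def is_inverse_def Hom_def by auto metis

lemma natural_iso_if_eq:
  assumes F: "is_functor C D F" and G: "is_functor C D G"
    and obj: "\<And>A. A \<in> Obj C \<Longrightarrow> fobj F A = fobj G A \<and> \<tau> A = Id D (fobj F A)"
    and arr: "\<And>f. f \<in> Arr C \<Longrightarrow> fmap F f = fmap G f"
  shows "natural_iso C D F G \<tau>"
proof -
  have C: "category C" and D: "category D" using F by (auto simp: is_functor_def)
  have iso: "\<tau> A \<in> isos D (fobj F A) (fobj G A)" if "A \<in> Obj C" for A
  proof -
    have "fobj F A \<in> Obj D" using F that by (simp add: is_functor_def)
    then show ?thesis using Id_iso[OF D] obj[OF that] by metis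
  qed
  have "\<tau> (Cod C f) \<cdot>\<^bsub>D\<^esub> fmap F f = fmap G f \<cdot>\<^bsub>D\<^esub> \<tau> (Dom C f)" if f: "f \<in> Arr C" for f
  proof -
    have "Dom C f \<in> Obj C" "Cod C f \<in> Obj C" using C f by (auto simp: category_def)
    moreover have "fmap F f \<in> Hom D (fobj F (Dom C f)) (fobj F (Cod C f))" using F f by (simp add: is_functor_def)
    ultimately show ?thesis using D obj unfolding arr[OF f] category_def Hom_def by auto
  qed
  then show ?thesis using F G iso by (auto simp: natural_iso_def natural_def isos_def)
qed

lemma inverse_Id:
  assumes C: "category C" and A: "A \<in> Obj C"
  shows "inverse_arr C (Id C A) = Id C A"
  unfolding inverse_arr_def
proof (rule the_equality)
  have I: "Id C A \<in> Arr C" "Dom C (Id C A) = A" "Cod C (Id C A) = A"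
    using C A by (auto simp: category_def Hom_def)
  show "is_inverse C (Id C A) (Id C A)"
    using C A I unfolding category_def is_inverse_def Hom_def by auto metis
  fix g assume "is_inverse C (Id C A) g"
  then have "g \<in> Arr C" "Dom C g = A" "g \<cdot>\<^bsub>C\<^esub> Id C A = Id C A"
    using I by (auto simp: is_inverse_def Hom_def)
  then show "g = Id C A" using C unfolding category_def by metis
qed

text \<open>Functors between concrete categories that leave underlying functions unchanged; the condition is
  imposed on all values of type \<^typ>\<open>('o, 'u) arrow\<close>, whether they are arrows of the category or not.\<close>

definition keeps_fn :: "('o, ('o, 'u) arrow, 'p, ('p, 'u) arrow) ftor \<Rightarrow> bool"
  where "keeps_fn F \<longleftrightarrow> (\<forall>p. fmap F p = Arrow (fobj F (src p)) (fn p) (fobj F (tgt p)))"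

lemma keeps_fnD: "keeps_fn F \<Longrightarrow> fmap F p = Arrow (fobj F (src p)) (fn p) (fobj F (tgt p))"
  by (simp add: keeps_fn_def)

lemma keeps_fn_simps [simp]:
  "keeps_fn idF" "keeps_fn O_S" "keeps_fn S_F" "keeps_fn underlying"
  "keeps_fn F \<Longrightarrow> keeps_fn G \<Longrightarrow> keeps_fn (F \<odot> G)"
  by (auto simp: keeps_fn_def idF_def O_S_def S_F_def underlying_def compF_def)

lemma fobj_simps [simp]:
  "fobj idF A = A" "fobj O_S B = fst B" "fobj S_F L = (L, carrier (Sl L))" "fobj underlying L = carrier L"
  "fobj (F \<odot> G) C = fobj F (fobj G C)" "fmap (F \<odot> G) p = fmap F (fmap G p)" "fmap idF q = q"
  by (auto simp: idF_def O_S_def S_F_def underlying_def compF_def)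

lemma is_functor_concrete:
  assumes "concrete_data \<O> c h" "concrete_data \<O>' c' h'" "keeps_fn F"
    and "\<And>A. A \<in> \<O> \<Longrightarrow> fobj F A \<in> \<O>' \<and> c' (fobj F A) = c A"
    and "\<And>A B f. A \<in> \<O> \<Longrightarrow> B \<in> \<O> \<Longrightarrow> h A B f \<Longrightarrow> h' (fobj F A) (fobj F B) f"
  shows "is_functor (concrete \<O> c h) (concrete \<O>' c' h') F"
  unfolding is_functor_def
  using assms by (auto simp: category_concrete keeps_fnD Arrow_Hom_concrete)

section \<open>The categories of frames, spaces and sets\<close>

lemma concrete_data_SET: "concrete_data {A. small A} (\<lambda>A. A) (\<lambda>A B f. f \<in> A \<rightarrow> B)"
  by (auto simp: concrete_data_def compose_eq)

lemma concrete_data_TOP: "concrete_data {X. small (topspace X)} topspace continuous_map"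
proof -
  have "continuous_map X X (\<lambda>x\<in>topspace X. x)" for X :: "'a topology"
    by (rule continuous_map_eq[OF continuous_map_id]) simp
  moreover have "continuous_map X Z (compose (topspace X) g f)"
    if "continuous_map X Y f" "continuous_map Y Z g" for f g and X Y Z :: "'a topology"
    by (rule continuous_map_eq[OF continuous_map_compose[OF that]]) (simp add: compose_eq)
  ultimately show ?thesis
    using continuous_map_funspace unfolding concrete_data_def by blast
qed

lemma concrete_data_FRM: "concrete_data {L. frame L \<and> small (carrier L)} carrier frame_hom"
proof -
  have "f \<in> carrier L \<rightarrow> carrier M" if "frame_hom L M f" for L M :: "'a gorder" and f
    using that by (simp add: frame_hom_def)
  then show ?thesis
    using frame_hom_id frame_hom_compose unfolding concrete_data_def by blast
qed

lemma TOP_D_eq: "TOP_D = concrete {X. small (topspace X) \<and> T_D X} topspace continuous_map"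
  unfolding TOP_D_def TOP_def full_sub_concrete by simp

lemma category_FRM: "category FRM"
  unfolding FRM_def by (rule category_concrete[OF concrete_data_FRM])

lemma Obj_FRM: "Obj FRM = {L. frame L \<and> small (carrier L)}"
  by (simp add: FRM_def)

section \<open>Skula extensions\<close>

lemma skula_extD:
  assumes "skula_ext A"
  shows "frame (fst A)" "small (carrier (fst A))" "subcolocale (Sl (fst A)) (snd A)"
    "carrier (Fl (fst A)) \<subseteq> snd A"
  using assms by (auto simp: skula_ext_def FRM_def split: prod.splits)

lemma skula_ext_sublocale:
  assumes "skula_ext A" "S \<in> snd A"
  shows "sublocale_of (fst A) S"
proof -
  interpret frm "fst A" using skula_extD(1)[OF assms(1)] by unfold_locales
  show ?thesis using skula_extD(3)[OF assms(1)] assms(2) by (auto simp: subcolocale_def)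
qed

lemma skula_ext_Sup:
  assumes "skula_ext A" "\<B> \<subseteq> snd A"
  shows "\<Squnion>\<^bsub>Sl (fst A)\<^esub> \<B> \<in> snd A"
  using skula_extD(3)[OF assms(1)] assms(2) by (simp add: subcolocale_def)

lemma skula_ext_bot:
  assumes "skula_ext A"
  shows "{\<top>\<^bsub>fst A\<^esub>} \<in> snd A"
proof -
  interpret frm "fst A" using skula_extD(1)[OF assms] by unfold_locales
  have "\<Squnion>\<^bsub>Sl (fst A)\<^esub> {} = {\<top>\<^bsub>fst A\<^esub>}"
    by (metis bottom_Sl complete_lattice.Sup_empty complete_lattice_Sl)
  then show ?thesis using skula_ext_Sup[OF assms, of "{}"] by simp
qed

lemma skula_hom_iff:
  assumes A: "skula_ext A" and B: "skula_ext B"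
  shows "skula_hom A B f \<longleftrightarrow> frame_hom (fst A) (fst B) f \<and>
    (\<forall>E\<in>snd B. right_adj (fst A) (fst B) f ` E \<in> snd A)"
proof -
  have "Sl_adj (fst A) (fst B) f E = right_adj (fst A) (fst B) f ` E"
    if "frame_hom (fst A) (fst B) f" "E \<in> snd B" for E
  proof -
    interpret frm_hom "fst A" "fst B" f
      using that skula_extD(1)[OF A] skula_extD(1)[OF B] by unfold_locales
    show ?thesis using skula_ext_sublocale[OF B that(2)] by (rule Sl_adj_eq)
  qed
  then show ?thesis by (auto simp: skula_hom_def split: prod.splits)
qed

lemma concrete_data_SKULA: "concrete_data {A. skula_ext A} (\<lambda>A. carrier (fst A)) skula_hom"
  unfolding concrete_data_def
proof (intro conjI ballI allI impI; unfold mem_Collect_eq)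
  show "skula_hom A A (\<lambda>x\<in>carrier (fst A). x)" if A: "skula_ext A" for A :: "'a skula"
  proof -
    have "right_adj (fst A) (fst A) (\<lambda>x\<in>carrier (fst A). x) ` E = E" if "E \<in> snd A" for E
    proof -
      interpret frm "fst A" using skula_extD(1)[OF A] by unfold_locales
      have "E \<subseteq> carrier (fst A)" using skula_ext_sublocale[OF A that] sublocaleD(1) by blast
      then show ?thesis by (rule right_adj_id_image[OF skula_extD(1)[OF A]])
    qed
    then show ?thesis using skula_extD[OF A] by (simp add: skula_hom_iff[OF A A] frame_hom_id)
  qed
  fix A B C :: "'a skula" and f g assume A: "skula_ext A" and B: "skula_ext B" and C: "skula_ext C"
  show "f \<in> carrier (fst A) \<rightarrow> carrier (fst B)" if "skula_hom A B f"
    using that by (auto simp: skula_hom_iff[OF A B] frame_hom_def)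
  assume fg: "skula_hom A B f" "skula_hom B C g"
  then have h: "frame_hom (fst A) (fst B) f" "frame_hom (fst B) (fst C) g"
    using A B C by (simp_all add: skula_hom_iff)
  note fr = skula_extD(1)[OF A] skula_extD(1)[OF B] skula_extD(1)[OF C]
  interpret M: frm "fst C" using fr by unfold_locales
  have "right_adj (fst A) (fst C) (compose (carrier (fst A)) g f) ` E
      = right_adj (fst A) (fst B) f ` right_adj (fst B) (fst C) g ` E" if "E \<in> snd C" for E
  proof -
    have "E \<subseteq> carrier (fst C)" using skula_ext_sublocale[OF C that] M.sublocaleD(1) by blast
    then show ?thesis using right_adj_compose[OF fr h] by (auto simp: image_image intro!: image_cong)
  qed
  then show "skula_hom A C (compose (carrier (fst A)) g f)"
    using fg A B C h frame_hom_compose by (auto simp: skula_hom_iff)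
qed

lemma skula_ext_Sl:
  assumes "frame L" "small (carrier L)"
  shows "skula_ext (L, carrier (Sl L))"
proof -
  interpret frm L using assms by unfold_locales
  show ?thesis using assms subcolocale_Sl sublocale_Fl by (auto simp: skula_ext_def FRM_def)
qed

lemma skula_ext_Fl:
  assumes "frame L" "small (carrier L)"
  shows "skula_ext (L, carrier (Fl L))"
proof -
  interpret frm L using assms by unfold_locales
  show ?thesis using assms subcolocale_Fl by (auto simp: skula_ext_def FRM_def)
qed

lemma skula_hom_from_Sl:
  assumes L: "frame L" "small (carrier L)" and B: "skula_ext B"
  shows "skula_hom (L, carrier (Sl L)) B f \<longleftrightarrow> frame_hom L (fst B) f"
proof -
  have "right_adj L (fst B) f ` E \<in> carrier (Sl L)" if "frame_hom L (fst B) f" "E \<in> snd B" for E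
  proof -
    interpret frm_hom L "fst B" f using that skula_extD(1)[OF B] L by unfold_locales
    show ?thesis using sublocale_image[OF skula_ext_sublocale[OF B that(2)]] by simp
  qed
  then show ?thesis using skula_hom_iff[OF skula_ext_Sl[OF L] B] by auto
qed

lemma locally_exact_iff_skula_hom:
  assumes L: "frame L" "small (carrier L)" and M: "frame M" "small (carrier M)"
  shows "locally_exact L M f \<longleftrightarrow> skula_hom (L, carrier (Fl L)) (M, carrier (Fl M)) f"
proof (cases "frame_hom L M f")
  case True
  then interpret frm_hom L M f using L M by unfold_locales
  show ?thesis
    using skula_hom_iff[OF skula_ext_Fl[OF L] skula_ext_Fl[OF M]] locally_exact_iff frame_hom by simp
next
  case False
  then show ?thesis by (simp add: locally_exact_def skula_hom_def)
qed

lemma concrete_data_FRM_LE: "concrete_data (Obj FRM) carrier locally_exact"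
proof -
  note d = concrete_data_SKULA[unfolded concrete_data_def, THEN conjunct1]
    concrete_data_SKULA[unfolded concrete_data_def, THEN conjunct2, THEN conjunct2]
  show ?thesis
    unfolding concrete_data_def Obj_FRM
  proof (intro conjI ballI allI impI; unfold mem_Collect_eq)
    fix A B C :: "'a gorder" and f g
    assume A: "frame A \<and> small (carrier A)"
    show "locally_exact A A (\<lambda>x\<in>carrier A. x)"
      using d(1) A skula_ext_Fl[of A] by (fastforce simp: locally_exact_iff_skula_hom)
    show "locally_exact A B f \<Longrightarrow> f \<in> carrier A \<rightarrow> carrier B"
      by (simp add: locally_exact_def frame_hom_def)
    assume B: "frame B \<and> small (carrier B)" and C: "frame C \<and> small (carrier C)"
      and fg: "locally_exact A B f" "locally_exact B C g"
    then have "skula_hom (A, carrier (Fl A)) (B, carrier (Fl B)) f"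
      "skula_hom (B, carrier (Fl B)) (C, carrier (Fl C)) g"
      using A by (simp_all add: locally_exact_iff_skula_hom)
    then have "skula_hom (A, carrier (Fl A)) (C, carrier (Fl C)) (compose (carrier A) g f)"
      using d(2) A B C skula_ext_Fl by fastforce
    then show "locally_exact A C (compose (carrier A) g f)"
      using A C by (simp add: locally_exact_iff_skula_hom)
  qed
qed

subsection \<open>Fiber-initial and fiber-terminal extensions\<close>

lemma frame_iso:
  assumes "\<theta> \<in> isos FRM M L"
  obtains g where "frame_hom M L (fn \<theta>)" "frame_hom L M g" "g \<in> extensional (carrier L)"
    "\<theta> = Arrow M (fn \<theta>) L" "fn \<theta> \<in> extensional (carrier M)"
    "\<And>x. x \<in> carrier M \<Longrightarrow> g (fn \<theta> x) = x" "\<And>y. y \<in> carrier L \<Longrightarrow> fn \<theta> (g y) = y"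
proof -
  obtain q where q: "\<theta> \<in> Hom FRM M L" "q \<in> Hom FRM L M"
    "compose (carrier M) (fn q) (fn \<theta>) = (\<lambda>x\<in>carrier M. x)"
    "compose (carrier L) (fn \<theta>) (fn q) = (\<lambda>x\<in>carrier L. x)"
    using assms unfolding FRM_def isos_concrete by blast
  show thesis
  proof (rule that[of "fn q"])
    show "fn q (fn \<theta> x) = x" if "x \<in> carrier M" for x
      using fun_cong[OF q(3), of x] that by (simp add: compose_eq)
    show "fn \<theta> (fn q x) = x" if "x \<in> carrier L" for x
      using fun_cong[OF q(4), of x] that by (simp add: compose_eq)
  qed (use q in \<open>auto simp: FRM_def Hom_concrete\<close>)
qed

text \<open>Isomorphisms of frames preserve the Funayama envelopes.\<close>

lemma iso_image_Fl:
  assumes L: "frame L" and M: "frame M" and f: "frame_hom M L f" and g: "frame_hom L M g"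
    and gf: "\<And>x. x \<in> carrier M \<Longrightarrow> g (f x) = x" and fg: "\<And>y. y \<in> carrier L \<Longrightarrow> f (g y) = y"
    and F: "F \<in> carrier (Fl L)"
  shows "right_adj M L f ` F \<in> carrier (Fl M)"
proof -
  interpret F: frm_hom M L f using assms by unfold_locales
  interpret G: frm_hom L M g using assms by unfold_locales
  have fr: "right_adj M L f y = g y" if "y \<in> carrier L" for y
  proof (rule F.L.eq_if_same_below)
    fix c assume c: "c \<in> carrier M"
    show "c \<sqsubseteq>\<^bsub>M\<^esub> right_adj M L f y \<longleftrightarrow> c \<sqsubseteq>\<^bsub>M\<^esub> g y"
      using c that F.f_mono[of c "g y"] G.f_mono[of "f c" y] by (auto simp: F.le_fr_iff gf fg)
  qed (use that in simp_all)
  have gr: "right_adj L M g x = f x" if "x \<in> carrier M" for x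
  proof (rule F.M.eq_if_same_below)
    fix c assume c: "c \<in> carrier L"
    show "c \<sqsubseteq>\<^bsub>L\<^esub> right_adj L M g x \<longleftrightarrow> c \<sqsubseteq>\<^bsub>L\<^esub> f x"
      using c that G.f_mono[of c "f x"] F.f_mono[of "g c" x] by (auto simp: G.le_fr_iff gf fg)
  qed (use that in simp_all)
  have basic: "right_adj M L f ` c \<in> basic_sl M" if "c \<in> basic_sl L" for c
  proof -
    obtain a b where ab: "a \<in> carrier L" "b \<in> carrier L" "c = closed_sl L a \<inter> open_sl L b"
      using \<open>c \<in> basic_sl L\<close> by (auto simp: basic_sl_def)
    let ?d = "closed_sl M (g a) \<inter> open_sl M (g b)"
    have c: "sublocale_of L c" and d: "sublocale_of M ?d"
      using F.M.sublocale_basic[OF that] F.L.sublocale_basic[OF F.L.basicI] ab G.f_closed by simp_all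
    have "right_adj M L f ` c \<subseteq> closed_sl M (g a)" "right_adj M L f ` c \<subseteq> open_sl M (g b)"
      using ab F.subset_preimage_iff[OF c F.L.sublocale_closed, of "g a"]
        F.subset_preimage_iff[OF c F.L.sublocale_open, of "g b"]
      by (simp_all add: F.preimage_closed F.preimage_open fg)
    moreover have "?d \<subseteq> right_adj M L f ` c"
    proof
      fix x assume x: "x \<in> ?d"
      then have xc: "x \<in> carrier M" using F.L.sublocaleD(1)[OF d] by blast
      have "right_adj L M g ` ?d \<subseteq> closed_sl L a" "right_adj L M g ` ?d \<subseteq> open_sl L b"
        using ab G.subset_preimage_iff[OF d F.M.sublocale_closed, of a]
          G.subset_preimage_iff[OF d F.M.sublocale_open, of b]
        by (simp_all add: G.preimage_closed G.preimage_open)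
      then have "f x \<in> c" using x gr[OF xc] ab by auto
      then show "x \<in> right_adj M L f ` c" using fr[of "f x"] gf[OF xc] xc by force
    qed
    ultimately have "right_adj M L f ` c = ?d" by blast
    then show ?thesis using ab by (simp add: F.L.basicI)
  qed
  obtain \<B> where \<B>: "F = \<Squnion>\<^bsub>Sl L\<^esub> \<B>" "\<B> \<subseteq> basic_sl L" using F by (auto simp: Fl_def basic_sl_def)
  then have "right_adj M L f ` F = \<Squnion>\<^bsub>Sl M\<^esub> ((`) (right_adj M L f) ` \<B>)"
    using F.image_Sup[of \<B>] F.M.sublocale_basic by blast
  moreover have "(`) (right_adj M L f) ` \<B> \<subseteq> carrier (Fl M)"
    using basic F.L.basic_Fl \<B>(2) by blast
  ultimately show ?thesis using F.L.Sup_Fl_closed by simp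
qed

lemma fiber_initial_iff:
  assumes A: "skula_ext A"
  shows "fiber_initial SKULA O_S A \<longleftrightarrow> snd A = carrier (Sl (fst A))"
proof
  note L = skula_extD(1,2)[OF A]
  interpret frm "fst A" using L by unfold_locales
  let ?id = "\<lambda>x\<in>carrier (fst A). x"
  have idi: "Id FRM (fst A) \<in> isos FRM (fst A) (fst A)"
    using L by (intro Id_iso) (auto simp: FRM_def category_concrete concrete_data_FRM)
  \<comment> \<open>Initiality is applied to the same frame with all sublocales and to the identity.\<close>
  assume "fiber_initial SKULA O_S A"
  then obtain p where p: "p \<in> Hom SKULA A (fst A, carrier (Sl (fst A)))"
    "Id FRM (fst A) \<cdot>\<^bsub>FRM\<^esub> fmap O_S p = Id FRM (fst A)"
    using skula_ext_Sl[OF L] idi unfolding fiber_initial_def SKULA_def by fastforce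
  then obtain f where f: "p = Arrow A f (fst A, carrier (Sl (fst A)))" "f \<in> extensional (carrier (fst A))"
    "skula_hom A (fst A, carrier (Sl (fst A))) f"
    by (auto simp: SKULA_def Hom_concrete)
  then have fh: "frame_hom (fst A) (fst A) f" using skula_hom_iff[OF A skula_ext_Sl[OF L]] by simp
  have "f = ?id"
  proof (rule extensionalityI[of _ "carrier (fst A)"])
    fix x assume x: "x \<in> carrier (fst A)"
    then have "f x \<in> carrier (fst A)" using fh by (auto simp: frame_hom_def)
    moreover have "compose (carrier (fst A)) ?id f x = x"
      using p(2) f(1) x by (simp add: FRM_def keeps_fnD[of O_S] fun_eq_iff)
    ultimately show "f x = ?id x" using x by (simp add: compose_eq)
  qed (use f in auto)
  have "S \<in> snd A" if "sublocale_of (fst A) S" for S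
  proof -
    have "right_adj (fst A) (fst A) ?id ` S = S"
      using sublocaleD(1)[OF that] by (rule right_adj_id_image[OF L(1)])
    moreover have "right_adj (fst A) (fst A) f ` S \<in> snd A"
      using f(3)[unfolded skula_hom_iff[OF A skula_ext_Sl[OF L]]] that by simp
    ultimately show ?thesis using \<open>f = ?id\<close> by simp
  qed
  then show "snd A = carrier (Sl (fst A))" using skula_ext_sublocale[OF A] by auto
next
  note L = skula_extD(1,2)[OF A]
  assume eq: "snd A = carrier (Sl (fst A))"
  show "fiber_initial SKULA O_S A"
    unfolding fiber_initial_def
  proof (intro ballI)
    fix D \<theta> assume D: "D \<in> Obj SKULA" and \<theta>: "\<theta> \<in> isos FRM (fobj O_S D) (fobj O_S A)"
    then have "\<theta> \<in> isos FRM (fst D) (fst A)" by simp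
    from frame_iso[OF this] obtain g where g: "frame_hom (fst A) (fst D) g"
      "g \<in> extensional (carrier (fst A))"
      "\<theta> = Arrow (fst D) (fn \<theta>) (fst A)" "\<And>y. y \<in> carrier (fst A) \<Longrightarrow> fn \<theta> (g y) = y"
      by metis
    have D': "skula_ext D" using D by (simp add: SKULA_def)
    have "skula_hom A D g" using skula_hom_from_Sl[OF L D'] g(1) eq by (metis prod.collapse)
    then have "Arrow A g D \<in> Hom SKULA A D" using A D' g(2) by (simp add: SKULA_def Arrow_Hom_concrete)
    moreover have "\<theta> \<cdot>\<^bsub>FRM\<^esub> fmap O_S (Arrow A g D) = Id FRM (fobj O_S A)"
    proof -
      have "compose (carrier (fst A)) (fn \<theta>) g = (\<lambda>x\<in>carrier (fst A). x)"
        using g(4) by (auto simp: compose_def)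
      moreover have "tgt \<theta> = fst A" using g(3) by (metis arrow.sel(3))
      ultimately show ?thesis by (simp add: FRM_def keeps_fnD[of O_S])
    qed
    ultimately show "\<exists>p\<in>Hom SKULA A D. \<theta> \<cdot>\<^bsub>FRM\<^esub> fmap O_S p = Id FRM (fobj O_S A)" by blast
  qed
qed

lemma fiber_terminal_iff:
  assumes A: "skula_ext A"
  shows "fiber_terminal SKULA O_S A \<longleftrightarrow> snd A = carrier (Fl (fst A))"
proof
  note L = skula_extD(1,2)[OF A]
  interpret frm "fst A" using L by unfold_locales
  let ?id = "\<lambda>x\<in>carrier (fst A). x"
  have idi: "Id FRM (fst A) \<in> isos FRM (fst A) (fst A)"
    using L by (intro Id_iso) (auto simp: FRM_def category_concrete concrete_data_FRM)
  \<comment> \<open>Terminality is applied to the same frame with its Funayama envelope and to the identity.\<close>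
  assume "fiber_terminal SKULA O_S A"
  then obtain p where p: "p \<in> Hom SKULA (fst A, carrier (Fl (fst A))) A" "fmap O_S p = Id FRM (fst A)"
    using skula_ext_Fl[OF L] idi unfolding fiber_terminal_def SKULA_def by fastforce
  then have f: "skula_hom (fst A, carrier (Fl (fst A))) A ?id"
    by (auto simp: SKULA_def FRM_def Hom_concrete keeps_fnD[of O_S])
  have "S \<in> carrier (Fl (fst A))" if "S \<in> snd A" for S
  proof -
    have "S \<subseteq> carrier (fst A)" using skula_ext_sublocale[OF A that] sublocaleD(1) by blast
    then have "right_adj (fst A) (fst A) ?id ` S = S" by (rule right_adj_id_image[OF L(1)])
    moreover have "right_adj (fst A) (fst A) ?id ` S \<in> carrier (Fl (fst A))"
      using f that by (simp add: skula_hom_iff[OF skula_ext_Fl[OF L] A])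
    ultimately show ?thesis by simp
  qed
  then show "snd A = carrier (Fl (fst A))" using skula_extD(4)[OF A] by auto
next
  note L = skula_extD(1,2)[OF A]
  assume eq: "snd A = carrier (Fl (fst A))"
  show "fiber_terminal SKULA O_S A"
    unfolding fiber_terminal_def
  proof (intro ballI)
    fix D \<theta> assume D: "D \<in> Obj SKULA" and \<theta>: "\<theta> \<in> isos FRM (fobj O_S D) (fobj O_S A)"
    then have "\<theta> \<in> isos FRM (fst D) (fst A)" by simp
    from frame_iso[OF this] obtain g where g: "frame_hom (fst D) (fst A) (fn \<theta>)" "frame_hom (fst A) (fst D) g"
      "\<theta> = Arrow (fst D) (fn \<theta>) (fst A)" "fn \<theta> \<in> extensional (carrier (fst D))"
      "\<And>x. x \<in> carrier (fst D) \<Longrightarrow> g (fn \<theta> x) = x" "\<And>y. y \<in> carrier (fst A) \<Longrightarrow> fn \<theta> (g y) = y"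
      by metis
    have D': "skula_ext D" using D by (simp add: SKULA_def)
    have "right_adj (fst D) (fst A) (fn \<theta>) ` E \<in> snd D" if "E \<in> snd A" for E
      using iso_image_Fl[OF L(1) skula_extD(1)[OF D'] g(1,2,5,6)] that eq skula_extD(4)[OF D'] by auto
    then have "Arrow D (fn \<theta>) A \<in> Hom SKULA D A"
      using A D' g by (simp add: SKULA_def Arrow_Hom_concrete skula_hom_iff)
    moreover have "fmap O_S (Arrow D (fn \<theta>) A) = \<theta>" using g(3) by (simp add: keeps_fnD[of O_S])
    ultimately show "\<exists>p\<in>Hom SKULA D A. fmap O_S p = \<theta>" by blast
  qed
qed

lemma full_sub_SKULA:
  "full_sub SKULA P = concrete {A. skula_ext A \<and> P A} (\<lambda>A. carrier (fst A)) skula_hom"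
  by (simp add: SKULA_def full_sub_concrete)

lemma SKULA_I_eq: "SKULA_I = concrete {A. skula_ext A \<and> snd A = carrier (Sl (fst A))} (\<lambda>A. carrier (fst A)) skula_hom"
proof -
  have "{A. skula_ext A \<and> fiber_initial SKULA O_S A} = {A. skula_ext A \<and> snd A = carrier (Sl (fst A))}"
    using fiber_initial_iff by auto
  then show ?thesis unfolding SKULA_I_def full_sub_SKULA by (rule arg_cong)
qed

lemma SKULA_T_eq: "SKULA_T = concrete {A. skula_ext A \<and> snd A = carrier (Fl (fst A))} (\<lambda>A. carrier (fst A)) skula_hom"
proof -
  have "{A. skula_ext A \<and> fiber_terminal SKULA O_S A} = {A. skula_ext A \<and> snd A = carrier (Fl (fst A))}"
    using fiber_terminal_iff by auto
  then show ?thesis unfolding SKULA_T_def full_sub_SKULA by (rule arg_cong)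
qed


section \<open>The frame of opens\<close>

text \<open>The point \<open>U \<mapsto> (x \<in> U)\<close> of \<open>\<Omega>X\<close>.\<close>

definition ev :: "'u topology \<Rightarrow> 'u \<Rightarrow> 'u \<Rightarrow> 'u"
  where "ev X x = (\<lambda>u \<in> carrier (fobj Omega X). if x \<in> dec u then one_u else zero_u)"

lemma Omega_simps:
  "carrier (fobj Omega X) = enc ` {U. openin X U}"
  "u \<sqsubseteq>\<^bsub>fobj Omega X\<^esub> v \<longleftrightarrow> dec u \<subseteq> dec v"
  "fmap Omega g = Arrow (fobj Omega (tgt g))
    (\<lambda>u \<in> carrier (fobj Omega (tgt g)). enc {x \<in> topspace (src g). fn g x \<in> dec u}) (fobj Omega (src g))"
  by (simp_all add: Omega_def Let_def)

lemma two_simps [simp]: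
  "carrier two_frm = {zero_u, one_u}" "x \<sqsubseteq>\<^bsub>two_frm\<^esub> y \<longleftrightarrow> x = zero_u \<or> y = one_u"
  by (simp_all add: two_frm_def)

context univ
begin

lemma small_open: "small (topspace X) \<Longrightarrow> openin X U \<Longrightarrow> small (U :: 'u set)"
  by (meson openin_subset small_subset)

lemma Omega_dec:
  assumes "small (topspace X)" "(w :: 'u) \<in> carrier (fobj Omega X)"
  shows "openin X (dec w)" "enc (dec w) = w"
  using assms small_open by (auto simp: Omega_simps(1))

lemma Omega_enc:
  assumes "small (topspace X)" "openin X U"
  shows "(enc U :: 'u) \<in> carrier (fobj Omega X)" "dec (enc U :: 'u) = U"
  using assms small_open by (auto simp: Omega_simps(1))

lemma Omega_eq_iff:
  assumes "small (topspace X)" "(w :: 'u) \<in> carrier (fobj Omega X)" "v \<in> carrier (fobj Omega X)"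
  shows "w = v \<longleftrightarrow> dec w = dec v"
  using assms Omega_dec by metis

lemma Sup_Omega_least:
  assumes X: "small (topspace X)" and A: "A \<subseteq> carrier (fobj Omega X :: 'u gorder)"
  shows "least (fobj Omega X) (enc (\<Union>(dec ` A))) (Upper (fobj Omega X) A)"
proof -
  have "openin X (\<Union>(dec ` A))" using Omega_dec[OF X] A by (auto intro!: openin_Union)
  then show ?thesis
    using Omega_enc[OF X, of "\<Union>(dec ` A)"] A
    by (auto simp: least_def Upper_def Omega_simps(2) simp del: dec_enc)
qed

lemma complete_lattice_Omega:
  assumes X: "small (topspace X)"
  shows "complete_lattice (fobj Omega X :: 'u gorder)"
proof (rule complete_lattice_if_sups)
  have eq: "eq (fobj Omega X :: 'u gorder) = (=)" by (simp add: Omega_def Let_def)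
  show "partial_order (fobj Omega X :: 'u gorder)"
    by unfold_locales (auto simp: eq Omega_simps(2) Omega_eq_iff[OF X])
qed (use Sup_Omega_least[OF X] in blast)

lemma dec_Sup:
  assumes X: "small (topspace X)" and A: "A \<subseteq> carrier (fobj Omega X :: 'u gorder)"
  shows "dec (\<Squnion>\<^bsub>fobj Omega X\<^esub> A) = \<Union>(dec ` A)"
proof -
  interpret O: complete_lattice "fobj Omega X :: 'u gorder" by (rule complete_lattice_Omega[OF X])
  have "\<Squnion>\<^bsub>fobj Omega X\<^esub> A = enc (\<Union>(dec ` A))"
    using O.least_unique[OF O.sup_lub[OF A] Sup_Omega_least[OF X A]] .
  moreover have "openin X (\<Union>(dec ` A))" using Omega_dec[OF X] A by (auto intro!: openin_Union)
  ultimately show ?thesis using Omega_enc(2)[OF X] by simp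
qed

lemma dec_meet:
  assumes X: "small (topspace X)"
    and uv: "(w :: 'u) \<in> carrier (fobj Omega X)" "v \<in> carrier (fobj Omega X)"
  shows "dec (w \<sqinter>\<^bsub>fobj Omega X\<^esub> v) = dec w \<inter> dec v"
proof -
  interpret O: complete_lattice "fobj Omega X :: 'u gorder" by (rule complete_lattice_Omega[OF X])
  have o: "openin X (dec w \<inter> dec v)" using Omega_dec[OF X] uv by auto
  have "w \<sqinter>\<^bsub>fobj Omega X\<^esub> v = enc (dec w \<inter> dec v)"
  proof (rule O.eq_if_same_below)
    show "(enc (dec w \<inter> dec v) :: 'u) \<in> carrier (fobj Omega X)" by (rule Omega_enc[OF X o])
    show "c \<sqsubseteq>\<^bsub>fobj Omega X\<^esub> w \<sqinter>\<^bsub>fobj Omega X\<^esub> v \<longleftrightarrow> c \<sqsubseteq>\<^bsub>fobj Omega X\<^esub> enc (dec w \<inter> dec v)"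
      if "c \<in> carrier (fobj Omega X)" for c
      using O.le_meet_iff[OF uv that] Omega_enc(2)[OF X o] unfolding Omega_simps(2) by simp
  qed (use uv in simp)
  then show ?thesis using Omega_enc(2)[OF X o] by simp
qed

lemma top_Omega:
  assumes X: "small (topspace X)"
  shows "\<top>\<^bsub>fobj Omega X\<^esub> = (enc (topspace X) :: 'u)"
proof -
  interpret O: complete_lattice "fobj Omega X :: 'u gorder" by (rule complete_lattice_Omega[OF X])
  have o: "openin X (topspace X)" by simp
  show ?thesis
  proof (rule O.eq_if_same_below)
    show "c \<sqsubseteq>\<^bsub>fobj Omega X\<^esub> \<top>\<^bsub>fobj Omega X\<^esub> \<longleftrightarrow> c \<sqsubseteq>\<^bsub>fobj Omega X\<^esub> enc (topspace X)"
      if "c \<in> carrier (fobj Omega X)" for c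
      using that Omega_dec[OF X that] Omega_enc(2)[OF X o]
      by (simp add: Omega_simps(2) openin_subset O.top_higher[unfolded Omega_simps(2)] del: dec_enc)
  qed (use Omega_enc(1)[OF X o] in simp_all)
qed

lemma frame_Omega:
  assumes X: "small (topspace X)"
  shows "frame (fobj Omega X :: 'u gorder)"
proof -
  interpret O: complete_lattice "fobj Omega X :: 'u gorder" by (rule complete_lattice_Omega[OF X])
  have "a \<sqinter>\<^bsub>fobj Omega X\<^esub> (\<Squnion>\<^bsub>fobj Omega X\<^esub> B) = \<Squnion>\<^bsub>fobj Omega X\<^esub> ((\<lambda>b. a \<sqinter>\<^bsub>fobj Omega X\<^esub> b) ` B)"
    if a: "a \<in> carrier (fobj Omega X)" and B: "B \<subseteq> carrier (fobj Omega X)" for B and a :: 'u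
  proof -
    have c: "(\<lambda>b. a \<sqinter>\<^bsub>fobj Omega X\<^esub> b) ` B \<subseteq> carrier (fobj Omega X)" using a B by auto
    have "dec (a \<sqinter>\<^bsub>fobj Omega X\<^esub> b) = dec a \<inter> dec b" if "b \<in> B" for b
      using dec_meet[OF X a] that B by auto
    then have "dec (a \<sqinter>\<^bsub>fobj Omega X\<^esub> (\<Squnion>\<^bsub>fobj Omega X\<^esub> B))
        = dec (\<Squnion>\<^bsub>fobj Omega X\<^esub> ((\<lambda>b. a \<sqinter>\<^bsub>fobj Omega X\<^esub> b) ` B))"
      using a B c by (simp add: dec_meet[OF X a O.sup_closed] dec_Sup[OF X])
    then show ?thesis using a B c by (subst Omega_eq_iff[OF X]) auto
  qed
  then show ?thesis using complete_lattice_Omega[OF X] by (simp add: frame_def)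
qed

lemma small_Omega:
  assumes X: "small (topspace X)"
  shows "small (carrier (fobj Omega X :: 'u gorder))"
proof -
  have "{U. openin X U} \<subseteq> Pow (topspace X)" using openin_subset by auto
  then have "carrier (fobj Omega X :: 'u gorder) \<subseteq> enc ` Pow (topspace X)" unfolding Omega_simps by (rule image_mono)
  then show ?thesis using small_image_Pow[OF X] small_subset by blast
qed

subsection \<open>The two-element frame\<close>

lemma Sup_two_least:
  assumes "A \<subseteq> {zero_u, one_u :: 'u}"
  shows "least two_frm (if one_u \<in> A then one_u else zero_u) (Upper two_frm A)"
  using assms by (auto simp: least_def Upper_def)

lemma complete_lattice_two: "complete_lattice (two_frm :: 'u gorder)"
proof (rule complete_lattice_if_sups)
  have eq: "eq (two_frm :: 'u gorder) = (=)" by (simp add: two_frm_def)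
  show "partial_order (two_frm :: 'u gorder)" by unfold_locales (auto simp: eq)
qed (use Sup_two_least in auto)

lemma Sup_two:
  assumes "A \<subseteq> {zero_u, one_u :: 'u}"
  shows "\<Squnion>\<^bsub>two_frm\<^esub> A = (if one_u \<in> A then one_u else zero_u)"
proof -
  interpret T: complete_lattice "two_frm :: 'u gorder" by (rule complete_lattice_two)
  have A: "A \<subseteq> carrier two_frm" using assms by simp
  show ?thesis using T.least_unique[OF T.sup_lub[OF A] Sup_two_least[OF assms]] .
qed

lemma meet_two:
  assumes "x \<in> {zero_u, one_u}" "y \<in> {zero_u, one_u :: 'u}"
  shows "x \<sqinter>\<^bsub>two_frm\<^esub> y = (if x = one_u \<and> y = one_u then one_u else zero_u)"
proof -
  interpret T: complete_lattice "two_frm :: 'u gorder" by (rule complete_lattice_two)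
  have "zero_u \<sqinter>\<^bsub>two_frm\<^esub> z = zero_u" "z \<sqinter>\<^bsub>two_frm\<^esub> one_u = z" if "z \<in> {zero_u, one_u}" for z :: 'u
    using that by (auto intro!: T.meet_absorb)
  then show ?thesis
    using assms meet_comm[of two_frm x y] by (cases "x = one_u"; cases "y = one_u") auto
qed

lemma top_two: "\<top>\<^bsub>two_frm\<^esub> = (one_u :: 'u)" and bot_two: "\<bottom>\<^bsub>two_frm\<^esub> = (zero_u :: 'u)"
proof -
  interpret T: complete_lattice "two_frm :: 'u gorder" by (rule complete_lattice_two)
  show "\<top>\<^bsub>two_frm\<^esub> = (one_u :: 'u)" using T.top_higher[of one_u] by simp
  show "\<bottom>\<^bsub>two_frm\<^esub> = (zero_u :: 'u)" using T.bottom_lower[of zero_u] by simp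
qed

lemma frame_two: "frame (two_frm :: 'u gorder)"
proof -
  have "a \<sqinter>\<^bsub>two_frm\<^esub> (\<Squnion>\<^bsub>two_frm\<^esub> B) = \<Squnion>\<^bsub>two_frm\<^esub> ((\<lambda>b. a \<sqinter>\<^bsub>two_frm\<^esub> b) ` B)"
    if a: "a \<in> {zero_u, one_u}" and B: "B \<subseteq> {zero_u, one_u}" for B and a :: 'u
  proof -
    have "a \<sqinter>\<^bsub>two_frm\<^esub> b = (if a = one_u \<and> b = one_u then one_u else zero_u)" if "b \<in> B" for b
      using meet_two[OF a] that B by blast
    then have im: "(\<lambda>b. a \<sqinter>\<^bsub>two_frm\<^esub> b) ` B = (\<lambda>b. if a = one_u \<and> b = one_u then one_u else zero_u) ` B"
      by (rule image_cong[OF refl])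
    have "\<Squnion>\<^bsub>two_frm\<^esub> ((\<lambda>b. a \<sqinter>\<^bsub>two_frm\<^esub> b) ` B) = (if a = one_u \<and> one_u \<in> B then one_u else zero_u)"
      unfolding im by (subst Sup_two) auto
    moreover have "\<Squnion>\<^bsub>two_frm\<^esub> B = (if one_u \<in> B then one_u else zero_u)" by (rule Sup_two[OF B])
    ultimately show ?thesis using meet_two[OF a, of "\<Squnion>\<^bsub>two_frm\<^esub> B"] by auto
  qed
  then show ?thesis using complete_lattice_two by (simp add: frame_def)
qed

text \<open>A point of a frame is a map to \<open>{0, 1}\<close> whose fibre over \<open>1\<close> is a completely prime filter.\<close>

lemma frame_hom_two_iff:
  fixes D :: "'a gorder" and f :: "'a \<Rightarrow> 'u"
  assumes D: "frame D"
  shows "frame_hom D two_frm f \<longleftrightarrow> f \<in> carrier D \<rightarrow> {zero_u, one_u} \<and> f \<top>\<^bsub>D\<^esub> = one_u \<and>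
    (\<forall>a\<in>carrier D. \<forall>b\<in>carrier D. f (a \<sqinter>\<^bsub>D\<^esub> b) = one_u \<longleftrightarrow> f a = one_u \<and> f b = one_u) \<and>
    (\<forall>A\<subseteq>carrier D. f (\<Squnion>\<^bsub>D\<^esub> A) = one_u \<longleftrightarrow> (\<exists>a\<in>A. f a = one_u))"
proof (cases "f \<in> carrier D \<rightarrow> {zero_u, one_u}")
  case f: True
  interpret D: frm D using D by unfold_locales
  have fc: "f a = zero_u \<or> f a = one_u" if "a \<in> carrier D" for a using f that by auto
  have cl: "complete_lattice D" "lattice D" "complete_lattice (two_frm :: 'u gorder)" "lattice (two_frm :: 'u gorder)"
    by (simp_all add: complete_lattice_two D.complete_lattice_axioms)
  have "f (a \<sqinter>\<^bsub>D\<^esub> b) = f a \<sqinter>\<^bsub>two_frm\<^esub> f b \<longleftrightarrow> (f (a \<sqinter>\<^bsub>D\<^esub> b) = one_u \<longleftrightarrow> f a = one_u \<and> f b = one_u)"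
    if "a \<in> carrier D" "b \<in> carrier D" for a b
    using that fc[of a] fc[of b] fc[of "a \<sqinter>\<^bsub>D\<^esub> b"] by (auto simp: meet_two)
  moreover have "f (\<Squnion>\<^bsub>D\<^esub> A) = \<Squnion>\<^bsub>two_frm\<^esub> (f ` A) \<longleftrightarrow> (f (\<Squnion>\<^bsub>D\<^esub> A) = one_u \<longleftrightarrow> (\<exists>a\<in>A. f a = one_u))"
    if "A \<subseteq> carrier D" for A
  proof -
    have "f ` A \<subseteq> {zero_u, one_u}" using f that by auto
    then show ?thesis using fc[OF D.sup_closed[OF that]] by (auto simp: Sup_two image_iff)
  qed
  ultimately show ?thesis
    using f cl by (simp add: frame_hom_def sup_pres_def meet_pres_def top_two) blast
qed (auto simp: frame_hom_def)

lemma small_two: "small (carrier (two_frm :: 'u gorder))"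
  by (simp add: small_pair)

lemma two_frm_Obj: "(two_frm :: 'u gorder) \<in> Obj FRM"
  unfolding Obj_FRM using frame_two small_two by blast

lemma ev_one_iff: "(w :: 'u) \<in> carrier (fobj Omega X) \<Longrightarrow> ev X x w = one_u \<longleftrightarrow> x \<in> dec w"
  by (simp add: ev_def)

lemma frame_hom_ev:
  assumes X: "small (topspace X)" and x: "(x :: 'u) \<in> topspace X"
  shows "frame_hom (fobj Omega X) two_frm (ev X x)"
proof -
  interpret O: frm "fobj Omega X :: 'u gorder" using frame_Omega[OF X] by unfold_locales
  have "openin X (topspace X)" by simp
  note t = Omega_enc[OF X this]
  show ?thesis
    unfolding frame_hom_two_iff[OF frame_Omega[OF X]]
  proof (intro conjI ballI allI impI)
    show "ev X x \<in> carrier (fobj Omega X) \<rightarrow> {zero_u, one_u}" by (auto simp: ev_def)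
    show "ev X x \<top>\<^bsub>fobj Omega X\<^esub> = one_u" using x t by (simp add: ev_one_iff top_Omega[OF X])
  next
    fix a b :: 'u assume "a \<in> carrier (fobj Omega X)" "b \<in> carrier (fobj Omega X)"
    then show "ev X x (a \<sqinter>\<^bsub>fobj Omega X\<^esub> b) = one_u \<longleftrightarrow> ev X x a = one_u \<and> ev X x b = one_u"
      by (simp add: ev_one_iff dec_meet[OF X])
  next
    fix A :: "'u set" assume "A \<subseteq> carrier (fobj Omega X)"
    then show "ev X x (\<Squnion>\<^bsub>fobj Omega X\<^esub> A) = one_u \<longleftrightarrow> (\<exists>a\<in>A. ev X x a = one_u)"
      by (auto simp: ev_one_iff dec_Sup[OF X] subset_iff)
  qed
qed

lemma frame_hom_Omega_iff:
  fixes D :: "'a gorder" and k :: "'a \<Rightarrow> 'u"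
  assumes D: "frame D" and X: "small (topspace X)"
  shows "frame_hom D (fobj Omega X) k \<longleftrightarrow> k \<in> carrier D \<rightarrow> carrier (fobj Omega X) \<and>
    (\<forall>x\<in>topspace X. frame_hom D two_frm (compose (carrier D) (ev X x) k))"
proof
  assume "frame_hom D (fobj Omega X) k"
  then show "k \<in> carrier D \<rightarrow> carrier (fobj Omega X) \<and>
    (\<forall>x\<in>topspace X. frame_hom D two_frm (compose (carrier D) (ev X x) k))"
    using frame_hom_compose frame_hom_ev[OF X] frame_hom_funcset by blast
next
  assume asm: "k \<in> carrier D \<rightarrow> carrier (fobj Omega X) \<and>
    (\<forall>x\<in>topspace X. frame_hom D two_frm (compose (carrier D) (ev X x) k))"
  then have k: "k a \<in> carrier (fobj Omega X)" if "a \<in> carrier D" for a using that by auto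
  interpret D: frm D using D by unfold_locales
  interpret O: frm "fobj Omega X :: 'u gorder" using frame_Omega[OF X] by unfold_locales
  have mem: "compose (carrier D) (ev X x) k a = one_u \<longleftrightarrow> x \<in> dec (k a)" if "a \<in> carrier D" for a x
    using that k by (simp add: compose_eq ev_one_iff)
  note h = asm[THEN conjunct2, unfolded frame_hom_two_iff[OF D]]
  have sub: "dec w \<subseteq> topspace X" if "w \<in> carrier (fobj Omega X)" for w :: 'u
    using Omega_dec[OF X that] openin_subset by blast
  have eqI: "w = v" if "w \<in> carrier (fobj Omega X)" "v \<in> carrier (fobj Omega X)"
    "\<And>x. x \<in> topspace X \<Longrightarrow> x \<in> dec w \<longleftrightarrow> x \<in> dec v" for w v :: 'u
    using that sub[OF that(1)] sub[OF that(2)] by (subst Omega_eq_iff[OF X that(1,2)]) blast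
  have "k (\<Squnion>\<^bsub>D\<^esub> A) = \<Squnion>\<^bsub>fobj Omega X\<^esub> (k ` A)" if A: "A \<subseteq> carrier D" for A
  proof (rule eqI)
    have kA: "k ` A \<subseteq> carrier (fobj Omega X)" using A k by auto
    then show "\<Squnion>\<^bsub>fobj Omega X\<^esub> (k ` A) \<in> carrier (fobj Omega X)" by simp
    fix x assume x: "x \<in> topspace X"
    have "compose (carrier D) (ev X x) k (\<Squnion>\<^bsub>D\<^esub> A) = one_u \<longleftrightarrow>
        (\<exists>a\<in>A. compose (carrier D) (ev X x) k a = one_u)"
      using h x A by blast
    then show "x \<in> dec (k (\<Squnion>\<^bsub>D\<^esub> A)) \<longleftrightarrow> x \<in> dec (\<Squnion>\<^bsub>fobj Omega X\<^esub> (k ` A))"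
      unfolding mem[OF D.sup_closed[OF A]] dec_Sup[OF X kA] using mem A by (auto simp: subset_iff)
  qed (use A k in simp)
  moreover have "k (a \<sqinter>\<^bsub>D\<^esub> b) = k a \<sqinter>\<^bsub>fobj Omega X\<^esub> k b" if ab: "a \<in> carrier D" "b \<in> carrier D" for a b
  proof (rule eqI)
    fix x assume x: "x \<in> topspace X"
    have "compose (carrier D) (ev X x) k (a \<sqinter>\<^bsub>D\<^esub> b) = one_u \<longleftrightarrow>
        compose (carrier D) (ev X x) k a = one_u \<and> compose (carrier D) (ev X x) k b = one_u"
      using h x ab by blast
    then show "x \<in> dec (k (a \<sqinter>\<^bsub>D\<^esub> b)) \<longleftrightarrow> x \<in> dec (k a \<sqinter>\<^bsub>fobj Omega X\<^esub> k b)"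
      using mem[OF D.meet_closed[OF ab]] mem ab dec_meet[OF X k k] by auto
  qed (use ab k in simp_all)
  moreover have "k \<top>\<^bsub>D\<^esub> = \<top>\<^bsub>fobj Omega X\<^esub>"
  proof (rule eqI)
    have "openin X (topspace X)" by simp
    note t = Omega_enc[OF X this]
    fix x assume x: "x \<in> topspace X"
    then have "compose (carrier D) (ev X x) k \<top>\<^bsub>D\<^esub> = one_u" using h by blast
    then show "x \<in> dec (k \<top>\<^bsub>D\<^esub>) \<longleftrightarrow> x \<in> dec \<top>\<^bsub>fobj Omega X\<^esub>"
      using mem[OF D.top_closed] x t by (simp add: top_Omega[OF X])
  qed (use k in simp_all)
  ultimately show "frame_hom D (fobj Omega X) k"
    using asm complete_lattice_lattice[OF D.complete_lattice_axioms]
      complete_lattice_lattice[OF O.complete_lattice_axioms]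
    by (simp add: frame_hom_def sup_pres_def meet_pres_def D.complete_lattice_axioms O.complete_lattice_axioms)
qed

subsection \<open>The sublocales \<open>b(x)\<close>\<close>

text \<open>\<open>b(x)\<close> is the image of \<open>2\<close> under the right adjoint of the evaluation at \<open>x\<close>, and \<open>0\<close> is sent to
  the largest open set that does not contain \<open>x\<close>.\<close>

lemma point_sl_eq:
  assumes X: "small (topspace X)" and x: "(x :: 'u) \<in> topspace X"
  shows "right_adj (fobj Omega X) two_frm (ev X x) ` carrier two_frm = point_sl X x"
proof -
  interpret E: frm_hom "fobj Omega X :: 'u gorder" two_frm "ev X x"
    using frame_Omega[OF X] frame_two frame_hom_ev[OF X x] by unfold_locales
  have o: "openin X (topspace X - X closure_of {x})" by (simp add: closedin_closure_of openin_diff)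
  note e = Omega_enc[OF X o]
  have "right_adj (fobj Omega X) two_frm (ev X x) zero_u = enc (topspace X - X closure_of {x})"
  proof (rule E.L.eq_if_same_below)
    fix c :: 'u assume c: "c \<in> carrier (fobj Omega X)"
    have oc: "openin X (dec c)" using Omega_dec[OF X c] by simp
    have "c \<sqsubseteq>\<^bsub>fobj Omega X\<^esub> right_adj (fobj Omega X) two_frm (ev X x) zero_u \<longleftrightarrow> x \<notin> dec c"
      using c E.le_fr_iff[OF c, of zero_u] by (simp add: ev_def)
    also have "\<dots> \<longleftrightarrow> dec c \<inter> X closure_of {x} = {}"
      using oc x by (subst openin_Int_closure_of_eq_empty[OF oc]) auto
    also have "\<dots> \<longleftrightarrow> c \<sqsubseteq>\<^bsub>fobj Omega X\<^esub> enc (topspace X - X closure_of {x})"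
      using e(2) openin_subset[OF oc] by (auto simp: Omega_simps(2) simp del: dec_enc)
    finally show "c \<sqsubseteq>\<^bsub>fobj Omega X\<^esub> right_adj (fobj Omega X) two_frm (ev X x) zero_u \<longleftrightarrow>
      c \<sqsubseteq>\<^bsub>fobj Omega X\<^esub> enc (topspace X - X closure_of {x})" .
  qed (use e in simp_all)
  moreover have "right_adj (fobj Omega X) two_frm (ev X x) one_u = enc (topspace X)"
    using E.fr_top by (simp add: top_two top_Omega[OF X])
  ultimately show ?thesis by (simp add: point_sl_def)
qed

lemma sublocale_point_sl:
  assumes X: "small (topspace X)" and x: "(x :: 'u) \<in> topspace X"
  shows "sublocale_of (fobj Omega X) (point_sl X x)"
proof -
  interpret E: frm_hom "fobj Omega X :: 'u gorder" two_frm "ev X x"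
    using frame_Omega[OF X] frame_two frame_hom_ev[OF X x] by unfold_locales
  show ?thesis using E.sublocale_image[OF E.M.sublocale_carrier] point_sl_eq[OF X x] by simp
qed

lemma point_sl_subset_ineq_iff:
  assumes X: "small (topspace X)" and x: "(x :: 'u) \<in> topspace X"
    and a: "a \<in> carrier (fobj Omega X)" and b: "b \<in> carrier (fobj Omega X)"
  shows "point_sl X x \<subseteq> ineq_sl (fobj Omega X) a b \<longleftrightarrow> (x \<in> dec a \<longrightarrow> x \<in> dec b)"
proof -
  interpret E: frm_hom "fobj Omega X :: 'u gorder" two_frm "ev X x"
    using frame_Omega[OF X] frame_two frame_hom_ev[OF X x] by unfold_locales
  have "point_sl X x \<subseteq> ineq_sl (fobj Omega X) a b \<longleftrightarrow>
      (\<forall>s\<in>carrier two_frm. ev X x b \<sqsubseteq>\<^bsub>two_frm\<^esub> s \<longrightarrow> ev X x a \<sqsubseteq>\<^bsub>two_frm\<^esub> s)"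
    using E.image_subset_ineq_iff[OF E.M.sublocale_carrier a b, unfolded point_sl_eq[OF X x]]
      E.M.subset_ineq_sl_iff[OF E.M.sublocale_carrier E.f_closed[OF a] E.f_closed[OF b]] by metis
  then show ?thesis using a b by (auto simp: ev_def)
qed

text \<open>The sublocales \<open>\<up>a \<inter> \<o>(b)\<close> of \<open>\<Omega>X\<close> are spatial.\<close>

lemma basic_eq_join_of_points:
  assumes X: "small (topspace X)"
    and a: "(a :: 'u) \<in> carrier (fobj Omega X)" and b: "b \<in> carrier (fobj Omega X)"
  shows "closed_sl (fobj Omega X) a \<inter> open_sl (fobj Omega X) b
    = \<Squnion>\<^bsub>Sl (fobj Omega X)\<^esub> (point_sl X ` (dec b - dec a))"
proof -
  interpret O: frm "fobj Omega X :: 'u gorder" using frame_Omega[OF X] by unfold_locales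
  let ?L = "fobj Omega X :: 'u gorder" and ?Y = "dec b - dec a"
  let ?S = "\<Squnion>\<^bsub>Sl ?L\<^esub> (point_sl X ` ?Y)"
  have Y: "?Y \<subseteq> topspace X" using Omega_dec[OF X b] openin_subset by blast
  have sl: "sublocale_of ?L S" if "S \<in> point_sl X ` ?Y" for S
    using that Y sublocale_point_sl[OF X] by auto
  have bot: "dec \<bottom>\<^bsub>?L\<^esub> = {}" using dec_Sup[OF X, of "{}"] by (simp add: O.Sup_empty)
  have "openin X (topspace X)" by simp
  note t = Omega_enc[OF X this]
  have "point_sl X y \<subseteq> ineq_sl ?L a \<bottom>\<^bsub>?L\<^esub>" "point_sl X y \<subseteq> ineq_sl ?L \<top>\<^bsub>?L\<^esub> b" if "y \<in> ?Y" for y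
    using that Y a b point_sl_subset_ineq_iff[OF X, of y] by (auto simp: bot subset_iff)
  then have "?S \<subseteq> closed_sl ?L a \<inter> open_sl ?L b"
    using O.Sup_Sl_subset_iff[OF sl O.sublocale_Int[OF O.sublocale_closed[OF a] O.sublocale_open[OF b]]] a b
    by (auto simp: O.ineq_sl_bot O.ineq_sl_top)
  moreover have "closed_sl ?L a \<inter> open_sl ?L b \<subseteq> ?S"
  proof
    fix w assume w: "w \<in> closed_sl ?L a \<inter> open_sl ?L b"
    then have wc: "w \<in> carrier ?L" and aw: "dec a \<subseteq> dec w" by (auto simp: closed_sl_def Omega_simps(2))
    show "w \<in> ?S"
    proof (rule O.mem_sublocale_if[OF O.sublocale_Sup[OF sl] wc])
      fix p q assume p: "p \<in> carrier ?L" and q: "q \<in> carrier ?L" and *: "?S \<subseteq> ineq_sl ?L p q"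
      have pq: "y \<in> dec q" if "y \<in> ?Y" "y \<in> dec p" for y
      proof -
        have "point_sl X y \<subseteq> ?S" by (rule O.subset_Sup_Sl[OF sl]) (use that in auto)
        then show ?thesis using that Y * point_sl_subset_ineq_iff[OF X _ p q] by blast
      qed
      have "dec c \<subseteq> dec w" if c: "c \<in> carrier ?L" "dec c \<subseteq> dec p" "dec c \<inter> dec q \<subseteq> dec w" for c
      proof -
        have "c \<sqinter>\<^bsub>?L\<^esub> b \<sqsubseteq>\<^bsub>?L\<^esub> w"
          using pq c aw b by (auto simp: Omega_simps(2) dec_meet[OF X])
        then have "c \<sqsubseteq>\<^bsub>?L\<^esub> w" using w c(1) b unfolding O.mem_open_sl_iff[OF b] Int_iff by blast
        then show ?thesis by (simp add: Omega_simps(2))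
      qed
      then show "w \<in> ineq_sl ?L p q"
        using wc q by (simp add: ineq_sl_def Omega_simps(2) dec_meet[OF X])
    qed
  qed
  ultimately show ?thesis by blast
qed

subsection \<open>Skula-closed sets\<close>

text \<open>The restriction to Skula-closed sets is immaterial: the points \<open>x\<close> with \<open>b(x)\<close> contained in a
  given sublocale \<open>S\<close> form the Skula-closed set of all \<open>x\<close> that satisfy \<open>x \<in> U \<longrightarrow> x \<in> V\<close> for every
  inequality \<open>U \<le> V\<close> forced by \<open>S\<close>.\<close>

lemma SKC_eq:
  assumes X: "small (topspace X)"
  shows "SKC X = joins_of (fobj Omega X) (point_sl X ` topspace (X :: 'u topology))"
proof
  interpret O: frm "fobj Omega X :: 'u gorder" using frame_Omega[OF X] by unfold_locales
  let ?L = "fobj Omega X :: 'u gorder"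
  have "\<Union>({U. openin X U} \<union> {topspace X - U | U. openin X U}) = topspace X"
    using openin_subset by fastforce
  then have top: "topspace (skula_top X) = topspace X"
    by (simp add: skula_top_def topology_generated_by_topspace)
  show "SKC X \<subseteq> joins_of ?L (point_sl X ` topspace X)"
  proof
    fix S assume "S \<in> SKC X"
    then obtain Y where Y: "S = \<Squnion>\<^bsub>Sl ?L\<^esub> (point_sl X ` Y)" "closedin (skula_top X) Y" by (auto simp: SKC_def)
    then have "Y \<subseteq> topspace X" using closedin_subset top by blast
    then have "point_sl X ` Y \<subseteq> point_sl X ` topspace X" by blast
    then show "S \<in> joins_of ?L (point_sl X ` topspace X)" using Y(1) unfolding joins_of_def by blast
  qed
  show "joins_of ?L (point_sl X ` topspace X) \<subseteq> SKC X"
  proof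
    fix S assume S: "S \<in> joins_of ?L (point_sl X ` topspace X)"
    have pt: "sublocale_of ?L c" if "c \<in> point_sl X ` topspace X" for c
      using that sublocale_point_sl[OF X] by auto
    have Ssl: "sublocale_of ?L S" using S O.mem_joins_of_iff[OF pt] by blast
    let ?Z = "{x \<in> topspace X. point_sl X x \<subseteq> S}"
    let ?R = "{(a, b). a \<in> carrier ?L \<and> b \<in> carrier ?L \<and> S \<subseteq> ineq_sl ?L a b}"
    have Zpt: "sublocale_of ?L c" if "c \<in> point_sl X ` ?Z" for c using that pt by auto
    have "?Z = topspace X - (\<Union>(a, b)\<in>?R. dec a \<inter> (topspace X - dec b))"
    proof -
      have "point_sl X x \<subseteq> S \<longleftrightarrow> (\<forall>(a, b)\<in>?R. x \<in> dec a \<longrightarrow> x \<in> dec b)" if x: "x \<in> topspace X" for x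
      proof
        assume "point_sl X x \<subseteq> S"
        then show "\<forall>(a, b)\<in>?R. x \<in> dec a \<longrightarrow> x \<in> dec b"
          using point_sl_subset_ineq_iff[OF X x] by (auto dest: order_trans)
      next
        assume r: "\<forall>(a, b)\<in>?R. x \<in> dec a \<longrightarrow> x \<in> dec b"
        show "point_sl X x \<subseteq> S"
          by (rule O.sublocale_subset_if[OF Ssl sublocale_point_sl[OF X x]])
            (use r point_sl_subset_ineq_iff[OF X x] in auto)
      qed
      then show ?thesis by blast
    qed
    moreover have "openin (skula_top X) (\<Union>(a, b)\<in>?R. dec a \<inter> (topspace X - dec b))"
    proof (rule openin_Union)
      fix W assume "W \<in> (\<lambda>(a, b). dec a \<inter> (topspace X - dec b)) ` ?R"
      then obtain a b where "a \<in> carrier ?L" "b \<in> carrier ?L" "W = dec a \<inter> (topspace X - dec b)" by auto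
      moreover from this have "openin (skula_top X) (dec a)" "openin (skula_top X) (topspace X - dec b)"
        unfolding skula_top_def using Omega_dec[OF X] by (auto intro!: topology_generated_by_Basis)
      ultimately show "openin (skula_top X) W" using openin_Int by blast
    qed
    ultimately have "closedin (skula_top X) ?Z"
      using top openin_subset[of "skula_top X"] by (metis (no_types, lifting) openin_closedin_eq closedin_diff closedin_topspace)
    moreover have "S = \<Squnion>\<^bsub>Sl ?L\<^esub> (point_sl X ` ?Z)"
    proof (rule subset_antisym)
      show "S \<subseteq> \<Squnion>\<^bsub>Sl ?L\<^esub> (point_sl X ` ?Z)"
      proof (rule O.joins_of_subsetI[OF pt S O.sublocale_Sup[OF Zpt]])
        fix c assume "c \<in> point_sl X ` topspace X" "c \<subseteq> S"
        then show "c \<subseteq> \<Squnion>\<^bsub>Sl ?L\<^esub> (point_sl X ` ?Z)" by (intro O.subset_Sup_Sl[OF Zpt]) auto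
      qed
      show "\<Squnion>\<^bsub>Sl ?L\<^esub> (point_sl X ` ?Z) \<subseteq> S" by (subst O.Sup_Sl_subset_iff[OF Zpt Ssl]) auto
    qed
    ultimately show "S \<in> SKC X" unfolding SKC_def by blast
  qed
qed

lemma point_sl_SKC:
  assumes X: "small (topspace X)" and x: "(x :: 'u) \<in> topspace X"
  shows "point_sl X x \<in> SKC X"
proof -
  interpret O: frm "fobj Omega X :: 'u gorder" using frame_Omega[OF X] by unfold_locales
  show ?thesis unfolding SKC_eq[OF X] using x sublocale_point_sl[OF X x] by (auto intro: O.gen_in_joins_of)
qed

lemma Fl_subset_SKC:
  assumes X: "small (topspace X)"
  shows "carrier (Fl (fobj Omega X)) \<subseteq> SKC (X :: 'u topology)"
proof -
  interpret O: frm "fobj Omega X :: 'u gorder" using frame_Omega[OF X] by unfold_locales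
  have "c \<in> joins_of (fobj Omega X) (point_sl X ` topspace X)" if "c \<in> basic_sl (fobj Omega X)" for c
  proof -
    obtain a b where ab: "a \<in> carrier (fobj Omega X)" "b \<in> carrier (fobj Omega X)"
      "c = closed_sl (fobj Omega X) a \<inter> open_sl (fobj Omega X) b"
      using \<open>c \<in> basic_sl _\<close> by (auto simp: basic_sl_def)
    have "point_sl X ` (dec b - dec a) \<subseteq> point_sl X ` topspace X"
      using Omega_dec[OF X ab(2)] openin_subset by blast
    then show ?thesis unfolding ab(3) basic_eq_join_of_points[OF X ab(1,2)] joins_of_def by blast
  qed
  then show ?thesis
    unfolding SKC_eq[OF X] O.carrier_Fl using sublocale_point_sl[OF X] by (intro O.joins_of_mono) auto
qed

text \<open>The nontrivial element of \<open>b(x)\<close> is prime. Hence the difference of a join of sublocales \<open>b(x)\<close> and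
  of \<open>K\<close> is the join of those that are not contained in \<open>K\<close>.\<close>

lemma point_sl_subset_join:
  assumes X: "small (topspace X)" and x: "(x :: 'u) \<in> topspace X"
    and K: "sublocale_of (fobj Omega X) K" and D: "sublocale_of (fobj Omega X) D"
    and sub: "point_sl X x \<subseteq> K \<squnion>\<^bsub>Sl (fobj Omega X)\<^esub> D"
  shows "point_sl X x \<subseteq> K \<or> point_sl X x \<subseteq> D"
proof -
  let ?L = "fobj Omega X :: 'u gorder"
  interpret O: frm ?L using frame_Omega[OF X] by unfold_locales
  interpret E: frm_hom ?L two_frm "ev X x"
    using frame_Omega[OF X] frame_two frame_hom_ev[OF X x] by unfold_locales
  let ?m = "right_adj ?L two_frm (ev X x) zero_u"
  have pt: "point_sl X x = {?m, \<top>\<^bsub>?L\<^esub>}" using point_sl_eq[OF X x] E.fr_top by (simp add: top_two)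
  then obtain k d where kd: "?m = k \<sqinter>\<^bsub>?L\<^esub> d" "k \<in> K" "d \<in> D" using sub K D by (auto simp: O.join_Sl)
  have c: "k \<in> carrier ?L" "d \<in> carrier ?L" using kd K D O.sublocaleD(1) by blast+
  have le: "w \<sqsubseteq>\<^bsub>?L\<^esub> ?m \<longleftrightarrow> x \<notin> dec w" if "w \<in> carrier ?L" for w
    using that E.le_fr_iff[OF that, of zero_u] by (simp add: ev_def)
  have "x \<notin> dec k \<or> x \<notin> dec d" using le[of "k \<sqinter>\<^bsub>?L\<^esub> d"] kd c dec_meet[OF X c] O.le_refl[of "k \<sqinter>\<^bsub>?L\<^esub> d"] by auto
  then have "k \<sqsubseteq>\<^bsub>?L\<^esub> ?m \<or> d \<sqsubseteq>\<^bsub>?L\<^esub> ?m" using le c by blast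
  then have "k = ?m \<or> d = ?m" using kd c O.meet_left[OF c] O.meet_right[OF c] by (auto intro: O.le_antisym)
  then show ?thesis using kd pt O.sublocaleD(4)[OF K] O.sublocaleD(4)[OF D] by auto
qed

lemma skula_ext_SK:
  assumes X: "small (topspace X)"
  shows "skula_ext (fobj Omega X, SKC (X :: 'u topology))"
proof -
  let ?L = "fobj Omega X :: 'u gorder" and ?G = "point_sl X ` topspace X"
  interpret O: frm ?L using frame_Omega[OF X] by unfold_locales
  have pt: "sublocale_of ?L c" if "c \<in> ?G" for c using that sublocale_point_sl[OF X] by auto
  have sl: "sublocale_of ?L S" if "S \<in> joins_of ?L ?G" for S using that O.mem_joins_of_iff[OF pt] by blast
  have "codiff (Sl ?L) S K \<in> joins_of ?L ?G" if S: "S \<in> joins_of ?L ?G" and K: "sublocale_of ?L K" for S K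
  proof -
    let ?D = "codiff (Sl ?L) S K"
    have D: "sublocale_of ?L ?D" and SD: "S \<subseteq> K \<squnion>\<^bsub>Sl ?L\<^esub> ?D"
      using O.sublocale_codiff[OF sl[OF S] K] O.codiff_subset_iff[OF sl[OF S] K] by auto
    have "?D \<subseteq> T" if T: "sublocale_of ?L T" "\<forall>c\<in>?G. c \<subseteq> ?D \<longrightarrow> c \<subseteq> T" for T
    proof -
      have "S \<subseteq> K \<squnion>\<^bsub>Sl ?L\<^esub> T"
      proof (rule O.joins_of_subsetI[OF pt S O.sublocale_join[OF K T(1)]])
        fix c assume c: "c \<in> ?G" "c \<subseteq> S"
        then obtain x where x: "x \<in> topspace X" "c = point_sl X x" by auto
        have "c \<subseteq> K \<or> c \<subseteq> ?D" using point_sl_subset_join[OF X x(1) K D] c SD x by auto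
        then show "c \<subseteq> K \<squnion>\<^bsub>Sl ?L\<^esub> T" using T(2) c(1) O.join_Sl_upper[OF K T(1)] by blast
      qed
      then show ?thesis using O.codiff_subset_iff[OF sl[OF S] K T(1)] by simp
    qed
    then show ?thesis using D O.mem_joins_of_iff[OF pt] by blast
  qed
  moreover have "\<Squnion>\<^bsub>Sl ?L\<^esub> \<B> \<in> joins_of ?L ?G" if "\<B> \<subseteq> joins_of ?L ?G" for \<B>
    using O.Sup_joins_of_closed[OF pt that] .
  ultimately have "subcolocale (Sl ?L) (joins_of ?L ?G)"
    using sl by (auto simp: subcolocale_def)
  then show ?thesis
    using Fl_subset_SKC[OF X] frame_Omega[OF X] small_Omega[OF X]
    by (simp add: skula_ext_def Obj_FRM SKC_eq[OF X])
qed

lemma SKC_eq_Fl: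
  assumes X: "small (topspace X)" and pt: "\<And>x. x \<in> topspace X \<Longrightarrow> point_sl X x \<in> carrier (Fl (fobj Omega X))"
  shows "SKC X = carrier (Fl (fobj Omega (X :: 'u topology)))"
proof
  interpret O: frm "fobj Omega X :: 'u gorder" using frame_Omega[OF X] by unfold_locales
  show "SKC X \<subseteq> carrier (Fl (fobj Omega X))"
    unfolding SKC_eq[OF X] using pt unfolding O.carrier_Fl by (intro O.joins_of_mono) (auto intro: O.sublocale_basic)
qed (rule Fl_subset_SKC[OF X])

lemma point_sl_Fl_if_T_D:
  assumes X: "small (topspace X)" and T: "T_D X" and x: "(x :: 'u) \<in> topspace X"
  shows "point_sl X x \<in> carrier (Fl (fobj Omega X))"
proof -
  interpret O: frm "fobj Omega X :: 'u gorder" using frame_Omega[OF X] by unfold_locales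
  obtain U C where UC: "openin X U" "closedin X C" "{x} = U \<inter> C" using T x unfolding T_D_def by blast
  then have "openin X (topspace X - C)" by auto
  note a = Omega_enc[OF X this] and b = Omega_enc[OF X UC(1)]
  have "U - (topspace X - C) = {x}" using UC openin_subset[OF UC(1)] by blast
  then have "closed_sl (fobj Omega X) (enc (topspace X - C)) \<inter> open_sl (fobj Omega X) (enc U)
      = \<Squnion>\<^bsub>Sl (fobj Omega X)\<^esub> {point_sl X x}"
    using basic_eq_join_of_points[OF X a(1) b(1)] a(2) b(2) by simp
  also have "\<dots> = point_sl X x"
    using O.subset_Sup_Sl[of "{point_sl X x}"] O.Sup_Sl_subset_iff[of "{point_sl X x}" "point_sl X x"]
      sublocale_point_sl[OF X x] by blast
  finally show ?thesis using O.basic_Fl[OF O.basicI[OF a(1) b(1)]] by simp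
qed

subsection \<open>Points of Skula extensions\<close>

lemma sublocale_two_iff: "sublocale_of (two_frm :: 'u gorder) S \<longleftrightarrow> S = {one_u} \<or> S = {zero_u, one_u}"
proof -
  interpret T: frm "two_frm :: 'u gorder" using frame_two by unfold_locales
  show ?thesis
    using T.sublocale_top T.sublocale_carrier T.sublocaleD(1)[of S] T.sublocaleD(4)[of S]
    by (auto simp: top_two)
qed

lemma skula_ext_two: "skula_ext (two_S :: 'u skula)"
  unfolding two_S_def fobj_simps by (rule skula_ext_Sl[OF frame_two small_two])

lemma fst_two_S [simp]: "fst two_S = two_frm" by (simp add: two_S_def)

lemma snd_two_S: "snd (two_S :: 'u skula) = {{one_u}, {zero_u, one_u}}"
proof -
  interpret T: frm "two_frm :: 'u gorder" using frame_two by unfold_locales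
  show ?thesis by (auto simp: two_S_def sublocale_two_iff)
qed

lemma Fl_two: "carrier (Fl two_frm) = carrier (Sl (two_frm :: 'u gorder))"
proof -
  interpret T: frm "two_frm :: 'u gorder" using frame_two by unfold_locales
  have "closed_sl two_frm \<bottom>\<^bsub>two_frm\<^esub> \<in> carrier (Fl (two_frm :: 'u gorder))"
    "closed_sl two_frm \<top>\<^bsub>two_frm\<^esub> \<in> carrier (Fl (two_frm :: 'u gorder))"
    by (intro T.basic_Fl T.closed_basic T.bottom_closed T.top_closed)+
  moreover have "closed_sl two_frm \<top>\<^bsub>two_frm\<^esub> = {one_u :: 'u}" by (auto simp: closed_sl_def top_two)
  ultimately show ?thesis using T.sublocale_Fl by (auto simp: T.closed_bot sublocale_two_iff)
qed

lemma skula_hom_two_iff: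
  assumes A: "skula_ext A"
  shows "skula_hom A (two_S :: 'u skula) f \<longleftrightarrow> frame_hom (fst A) two_frm f \<and>
    right_adj (fst A) two_frm f ` carrier two_frm \<in> snd A"
proof -
  have "right_adj (fst A) two_frm f ` {one_u} \<in> snd A" if "frame_hom (fst A) two_frm f"
  proof -
    interpret frm_hom "fst A" two_frm f using that skula_extD(1)[OF A] frame_two by unfold_locales
    show ?thesis using fr_bot_image skula_ext_bot[OF A] by (simp add: top_two)
  qed
  then show ?thesis unfolding skula_hom_iff[OF A skula_ext_two] by (auto simp: snd_two_S)
qed

text \<open>\<open>(\<Omega>X, \<S>\<K>\<C>\<^sup>*X)\<close> is the cartesian lift of the evaluations. If the composites with all evaluations
  are points, then \<open>k\<^sub>*[-]\<close> sends every \<open>b(x)\<close> into the structure of \<open>A\<close>, and hence all their joins.\<close>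

lemma skula_hom_SK_iff:
  assumes A: "skula_ext A" and X: "small (topspace (X :: 'u topology))"
  shows "skula_hom A (fobj Omega X, SKC X) k \<longleftrightarrow> k \<in> carrier (fst A) \<rightarrow> carrier (fobj Omega X) \<and>
    (\<forall>x\<in>topspace X. skula_hom A two_S (compose (carrier (fst A)) (ev X x) k))"
proof
  note SK = skula_ext_SK[OF X]
  note d = concrete_data_SKULA[unfolded concrete_data_def, THEN conjunct2, THEN conjunct2]
  have "skula_hom (fobj Omega X, SKC X) two_S (ev X x)" if "x \<in> topspace X" for x
    using that point_sl_eq[OF X that] point_sl_SKC[OF X that] frame_hom_ev[OF X that]
    by (simp add: skula_hom_two_iff[OF SK])
  moreover assume k: "skula_hom A (fobj Omega X, SKC X) k"
  ultimately have "skula_hom A two_S (compose (carrier (fst A)) (ev X x) k)" if "x \<in> topspace X" for x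
    using d that A SK skula_ext_two by blast
  moreover have "frame_hom (fst A) (fobj Omega X) k" using k by (simp add: skula_hom_iff[OF A SK])
  ultimately show "k \<in> carrier (fst A) \<rightarrow> carrier (fobj Omega X) \<and>
    (\<forall>x\<in>topspace X. skula_hom A two_S (compose (carrier (fst A)) (ev X x) k))"
    using frame_hom_funcset by blast
next
  note SK = skula_ext_SK[OF X]
  assume k: "k \<in> carrier (fst A) \<rightarrow> carrier (fobj Omega X) \<and>
    (\<forall>x\<in>topspace X. skula_hom A two_S (compose (carrier (fst A)) (ev X x) k))"
  then have hom: "frame_hom (fst A) (fobj Omega X) k"
    by (simp add: frame_hom_Omega_iff[OF skula_extD(1)[OF A] X] skula_hom_two_iff[OF A])
  interpret K: frm_hom "fst A" "fobj Omega X :: 'u gorder" k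
    using skula_extD(1)[OF A] frame_Omega[OF X] hom by unfold_locales
  have pts: "K.fr ` point_sl X x \<in> snd A" if x: "x \<in> topspace X" for x
  proof -
    have "right_adj (fst A) two_frm (compose (carrier (fst A)) (ev X x) k) ` carrier two_frm
        = K.fr ` point_sl X x"
      unfolding point_sl_eq[OF X x, symmetric] image_image
      by (intro image_cong refl right_adj_compose[OF skula_extD(1)[OF A] frame_Omega[OF X] frame_two hom
            frame_hom_ev[OF X x]])
    moreover have "skula_hom A two_S (compose (carrier (fst A)) (ev X x) k)" using k x by blast
    ultimately show ?thesis unfolding skula_hom_two_iff[OF A] by metis
  qed
  have "K.fr ` E \<in> snd A" if "E \<in> SKC X" for E
  proof -
    obtain \<B> where \<B>: "E = \<Squnion>\<^bsub>Sl (fobj Omega X)\<^esub> \<B>" "\<B> \<subseteq> point_sl X ` topspace X"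
      using \<open>E \<in> SKC X\<close> unfolding SKC_eq[OF X] joins_of_def by blast
    have "K.fr ` E = \<Squnion>\<^bsub>Sl (fst A)\<^esub> ((`) K.fr ` \<B>)"
      unfolding \<B>(1) by (rule K.image_Sup) (use \<B>(2) sublocale_point_sl[OF X] in auto)
    moreover have "(`) K.fr ` \<B> \<subseteq> snd A" using pts \<B>(2) by blast
    ultimately show ?thesis using skula_ext_Sup[OF A] by simp
  qed
  then show "skula_hom A (fobj Omega X, SKC X) k" using hom by (simp add: skula_hom_iff[OF A SK])
qed

end


section \<open>Spectra\<close>

text \<open>PFC-categories whose arrows \<open>A \<rightarrow> B\<close> are those frame maps between the underlying frames that
  satisfy \<open>hom A B\<close>, and whose distinguished object lies over the frame \<open>2\<close> itself.\<close>

locale frame_pfc = univ u for u :: "'u itself" +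
  fixes P :: "('o, ('o, 'u) arrow, 'u) pfc" and hom :: "'o \<Rightarrow> 'o \<Rightarrow> ('u \<Rightarrow> 'u) \<Rightarrow> bool"
  assumes pcat: "pcat P = concrete (Obj (pcat P)) (\<lambda>A. carrier (fobj (pO P) A)) hom"
    and data: "concrete_data (Obj (pcat P)) (\<lambda>A. carrier (fobj (pO P) A)) hom"
    and pO: "keeps_fn (pO P)"
    and frame_obj: "A \<in> Obj (pcat P) \<Longrightarrow> fobj (pO P) A \<in> Obj FRM"
    and frame_map: "A \<in> Obj (pcat P) \<Longrightarrow> B \<in> Obj (pcat P) \<Longrightarrow> hom A B f \<Longrightarrow>
      frame_hom (fobj (pO P) A) (fobj (pO P) B) f"
    and ptwo: "ptwo P \<in> Obj (pcat P)" "fobj (pO P) (ptwo P) = two_frm"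
    and piota: "piota P = Id FRM two_frm"
begin

abbreviation "\<O> \<equiv> Obj (pcat P)"
abbreviation "car A \<equiv> carrier (fobj (pO P) A)"
abbreviation "top_pt A \<equiv> topspace (pt_space P A)"

lemma pcat_simps [simp]:
  "Dom (pcat P) = src" "Cod (pcat P) = tgt"
  "Id (pcat P) A = Arrow A (\<lambda>x\<in>car A. x) A"
  "g \<cdot>\<^bsub>pcat P\<^esub> f = Arrow (src f) (compose (car (src f)) (fn g) (fn f)) (tgt g)"
  by (subst pcat; simp)+

lemma Arr_pcat: "p \<in> Arr (pcat P) \<longleftrightarrow>
    src p \<in> \<O> \<and> tgt p \<in> \<O> \<and> fn p \<in> extensional (car (src p)) \<and> hom (src p) (tgt p) (fn p)"
  by (subst pcat) simp

lemma Hom_pcat: "p \<in> Hom (pcat P) A B \<longleftrightarrow>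
    A \<in> \<O> \<and> B \<in> \<O> \<and> (\<exists>f. p = Arrow A f B \<and> f \<in> extensional (car A) \<and> hom A B f)"
  by (subst pcat) (rule Hom_concrete)

lemma Arrow_Hom_pcat: "Arrow A f B \<in> Hom (pcat P) A B \<longleftrightarrow>
    A \<in> \<O> \<and> B \<in> \<O> \<and> f \<in> extensional (car A) \<and> hom A B f"
  by (auto simp: Hom_pcat)

lemma category_pcat: "category (pcat P)"
  by (subst pcat) (rule category_concrete[OF data])

lemma hom_funcset: "A \<in> \<O> \<Longrightarrow> B \<in> \<O> \<Longrightarrow> hom A B f \<Longrightarrow> f \<in> car A \<rightarrow> car B"
  using data unfolding concrete_data_def by blast

lemma Hom_pcatD:
  assumes "p \<in> Hom (pcat P) A B"
  shows "A \<in> \<O>" "B \<in> \<O>" "src p = A" "tgt p = B" "fn p \<in> extensional (car A)" "hom A B (fn p)"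
    "a \<in> car A \<Longrightarrow> fn p a \<in> car B"
  using assms hom_funcset[of A B "fn p"] by (auto simp: Hom_pcat)

lemma hom_id: "A \<in> \<O> \<Longrightarrow> hom A A (\<lambda>x\<in>car A. x)"
  using data unfolding concrete_data_def by blast

lemma hom_compose:
  "A \<in> \<O> \<Longrightarrow> B \<in> \<O> \<Longrightarrow> C \<in> \<O> \<Longrightarrow> hom A B f \<Longrightarrow> hom B C g \<Longrightarrow> hom A C (compose (car A) g f)"
  using data unfolding concrete_data_def by blast

lemma frame_car: "A \<in> \<O> \<Longrightarrow> frame (fobj (pO P) A)" and small_car: "A \<in> \<O> \<Longrightarrow> small (car A)"
  using frame_obj by (auto simp: Obj_FRM)

lemma pfc_category: "pfc_category P"
  unfolding pfc_category_def faithful_def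
proof (intro conjI ballI)
  show "is_functor (pcat P) FRM (pO P)"
    unfolding FRM_def
    by (subst pcat, rule is_functor_concrete[OF data concrete_data_FRM pO])
      (use frame_obj frame_map in \<open>auto simp: Obj_FRM\<close>)
  show "inj_on (fmap (pO P)) (Hom (pcat P) A B)" for A B
    by (auto simp: inj_on_def Hom_pcat keeps_fnD[OF pO])
  show "piota P \<in> isos FRM (fobj (pO P) (ptwo P)) two_frm"
    using Id_iso[of FRM two_frm] frame_obj[OF ptwo(1)]
    by (simp add: piota ptwo(2) FRM_def category_concrete[OF concrete_data_FRM])
qed (rule ptwo(1))

subsection \<open>Points by names\<close>

text \<open>A point \<open>f : A \<rightarrow> 2\<close> is named by its completely prime filter \<open>{a | f a = 1}\<close>, and
  \<open>filter_map A n\<close> is the map with the filter \<open>n\<close>.\<close>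

definition filter_map :: "'o \<Rightarrow> 'u \<Rightarrow> 'u \<Rightarrow> 'u"
  where "filter_map A n = (\<lambda>a\<in>car A. if a \<in> dec n then one_u else zero_u)"

definition filter_name :: "'o \<Rightarrow> ('u \<Rightarrow> 'u) \<Rightarrow> 'u"
  where "filter_name A f = enc {a \<in> car A. f a = one_u}"

lemma filter_one_iff [simp]: "a \<in> car A \<Longrightarrow> filter_map A n a = one_u \<longleftrightarrow> a \<in> dec n"
  by (simp add: filter_map_def)

lemma dec_filter_name: "A \<in> \<O> \<Longrightarrow> dec (filter_name A f) = {a \<in> car A. f a = one_u}"
  unfolding filter_name_def by (intro dec_enc small_subset[OF small_car]) auto

lemma hom_two_range:
  "A \<in> \<O> \<Longrightarrow> hom A (ptwo P) f \<Longrightarrow> a \<in> car A \<Longrightarrow> f a = zero_u \<or> f a = one_u"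
  using hom_funcset[of A "ptwo P" f] ptwo by auto

lemma filter_map_name:
  assumes "A \<in> \<O>" "f \<in> extensional (car A)" "hom A (ptwo P) f"
  shows "filter_map A (filter_name A f) = f"
proof (rule extensionalityI[of _ "car A"])
  fix a assume "a \<in> car A"
  then show "filter_map A (filter_name A f) a = f a"
    using assms hom_two_range[of A f a] by (auto simp: filter_map_def dec_filter_name)
qed (use assms in \<open>auto simp: filter_map_def\<close>)

lemma pt_map_eq: "p \<in> Hom (pcat P) A (ptwo P) \<Longrightarrow> pt_map P p = fn p"
proof -
  assume p: "p \<in> Hom (pcat P) A (ptwo P)"
  then obtain f where f: "p = Arrow A f (ptwo P)" "f \<in> extensional (car A)" "hom A (ptwo P) f" "A \<in> \<O>"
    by (auto simp: Hom_pcat)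
  have "compose (car A) (\<lambda>x\<in>carrier two_frm. x) f = f"
    by (rule extensionalityI[of _ "car A"])
      (use f hom_two_range[OF f(4,3)] in \<open>auto simp: compose_eq\<close>)
  then show ?thesis using f(1) by (simp add: pt_map_def piota FRM_def keeps_fnD[OF pO])
qed

lemma pt_name_eq: "p \<in> Hom (pcat P) A (ptwo P) \<Longrightarrow> pt_name P A p = filter_name A (fn p)"
  by (simp add: pt_name_def name2_def filter_name_def pt_map_eq)

lemma pt_name_Arrow:
  "A \<in> \<O> \<Longrightarrow> f \<in> extensional (car A) \<Longrightarrow> hom A (ptwo P) f \<Longrightarrow>
    pt_name P A (Arrow A f (ptwo P)) = filter_name A f"
  using pt_name_eq[of "Arrow A f (ptwo P)" A] ptwo by (simp add: Arrow_Hom_pcat)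

text \<open>The names of the points of \<open>A\<close>. The second condition excludes elements \<open>n\<close> of the universe that
  represent a filter together with elements outside of the frame.\<close>

definition names :: "'o \<Rightarrow> 'u set"
  where "names A = {n. hom A (ptwo P) (filter_map A n) \<and> n = filter_name A (filter_map A n)}"

lemma filter_name_names:
  "A \<in> \<O> \<Longrightarrow> f \<in> extensional (car A) \<Longrightarrow> hom A (ptwo P) f \<Longrightarrow> filter_name A f \<in> names A"
  by (simp add: names_def filter_map_name)

lemma filter_map_Arrow: "A \<in> \<O> \<Longrightarrow> n \<in> names A \<Longrightarrow>
    Arrow A (filter_map A n) (ptwo P) \<in> Hom (pcat P) A (ptwo P)"
  using ptwo by (simp add: Arrow_Hom_pcat names_def filter_map_def)

lemma pt_name_image:
  assumes "A \<in> \<O>"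
  shows "pt_name P A ` {p \<in> Hom (pcat P) A (ptwo P). Q (fn p)} = {n \<in> names A. Q (filter_map A n)}"
proof (intro subset_antisym subsetI)
  fix n assume "n \<in> pt_name P A ` {p \<in> Hom (pcat P) A (ptwo P). Q (fn p)}"
  then obtain p where p: "p \<in> Hom (pcat P) A (ptwo P)" "Q (fn p)" "n = pt_name P A p" by blast
  then have "fn p \<in> extensional (car A)" "hom A (ptwo P) (fn p)" by (auto simp: Hom_pcat)
  then show "n \<in> {n \<in> names A. Q (filter_map A n)}"
    using p assms by (simp add: pt_name_eq filter_name_names filter_map_name)
next
  fix n assume n: "n \<in> {n \<in> names A. Q (filter_map A n)}"
  then have "n = pt_name P A (Arrow A (filter_map A n) (ptwo P))"
    using pt_name_eq[OF filter_map_Arrow[OF assms]] by (simp add: names_def)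
  moreover have "Arrow A (filter_map A n) (ptwo P) \<in> {p \<in> Hom (pcat P) A (ptwo P). Q (fn p)}"
    using n filter_map_Arrow[OF assms] by simp
  ultimately show "n \<in> pt_name P A ` {p \<in> Hom (pcat P) A (ptwo P). Q (fn p)}" by blast
qed

lemma pt_open_eq:
  assumes "A \<in> \<O>" "a \<in> car A"
  shows "pt_open P A a = {n \<in> names A. a \<in> dec n}"
proof -
  have "{f \<in> Hom (pcat P) A (ptwo P). pt_map P f a = one_u} = {p \<in> Hom (pcat P) A (ptwo P). fn p a = one_u}"
    using pt_map_eq by auto
  then show ?thesis unfolding pt_open_def using pt_name_image[OF assms(1), of "\<lambda>f. f a = one_u"] assms by auto
qed

lemma openin_pt_iff:
  assumes A: "A \<in> \<O>"
  shows "openin (pt_space P A) U \<longleftrightarrow> (\<exists>a\<in>car A. U = pt_open P A a)"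
proof -
  interpret L: frm "fobj (pO P) A" using frame_car[OF A] by unfold_locales
  have fh: "frame_hom (fobj (pO P) A) two_frm (filter_map A n)" if "n \<in> names A" for n
    using that frame_map[OF A ptwo(1)] by (simp add: names_def ptwo(2))
  note fh' = fh[unfolded frame_hom_two_iff[OF frame_car[OF A]]]
  have meet: "a \<sqinter>\<^bsub>fobj (pO P) A\<^esub> b \<in> dec n \<longleftrightarrow> a \<in> dec n \<and> b \<in> dec n"
    if "n \<in> names A" "a \<in> car A" "b \<in> car A" for n a b
    using fh'[OF that(1)] that(2,3) filter_one_iff L.meet_closed by metis
  have Sup: "\<Squnion>\<^bsub>fobj (pO P) A\<^esub> B \<in> dec n \<longleftrightarrow> (\<exists>a\<in>B. a \<in> dec n)" if "n \<in> names A" "B \<subseteq> car A" for n B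
  proof -
    have "filter_map A n (\<Squnion>\<^bsub>fobj (pO P) A\<^esub> B) = one_u \<longleftrightarrow> (\<exists>a\<in>B. filter_map A n a = one_u)"
      using fh'[OF that(1)] that(2) by blast
    moreover have "(\<exists>a\<in>B. filter_map A n a = one_u) \<longleftrightarrow> (\<exists>a\<in>B. a \<in> dec n)"
      using that(2) by (intro bex_cong refl filter_one_iff) auto
    ultimately show ?thesis using L.sup_closed[OF that(2)] by simp
  qed
  have "istopology (\<lambda>U. \<exists>a\<in>car A. U = pt_open P A a)"
    unfolding istopology_def
  proof (intro conjI allI impI)
    fix S T assume "\<exists>a\<in>car A. S = pt_open P A a" "\<exists>a\<in>car A. T = pt_open P A a"
    then obtain a b where ab: "a \<in> car A" "b \<in> car A" "S = pt_open P A a" "T = pt_open P A b" by blast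
    then have "S \<inter> T = pt_open P A (a \<sqinter>\<^bsub>fobj (pO P) A\<^esub> b)"
      using meet by (auto simp: pt_open_eq[OF A])
    then show "\<exists>a\<in>car A. S \<inter> T = pt_open P A a" using ab L.meet_closed by blast
  next
    fix \<K> assume \<K>: "\<forall>K\<in>\<K>. \<exists>a\<in>car A. K = pt_open P A a"
    let ?B = "{a \<in> car A. pt_open P A a \<in> \<K>}"
    have B: "?B \<subseteq> car A" by auto
    have "\<Union>\<K> = pt_open P A (\<Squnion>\<^bsub>fobj (pO P) A\<^esub> ?B)"
    proof (intro subset_antisym subsetI)
      fix n assume "n \<in> \<Union>\<K>"
      then obtain K where K: "K \<in> \<K>" "n \<in> K" by blast
      then obtain a where "a \<in> car A" "K = pt_open P A a" using \<K> by blast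
      then show "n \<in> pt_open P A (\<Squnion>\<^bsub>fobj (pO P) A\<^esub> ?B)"
        using K Sup[of n ?B] B L.sup_closed[OF B] by (auto simp: pt_open_eq[OF A])
    next
      fix n assume "n \<in> pt_open P A (\<Squnion>\<^bsub>fobj (pO P) A\<^esub> ?B)"
      then have "n \<in> names A" "\<Squnion>\<^bsub>fobj (pO P) A\<^esub> ?B \<in> dec n"
        using L.sup_closed[OF B] by (auto simp: pt_open_eq[OF A])
      then obtain a where "a \<in> ?B" "a \<in> dec n" using Sup[of n ?B] B by blast
      then show "n \<in> \<Union>\<K>" using \<open>n \<in> names A\<close> pt_open_eq[OF A, of a] by auto
    qed
    then show "\<exists>a\<in>car A. \<Union>\<K> = pt_open P A a" using L.sup_closed[OF B] by blast
  qed
  then show ?thesis by (simp add: pt_space_def topology_inverse')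
qed

lemma topspace_pt:
  assumes A: "A \<in> \<O>"
  shows "top_pt A = names A"
proof -
  interpret L: frm "fobj (pO P) A" using frame_car[OF A] by unfold_locales
  have "\<top>\<^bsub>fobj (pO P) A\<^esub> \<in> dec n" if "n \<in> names A" for n
  proof -
    have "frame_hom (fobj (pO P) A) two_frm (filter_map A n)"
      using that frame_map[OF A ptwo(1)] by (simp add: names_def ptwo(2))
    then have "filter_map A n \<top>\<^bsub>fobj (pO P) A\<^esub> = one_u" using frame_hom_two_iff[OF frame_car[OF A]] by blast
    then show ?thesis by simp
  qed
  then have "pt_open P A \<top>\<^bsub>fobj (pO P) A\<^esub> = names A" by (auto simp: pt_open_eq[OF A])
  then have "openin (pt_space P A) (names A)" using openin_pt_iff[OF A] L.top_closed by metis
  moreover have "U \<subseteq> names A" if "openin (pt_space P A) U" for U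
    using that by (auto simp: openin_pt_iff[OF A] pt_open_eq[OF A])
  ultimately show ?thesis by (metis openin_subset openin_topspace subset_antisym)
qed

lemma names_enc: "A \<in> \<O> \<Longrightarrow> n \<in> names A \<Longrightarrow> enc {a \<in> car A. a \<in> dec n} = n"
proof -
  assume "n \<in> names A"
  then have "n = enc {a \<in> car A. filter_map A n a = one_u}" unfolding names_def filter_name_def by blast
  moreover have "{a \<in> car A. filter_map A n a = one_u} = {a \<in> car A. a \<in> dec n}" by auto
  ultimately show ?thesis by simp
qed

lemma small_pt:
  assumes A: "A \<in> \<O>"
  shows "small (top_pt A)"
proof -
  have "names A \<subseteq> enc ` Pow (car A)" unfolding names_def filter_name_def by auto
  then show ?thesis using small_image_Pow[OF small_car[OF A]] small_subset topspace_pt[OF A] by metis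
qed

lemma pt_of_name_eq:
  assumes A: "A \<in> \<O>" and n: "n \<in> names A"
  shows "pt_of_name P A n = Arrow A (filter_map A n) (ptwo P)"
  unfolding pt_of_name_def
proof (rule inv_into_f_eq)
  show "inj_on (pt_name P A) (Hom (pcat P) A (ptwo P))"
  proof (rule inj_onI)
    fix p q assume p: "p \<in> Hom (pcat P) A (ptwo P)" and q: "q \<in> Hom (pcat P) A (ptwo P)"
      and eq: "pt_name P A p = pt_name P A q"
    have "fn p = filter_map A (pt_name P A p)" "fn q = filter_map A (pt_name P A q)"
      using p q by (auto simp: pt_name_eq Hom_pcat filter_map_name)
    then show "p = q" using p q eq by (auto simp: Hom_pcat)
  qed
  show "pt_name P A (Arrow A (filter_map A n) (ptwo P)) = n"
    using pt_name_eq[OF filter_map_Arrow[OF A n]] n by (simp add: names_def)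
qed (rule filter_map_Arrow[OF A n])

lemma pt_obj: "fobj (pt P) A = pt_space P A"
  by (simp add: pt_def)

lemma pt_map_names:
  assumes p: "p \<in> Hom (pcat P) A B" and n: "n \<in> names B"
  shows "enc {a \<in> car A. fn p a \<in> dec n} \<in> names A"
    and "dec (enc {a \<in> car A. fn p a \<in> dec n} :: 'u) = {a \<in> car A. fn p a \<in> dec n}"
    and "pt_name P A (pt_of_name P B n \<cdot>\<^bsub>pcat P\<^esub> p) = enc {a \<in> car A. fn p a \<in> dec n}"
proof -
  have AB: "A \<in> \<O>" "B \<in> \<O>" "hom A B (fn p)" "src p = A" "fn p \<in> car A \<rightarrow> car B"
    using Hom_pcatD[OF p] by auto
  let ?f = "compose (car A) (filter_map B n) (fn p)"
  have f: "hom A (ptwo P) ?f" "?f \<in> extensional (car A)"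
    using hom_compose[OF AB(1,2) ptwo(1) AB(3)] n by (auto simp: names_def)
  have "fn p a \<in> car B" if "a \<in> car A" for a using AB that by auto
  then have name: "filter_name A ?f = enc {a \<in> car A. fn p a \<in> dec n}"
    unfolding filter_name_def by (auto simp: compose_eq intro!: arg_cong[of _ _ enc])
  show "enc {a \<in> car A. fn p a \<in> dec n} \<in> names A"
    using filter_name_names[OF AB(1) f(2,1)] name by simp
  show "dec (enc {a \<in> car A. fn p a \<in> dec n} :: 'u) = {a \<in> car A. fn p a \<in> dec n}"
    by (intro dec_enc small_subset[OF small_car[OF AB(1)]]) auto
  show "pt_name P A (pt_of_name P B n \<cdot>\<^bsub>pcat P\<^esub> p) = enc {a \<in> car A. fn p a \<in> dec n}"
    using pt_name_Arrow[OF AB(1) f(2,1)] name AB(4) by (simp add: pt_of_name_eq[OF AB(2) n])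
qed

lemma fmap_pt:
  assumes p: "p \<in> Hom (pcat P) A B"
  shows "fmap (pt P) p = Arrow (pt_space P B) (\<lambda>n\<in>names B. enc {a \<in> car A. fn p a \<in> dec n}) (pt_space P A)"
proof -
  have AB: "B \<in> \<O>" "src p = A" "tgt p = B" using p by (auto simp: Hom_pcat)
  then show ?thesis
    unfolding pt_def using pt_map_names(3)[OF p] by (auto simp: topspace_pt intro!: restrict_ext)
qed

lemma continuous_pt_iff:
  assumes A: "A \<in> \<O>"
  shows "continuous_map X (pt_space P A) g \<longleftrightarrow> g \<in> topspace X \<rightarrow> names A \<and>
    (\<forall>a\<in>car A. openin X {x \<in> topspace X. a \<in> dec (g x)})"
proof -
  have "{x \<in> topspace X. g x \<in> pt_open P A a} = {x \<in> topspace X. a \<in> dec (g x)}"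
    if "g \<in> topspace X \<rightarrow> names A" "a \<in> car A" for a
    using that by (auto simp: pt_open_eq[OF A])
  then show ?thesis unfolding continuous_map_def topspace_pt[OF A] openin_pt_iff[OF A] by auto
qed

lemma continuous_pt_map:
  assumes p: "p \<in> Hom (pcat P) A B"
  shows "continuous_map (pt_space P B) (pt_space P A) (\<lambda>n\<in>names B. enc {a \<in> car A. fn p a \<in> dec n})"
proof -
  have AB: "A \<in> \<O>" "B \<in> \<O>" using p by (auto simp: Hom_pcat)
  have fc: "fn p a \<in> car B" if "a \<in> car A" for a
    using Hom_pcatD(7)[OF p that] .
  have "{n \<in> names B. a \<in> dec (if n \<in> names B then enc {a \<in> car A. fn p a \<in> dec n} else undefined)}
      = pt_open P B (fn p a)" if "a \<in> car A" for a
    using that pt_map_names(2)[OF p] by (auto simp: pt_open_eq[OF AB(2) fc])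
  then show ?thesis
    using pt_map_names(1)[OF p] fc by (auto simp: continuous_pt_iff[OF AB(1)] topspace_pt[OF AB(2)] openin_pt_iff[OF AB(2)])
qed

end

subsection \<open>The spectral adjunction\<close>

text \<open>The functor \<open>G\<close> equips the frames of opens of the spaces in \<open>Sp\<close> with a structure. The assumption
  \<open>initial\<close> says that this structure is the cartesian lift of the evaluations at the points.\<close>

locale spectral = frame_pfc u P hom
  for u :: "'u itself" and P :: "('o, ('o, 'u) arrow, 'u) pfc" and hom +
  fixes Sp :: "'u topology set" and G :: "('u topology, ('u topology, 'u) arrow, 'o, ('o, 'u) arrow) ftor"
  assumes Sp_small: "X \<in> Sp \<Longrightarrow> small (topspace X)"
    and pt_Sp: "A \<in> Obj (pcat P) \<Longrightarrow> pt_space P A \<in> Sp"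
    and G_obj: "X \<in> Sp \<Longrightarrow> fobj G X \<in> Obj (pcat P)"
    and G_frame: "X \<in> Sp \<Longrightarrow> fobj (pO P) (fobj G X) = fobj Omega X"
    and G_map: "fmap G g = Arrow (fobj G (tgt g)) (fn (fmap Omega g)) (fobj G (src g))"
    and initial: "X \<in> Sp \<Longrightarrow> A \<in> Obj (pcat P) \<Longrightarrow> k \<in> extensional (carrier (fobj (pO P) A)) \<Longrightarrow>
      hom A (fobj G X) k \<longleftrightarrow> k \<in> carrier (fobj (pO P) A) \<rightarrow> carrier (fobj Omega X) \<and>
        (\<forall>x\<in>topspace X. hom A (ptwo P) (compose (carrier (fobj (pO P) A)) (ev X x) k))"
begin

abbreviation "\<T> \<equiv> concrete Sp topspace continuous_map"

lemma data_T: "concrete_data Sp topspace continuous_map"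
  by (rule concrete_data_subset[OF concrete_data_TOP]) (use Sp_small in auto)

lemma hom_ev:
  assumes X: "X \<in> Sp" and x: "x \<in> topspace X"
  shows "hom (fobj G X) (ptwo P) (ev X x)"
proof -
  have "compose (car (fobj G X)) (ev X x) (\<lambda>u\<in>car (fobj G X). u) = ev X x"
    by (auto simp: compose_def ev_def G_frame[OF X])
  then show ?thesis
    using initial[OF X G_obj[OF X], of "\<lambda>u\<in>car (fobj G X). u"] hom_id[OF G_obj[OF X]] x by auto
qed

lemma is_functor_pt: "is_functor (pcat P) (op_cat \<T>) (pt P)"
  unfolding is_functor_def op_simps
proof (intro conjI ballI impI)
  show "category (pcat P)" by (rule category_pcat)
  show "category (op_cat \<T>)" by (intro category_op category_concrete data_T)
  show "fobj (pt P) A \<in> Obj \<T>" if "A \<in> \<O>" for A using that pt_Sp by (simp add: pt_obj)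
  fix p assume "p \<in> Arr (pcat P)"
  then have p: "p \<in> Hom (pcat P) (src p) (tgt p)" by (auto simp: Hom_def)
  then have AB: "src p \<in> \<O>" "tgt p \<in> \<O>" by (auto simp: Hom_pcat)
  show "fmap (pt P) p \<in> Hom \<T> (fobj (pt P) (Cod (pcat P) p)) (fobj (pt P) (Dom (pcat P) p))"
    using continuous_pt_map[OF p] AB pt_Sp
    by (simp add: fmap_pt[OF p] pt_obj Arrow_Hom_concrete topspace_pt)
  fix q assume "q \<in> Arr (pcat P)" and pq: "Cod (pcat P) p = Dom (pcat P) q"
  then have q: "q \<in> Hom (pcat P) (tgt p) (tgt q)" by (auto simp: Hom_def)
  then have qp: "q \<cdot>\<^bsub>pcat P\<^esub> p \<in> Hom (pcat P) (src p) (tgt q)"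
    using p pq category_pcat unfolding category_def Hom_def by auto
  have C: "tgt q \<in> \<O>" using q by (auto simp: Hom_pcat)
  have fc: "fn p a \<in> car (tgt p)" if "a \<in> car (src p)" for a
    using Hom_pcatD(7)[OF p that] .
  have "enc {a \<in> car (src p). fn q (fn p a) \<in> dec n}
      = enc {a \<in> car (src p). fn p a \<in> dec (enc {b \<in> car (tgt p). fn q b \<in> dec n} :: 'u)}"
    if "n \<in> names (tgt q)" for n
    using fc by (intro arg_cong[of _ _ enc]) (auto simp: pt_map_names(2)[OF q that])
  then show "fmap (pt P) (q \<cdot>\<^bsub>pcat P\<^esub> p) = fmap (pt P) p \<cdot>\<^bsub>\<T>\<^esub> fmap (pt P) q"
    unfolding fmap_pt[OF qp] fmap_pt[OF p] fmap_pt[OF q] using pt_map_names(1)[OF q] C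
    by (auto simp: compose_def topspace_pt cong: conj_cong intro!: restrict_ext)
next
  fix A assume A: "A \<in> \<O>"
  have I: "Id (pcat P) A \<in> Hom (pcat P) A A" using category_pcat A unfolding category_def by blast
  show "fmap (pt P) (Id (pcat P) A) = Id \<T> (fobj (pt P) A)"
    unfolding fmap_pt[OF I] pt_obj concrete_simps topspace_pt[OF A]
    using names_enc[OF A] by (auto cong: conj_cong intro!: restrict_ext)
qed

lemma G_fn:
  "X \<in> Sp \<Longrightarrow> g \<in> Hom \<T> X Y \<Longrightarrow> fmap G g = Arrow (fobj G Y)
    (\<lambda>v\<in>carrier (fobj Omega Y). enc {x \<in> topspace X. fn g x \<in> dec v}) (fobj G X)"
  by (auto simp: G_map Hom_def Omega_simps(3))

lemma preimage_open:
  assumes g: "g \<in> Hom \<T> X Y" and v: "v \<in> carrier (fobj Omega Y)"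
  shows "enc {x \<in> topspace X. fn g x \<in> dec v} \<in> carrier (fobj Omega X)"
    and "dec (enc {x \<in> topspace X. fn g x \<in> dec v} :: 'u) = {x \<in> topspace X. fn g x \<in> dec v}"
proof -
  have XY: "X \<in> Sp" "Y \<in> Sp" "continuous_map X Y (fn g)" using Hom_concreteD[OF g] by auto
  then have "openin X {x \<in> topspace X. fn g x \<in> dec v}"
    using openin_continuous_map_preimage Omega_dec(1)[OF Sp_small v] by blast
  note Omega_enc[OF Sp_small[OF XY(1)] this]
  then show "enc {x \<in> topspace X. fn g x \<in> dec v} \<in> carrier (fobj Omega X)"
    "dec (enc {x \<in> topspace X. fn g x \<in> dec v} :: 'u) = {x \<in> topspace X. fn g x \<in> dec v}" by auto
qed

text \<open>Preimages are arrows because composing them with evaluations gives evaluations.\<close>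

lemma is_functor_G: "is_functor (op_cat \<T>) (pcat P) G"
  unfolding is_functor_def op_simps
proof (intro conjI ballI impI)
  show "category (pcat P)" by (rule category_pcat)
  show "category (op_cat \<T>)" by (intro category_op category_concrete data_T)
  show "fobj G X \<in> \<O>" if "X \<in> Obj \<T>" for X using that G_obj by simp
  fix g assume "g \<in> Arr \<T>"
  then have g: "g \<in> Hom \<T> (src g) (tgt g)" by (auto simp: Hom_def)
  then have XY: "src g \<in> Sp" "tgt g \<in> Sp" and cont: "continuous_map (src g) (tgt g) (fn g)"
    using Hom_concreteD[OF g] by auto
  let ?k = "\<lambda>v\<in>carrier (fobj Omega (tgt g)). enc {x \<in> topspace (src g). fn g x \<in> dec v} :: 'u"
  have "hom (fobj G (tgt g)) (fobj G (src g)) ?k"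
  proof (subst initial[OF XY(1) G_obj[OF XY(2)]])
    show "?k \<in> extensional (car (fobj G (tgt g)))" by (simp add: G_frame[OF XY(2)])
    have "hom (fobj G (tgt g)) (ptwo P) (compose (car (fobj G (tgt g))) (ev (src g) x) ?k)"
      if x: "x \<in> topspace (src g)" for x
    proof -
      have "fn g x \<in> topspace (tgt g)" using cont x continuous_map_funspace by blast
      moreover have "compose (car (fobj G (tgt g))) (ev (src g) x) ?k = ev (tgt g) (fn g x)"
        using x preimage_open[OF g] by (auto simp: compose_def ev_def G_frame[OF XY(2)])
      ultimately show ?thesis using hom_ev[OF XY(2)] by simp
    qed
    then show "?k \<in> car (fobj G (tgt g)) \<rightarrow> carrier (fobj Omega (src g)) \<and>
      (\<forall>x\<in>topspace (src g). hom (fobj G (tgt g)) (ptwo P) (compose (car (fobj G (tgt g))) (ev (src g) x) ?k))"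
      using preimage_open[OF g] by (auto simp: G_frame[OF XY(2)])
  qed
  then show "fmap G g \<in> Hom (pcat P) (fobj G (Cod \<T> g)) (fobj G (Dom \<T> g))"
    unfolding G_fn[OF XY(1) g] using XY G_obj by (simp add: Arrow_Hom_pcat G_frame)
  fix k assume "k \<in> Arr \<T>" and gk: "Dom \<T> g = Cod \<T> k"
  then have k: "k \<in> Hom \<T> (src k) (src g)" by (auto simp: Hom_def)
  then have Z: "src k \<in> Sp" and kf: "fn k \<in> topspace (src k) \<rightarrow> topspace (src g)"
    using Hom_concreteD[OF k] continuous_map_funspace by blast+
  have gk': "g \<cdot>\<^bsub>\<T>\<^esub> k \<in> Hom \<T> (src k) (tgt g)"
    using category_concrete[OF data_T] g k unfolding category_def Hom_def by auto
  have "enc {x \<in> topspace (src k). fn g (fn k x) \<in> dec v}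
      = enc {x \<in> topspace (src k). fn k x \<in> dec (enc {y \<in> topspace (src g). fn g y \<in> dec v} :: 'u)}"
    if "v \<in> carrier (fobj Omega (tgt g))" for v
    using kf by (intro arg_cong[of _ _ enc]) (auto simp: preimage_open(2)[OF g that])
  then show "fmap G (g \<cdot>\<^bsub>\<T>\<^esub> k) = fmap G k \<cdot>\<^bsub>pcat P\<^esub> fmap G g"
    unfolding G_fn[OF Z gk'] G_fn[OF XY(1) g] G_fn[OF Z k] using preimage_open(1)[OF g]
    by (auto simp: compose_def G_frame[OF XY(2)] cong: conj_cong intro!: restrict_ext)
next
  fix X assume "X \<in> Obj \<T>"
  then have X: "X \<in> Sp" by simp
  have I: "Id \<T> X \<in> Hom \<T> X X" using category_concrete[OF data_T] X unfolding category_def by auto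
  have "enc {x \<in> topspace X. x \<in> dec v} = v" if v: "v \<in> carrier (fobj Omega X)" for v :: 'u
  proof -
    have "{x \<in> topspace X. x \<in> dec v} = dec v"
      using Omega_dec(1)[OF Sp_small[OF X] v] openin_subset by auto
    then show ?thesis using Omega_dec(2)[OF Sp_small[OF X] v] by metis
  qed
  then show "fmap G (Id \<T> X) = Id (pcat P) (fobj G X)"
    unfolding G_fn[OF X I] by (auto simp: G_frame[OF X] cong: conj_cong intro!: restrict_ext)
qed

lemma pt_open_Omega:
  assumes A: "A \<in> \<O>" and a: "a \<in> car A"
  shows "enc (pt_open P A a) \<in> carrier (fobj Omega (pt_space P A))"
    and "dec (enc (pt_open P A a)) = pt_open P A a"
  using Omega_enc[OF small_pt[OF A], of "pt_open P A a"] openin_pt_iff[OF A] a by blast+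

text \<open>The unit is an arrow because composing it with the evaluation at a point gives this point.\<close>

lemma spec_unit_Hom:
  assumes A: "A \<in> \<O>"
  shows "spec_unit P G A \<in> Hom (pcat P) A (fobj G (pt_space P A))"
proof -
  let ?k = "\<lambda>a\<in>car A. enc (pt_open P A a)" and ?X = "pt_space P A"
  note X = pt_Sp[OF A]
  have "hom A (fobj G ?X) ?k"
  proof (subst initial[OF X A])
    show "?k \<in> extensional (car A)" by simp
    have "hom A (ptwo P) (compose (car A) (ev ?X n) ?k)" if "n \<in> topspace ?X" for n
    proof -
      have n: "n \<in> names A" using that topspace_pt[OF A] by simp
      have "compose (car A) (ev ?X n) ?k = filter_map A n"
        using n pt_open_Omega[OF A] by (auto simp: compose_def filter_map_def ev_def pt_open_eq[OF A])
      then show ?thesis using n by (simp add: names_def)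
    qed
    then show "?k \<in> car A \<rightarrow> carrier (fobj Omega ?X) \<and>
      (\<forall>x\<in>topspace ?X. hom A (ptwo P) (compose (car A) (ev ?X x) ?k))"
      using pt_open_Omega[OF A] by auto
  qed
  then show ?thesis
    unfolding spec_unit_def using A G_obj[OF X] by (simp add: Arrow_Hom_pcat)
qed

lemma spec_counit_eq:
  assumes X: "X \<in> Sp"
  shows "spec_counit P G X = Arrow X
    (\<lambda>x\<in>topspace X. enc {v \<in> carrier (fobj Omega X). x \<in> dec v}) (pt_space P (fobj G X))"
    and "x \<in> topspace X \<Longrightarrow> (enc {v \<in> carrier (fobj Omega X). x \<in> dec v} :: 'u) \<in> names (fobj G X)"
    and "dec (enc {v \<in> carrier (fobj Omega X). x \<in> dec v} :: 'u) = {v \<in> carrier (fobj Omega X). x \<in> dec v}"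
proof -
  have ext: "ev X x \<in> extensional (car (fobj G X))" for x by (simp add: ev_def G_frame[OF X])
  have name: "filter_name (fobj G X) (ev X x) = enc {v \<in> carrier (fobj Omega X). x \<in> dec v}" for x
    unfolding filter_name_def G_frame[OF X] by (rule arg_cong[of _ _ enc]) (auto simp: ev_one_iff)
  show "x \<in> topspace X \<Longrightarrow> (enc {v \<in> carrier (fobj Omega X). x \<in> dec v} :: 'u) \<in> names (fobj G X)"
    using filter_name_names[OF G_obj[OF X] ext hom_ev[OF X]] name by simp
  show "dec (enc {v \<in> carrier (fobj Omega X). x \<in> dec v} :: 'u) = {v \<in> carrier (fobj Omega X). x \<in> dec v}"
    by (intro dec_enc small_subset[OF small_Omega[OF Sp_small[OF X]]]) auto
  have "pt_name P (fobj G X) (Arrow (fobj G X) (ev X x) (ptwo P)) = enc {v \<in> carrier (fobj Omega X). x \<in> dec v}"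
    if "x \<in> topspace X" for x
    using pt_name_Arrow[OF G_obj[OF X] ext hom_ev[OF X that]] name by simp
  then show "spec_counit P G X = Arrow X
    (\<lambda>x\<in>topspace X. enc {v \<in> carrier (fobj Omega X). x \<in> dec v}) (pt_space P (fobj G X))"
    unfolding spec_counit_def ev_def[symmetric] by (auto intro!: restrict_ext)
qed

lemma spec_counit_Hom:
  assumes X: "X \<in> Sp"
  shows "spec_counit P G X \<in> Hom \<T> X (pt_space P (fobj G X))"
proof -
  have "openin X {x \<in> topspace X. v \<in> dec (if x \<in> topspace X then enc {v \<in> carrier (fobj Omega X). x \<in> dec v} else undefined)}"
    if v: "v \<in> carrier (fobj Omega X)" for v :: 'u
  proof -
    have "{x \<in> topspace X. v \<in> dec (if x \<in> topspace X then enc {v \<in> carrier (fobj Omega X). x \<in> dec v} else undefined)} = dec v"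
      using v spec_counit_eq(3)[OF X] openin_subset[OF Omega_dec(1)[OF Sp_small[OF X] v]] by auto
    then show ?thesis using Omega_dec(1)[OF Sp_small[OF X] v] by simp
  qed
  then have "continuous_map X (pt_space P (fobj G X)) (\<lambda>x\<in>topspace X. enc {v \<in> carrier (fobj Omega X). x \<in> dec v})"
    using spec_counit_eq(2)[OF X] by (simp add: continuous_pt_iff[OF G_obj[OF X]] G_frame[OF X])
  then show ?thesis
    unfolding spec_counit_eq(1)[OF X] using X pt_Sp[OF G_obj[OF X]] by (simp add: Arrow_Hom_concrete)
qed

theorem spec_adjunction: "adjunction (spec_adj P \<T> G)"
  unfolding adjunction_def spec_adj_def adj.simps
proof (intro conjI ballI)
  note F = is_functor_pt and G = is_functor_G
  show "is_functor (pcat P) (op_cat \<T>) (pt P)" by (rule F)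
  show "is_functor (op_cat \<T>) (pcat P) G" by (rule G)
  show "natural (pcat P) (pcat P) idF (G \<odot> pt P) (spec_unit P G)"
    unfolding natural_def
  proof (intro conjI ballI)
    fix p assume "p \<in> Arr (pcat P)"
    then have p: "p \<in> Hom (pcat P) (src p) (tgt p)" by (auto simp: Hom_def)
    then have AB: "src p \<in> \<O>" "tgt p \<in> \<O>" by (auto simp: Hom_pcat)
    have pf: "fn p a \<in> car (tgt p)" if "a \<in> car (src p)" for a
      using Hom_pcatD(7)[OF p that] .
    have ptp: "fmap (pt P) p \<in> Hom \<T> (pt_space P (tgt p)) (pt_space P (src p))"
      using F p unfolding is_functor_def Hom_def by (auto simp: pt_obj)
    have "pt_open P (tgt p) (fn p a) = {n \<in> names (tgt p). fn (fmap (pt P) p) n \<in> dec (enc (pt_open P (src p) a))}"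
      if a: "a \<in> car (src p)" for a
      unfolding fmap_pt[OF p] pt_open_Omega(2)[OF AB(1) a]
      using a pt_map_names[OF p] by (auto simp: pt_open_eq[OF AB(1) a] pt_open_eq[OF AB(2) pf[OF a]])
    then show "spec_unit P G (Cod (pcat P) p) \<cdot>\<^bsub>pcat P\<^esub> fmap idF p
        = fmap (G \<odot> pt P) p \<cdot>\<^bsub>pcat P\<^esub> spec_unit P G (Dom (pcat P) p)"
      using pf pt_open_Omega(1)[OF AB(1)]
      by (auto simp: spec_unit_def G_fn[OF pt_Sp[OF AB(2)] ptp] compose_def topspace_pt[OF AB(2)] intro!: restrict_ext)
  qed (use is_functor_comp[OF F G] is_functor_id[OF category_pcat] spec_unit_Hom in \<open>auto simp: pt_obj\<close>)
  show "natural (op_cat \<T>) (op_cat \<T>) (pt P \<odot> G) idF (spec_counit P G)"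
    unfolding natural_def op_simps
  proof (intro conjI ballI)
    fix g assume "g \<in> Arr \<T>"
    then have g: "g \<in> Hom \<T> (src g) (tgt g)" by (auto simp: Hom_def)
    then have XY: "src g \<in> Sp" "tgt g \<in> Sp" and gf: "fn g \<in> topspace (src g) \<rightarrow> topspace (tgt g)"
      using Hom_concreteD[OF g] continuous_map_funspace by blast+
    have Gg: "fmap G g \<in> Hom (pcat P) (fobj G (tgt g)) (fobj G (src g))"
      using G g unfolding is_functor_def Hom_def by auto
    have "enc {v \<in> carrier (fobj Omega (tgt g)). fn (fmap G g) v \<in> dec (enc {w \<in> carrier (fobj Omega (src g)). x \<in> dec w} :: 'u)}
        = (enc {v \<in> carrier (fobj Omega (tgt g)). fn g x \<in> dec v} :: 'u)" if x: "x \<in> topspace (src g)" for x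
      unfolding G_fn[OF XY(1) g] spec_counit_eq(3)[OF XY(1)]
      using x preimage_open[OF g] by (intro arg_cong[of _ _ enc]) auto
    then show "fmap (pt P \<odot> G) g \<cdot>\<^bsub>\<T>\<^esub> spec_counit P G (Dom \<T> g) = spec_counit P G (Cod \<T> g) \<cdot>\<^bsub>\<T>\<^esub> fmap idF g"
      using gf spec_counit_eq(2)[OF XY(1)]
      by (auto simp: spec_counit_eq(1)[OF XY(1)] spec_counit_eq(1)[OF XY(2)] fmap_pt[OF Gg] compose_def
          G_frame[OF XY(2)] intro!: restrict_ext)
  qed (use is_functor_comp[OF G F]
    is_functor_id[OF category_op[OF category_concrete[OF data_T]]] spec_counit_Hom in \<open>auto simp: pt_obj\<close>)
  fix A assume A: "A \<in> \<O>"
  note X = pt_Sp[OF A] and H = spec_unit_Hom[OF A]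
  have "enc {a \<in> car A. fn (spec_unit P G A) a \<in> dec (enc {v \<in> carrier (fobj Omega (pt_space P A)). n \<in> dec v} :: 'u)} = n"
    if n: "n \<in> names A" for n
  proof -
    have "{a \<in> car A. fn (spec_unit P G A) a \<in> dec (enc {v \<in> carrier (fobj Omega (pt_space P A)). n \<in> dec v} :: 'u)}
        = {a \<in> car A. a \<in> dec n}"
      using n pt_open_Omega[OF A] unfolding spec_counit_eq(3)[OF X] by (auto simp: spec_unit_def pt_open_eq[OF A])
    then show ?thesis using names_enc[OF A n] by simp
  qed
  then show "spec_counit P G (fobj (pt P) A) \<cdot>\<^bsub>op_cat \<T>\<^esub> fmap (pt P) (spec_unit P G A) = Id (op_cat \<T>) (fobj (pt P) A)"
    unfolding op_simps pt_obj spec_counit_eq(1)[OF X] fmap_pt[OF H] using spec_counit_eq(2)[OF X]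
    by (auto simp: compose_def topspace_pt[OF A] intro!: restrict_ext)
next
  fix X assume "X \<in> Obj (op_cat \<T>)"
  then have X: "X \<in> Sp" by simp
  note Y = pt_Sp[OF G_obj[OF X]] and A = G_obj[OF X]
  have "enc {x \<in> topspace X. fn (spec_counit P G X) x \<in> dec (enc (pt_open P (fobj G X) v))} = v"
    if v: "v \<in> carrier (fobj Omega X)" for v
  proof -
    have v': "v \<in> car (fobj G X)" using v by (simp add: G_frame[OF X])
    have "{x \<in> topspace X. fn (spec_counit P G X) x \<in> dec (enc (pt_open P (fobj G X) v))} = dec v"
      unfolding pt_open_Omega(2)[OF A v'] unfolding pt_open_eq[OF A v'] spec_counit_eq(1)[OF X]
      using v spec_counit_eq(2,3)[OF X] openin_subset[OF Omega_dec(1)[OF Sp_small[OF X] v]] by auto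
    then show ?thesis using Omega_dec(2)[OF Sp_small[OF X] v] by simp
  qed
  then show "fmap G (spec_counit P G X) \<cdot>\<^bsub>pcat P\<^esub> spec_unit P G (fobj G X) = Id (pcat P) (fobj G X)"
    unfolding G_fn[OF X spec_counit_Hom[OF X]] spec_unit_def using pt_open_Omega(1)[OF A]
    by (auto simp: compose_def G_frame[OF X] intro!: restrict_ext)
qed

end


section \<open>Comparison of spectra\<close>

text \<open>A functor that leaves frames, underlying functions and the distinguished object unchanged, and
  that carries the structure \<open>G\<close> on frames of opens to \<open>G'\<close>.\<close>

locale spectral_morphism =
  S: spectral u P hom Sp G + T: spectral u Q hom' Sp' G'
  for u :: "'u itself" and P :: "('o, ('o, 'u) arrow, 'u) pfc" and hom Sp G
    and Q :: "('p, ('p, 'u) arrow, 'u) pfc" and hom' Sp' G' +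
  fixes H :: "('o, ('o, 'u) arrow, 'p, ('p, 'u) arrow) ftor"
  assumes H: "is_functor (pcat P) (pcat Q) H" "keeps_fn H"
    and H_frame: "A \<in> Obj (pcat P) \<Longrightarrow> fobj (pO Q) (fobj H A) = fobj (pO P) A"
    and H_two: "fobj H (ptwo P) = ptwo Q"
    and Sp: "Sp \<subseteq> Sp'"
    and H_G: "X \<in> Sp \<Longrightarrow> fobj H (fobj G X) = fobj G' X"
begin

lemma H_obj: "A \<in> S.\<O> \<Longrightarrow> fobj H A \<in> T.\<O>"
  using H(1) by (simp add: is_functor_def)

lemma H_map: "p \<in> Hom (pcat P) A B \<Longrightarrow> fmap H p = Arrow (fobj H A) (fn p) (fobj H B)"
  using S.Hom_pcatD[of p A B] by (simp add: keeps_fnD[OF H(2)])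

lemma H_Hom: "p \<in> Hom (pcat P) A B \<Longrightarrow> fmap H p \<in> Hom (pcat Q) (fobj H A) (fobj H B)"
  using H(1) by (auto simp: is_functor_def Hom_def)

lemma H_hom:
  assumes "A \<in> S.\<O>" "B \<in> S.\<O>" "f \<in> extensional (S.car A)" "hom A B f"
  shows "hom' (fobj H A) (fobj H B) f"
proof -
  have p: "Arrow A f B \<in> Hom (pcat P) A B" using assms by (simp add: S.Arrow_Hom_pcat)
  show ?thesis using H_Hom[OF p] unfolding H_map[OF p] by (simp add: T.Arrow_Hom_pcat)
qed

lemma filter_H: "A \<in> S.\<O> \<Longrightarrow> T.filter_map (fobj H A) n = S.filter_map A n"
  "A \<in> S.\<O> \<Longrightarrow> T.filter_name (fobj H A) f = S.filter_name A f"
  by (simp_all add: T.filter_map_def S.filter_map_def T.filter_name_def S.filter_name_def H_frame)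

lemma names_H:
  assumes A: "A \<in> S.\<O>"
  shows "S.names A \<subseteq> T.names (fobj H A)"
proof
  fix n assume n: "n \<in> S.names A"
  have "hom' (fobj H A) (ptwo Q) (S.filter_map A n)"
    using H_hom[OF A S.ptwo(1), of "S.filter_map A n"] n by (simp add: S.names_def S.filter_map_def H_two)
  then show "n \<in> T.names (fobj H A)" using n by (simp add: T.names_def S.names_def filter_H[OF A])
qed

text \<open>On names of points, the comparison map is an inclusion.\<close>

lemma comparison_eq:
  assumes A: "A \<in> S.\<O>"
  shows "spec_comparison P Q H A = Arrow (pt_space P A) (\<lambda>n\<in>S.names A. n) (pt_space Q (fobj H A))"
proof -
  have "pt_name Q (fobj H A) (fmap H (pt_of_name P A n)) = n" if n: "n \<in> S.names A" for n
  proof -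
    note p = S.filter_map_Arrow[OF A n]
    have "fmap H (pt_of_name P A n) \<in> Hom (pcat Q) (fobj H A) (ptwo Q)"
      using H_Hom[OF p] by (simp add: S.pt_of_name_eq[OF A n] H_two)
    then show ?thesis
      using n H_map[OF p] by (simp add: T.pt_name_eq S.pt_of_name_eq[OF A n] filter_H[OF A] S.names_def)
  qed
  then show ?thesis by (auto simp: spec_comparison_def S.topspace_pt[OF A] intro!: restrict_ext)
qed

lemma comparison_Hom:
  assumes A: "A \<in> S.\<O>"
  shows "spec_comparison P Q H A \<in> Hom T.\<T> (pt_space P A) (pt_space Q (fobj H A))"
proof -
  have "{n \<in> S.names A. a \<in> dec (if n \<in> S.names A then n else undefined)} = pt_open P A a"
    if "a \<in> S.car A" for a
    using that by (auto simp: S.pt_open_eq[OF A])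
  then have "continuous_map (pt_space P A) (pt_space Q (fobj H A)) (\<lambda>n\<in>S.names A. n)"
    using names_H[OF A]
    by (auto simp: T.continuous_pt_iff[OF H_obj[OF A]] H_frame[OF A] S.topspace_pt[OF A] S.openin_pt_iff[OF A])
  then show ?thesis
    unfolding comparison_eq[OF A]
    using Sp S.pt_Sp[OF A] T.pt_Sp[OF H_obj[OF A]] by (auto simp: Arrow_Hom_concrete S.topspace_pt[OF A])
qed

lemma is_functor_inclusion: "is_functor (op_cat S.\<T>) (op_cat T.\<T>) idF"
proof -
  have "is_functor S.\<T> T.\<T> idF"
    by (rule is_functor_concrete[OF S.data_T T.data_T]) (use Sp in auto)
  then show ?thesis
    using category_op[OF category_concrete[OF S.data_T]] category_op[OF category_concrete[OF T.data_T]]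
    unfolding is_functor_def by auto
qed

theorem right_adjunction_morphism:
  "right_adjunction_morphism (spec_adj P S.\<T> G) (spec_adj Q T.\<T> G') H idF
    (id_trans (pcat Q) G') (spec_comparison P Q H)"
  unfolding right_adjunction_morphism_def
proof (intro conjI ballI)
  show "adjunction (spec_adj P S.\<T> G)" "adjunction (spec_adj Q T.\<T> G')"
    by (rule S.spec_adjunction T.spec_adjunction)+
  show "is_functor (lcat (spec_adj P S.\<T> G)) (lcat (spec_adj Q T.\<T> G')) H"
    "is_functor (rcat (spec_adj P S.\<T> G)) (rcat (spec_adj Q T.\<T> G')) idF"
    using H(1) is_functor_inclusion by (simp_all add: spec_adj_def)
  have "natural_iso (op_cat S.\<T>) (pcat Q) (H \<odot> G) (G' \<odot> idF) (id_trans (pcat Q) G')"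
  proof (rule natural_iso_if_eq)
    show "is_functor (op_cat S.\<T>) (pcat Q) (H \<odot> G)" by (rule is_functor_comp[OF S.is_functor_G H(1)])
    show "is_functor (op_cat S.\<T>) (pcat Q) (G' \<odot> idF)"
      by (rule is_functor_comp[OF is_functor_inclusion T.is_functor_G])
  qed (auto simp: H_G id_trans_def keeps_fnD[OF H(2)] S.G_map T.G_map)
  then show "natural_iso (rcat (spec_adj P S.\<T> G)) (lcat (spec_adj Q T.\<T> G'))
      (H \<odot> radj (spec_adj P S.\<T> G)) (radj (spec_adj Q T.\<T> G') \<odot> idF) (id_trans (pcat Q) G')"
    by (simp add: spec_adj_def)
  have "natural (pcat P) (op_cat T.\<T>) (pt Q \<odot> H) (idF \<odot> pt P) (spec_comparison P Q H)"
    unfolding natural_def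
  proof (intro conjI ballI)
    show "is_functor (pcat P) (op_cat T.\<T>) (pt Q \<odot> H)" by (rule is_functor_comp[OF H(1) T.is_functor_pt])
    show "is_functor (pcat P) (op_cat T.\<T>) (idF \<odot> pt P)"
      by (rule is_functor_comp[OF S.is_functor_pt is_functor_inclusion])
    show "spec_comparison P Q H A \<in> Hom (op_cat T.\<T>) (fobj (pt Q \<odot> H) A) (fobj (idF \<odot> pt P) A)"
      if "A \<in> S.\<O>" for A
      using comparison_Hom[OF that] by (simp add: S.pt_obj T.pt_obj)
    fix p assume "p \<in> Arr (pcat P)"
    then have p: "p \<in> Hom (pcat P) (src p) (tgt p)" by (auto simp: Hom_def)
    note AB = S.Hom_pcatD[OF p]
    have Hp: "fmap H p \<in> Hom (pcat Q) (fobj H (src p)) (fobj H (tgt p))" by (rule H_Hom[OF p])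
    show "spec_comparison P Q H (Cod (pcat P) p) \<cdot>\<^bsub>op_cat T.\<T>\<^esub> fmap (pt Q \<odot> H) p
        = fmap (idF \<odot> pt P) p \<cdot>\<^bsub>op_cat T.\<T>\<^esub> spec_comparison P Q H (Dom (pcat P) p)"
      using S.pt_map_names(1)[OF p] names_H[OF AB(2)]
      by (auto simp: comparison_eq[OF AB(1)] comparison_eq[OF AB(2)] S.fmap_pt[OF p] T.fmap_pt[OF Hp[unfolded H_map[OF p]]]
          H_frame[OF AB(1)] H_map[OF p] compose_def S.topspace_pt[OF AB(2)] intro!: restrict_ext)
  qed
  then show "natural (lcat (spec_adj P S.\<T> G)) (rcat (spec_adj Q T.\<T> G'))
      (ladj (spec_adj Q T.\<T> G') \<odot> H) (idF \<odot> ladj (spec_adj P S.\<T> G)) (spec_comparison P Q H)"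
    by (simp add: spec_adj_def)
  fix A assume "A \<in> Obj (lcat (spec_adj P S.\<T> G))"
  then have A: "A \<in> S.\<O>" by (simp add: spec_adj_def)
  let ?X = "pt_space P A"
  have X: "?X \<in> Sp" and X': "?X \<in> Sp'" using S.pt_Sp[OF A] Sp by auto
  have I: "Id (pcat Q) (fobj G' ?X) \<in> Hom (pcat Q) (fobj G' ?X) (fobj G' ?X)"
    using T.category_pcat T.G_obj[OF X'] unfolding category_def by blast
  have \<eta>: "fmap H (spec_unit P G A) \<in> Hom (pcat Q) (fobj H A) (fobj G' ?X)"
    using H_Hom[OF S.spec_unit_Hom[OF A]] H_G[OF X] by simp
  have fn\<eta>: "fn (fmap H (spec_unit P G A)) = (\<lambda>a\<in>S.car A. enc (pt_open P A a))"
    by (simp add: H_map[OF S.spec_unit_Hom[OF A]]) (simp add: spec_unit_def)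
  have eps: "(enc {v \<in> carrier (fobj Omega ?X). n \<in> dec v} :: 'u) \<in> T.names (fobj G' ?X)" if "n \<in> S.names A" for n
    using T.spec_counit_eq(2)[OF X'] that S.topspace_pt[OF A] by simp
  have id: "enc {v \<in> T.car (fobj G' ?X). fn (Id (pcat Q) (fobj G' ?X)) v \<in> dec m} = m"
    if "m \<in> T.names (fobj G' ?X)" for m
  proof -
    have "{v \<in> T.car (fobj G' ?X). fn (Id (pcat Q) (fobj G' ?X)) v \<in> dec m} = {v \<in> T.car (fobj G' ?X). v \<in> dec m}"
      by auto
    then show ?thesis using T.names_enc[OF T.G_obj[OF X'] that] by metis
  qed
  have "enc {a \<in> T.car (fobj H A). fn (fmap H (spec_unit P G A)) a
      \<in> dec (enc {v \<in> carrier (fobj Omega ?X). n \<in> dec v} :: 'u)} = n" if n: "n \<in> S.names A" for n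
  proof -
    have "{a \<in> T.car (fobj H A). fn (fmap H (spec_unit P G A)) a
        \<in> dec (enc {v \<in> carrier (fobj Omega ?X). n \<in> dec v} :: 'u)} = {a \<in> S.car A. a \<in> dec n}"
      using n S.pt_open_Omega[OF A] unfolding T.spec_counit_eq(3)[OF X'] fn\<eta> H_frame[OF A]
      by (auto simp: S.pt_open_eq[OF A])
    then show ?thesis using S.names_enc[OF A n] by simp
  qed
  then have "Arrow ?X (\<lambda>n\<in>S.names A. n) (pt_space Q (fobj H A))
    = fmap (pt Q) (fmap H (spec_unit P G A)) \<cdot>\<^bsub>T.\<T>\<^esub>
      (fmap (pt Q) (Id (pcat Q) (fobj G' ?X)) \<cdot>\<^bsub>T.\<T>\<^esub> spec_counit Q G' ?X)"
    using eps id
    by (auto simp: T.fmap_pt[OF I] T.fmap_pt[OF \<eta>] T.spec_counit_eq(1)[OF X'] compose_def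
        S.topspace_pt[OF A] simp del: T.pcat_simps intro!: restrict_ext)
  also have "\<dots> = (fmap (pt Q) (fmap H (spec_unit P G A)) \<cdot>\<^bsub>T.\<T>\<^esub>
      fmap (pt Q) (Id (pcat Q) (fobj G' ?X))) \<cdot>\<^bsub>T.\<T>\<^esub> spec_counit Q G' ?X"
  proof -
    have "fmap (pt Q) (Id (pcat Q) (fobj G' ?X)) \<in> Hom T.\<T> (pt_space Q (fobj G' ?X)) (pt_space Q (fobj G' ?X))"
      "fmap (pt Q) (fmap H (spec_unit P G A)) \<in> Hom T.\<T> (pt_space Q (fobj G' ?X)) (pt_space Q (fobj H A))"
      using T.is_functor_pt I \<eta> by (auto simp: is_functor_def T.pt_obj Hom_def simp del: T.pcat_simps concrete_simps)
    then show ?thesis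
      using category_concrete[OF T.data_T] T.spec_counit_Hom[OF X']
      unfolding category_def Hom_def by (auto simp del: concrete_simps)
  qed
  finally show "spec_comparison P Q H A =
      counit (spec_adj Q T.\<T> G') (fobj idF (fobj (ladj (spec_adj P S.\<T> G)) A)) \<cdot>\<^bsub>rcat (spec_adj Q T.\<T> G')\<^esub>
      fmap (ladj (spec_adj Q T.\<T> G')) (id_trans (pcat Q) G' (fobj (ladj (spec_adj P S.\<T> G)) A)) \<cdot>\<^bsub>rcat (spec_adj Q T.\<T> G')\<^esub>
      fmap (ladj (spec_adj Q T.\<T> G')) (fmap H (unit (spec_adj P S.\<T> G) A))"
    unfolding spec_adj_def adj.simps op_simps comparison_eq[OF A] id_trans_def fobj_simps S.pt_obj .
qed

theorem strong_adjunction_morphism: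
  assumes "\<And>A. A \<in> S.\<O> \<Longrightarrow> T.names (fobj H A) \<subseteq> S.names A"
  shows "strong_adjunction_morphism (spec_adj P S.\<T> G) (spec_adj Q T.\<T> G') H idF
    (id_trans (pcat Q) G') (spec_comparison P Q H)"
proof -
  have "spec_comparison P Q H A \<in> isos (op_cat T.\<T>) (pt_space Q (fobj H A)) (pt_space P A)"
    if A: "A \<in> S.\<O>" for A
  proof -
    have names: "T.names (fobj H A) = S.names A" using assms[OF A] names_H[OF A] by blast
    have "openin (pt_space Q (fobj H A)) = openin (pt_space P A)"
      using names by (auto simp: fun_eq_iff T.openin_pt_iff[OF H_obj[OF A]] S.openin_pt_iff[OF A]
          H_frame[OF A] S.pt_open_eq[OF A] T.pt_open_eq[OF H_obj[OF A]])
    then have eq: "pt_space Q (fobj H A) = pt_space P A" by (simp add: topology_eq)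
    then have "spec_comparison P Q H A = Id (op_cat T.\<T>) (pt_space P A)"
      by (simp add: comparison_eq[OF A] S.topspace_pt[OF A])
    then show ?thesis
      using eq Id_iso[OF category_op[OF category_concrete[OF T.data_T]], of "pt_space P A"] S.pt_Sp[OF A] Sp by auto
  qed
  then show ?thesis
    using right_adjunction_morphism
    unfolding strong_adjunction_morphism_def natural_iso_def right_adjunction_morphism_def
    by (auto simp: spec_adj_def S.pt_obj T.pt_obj)
qed

end

section \<open>Cartesian lifts of spaces\<close>

context univ
begin

lemma openin_sierpinski: "openin (sierpinski :: 'u topology) U \<longleftrightarrow> U \<in> {{}, {one_u}, {zero_u, one_u}}"
proof -
  have "istopology (\<lambda>U. U \<in> {{}, {one_u}, {zero_u, one_u :: 'u}})"
    unfolding istopology_def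
  proof (intro conjI allI impI)
    fix \<K> assume \<K>: "\<forall>K\<in>\<K>. K \<in> {{}, {one_u}, {zero_u, one_u :: 'u}}"
    show "\<Union>\<K> \<in> {{}, {one_u}, {zero_u, one_u}}"
    proof (cases "{zero_u, one_u} \<in> \<K>")
      case True
      then have "\<Union>\<K> = {zero_u, one_u}" using \<K> by blast
      then show ?thesis by simp
    next
      case False
      then have "\<Union>\<K> = {} \<or> \<Union>\<K> = {one_u}" using \<K> by blast
      then show ?thesis by blast
    qed
  qed auto
  then show ?thesis by (simp add: sierpinski_def topology_inverse')
qed

lemma topspace_sierpinski: "topspace (sierpinski :: 'u topology) = {zero_u, one_u}"
  unfolding topspace_def openin_sierpinski by auto

lemma continuous_sierpinski_iff:
  "continuous_map X (sierpinski :: 'u topology) g \<longleftrightarrow> g \<in> topspace X \<rightarrow> {zero_u, one_u} \<and>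
    openin X {x \<in> topspace X. g x = one_u}"
proof -
  have "{x \<in> topspace X. g x \<in> {zero_u, one_u}} = topspace X" if "g \<in> topspace X \<rightarrow> {zero_u, one_u}"
    using that by auto
  then show ?thesis
    unfolding continuous_map_def topspace_sierpinski openin_sierpinski by auto
qed

lemma T_D_sierpinski: "T_D (sierpinski :: 'u topology)"
  unfolding T_D_def topspace_sierpinski
proof
  have o: "openin (sierpinski :: 'u topology) {one_u}" "openin (sierpinski :: 'u topology) {zero_u, one_u}"
    by (simp_all add: openin_sierpinski)
  have c: "closedin (sierpinski :: 'u topology) {zero_u}" "closedin (sierpinski :: 'u topology) {zero_u, one_u}"
    by (auto simp: closedin_def topspace_sierpinski openin_sierpinski insert_Diff_if)
  fix x :: 'u assume "x \<in> {zero_u, one_u}"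
  then have "{x} = {one_u} \<inter> {zero_u, one_u} \<or> {x} = {zero_u, one_u} \<inter> {zero_u}" by auto
  then show "\<exists>U C. openin sierpinski U \<and> closedin sierpinski C \<and> {x} = U \<inter> C" using o c by blast
qed

lemma sierp_name_Arrow:
  "sierp_name X (Arrow X g sierpinski) = enc {x \<in> topspace X. g x = one_u}"
  by (simp add: sierp_name_def name2_def)

text \<open>The name of a map \<open>X \<rightarrow> \<S>\<close> is the code of the open set that it classifies. Hence the set of
  these names is the carrier of \<open>\<Omega>X\<close>, and \<open>\<chi>\<^sub>x\<close> is the evaluation at \<open>x\<close>.\<close>

lemma sierp_maps_chi:
  assumes X: "small (topspace (X :: 'u topology))"
  shows "sierp_maps X = carrier (fobj Omega X)"
    and "x \<in> topspace X \<Longrightarrow> chi X x = Arrow (carrier (fobj Omega X)) (ev X x) (carrier two_frm)"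
proof -
  have small_S: "small (topspace (sierpinski :: 'u topology))" by (simp add: topspace_sierpinski small_pair)
  define ch where "ch U = (\<lambda>x\<in>topspace X. if x \<in> U then one_u else zero_u :: 'u)" for U
  have ch: "{x \<in> topspace X. ch U x = one_u} = U" if "openin X U" for U
    using openin_subset[OF that] by (auto simp: ch_def)
  have Hom_ch: "Arrow X (ch U) sierpinski \<in> Hom TOP X sierpinski" if "openin X U" for U
  proof -
    have "ch U \<in> topspace X \<rightarrow> {zero_u, one_u}" "ch U \<in> extensional (topspace X)" by (auto simp: ch_def)
    then show ?thesis
      by (simp add: TOP_def Arrow_Hom_concrete continuous_sierpinski_iff ch[OF that] that X small_S)
  qed
  have HomE: "\<exists>U. openin X U \<and> g = Arrow X (ch U) sierpinski" if g: "g \<in> Hom TOP X sierpinski" for g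
  proof -
    note d = Hom_concreteD[OF g[unfolded TOP_def]]
    let ?U = "{x \<in> topspace X. fn g x = one_u}"
    have r: "fn g \<in> topspace X \<rightarrow> {zero_u, one_u}" "openin X ?U"
      using d(6) by (simp_all add: continuous_sierpinski_iff)
    have "fn g = ch ?U"
      by (rule extensionalityI[of _ "topspace X"]) (use d(5) r in \<open>auto simp: ch_def\<close>)
    then show ?thesis using r(2) d(3,4) by (metis arrow.collapse)
  qed
  have name: "sierp_name X (Arrow X (ch U) sierpinski) = enc U" if "openin X U" for U
    using ch[OF that] by (simp add: sierp_name_Arrow)
  show maps: "sierp_maps X = carrier (fobj Omega X)"
  proof (intro subset_antisym subsetI)
    fix n assume "n \<in> sierp_maps X"
    then obtain g where "g \<in> Hom TOP X sierpinski" "n = sierp_name X g" by (auto simp: sierp_maps_def)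
    then show "n \<in> carrier (fobj Omega X)" using HomE[of g] name by (auto simp: Omega_simps(1))
  next
    fix n :: 'u assume "n \<in> carrier (fobj Omega X)"
    then obtain U where "openin X U" "n = enc U" by (auto simp: Omega_simps(1))
    then show "n \<in> sierp_maps X" unfolding sierp_maps_def using Hom_ch name by force
  qed
  have inj: "inj_on (sierp_name X) (Hom TOP X sierpinski)"
  proof (rule inj_onI)
    fix g k assume "g \<in> Hom TOP X sierpinski" "k \<in> Hom TOP X sierpinski" and eq: "sierp_name X g = sierp_name X k"
    then obtain U V where "openin X U" "g = Arrow X (ch U) sierpinski" "openin X V" "k = Arrow X (ch V) sierpinski"
      using HomE by metis
    then show "g = k" using eq name enc_eq_iff[OF small_open[OF X] small_open[OF X]] by auto
  qed
  assume x: "x \<in> topspace X"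
  have "fn (inv_into (Hom TOP X sierpinski) (sierp_name X) n) x = ev X x n" if n: "n \<in> carrier (fobj Omega X)" for n
  proof -
    note o = Omega_dec[OF X n]
    have "inv_into (Hom TOP X sierpinski) (sierp_name X) n = Arrow X (ch (dec n)) sierpinski"
      by (rule inv_into_f_eq[OF inj Hom_ch[OF o(1)]]) (use name[OF o(1)] o(2) in simp)
    then show ?thesis using x n by (simp add: ch_def ev_def)
  qed
  then show "chi X x = Arrow (carrier (fobj Omega X)) (ev X x) (carrier two_frm)"
    unfolding chi_def maps by (auto simp: ev_def intro!: ext)
qed

end

context frame_pfc
begin

text \<open>The universal property of a cartesian lift of \<open>X\<close> with object \<open>Y\<close> and bijection \<open>t : |Y| \<rightarrow> |\<Omega>X|\<close>,
  in terms of underlying functions.\<close>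

definition lift_at :: "'u topology \<Rightarrow> 'o \<Rightarrow> ('u \<Rightarrow> 'u) \<Rightarrow> bool"
  where "lift_at X Y t \<longleftrightarrow> (\<forall>D\<in>\<O>. \<forall>k \<in> car D \<rightarrow>\<^sub>E car Y. hom D Y k \<longleftrightarrow>
    (\<forall>x\<in>topspace X. hom D (ptwo P) (compose (car D) (ev X x) (compose (car D) t k))))"

lemma lifts_iff:
  assumes D: "D \<in> \<O>" and Y: "Y \<in> \<O>" and k: "k \<in> extensional (car D)"
  shows "lifts (pcat P) (underlying \<odot> pO P) D Y (Arrow (car D) k (car Y)) \<longleftrightarrow> hom D Y k"
proof
  assume "lifts (pcat P) (underlying \<odot> pO P) D Y (Arrow (car D) k (car Y))"
  then obtain p where p: "p \<in> Hom (pcat P) D Y" "fmap (underlying \<odot> pO P) p = Arrow (car D) k (car Y)"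
    by (auto simp: lifts_def)
  then have "fn p = k" by (simp add: keeps_fnD[OF pO] keeps_fnD[of underlying])
  then show "hom D Y k" using Hom_pcatD(6)[OF p(1)] by simp
next
  assume "hom D Y k"
  then have "Arrow D k Y \<in> Hom (pcat P) D Y" using D Y k by (simp add: Arrow_Hom_pcat)
  moreover have "fmap (underlying \<odot> pO P) (Arrow D k Y) = Arrow (car D) k (car Y)"
    by (simp add: keeps_fnD[OF pO] keeps_fnD[of underlying])
  ultimately show "lifts (pcat P) (underlying \<odot> pO P) D Y (Arrow (car D) k (car Y))"
    unfolding lifts_def by blast
qed

lemma cartesian_lift_iff:
  assumes X: "small (topspace X)" and Y: "Y \<in> \<O>" and \<theta>: "\<theta> \<in> isos SET (car Y) (carrier (fobj Omega X))"
  shows "cartesian_lift (pcat P) SET (underlying \<odot> pO P) (sierp_maps X) (ptwo P)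
      {chi X x | x. x \<in> topspace X} Y \<theta> \<longleftrightarrow> lift_at X Y (fn \<theta>)"
proof -
  have th: "\<theta> \<in> Hom SET (car Y) (carrier (fobj Omega X))" using \<theta> by (simp add: isos_def)
  note thd = Hom_concreteD[OF th[unfolded SET_def]]
  have "lifts (pcat P) (underlying \<odot> pO P) D (ptwo P) (chi X x \<cdot>\<^bsub>SET\<^esub> \<theta> \<cdot>\<^bsub>SET\<^esub> Arrow (car D) k (car Y)) \<longleftrightarrow>
      hom D (ptwo P) (compose (car D) (ev X x) (compose (car D) (fn \<theta>) k))"
    if D: "D \<in> \<O>" and x: "x \<in> topspace X" for D x k
    using lifts_iff[OF D ptwo(1), of "compose (car D) (ev X x) (compose (car D) (fn \<theta>) k)"] thd(3,4)
    by (simp add: SET_def sierp_maps_chi(2)[OF X x] ptwo(2))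
  then have *: "(\<forall>f\<in>{chi X x | x. x \<in> topspace X}.
      lifts (pcat P) (underlying \<odot> pO P) D (ptwo P) (f \<cdot>\<^bsub>SET\<^esub> \<theta> \<cdot>\<^bsub>SET\<^esub> Arrow (car D) k (car Y))) \<longleftrightarrow>
      (\<forall>x\<in>topspace X. hom D (ptwo P) (compose (car D) (ev X x) (compose (car D) (fn \<theta>) k)))"
    if "D \<in> \<O>" for D k using that by blast
  have Hom_SET: "h \<in> Hom SET (car D) (car Y) \<longleftrightarrow> (\<exists>k\<in>car D \<rightarrow>\<^sub>E car Y. h = Arrow (car D) k (car Y))"
    if "D \<in> \<O>" for D h
    using small_car[OF that] small_car[OF Y] by (auto simp: SET_def Hom_concrete PiE_def)
  have "(\<forall>h\<in>Hom SET (car D) (car Y). lifts (pcat P) (underlying \<odot> pO P) D Y h \<longleftrightarrow>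
      (\<forall>f\<in>{chi X x | x. x \<in> topspace X}. lifts (pcat P) (underlying \<odot> pO P) D (ptwo P) (f \<cdot>\<^bsub>SET\<^esub> \<theta> \<cdot>\<^bsub>SET\<^esub> h))) \<longleftrightarrow>
    (\<forall>k\<in>car D \<rightarrow>\<^sub>E car Y. hom D Y k \<longleftrightarrow>
      (\<forall>x\<in>topspace X. hom D (ptwo P) (compose (car D) (ev X x) (compose (car D) (fn \<theta>) k))))"
    (is "(\<forall>h\<in>_. ?l h) \<longleftrightarrow> (\<forall>k\<in>_. ?r k)") if D: "D \<in> \<O>" for D
  proof -
    have "?l (Arrow (car D) k (car Y)) \<longleftrightarrow> ?r k" if "k \<in> car D \<rightarrow>\<^sub>E car Y" for k
      unfolding *[OF D] using lifts_iff[OF D Y, of k] that by (simp add: PiE_def)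
    moreover have "Hom SET (car D) (car Y) = (\<lambda>k. Arrow (car D) k (car Y)) ` (car D \<rightarrow>\<^sub>E car Y)"
      using Hom_SET[OF D] by blast
    ultimately show ?thesis by (simp only: ball_simps cong: ball_cong)
  qed
  then show ?thesis
    unfolding cartesian_lift_def lift_at_def using Y \<theta> by (simp add: sierp_maps_chi(1)[OF X])
qed

lemma iota_chi:
  assumes X: "small (topspace (X :: 'u topology))" and x: "x \<in> topspace X"
  shows "fmap underlying (Id FRM (two_frm :: 'u gorder)) \<cdot>\<^bsub>SET\<^esub> chi X x = chi X x"
    and "fmap underlying (inverse_arr FRM (Id FRM (two_frm :: 'u gorder))) = fmap underlying (Id FRM two_frm)"
proof -
  have "compose (carrier (fobj Omega X)) (\<lambda>y\<in>carrier two_frm. y) (ev X x) = ev X x"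
    by (auto simp: compose_def ev_def)
  then show "fmap underlying (Id FRM two_frm) \<cdot>\<^bsub>SET\<^esub> chi X x = chi X x"
    by (simp add: sierp_maps_chi(2)[OF X x] SET_def FRM_def keeps_fnD[of underlying])
  show "fmap underlying (inverse_arr FRM (Id FRM (two_frm :: 'u gorder))) = fmap underlying (Id FRM two_frm)"
    unfolding inverse_Id[OF category_FRM two_frm_Obj] ..
qed

lemma pfc_lift_iff:
  assumes X: "small (topspace X)"
  shows "pfc_lift P X Y \<theta> \<longleftrightarrow>
    Y \<in> \<O> \<and> \<theta> \<in> isos SET (car Y) (carrier (fobj Omega X)) \<and> lift_at X Y (fn \<theta>)"
proof -
  have fam: "{fmap underlying (inverse_arr FRM (piota P)) \<cdot>\<^bsub>SET\<^esub> chi X x | x. x \<in> topspace X}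
      = {chi X x | x. x \<in> topspace X}"
  proof -
    have "fmap underlying (inverse_arr FRM (piota P)) \<cdot>\<^bsub>SET\<^esub> chi X x = chi X x" if "x \<in> topspace X" for x
      unfolding piota iota_chi(2)[OF X that] by (rule iota_chi(1)[OF X that])
    then show ?thesis by (intro Collect_cong ex_cong1) (auto simp del: concrete_simps)
  qed
  show ?thesis
    unfolding pfc_lift_def fam
    using cartesian_lift_iff[OF X, of Y \<theta>] by (auto simp: cartesian_lift_def sierp_maps_chi(1)[OF X])
qed

end

context spectral
begin

lemma lift_at_G:
  assumes X: "X \<in> Sp"
  shows "lift_at X (fobj G X) (\<lambda>w\<in>carrier (fobj Omega X). w)"
proof -
  have "compose (car D) (\<lambda>w\<in>carrier (fobj Omega X). w) k = k" if "k \<in> car D \<rightarrow>\<^sub>E carrier (fobj Omega X)" for D k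
    using that by (auto simp: compose_def PiE_def extensional_def fun_eq_iff)
  then show ?thesis
    using initial[OF X] unfolding lift_at_def by (auto simp: G_frame[OF X] PiE_def)
qed

lemma pfc_lift_G:
  assumes X: "X \<in> Sp"
  shows "pfc_lift P X (fobj G X) (Id SET (carrier (fobj Omega X)))"
proof -
  have "Id SET (carrier (fobj Omega X)) \<in> isos SET (carrier (fobj Omega X)) (carrier (fobj Omega X :: 'u gorder))"
    by (rule Id_iso) (use small_Omega[OF Sp_small[OF X]] in \<open>auto simp: SET_def category_concrete[OF concrete_data_SET]\<close>)
  then show ?thesis
    using lift_at_G[OF X] G_obj[OF X] G_frame[OF X] by (simp add: pfc_lift_iff[OF Sp_small[OF X]]) (simp add: SET_def)
qed

lemma Obj_Top_of: "X \<in> Obj (Top_of P) \<longleftrightarrow> small (topspace X) \<and> (\<exists>Y \<theta>. pfc_lift P X Y \<theta>)"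
  by (simp add: Top_of_def full_sub_def TOP_def)

lemma sfc_category:
  assumes "sierpinski \<in> Sp"
  shows "sfc_category P"
  unfolding sfc_category_def Obj_Top_of
  using pfc_category assms pt_Sp Sp_small pfc_lift_G by blast

end

context spectral_morphism
begin

lemma compose_inverse:
  assumes "f \<in> A \<rightarrow> B" "compose A g f = (\<lambda>x\<in>A. x)" "k \<in> D \<rightarrow>\<^sub>E A"
  shows "compose D g (compose D f k) = k"
proof (rule extensionalityI[of _ D])
  fix d assume d: "d \<in> D"
  then have "k d \<in> A" using assms(3) by auto
  then show "compose D g (compose D f k) d = k d" using fun_cong[OF assms(2), of "k d"] d by (simp add: compose_eq)
qed (use assms in \<open>auto simp: PiE_def\<close>)

text \<open>Two cartesian lifts of the same space are isomorphic over its frame of opens. Hence it suffices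
  to know one lift that is preserved.\<close>

lemma lift_preserved:
  assumes X: "X \<in> Sp" and Y: "pfc_lift P X Y \<theta>"
  shows "pfc_lift Q X (fobj H Y) \<theta>"
proof -
  let ?A = "fobj G X"
  have sm: "small (topspace X)" and X': "X \<in> Sp'" using S.Sp_small[OF X] X Sp by auto
  have YO: "Y \<in> S.\<O>" and iso: "\<theta> \<in> isos SET (S.car Y) (carrier (fobj Omega X))" and lift: "S.lift_at X Y (fn \<theta>)"
    using Y by (auto simp: S.pfc_lift_iff[OF sm])
  note AO = S.G_obj[OF X] and carA = S.G_frame[OF X]
  obtain q where th: "\<theta> \<in> Hom SET (S.car Y) (carrier (fobj Omega X))"
    and q: "q \<in> Hom SET (carrier (fobj Omega X)) (S.car Y)"
    and inv: "compose (S.car Y) (fn q) (fn \<theta>) = (\<lambda>x\<in>S.car Y. x)"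
      "compose (carrier (fobj Omega X)) (fn \<theta>) (fn q) = (\<lambda>x\<in>carrier (fobj Omega X). x)"
    using iso unfolding SET_def isos_concrete by blast
  note t = Hom_concreteD(5,6)[OF th[unfolded SET_def]] and g = Hom_concreteD(5,6)[OF q[unfolded SET_def]]
  have t1: "compose (S.car Y) (fn \<theta>) (\<lambda>x\<in>S.car Y. x) = fn \<theta>"
    using t by (auto simp: compose_def extensional_def)
  have "hom Y Y (\<lambda>x\<in>S.car Y. x)" by (rule S.hom_id[OF YO])
  then have "\<forall>x\<in>topspace X. hom Y (ptwo P) (compose (S.car Y) (ev X x) (fn \<theta>))"
    using lift YO unfolding S.lift_at_def by (auto simp: t1)
  then have hom_t: "hom Y ?A (fn \<theta>)" using S.initial[OF X YO t(1)] t(2) by simp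
  have "compose (carrier (fobj Omega X)) (ev X x) (compose (carrier (fobj Omega X)) (fn \<theta>) (fn q)) = ev X x" for x
    unfolding inv by (auto simp: compose_def ev_def)
  then have hom_q: "hom ?A Y (fn q)"
    using lift AO S.hom_ev[OF X] g unfolding S.lift_at_def by (auto simp: carA PiE_def)
  have Ht: "hom' (fobj H Y) (fobj G' X) (fn \<theta>)" and Hq: "hom' (fobj G' X) (fobj H Y) (fn q)"
    using H_hom[OF YO AO _ hom_t] H_hom[OF AO YO _ hom_q] t g H_G[OF X] by (simp_all add: carA)
  note HY = H_obj[OF YO] and GX = T.G_obj[OF X']
  have "T.lift_at X (fobj H Y) (fn \<theta>)"
    unfolding T.lift_at_def
  proof (intro ballI)
    fix D k assume D: "D \<in> T.\<O>" and "k \<in> T.car D \<rightarrow>\<^sub>E T.car (fobj H Y)"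
    then have k: "k \<in> T.car D \<rightarrow>\<^sub>E S.car Y" by (simp add: H_frame[OF YO])
    let ?tk = "compose (T.car D) (fn \<theta>) k"
    have "hom' D (fobj H Y) k \<longleftrightarrow> hom' D (fobj G' X) ?tk"
    proof
      show "hom' D (fobj H Y) k \<Longrightarrow> hom' D (fobj G' X) ?tk" using T.hom_compose[OF D HY GX] Ht by blast
      have "compose (T.car D) (fn q) ?tk = k" by (rule compose_inverse[OF t(2) inv(1) k])
      then show "hom' D (fobj G' X) ?tk \<Longrightarrow> hom' D (fobj H Y) k" using T.hom_compose[OF D GX HY _ Hq, of ?tk] by simp
    qed
    also have "\<dots> \<longleftrightarrow> (\<forall>x\<in>topspace X. hom' D (ptwo Q) (compose (T.car D) (ev X x) ?tk))"
      using T.initial[OF X' D, of ?tk] t(2) k by (auto simp: compose_eq PiE_def Pi_iff)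
    finally show "hom' D (fobj H Y) k \<longleftrightarrow> (\<forall>x\<in>topspace X. hom' D (ptwo Q) (compose (T.car D) (ev X x) ?tk))" .
  qed
  then show ?thesis using HY iso by (simp add: T.pfc_lift_iff[OF sm] H_frame[OF YO])
qed

end


subsection \<open>Morphisms of SFC-categories\<close>

context spectral_morphism
begin

theorem sfc_morphism:
  assumes sierp: "sierpinski \<in> Sp" and Top: "Obj (Top_of P) \<subseteq> Sp"
  shows "sfc_morphism P Q H (id_trans FRM (pO P)) (Id (pcat Q) (ptwo Q))"
  unfolding sfc_morphism_def
proof (intro conjI ballI allI impI)
  show "sfc_category P" "sfc_category Q"
    using S.sfc_category[OF sierp] T.sfc_category sierp Sp by auto
  show "is_functor (pcat P) (pcat Q) H" by (rule H(1))
  have O: "is_functor (pcat P) FRM (pO P)" "is_functor (pcat Q) FRM (pO Q)"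
    using S.pfc_category T.pfc_category by (auto simp: pfc_category_def faithful_def)
  show "natural_iso (pcat P) FRM (pO Q \<odot> H) (pO P) (id_trans FRM (pO P))"
  proof (rule natural_iso_if_eq)
    show "is_functor (pcat P) FRM (pO Q \<odot> H)" by (rule is_functor_comp[OF H(1) O(2)])
  qed (use O in \<open>auto simp: H_frame id_trans_def keeps_fnD[OF H(2)] keeps_fnD[OF S.pO] keeps_fnD[OF T.pO] S.Arr_pcat\<close>)
  show "Id (pcat Q) (ptwo Q) \<in> isos (pcat Q) (fobj H (ptwo P)) (ptwo Q)"
    unfolding H_two by (rule Id_iso[OF T.category_pcat T.ptwo(1)])
  have "fmap (pO Q) (Id (pcat Q) (ptwo Q)) = Id FRM two_frm"
    using O(2) T.ptwo by (simp add: is_functor_def del: T.pcat_simps)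
  then show "piota Q \<cdot>\<^bsub>FRM\<^esub> fmap (pO Q) (Id (pcat Q) (ptwo Q)) = piota P \<cdot>\<^bsub>FRM\<^esub> id_trans FRM (pO P) (ptwo P)"
    by (simp only: S.piota T.piota id_trans_def S.ptwo(2))
  fix X Y \<theta> assume "X \<in> Obj (Top_of P)" and lift: "pfc_lift P X Y \<theta>"
  then have X: "X \<in> Sp" and sm: "small (topspace X)" using Top S.Sp_small by auto
  have YO: "Y \<in> S.\<O>" and iso: "\<theta> \<in> isos SET (S.car Y) (carrier (fobj Omega X))"
    using lift by (auto simp: S.pfc_lift_iff[OF sm])
  have fam: "{fmap underlying (inverse_arr FRM (id_trans FRM (pO P) (ptwo P))) \<cdot>\<^bsub>SET\<^esub>
      fmap underlying (inverse_arr FRM (piota P)) \<cdot>\<^bsub>SET\<^esub> chi X x | x. x \<in> topspace X} = {chi X x | x. x \<in> topspace X}"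
  proof -
    have "fmap underlying (inverse_arr FRM (Id FRM two_frm)) \<cdot>\<^bsub>SET\<^esub> chi X x = chi X x" if "x \<in> topspace X" for x
      unfolding S.iota_chi(2)[OF sm that] by (rule S.iota_chi(1)[OF sm that])
    then show ?thesis
      unfolding id_trans_def S.ptwo(2) S.piota by (intro Collect_cong ex_cong1) (auto simp del: concrete_simps)
  qed
  have th: "\<theta> \<in> Hom SET (S.car Y) (carrier (fobj Omega X))" using iso by (simp add: isos_def)
  note d = Hom_concreteD[OF th[unfolded SET_def]]
  have "compose (S.car Y) (fn \<theta>) (\<lambda>x\<in>S.car Y. x) = fn \<theta>"
    using d(5) by (auto simp: compose_def extensional_def fun_eq_iff)
  then have \<theta>: "\<theta> \<cdot>\<^bsub>SET\<^esub> fmap underlying (id_trans FRM (pO P) Y) = \<theta>"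
    using d(3,4) by (simp add: SET_def FRM_def id_trans_def keeps_fnD[of underlying] arrow.expand)
  have "pfc_lift Q X (fobj H Y) \<theta>" by (rule lift_preserved[OF X lift])
  then show "cartesian_lift (pcat Q) SET (underlying \<odot> pO Q) (sierp_maps X) (fobj H (ptwo P))
     {fmap underlying (inverse_arr FRM (id_trans FRM (pO P) (ptwo P))) \<cdot>\<^bsub>SET\<^esub>
      fmap underlying (inverse_arr FRM (piota P)) \<cdot>\<^bsub>SET\<^esub> chi X x | x. x \<in> topspace X}
     (fobj H Y) (\<theta> \<cdot>\<^bsub>SET\<^esub> fmap underlying (id_trans FRM (pO P) Y))"
    unfolding fam \<theta> H_two by (auto simp: T.pfc_lift_iff[OF sm] T.cartesian_lift_iff[OF sm])
qed

end

section \<open>Spectra that are \<open>T\<^sub>D\<close>\<close>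

context frame_pfc
begin

text \<open>Let \<open>b(p) = p\<^sub>*[2]\<close> for a point \<open>p\<close> of a frame \<open>L\<close>. If \<open>b(p) \<in> \<F>L\<close>, then \<open>b(p)\<close>, having only two
  elements, is itself of the form \<open>\<up>a \<inter> \<o>(b)\<close>, and \<open>p\<close> is the only point with \<open>p(b) = 1\<close> and
  \<open>p(a) = 0\<close>.\<close>

lemma T_D_pt_space:
  assumes A: "A \<in> \<O>"
    and Fl: "\<And>n. n \<in> names A \<Longrightarrow>
      right_adj (fobj (pO P) A) two_frm (filter_map A n) ` carrier two_frm \<in> carrier (Fl (fobj (pO P) A))"
  shows "T_D (pt_space P A)"
  unfolding T_D_def topspace_pt[OF A]
proof
  let ?L = "fobj (pO P) A"
  interpret L: frm ?L using frame_car[OF A] by unfold_locales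
  have fh: "frame_hom ?L two_frm (filter_map A n)" if "n \<in> names A" for n
    using that frame_map[OF A ptwo(1)] by (simp add: names_def ptwo(2))
  \<comment> \<open>\<open>m n\<close> is the largest element that the point named \<open>n\<close> sends to \<open>0\<close>.\<close>
  define m where "m n = right_adj ?L two_frm (filter_map A n) zero_u" for n
  have m: "m n \<in> car A" "a \<in> car A \<Longrightarrow> a \<sqsubseteq>\<^bsub>?L\<^esub> m n \<longleftrightarrow> a \<notin> dec n"
    "right_adj ?L two_frm (filter_map A n) ` carrier two_frm = {m n, \<top>\<^bsub>?L\<^esub>}"
    "a \<in> car A \<Longrightarrow> b \<in> car A \<Longrightarrow> a \<sqinter>\<^bsub>?L\<^esub> b \<in> dec n \<longleftrightarrow> a \<in> dec n \<and> b \<in> dec n" "\<top>\<^bsub>?L\<^esub> \<in> dec n"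
    if n: "n \<in> names A" for n a b
  proof -
    interpret E: frm_hom ?L two_frm "filter_map A n"
      using frame_car[OF A] frame_two fh[OF n] by unfold_locales
    note h = fh[OF n, unfolded frame_hom_two_iff[OF frame_car[OF A]]]
    show "m n \<in> car A" by (simp add: m_def)
    show "a \<in> car A \<Longrightarrow> a \<sqsubseteq>\<^bsub>?L\<^esub> m n \<longleftrightarrow> a \<notin> dec n"
      using E.le_fr_iff[of a zero_u] by (simp add: m_def filter_map_def)
    show "right_adj ?L two_frm (filter_map A n) ` carrier two_frm = {m n, \<top>\<^bsub>?L\<^esub>}"
      using E.fr_top by (simp add: m_def top_two)
    show "a \<in> car A \<Longrightarrow> b \<in> car A \<Longrightarrow> a \<sqinter>\<^bsub>?L\<^esub> b \<in> dec n \<longleftrightarrow> a \<in> dec n \<and> b \<in> dec n"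
      using h filter_one_iff L.meet_closed by metis
    show "\<top>\<^bsub>?L\<^esub> \<in> dec n" using h filter_one_iff L.top_closed by metis
  qed
  fix n assume n: "n \<in> names A"
  have "\<not> {m n, \<top>\<^bsub>?L\<^esub>} \<subseteq> {\<top>\<^bsub>?L\<^esub>}" using m(2,5)[OF n] L.top_closed L.le_refl by auto
  moreover have "{m n, \<top>\<^bsub>?L\<^esub>} \<in> carrier (Fl ?L)" using Fl[OF n] m(3)[OF n] by simp
  ultimately obtain c where c: "c \<in> basic_sl ?L" "c \<subseteq> {m n, \<top>\<^bsub>?L\<^esub>}" "\<not> c \<subseteq> {\<top>\<^bsub>?L\<^esub>}"
    using L.Fl_subsetI[OF _ L.sublocale_top, of "{m n, \<top>\<^bsub>?L\<^esub>}"] by metis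
  then obtain a b where ab: "a \<in> car A" "b \<in> car A" "c = closed_sl ?L a \<inter> open_sl ?L b"
    by (auto simp: basic_sl_def)
  have mc: "m n \<in> closed_sl ?L a" "m n \<in> open_sl ?L b" using c ab by auto
  have "b \<in> dec n"
  proof (rule ccontr)
    assume "b \<notin> dec n"
    then have "\<top>\<^bsub>?L\<^esub> \<sqinter>\<^bsub>?L\<^esub> b \<sqsubseteq>\<^bsub>?L\<^esub> m n" using m(2,4)[OF n] ab by simp
    then have "\<top>\<^bsub>?L\<^esub> \<sqsubseteq>\<^bsub>?L\<^esub> m n" using mc(2) L.mem_open_sl_iff[OF ab(2)] L.top_closed by blast
    then show False using m(2,5)[OF n] by simp
  qed
  moreover have "a \<notin> dec n" using mc(1) m(2)[OF n ab(1)] by (simp add: closed_sl_def)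
  \<comment> \<open>The least element of \<open>b(k)\<close> belongs to \<open>\<up>a \<inter> \<o>(b)\<close> too, and hence is that of \<open>b(n)\<close>.\<close>
  moreover have "k = n" if k: "k \<in> names A" "b \<in> dec k" "a \<notin> dec k" for k
  proof -
    have "m k \<in> closed_sl ?L a" using k m(1,2)[OF k(1)] ab by (simp add: closed_sl_def)
    moreover have "m k \<in> open_sl ?L b"
      unfolding L.mem_open_sl_iff[OF ab(2)]
    proof (intro conjI ballI impI)
      fix d assume d: "d \<in> car A" "d \<sqinter>\<^bsub>?L\<^esub> b \<sqsubseteq>\<^bsub>?L\<^esub> m k"
      then have "d \<sqinter>\<^bsub>?L\<^esub> b \<notin> dec k" using m(2)[OF k(1)] ab by simp
      then show "d \<sqsubseteq>\<^bsub>?L\<^esub> m k" using m(2,4)[OF k(1)] d ab k by simp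
    qed (rule m(1)[OF k(1)])
    ultimately have "m k \<in> {m n, \<top>\<^bsub>?L\<^esub>}" using c(2) ab(3) by blast
    moreover have "m k \<noteq> \<top>\<^bsub>?L\<^esub>" using m(2,5)[OF k(1)] L.top_closed L.le_refl by metis
    ultimately have "m k = m n" by simp
    then have "d \<in> dec k \<longleftrightarrow> d \<in> dec n" if "d \<in> car A" for d using m(2)[OF n that] m(2)[OF k(1) that] by metis
    then have "{d \<in> car A. d \<in> dec k} = {d \<in> car A. d \<in> dec n}" by blast
    then show ?thesis using names_enc[OF A n] names_enc[OF A k(1)] by metis
  qed
  ultimately have "{n} = pt_open P A b \<inter> (names A - pt_open P A a)"
    unfolding pt_open_eq[OF A ab(1)] pt_open_eq[OF A ab(2)] using n by blast
  moreover have "openin (pt_space P A) (pt_open P A b)" "closedin (pt_space P A) (names A - pt_open P A a)"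
  proof -
    show "openin (pt_space P A) (pt_open P A b)" using ab openin_pt_iff[OF A] by blast
    have "openin (pt_space P A) (pt_open P A a)" using ab openin_pt_iff[OF A] by blast
    then show "closedin (pt_space P A) (names A - pt_open P A a)" using topspace_pt[OF A] by (metis closedin_def closedin_diff closedin_topspace)
  qed
  ultimately show "\<exists>U C. openin (pt_space P A) U \<and> closedin (pt_space P A) C \<and> {n} = U \<inter> C" by blast
qed

end

section \<open>The five spectra\<close>

abbreviation small_spaces :: "'u topology set"
  where "small_spaces \<equiv> {X. small (topspace X)}"

abbreviation small_T_D_spaces :: "'u topology set"
  where "small_T_D_spaces \<equiv> {X. small (topspace X) \<and> T_D X}"

text \<open>The spaces on which \<open>\<S>\<K>\<close> takes fiber-terminal values. They need not be \<open>T\<^sub>0\<close>: these are the spaces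
  whose \<open>T\<^sub>0\<close>-quotient is \<open>T\<^sub>D\<close>.\<close>

definition Fl_spaces :: "'u topology set"
  where "Fl_spaces = {X. small (topspace X) \<and> (\<forall>x\<in>topspace X. point_sl X x \<in> carrier (Fl (fobj Omega X)))}"

lemma SK_simps [simp]:
  "fobj SK X = (fobj Omega X, SKC X)"
  "fmap SK g = Arrow (fobj Omega (tgt g), SKC (tgt g)) (fn (fmap Omega g)) (fobj Omega (src g), SKC (src g))"
  by (simp_all add: SK_def)

lemma pfc_simps [simp]:
  "pcat Skula = SKULA" "pO Skula = O_S" "ptwo Skula = two_S" "piota Skula = Id FRM two_frm"
  "pcat Skula_I = SKULA_I" "pO Skula_I = O_S" "ptwo Skula_I = two_S" "piota Skula_I = Id FRM two_frm"
  "pcat Skula_T = SKULA_T" "pO Skula_T = O_S" "ptwo Skula_T = two_S" "piota Skula_T = Id FRM two_frm"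
  "pcat Frm = FRM" "pO Frm = idF" "ptwo Frm = two_frm" "piota Frm = Id FRM two_frm"
  "pcat Frm_LE = FRM_LE" "pO Frm_LE = idF" "ptwo Frm_LE = two_frm" "piota Frm_LE = Id FRM two_frm"
  by (simp_all add: Skula_def Skula_I_def Skula_T_def Frm_def Frm_LE_def)

lemma Obj_simps [simp]:
  "Obj SKULA = {A. skula_ext A}"
  "Obj SKULA_I = {A. skula_ext A \<and> snd A = carrier (Sl (fst A))}"
  "Obj SKULA_T = {A. skula_ext A \<and> snd A = carrier (Fl (fst A))}"
  "Obj FRM_LE = Obj FRM"
  by (simp_all add: SKULA_def SKULA_I_eq SKULA_T_eq FRM_LE_def)

lemma frame_hom_inverse:
  assumes L: "frame L" and M: "frame M" and f: "frame_hom L M f" and g: "g \<in> carrier M \<rightarrow> carrier L"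
    and gf: "\<And>x. x \<in> carrier L \<Longrightarrow> g (f x) = x" and fg: "\<And>y. y \<in> carrier M \<Longrightarrow> f (g y) = y"
  shows "frame_hom M L g"
proof -
  interpret frm_hom L M f using L M f by unfold_locales
  have gc: "g y \<in> carrier L" if "y \<in> carrier M" for y using g that by auto
  have "g (\<Squnion>\<^bsub>M\<^esub> B) = \<Squnion>\<^bsub>L\<^esub> (g ` B)" if B: "B \<subseteq> carrier M" for B
  proof -
    have "g ` B \<subseteq> carrier L" "f ` g ` B = B" using B gc fg by (auto simp: image_image subset_iff image_iff)
    then show ?thesis using f_Sup[of "g ` B"] gf by (metis L.sup_closed)
  qed
  moreover have "g (x \<sqinter>\<^bsub>M\<^esub> y) = g x \<sqinter>\<^bsub>L\<^esub> g y" if "x \<in> carrier M" "y \<in> carrier M" for x y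
    using f_meet[of "g x" "g y"] that gc fg gf by (metis L.meet_closed)
  moreover have "g \<top>\<^bsub>M\<^esub> = \<top>\<^bsub>L\<^esub>" using f_top gf by (metis L.top_closed)
  ultimately show ?thesis
    using g by (simp add: frame_hom_def sup_pres_def meet_pres_def L.complete_lattice_axioms M.complete_lattice_axioms)
qed

context univ
begin

lemma two_S_Obj:
  "(two_S :: 'u skula) \<in> Obj SKULA" "(two_S :: 'u skula) \<in> Obj SKULA_I" "(two_S :: 'u skula) \<in> Obj SKULA_T"
proof -
  have "snd (two_S :: 'u skula) = carrier (Sl two_frm)" by (simp add: two_S_def)
  then show "(two_S :: 'u skula) \<in> Obj SKULA" "(two_S :: 'u skula) \<in> Obj SKULA_I" "(two_S :: 'u skula) \<in> Obj SKULA_T"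
    using skula_ext_two by (simp_all add: Fl_two)
qed

lemma two_S_eq: "two_S = (two_frm, carrier (Fl (two_frm :: 'u gorder)))"
  by (simp add: two_S_def Fl_two)

lemma frame_pfc_if_skula:
  fixes P :: "'u skula_pfc"
  assumes P: "pcat P = concrete \<O> (\<lambda>A. carrier (fst A)) skula_hom" "pO P = O_S" "ptwo P = two_S"
    "piota P = Id FRM two_frm" and O: "\<O> \<subseteq> {A. skula_ext A}" "two_S \<in> \<O>"
  shows "frame_pfc u P skula_hom"
proof unfold_locales
  have Obj: "Obj (pcat P) = \<O>" by (simp add: P(1))
  show "pcat P = concrete (Obj (pcat P)) (\<lambda>A. carrier (fobj (pO P) A)) skula_hom"
    unfolding Obj by (simp add: P)
  show "concrete_data (Obj (pcat P)) (\<lambda>A. carrier (fobj (pO P) A)) skula_hom"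
    unfolding Obj using concrete_data_subset[OF concrete_data_SKULA O(1)] by (simp add: P)
  show "fobj (pO P) A \<in> Obj FRM" if "A \<in> Obj (pcat P)" for A
    using that O(1) skula_extD(1,2)[of A] unfolding Obj by (auto simp: P Obj_FRM)
  show "frame_hom (fobj (pO P) A) (fobj (pO P) B) f"
    if "A \<in> Obj (pcat P)" "B \<in> Obj (pcat P)" "skula_hom A B f" for A B f
    using that(3) by (auto simp: P skula_hom_def split: prod.splits)
qed (use P O in auto)

lemma frame_pfc_Skula: "frame_pfc u (Skula :: 'u skula_pfc) skula_hom"
  by (rule frame_pfc_if_skula[of _ "{A. skula_ext A}"]) (use two_S_Obj in \<open>simp_all add: SKULA_def\<close>)

lemma frame_pfc_Skula_I: "frame_pfc u (Skula_I :: 'u skula_pfc) skula_hom"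
  by (rule frame_pfc_if_skula[OF _ _ _ _ _ two_S_Obj(2)]) (simp_all add: SKULA_I_eq, blast)

lemma frame_pfc_Skula_T: "frame_pfc u (Skula_T :: 'u skula_pfc) skula_hom"
  by (rule frame_pfc_if_skula[OF _ _ _ _ _ two_S_Obj(3)]) (simp_all add: SKULA_T_eq, blast)

lemma frame_pfc_Frm: "frame_pfc u (Frm :: 'u frame_pfc) frame_hom"
  by unfold_locales (use concrete_data_FRM two_frm_Obj in \<open>auto simp: Obj_FRM\<close>, simp_all add: FRM_def)

lemma frame_pfc_Frm_LE: "frame_pfc u (Frm_LE :: 'u frame_pfc) locally_exact"
  by unfold_locales
    (use concrete_data_FRM_LE two_frm_Obj in \<open>auto simp: locally_exact_def\<close>, simp_all add: FRM_LE_def)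

lemma spectral_Skula: "spectral u (Skula :: 'u skula_pfc) skula_hom small_spaces SK"
proof -
  interpret frame_pfc u "Skula :: 'u skula_pfc" skula_hom by (rule frame_pfc_Skula)
  show ?thesis
  proof unfold_locales
    show "pt_space Skula A \<in> small_spaces" if "A \<in> Obj (pcat Skula)" for A :: "'u skula"
      using small_pt[OF that] by simp
  qed (simp_all add: skula_ext_SK skula_hom_SK_iff)
qed

lemma spectral_Skula_I: "spectral u (Skula_I :: 'u skula_pfc) skula_hom small_spaces (S_F \<odot> O_S \<odot> SK)"
proof -
  interpret frame_pfc u "Skula_I :: 'u skula_pfc" skula_hom by (rule frame_pfc_Skula_I)
  show ?thesis
  proof unfold_locales
    show "pt_space Skula_I A \<in> small_spaces" if "A \<in> Obj (pcat Skula_I)" for A :: "'u skula"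
      using small_pt[OF that] by simp
    fix X :: "'u topology" and A :: "'u skula" and k assume X: "X \<in> small_spaces" and A: "A \<in> Obj (pcat Skula_I)"
    then have A': "frame (fst A)" "small (carrier (fst A))" "A = (fst A, carrier (Sl (fst A)))"
      using skula_extD(1,2)[of A] by (auto intro: prod_eqI)
    have "skula_hom A B f \<longleftrightarrow> frame_hom (fst A) (fst B) f" if "skula_ext B" for B :: "'u skula" and f
      using skula_hom_from_Sl[OF A'(1,2) that] A'(3) by metis
    moreover have "skula_ext (fobj Omega X, carrier (Sl (fobj Omega X)))"
      using X skula_ext_Sl frame_Omega small_Omega by auto
    ultimately show "skula_hom A (fobj (S_F \<odot> O_S \<odot> SK) X) k \<longleftrightarrow>
      k \<in> carrier (fobj (pO Skula_I) A) \<rightarrow> carrier (fobj Omega X) \<and>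
      (\<forall>x\<in>topspace X. skula_hom A (ptwo Skula_I) (compose (carrier (fobj (pO Skula_I) A)) (ev X x) k))"
      using X frame_hom_Omega_iff[OF A'(1), of X k] by (simp add: skula_ext_two)
  qed (simp_all add: skula_ext_Sl frame_Omega small_Omega keeps_fnD[of O_S] keeps_fnD[of S_F])
qed

lemma spectral_Skula_T:
  assumes "small_T_D_spaces \<subseteq> Sp" "Sp \<subseteq> Fl_spaces"
  shows "spectral u (Skula_T :: 'u skula_pfc) skula_hom Sp SK"
proof -
  interpret frame_pfc u "Skula_T :: 'u skula_pfc" skula_hom by (rule frame_pfc_Skula_T)
  have Sp: "small (topspace X)" "SKC X = carrier (Fl (fobj Omega X))" if "X \<in> Sp" for X
    using that assms SKC_eq_Fl[of X] by (auto simp: Fl_spaces_def)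
  show ?thesis
  proof unfold_locales
    fix A :: "'u skula" assume A: "A \<in> Obj (pcat Skula_T)"
    then have "right_adj (fst A) two_frm f ` carrier two_frm \<in> carrier (Fl (fst A))" if "skula_hom A two_S f" for f
      using that skula_hom_two_iff[of A f] by simp
    then have "T_D (pt_space Skula_T A)" using A by (intro T_D_pt_space) (simp_all add: names_def)
    then show "pt_space Skula_T A \<in> Sp" using small_pt[OF A] assms by auto
  next
    show "fobj SK X \<in> Obj (pcat Skula_T)" if "X \<in> Sp" for X
      using skula_ext_SK[OF Sp(1)[OF that]] Sp(2)[OF that] by simp
    show "skula_hom A (fobj SK X) k \<longleftrightarrow> k \<in> carrier (fobj (pO Skula_T) A) \<rightarrow> carrier (fobj Omega X) \<and>
        (\<forall>x\<in>topspace X. skula_hom A (ptwo Skula_T) (compose (carrier (fobj (pO Skula_T) A)) (ev X x) k))"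
      if "X \<in> Sp" "A \<in> Obj (pcat Skula_T)" for X A k
      using that Sp(1)[OF that(1)] by (simp add: skula_hom_SK_iff)
  qed (use Sp in simp_all)
qed

lemma T_D_Fl_spaces: "small_T_D_spaces \<subseteq> (Fl_spaces :: 'u topology set)"
  using point_sl_Fl_if_T_D by (auto simp: Fl_spaces_def)

lemma spectral_Frm: "spectral u (Frm :: 'u frame_pfc) frame_hom small_spaces Omega"
proof -
  interpret frame_pfc u "Frm :: 'u frame_pfc" frame_hom by (rule frame_pfc_Frm)
  show ?thesis
  proof unfold_locales
    show "pt_space Frm A \<in> small_spaces" if "A \<in> Obj (pcat Frm)" for A :: "'u gorder"
      using small_pt[OF that] by simp
    show "fmap Omega g = Arrow (fobj Omega (tgt g)) (fn (fmap Omega g)) (fobj Omega (src g))"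
      for g :: "('u topology, 'u) arrow" by (simp add: Omega_simps(3))
  qed (simp_all add: Obj_FRM frame_Omega small_Omega frame_hom_Omega_iff)
qed

lemma locally_exact_two_iff:
  fixes L :: "'u gorder"
  assumes "L \<in> Obj FRM"
  shows "locally_exact L two_frm f \<longleftrightarrow> skula_hom (L, carrier (Fl L)) two_S f"
  using assms two_frm_Obj by (simp add: Obj_FRM locally_exact_iff_skula_hom two_S_eq)

lemma spectral_Frm_LE: "spectral u (Frm_LE :: 'u frame_pfc) locally_exact small_T_D_spaces Omega"
proof -
  interpret frame_pfc u "Frm_LE :: 'u frame_pfc" locally_exact by (rule frame_pfc_Frm_LE)
  have Obj: "A \<in> Obj (pcat Frm_LE) \<longleftrightarrow> frame A \<and> small (carrier A)" for A :: "'u gorder"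
    by (simp add: Obj_FRM)
  show ?thesis
  proof unfold_locales
    fix A :: "'u gorder" assume A: "A \<in> Obj (pcat Frm_LE)"
    then have "right_adj A two_frm f ` carrier two_frm \<in> carrier (Fl A)" if "locally_exact A two_frm f"
      for f :: "'u \<Rightarrow> 'u"
      using that skula_hom_two_iff[OF skula_ext_Fl, of A f] by (simp add: locally_exact_two_iff) (simp add: Obj_FRM)
    then have "T_D (pt_space Frm_LE A)" using A by (intro T_D_pt_space) (simp_all add: names_def)
    then show "pt_space Frm_LE A \<in> small_T_D_spaces" using small_pt[OF A] by simp
  next
    show "fmap Omega g = Arrow (fobj Omega (tgt g)) (fn (fmap Omega g)) (fobj Omega (src g))"
      for g :: "('u topology, 'u) arrow" by (simp add: Omega_simps(3))
    fix X :: "'u topology" and A :: "'u gorder" and k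
    assume X: "X \<in> small_T_D_spaces" and A: "A \<in> Obj (pcat Frm_LE)"
    then have "SKC X = carrier (Fl (fobj Omega X))" by (intro SKC_eq_Fl point_sl_Fl_if_T_D) auto
    then have "locally_exact A (fobj Omega X) k \<longleftrightarrow> skula_hom (A, carrier (Fl A)) (fobj Omega X, SKC X) k"
      using X A frame_Omega[of X] small_Omega[of X] by (simp add: Obj locally_exact_iff_skula_hom del: pfc_simps)
    also have "\<dots> \<longleftrightarrow> k \<in> carrier A \<rightarrow> carrier (fobj Omega X) \<and>
        (\<forall>x\<in>topspace X. skula_hom (A, carrier (Fl A)) two_S (compose (carrier A) (ev X x) k))"
      using skula_hom_SK_iff[of "(A, carrier (Fl A))" X k] skula_ext_Fl[of A] A X unfolding Obj by simp
    finally show "locally_exact A (fobj Omega X) k \<longleftrightarrow>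
        k \<in> carrier (fobj (pO Frm_LE) A) \<rightarrow> carrier (fobj Omega X) \<and>
        (\<forall>x\<in>topspace X. locally_exact A (ptwo Frm_LE) (compose (carrier (fobj (pO Frm_LE) A)) (ev X x) k))"
      using A by (simp add: locally_exact_two_iff)
  qed (simp_all add: Obj_FRM frame_Omega small_Omega)
qed

text \<open>Every cartesian lift of \<open>X\<close> in the fiber-terminal Skula extensions is carried by \<open>\<Omega>X\<close>, with the
  evaluations as points; so the sublocales \<open>b(x)\<close> belong to the Funayama envelope.\<close>

lemma Top_of_Skula_T: "Obj (Top_of (Skula_T :: 'u skula_pfc)) \<subseteq> Fl_spaces"
proof
  interpret S: frame_pfc u "Skula_T :: 'u skula_pfc" skula_hom by (rule frame_pfc_Skula_T)
  fix X :: "'u topology" assume "X \<in> Obj (Top_of Skula_T)"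
  then obtain Y \<theta> where X: "small (topspace X)" and "pfc_lift Skula_T X Y \<theta>"
    by (auto simp: Top_of_def full_sub_def TOP_def)
  then have Y: "skula_ext Y" "snd Y = carrier (Fl (fst Y))"
    and iso: "\<theta> \<in> isos SET (carrier (fst Y)) (carrier (fobj Omega X))" and lift: "S.lift_at X Y (fn \<theta>)"
    using S.pfc_lift_iff[OF X, of Y \<theta>] by auto
  note L = skula_extD(1)[OF Y(1)] and M = frame_Omega[OF X]
  obtain q where th: "\<theta> \<in> Hom SET (carrier (fst Y)) (carrier (fobj Omega X))"
    and q: "q \<in> Hom SET (carrier (fobj Omega X)) (carrier (fst Y))"
    and inv: "compose (carrier (fst Y)) (fn q) (fn \<theta>) = (\<lambda>x\<in>carrier (fst Y). x)"
      "compose (carrier (fobj Omega X)) (fn \<theta>) (fn q) = (\<lambda>x\<in>carrier (fobj Omega X). x)"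
    using iso unfolding SET_def isos_concrete by blast
  note t = Hom_concreteD(5,6)[OF th[unfolded SET_def]] and g = Hom_concreteD(5,6)[OF q[unfolded SET_def]]
  have gf: "fn q (fn \<theta> x) = x" if "x \<in> carrier (fst Y)" for x
    using fun_cong[OF inv(1), of x] that by (simp add: compose_eq)
  have fg: "fn \<theta> (fn q y) = y" if "y \<in> carrier (fobj Omega X)" for y
    using fun_cong[OF inv(2), of y] that by (simp add: compose_eq)
  have "compose (carrier (fst Y)) (fn \<theta>) (\<lambda>x\<in>carrier (fst Y). x) = fn \<theta>"
    using t by (auto simp: compose_def extensional_def fun_eq_iff)
  moreover have "skula_hom Y Y (\<lambda>x\<in>carrier (fst Y). x)" using S.hom_id[of Y] Y by simp
  ultimately have pt: "skula_hom Y two_S (compose (carrier (fst Y)) (ev X x) (fn \<theta>))" if "x \<in> topspace X" for x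
    using lift Y that unfolding S.lift_at_def by auto
  then have ht: "frame_hom (fst Y) (fobj Omega X) (fn \<theta>)"
    using t(2) frame_hom_Omega_iff[OF L X] skula_hom_two_iff[OF Y(1)] by blast
  have hq: "frame_hom (fobj Omega X) (fst Y) (fn q)"
    by (rule frame_hom_inverse[OF L M ht g(2) gf fg])
  have "point_sl X x \<in> carrier (Fl (fobj Omega X))" if x: "x \<in> topspace X" for x
  proof -
    have "right_adj (fst Y) two_frm (compose (carrier (fst Y)) (ev X x) (fn \<theta>)) ` carrier two_frm
        = right_adj (fst Y) (fobj Omega X) (fn \<theta>) ` point_sl X x"
      unfolding point_sl_eq[OF X x, symmetric] image_image
      by (intro image_cong refl right_adj_compose[OF L M frame_two ht frame_hom_ev[OF X x]])
    then have "right_adj (fst Y) (fobj Omega X) (fn \<theta>) ` point_sl X x \<in> carrier (Fl (fst Y))"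
      using pt[OF x] Y unfolding skula_hom_two_iff[OF Y(1)] by metis
    then have "right_adj (fobj Omega X) (fst Y) (fn q) ` right_adj (fst Y) (fobj Omega X) (fn \<theta>) ` point_sl X x
        \<in> carrier (Fl (fobj Omega X))"
      by (intro iso_image_Fl[OF L M hq ht]) (simp_all add: fg gf)
    moreover have "right_adj (fobj Omega X) (fst Y) (fn q) (right_adj (fst Y) (fobj Omega X) (fn \<theta>) w) = w"
      if "w \<in> carrier (fobj Omega X)" for w
      using right_adj_compose[OF M L M hq ht that] right_adj_id[OF M that] inv(2) by simp
    moreover have "point_sl X x \<subseteq> carrier (fobj Omega X)"
    proof -
      interpret O: frm "fobj Omega X :: 'u gorder" using M by unfold_locales
      show ?thesis using O.sublocaleD(1)[OF sublocale_point_sl[OF X x]] .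
    qed
    ultimately show ?thesis by (simp add: image_image subset_iff cong: image_cong)
  qed
  then show "X \<in> Fl_spaces" using X by (simp add: Fl_spaces_def)
qed

section \<open>The morphisms between them\<close>

lemma is_functor_SKULA_I: "is_functor SKULA (SKULA_I :: ('u skula, _) cat) (S_F \<odot> O_S)"
  unfolding SKULA_def SKULA_I_eq
proof (rule is_functor_concrete[OF concrete_data_SKULA concrete_data_subset[OF concrete_data_SKULA]])
  fix A B :: "'u skula" and f assume "A \<in> {A. skula_ext A}" "B \<in> {A. skula_ext A}" "skula_hom A B f"
  then show "skula_hom (fobj (S_F \<odot> O_S) A) (fobj (S_F \<odot> O_S) B) f"
    using skula_hom_from_Sl[of "fst A" "fobj (S_F \<odot> O_S) B" f] skula_extD(1,2)[of A] skula_extD(1,2)[of B]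
    by (simp add: skula_hom_iff[of A B] skula_ext_Sl)
qed (auto simp: skula_ext_Sl skula_extD)

lemma morphism_Skula_I:
  "spectral_morphism u Skula skula_hom small_spaces SK (Skula_I :: 'u skula_pfc) skula_hom small_spaces
    (S_F \<odot> O_S \<odot> SK) (S_F \<odot> O_S)"
  using spectral_Skula spectral_Skula_I is_functor_SKULA_I
  by (intro spectral_morphism.intro spectral_morphism_axioms.intro) (simp_all add: two_S_def)

lemma morphism_Skula_T:
  assumes "small_T_D_spaces \<subseteq> Sp" "Sp \<subseteq> Fl_spaces"
  shows "spectral_morphism u Skula_T skula_hom Sp SK (Skula :: 'u skula_pfc) skula_hom small_spaces SK idF"
proof -
  have "is_functor SKULA_T (SKULA :: ('u skula, _) cat) idF"
    unfolding SKULA_def SKULA_T_eq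
    by (rule is_functor_concrete[OF concrete_data_subset[OF concrete_data_SKULA] concrete_data_SKULA]) auto
  then show ?thesis
    using spectral_Skula spectral_Skula_T[OF assms] assms
    by (intro spectral_morphism.intro spectral_morphism_axioms.intro) (auto simp: Fl_spaces_def)
qed

lemma skula_hom_Fl:
  fixes A B :: "'u skula"
  assumes "A \<in> Obj SKULA_T" "B \<in> Obj SKULA_T"
  shows "skula_hom A B f \<longleftrightarrow> locally_exact (fst A) (fst B) f"
proof -
  have "A = (fst A, carrier (Fl (fst A)))" "B = (fst B, carrier (Fl (fst B)))"
    using assms by (auto intro: prod_eqI)
  then show ?thesis
    using locally_exact_iff_skula_hom[of "fst A" "fst B" f] assms skula_extD(1,2)[of A] skula_extD(1,2)[of B]
    by simp
qed

lemma is_functor_FRM_LE: "is_functor SKULA_T (FRM_LE :: ('u gorder, _) cat) (O_S \<odot> idF)"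
proof -
  have "concrete_data (Obj (SKULA_T :: ('u skula, _) cat)) (\<lambda>A. carrier (fst A)) skula_hom"
    by (rule concrete_data_subset[OF concrete_data_SKULA]) auto
  then have "is_functor (concrete (Obj SKULA_T) (\<lambda>A. carrier (fst A)) skula_hom)
      (concrete (Obj FRM) carrier locally_exact) (O_S \<odot> idF :: ('u skula, _, _, _) ftor)"
    by (rule is_functor_concrete[OF _ concrete_data_FRM_LE])
      (simp_all add: skula_hom_Fl skula_extD Obj_FRM del: Obj_simps, auto simp: skula_extD)
  then show ?thesis by (simp add: SKULA_T_eq FRM_LE_def)
qed

lemma morphism_Frm_LE:
  "spectral_morphism u Skula_T skula_hom small_T_D_spaces SK (Frm_LE :: 'u frame_pfc) locally_exact
    small_T_D_spaces Omega (O_S \<odot> idF)"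
  using spectral_Skula_T[OF subset_refl T_D_Fl_spaces] spectral_Frm_LE is_functor_FRM_LE
  by (intro spectral_morphism.intro spectral_morphism_axioms.intro) simp_all

lemma morphism_Frm:
  "spectral_morphism u Frm_LE locally_exact small_T_D_spaces Omega (Frm :: 'u frame_pfc) frame_hom small_spaces Omega idF"
proof -
  have "is_functor FRM_LE (FRM :: ('u gorder, _) cat) idF"
    unfolding FRM_def FRM_LE_def Obj_FRM[unfolded FRM_def]
    by (rule is_functor_concrete[OF concrete_data_FRM_LE[unfolded Obj_FRM] concrete_data_FRM])
      (auto simp: locally_exact_def)
  then show ?thesis
    using spectral_Frm spectral_Frm_LE
    by (intro spectral_morphism.intro spectral_morphism_axioms.intro) auto
qed

lemma strong_Skula:
  "strong_adjunction_morphism (spec_adj (Skula_T :: 'u skula_pfc) TOP_D SK) (spec_adj Skula TOP SK)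
    idF idF (id_trans SKULA SK) (spec_comparison Skula_T Skula idF)"
proof -
  interpret spectral_morphism u "Skula_T :: 'u skula_pfc" skula_hom small_T_D_spaces SK Skula skula_hom
    small_spaces SK idF
    by (rule morphism_Skula_T[OF subset_refl T_D_Fl_spaces])
  have "T.names (fobj idF A) \<subseteq> S.names A" for A
    by (simp add: T.names_def S.names_def T.filter_map_def S.filter_map_def T.filter_name_def S.filter_name_def)
  from strong_adjunction_morphism[OF this] show ?thesis by (simp only: TOP_def[symmetric] TOP_D_eq[symmetric] pfc_simps)
qed

lemma strong_Frm_LE:
  "strong_adjunction_morphism (spec_adj (Skula_T :: 'u skula_pfc) TOP_D SK) (spec_adj Frm_LE TOP_D Omega)
    (O_S \<odot> idF) idF (id_trans FRM_LE Omega) (spec_comparison Skula_T Frm_LE (O_S \<odot> idF))"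
proof -
  interpret spectral_morphism u "Skula_T :: 'u skula_pfc" skula_hom small_T_D_spaces SK Frm_LE locally_exact
    small_T_D_spaces Omega "O_S \<odot> idF"
    by (rule morphism_Frm_LE)
  have "T.names (fobj (O_S \<odot> idF) A) \<subseteq> S.names A" if "A \<in> Obj (pcat Skula_T)" for A :: "'u skula"
    using skula_hom_Fl[of A two_S] that two_S_Obj(3)
    by (simp add: T.names_def S.names_def T.filter_map_def S.filter_map_def T.filter_name_def
        S.filter_name_def del: Obj_simps)
  then show ?thesis
    using strong_adjunction_morphism by (simp only: TOP_def[symmetric] TOP_D_eq[symmetric] pfc_simps)
qed

lemma equivalence_FRM_LE: "equivalence (SKULA_T :: ('u skula, ('u skula, 'u) arrow) cat) FRM_LE (O_S \<odot> idF)"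
proof -
  let ?F = "O_S \<odot> idF :: ('u skula, ('u skula, 'u) arrow, 'u gorder, ('u gorder, 'u) arrow) ftor"
  \<comment> \<open>The inverse equips every frame with its Funayama envelope; both composites are identities.\<close>
  define G :: "('u gorder, ('u gorder, 'u) arrow, 'u skula, ('u skula, 'u) arrow) ftor"
    where "G = \<lparr> fobj = (\<lambda>L. (L, carrier (Fl L))),
      fmap = (\<lambda>f. Arrow (src f, carrier (Fl (src f))) (fn f) (tgt f, carrier (Fl (tgt f)))) \<rparr>"
  have kG: "keeps_fn G" and oG: "fobj G L = (L, carrier (Fl L))" for L by (simp_all add: keeps_fn_def G_def)
  have dT: "concrete_data (Obj (SKULA_T :: ('u skula, _) cat)) (\<lambda>A. carrier (fst A)) skula_hom"
    by (rule concrete_data_subset[OF concrete_data_SKULA]) auto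
  have "is_functor (concrete (Obj FRM) carrier locally_exact) (concrete (Obj SKULA_T) (\<lambda>A. carrier (fst A)) skula_hom) G"
    by (rule is_functor_concrete[OF concrete_data_FRM_LE dT kG])
      (auto simp: oG Obj_FRM skula_ext_Fl locally_exact_iff_skula_hom)
  then have FG: "is_functor SKULA_T FRM_LE ?F" "is_functor FRM_LE SKULA_T G"
    using is_functor_FRM_LE by (simp_all add: SKULA_T_eq FRM_LE_def)
  have cat: "category (SKULA_T :: ('u skula, _) cat)" "category (FRM_LE :: ('u gorder, _) cat)"
    using FG by (auto simp: is_functor_def)
  have "natural_iso SKULA_T SKULA_T idF (G \<odot> ?F) (id_trans SKULA_T idF)"
    by (rule natural_iso_if_eq[OF is_functor_id[OF cat(1)] is_functor_comp[OF FG]])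
      (auto simp: oG id_trans_def keeps_fnD[OF kG] keeps_fnD[of O_S] SKULA_T_eq arrow.expand prod_eq_iff)
  moreover have "natural_iso FRM_LE FRM_LE (?F \<odot> G) idF (id_trans FRM_LE idF)"
    by (rule natural_iso_if_eq[OF is_functor_comp[OF FG(2,1)] is_functor_id[OF cat(2)]])
      (auto simp: oG id_trans_def keeps_fnD[OF kG] keeps_fnD[of O_S])
  ultimately show ?thesis using FG unfolding equivalence_def by blast
qed

end

theorem theorem3p30:
  assumes "universe TYPE('u)"
  shows
    "sfc_morphism (Skula_T :: 'u skula_pfc) Skula idF
       (id_trans FRM O_S) (Id SKULA two_S) \<and>
     sfc_morphism (Skula :: 'u skula_pfc) Skula_I (S_F \<odot> O_S)
       (id_trans FRM O_S) (Id SKULA_I two_S) \<and>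
     adjunction (spec_adj (Skula_I :: 'u skula_pfc) TOP (S_F \<odot> O_S \<odot> SK)) \<and>
     adjunction (spec_adj (Skula :: 'u skula_pfc) TOP SK) \<and>
     adjunction (spec_adj (Skula_T :: 'u skula_pfc) TOP_D SK) \<and>
     adjunction (spec_adj (Frm_LE :: 'u frame_pfc) TOP_D Omega) \<and>
     adjunction (spec_adj (Frm :: 'u frame_pfc) TOP Omega) \<and>
     right_adjunction_morphism
       (spec_adj (Skula :: 'u skula_pfc) TOP SK) (spec_adj Skula_I TOP (S_F \<odot> O_S \<odot> SK))
       (S_F \<odot> O_S) idF
       (id_trans SKULA_I (S_F \<odot> O_S \<odot> SK)) (spec_comparison Skula Skula_I (S_F \<odot> O_S)) \<and>
     strong_adjunction_morphism
       (spec_adj (Skula_T :: 'u skula_pfc) TOP_D SK) (spec_adj Skula TOP SK)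
       idF idF
       (id_trans SKULA SK) (spec_comparison Skula_T Skula idF) \<and>
     strong_adjunction_morphism
       (spec_adj (Skula_T :: 'u skula_pfc) TOP_D SK) (spec_adj Frm_LE TOP_D Omega)
       (O_S \<odot> idF) idF
       (id_trans FRM_LE Omega) (spec_comparison Skula_T Frm_LE (O_S \<odot> idF)) \<and>
     equivalence (SKULA_T :: ('u skula, ('u skula, 'u) arrow) cat) FRM_LE (O_S \<odot> idF) \<and>
     right_adjunction_morphism
       (spec_adj (Frm_LE :: 'u frame_pfc) TOP_D Omega) (spec_adj Frm TOP Omega)
       idF idF
       (id_trans FRM Omega) (spec_comparison Frm_LE Frm idF)"
proof -
  interpret univ "TYPE('u)" using assms by unfold_locales
  note TOP = TOP_def[symmetric] TOP_D_eq[symmetric]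
  have sierp: "(sierpinski :: 'u topology) \<in> small_T_D_spaces"
    using T_D_sierpinski small_pair by (simp add: topspace_sierpinski)
  have Top: "Obj (Top_of (Skula :: 'u skula_pfc)) \<subseteq> small_spaces"
    by (auto simp: Top_of_def full_sub_def TOP_def)
  note T_D = subset_refl T_D_Fl_spaces
  show ?thesis
  proof (intro conjI)
    \<comment> \<open>Spaces that are not \<open>T\<^sub>0\<close> may have lifts as well, so the \<open>T\<^sub>D\<close>-spaces do not suffice here.\<close>
    show "sfc_morphism (Skula_T :: 'u skula_pfc) Skula idF (id_trans FRM O_S) (Id SKULA two_S)"
      using spectral_morphism.sfc_morphism[OF morphism_Skula_T[OF T_D_Fl_spaces subset_refl]
          subsetD[OF T_D_Fl_spaces sierp] Top_of_Skula_T]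
      by (simp only: pfc_simps)
    show "sfc_morphism (Skula :: 'u skula_pfc) Skula_I (S_F \<odot> O_S) (id_trans FRM O_S) (Id SKULA_I two_S)"
      using spectral_morphism.sfc_morphism[OF morphism_Skula_I _ Top] sierp by (simp del: Obj_simps concrete_simps)
  qed (use spectral.spec_adjunction[OF spectral_Skula_I] spectral.spec_adjunction[OF spectral_Skula]
      spectral.spec_adjunction[OF spectral_Skula_T[OF T_D]] spectral.spec_adjunction[OF spectral_Frm_LE]
      spectral.spec_adjunction[OF spectral_Frm]
      spectral_morphism.right_adjunction_morphism[OF morphism_Skula_I]
      spectral_morphism.right_adjunction_morphism[OF morphism_Frm]
      strong_Skula strong_Frm_LE equivalence_FRM_LE in \<open>simp_all only: TOP pfc_simps\<close>)
qed

end
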